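(* For every regular cardinal $\kappa$, $V^{\mathrm{Fn}(\kappa,2)}\models\mathfrak a^+(\aleph_1)\ge\kappa$.
   Context: Two countable sets are almost disjoint (ad) if their intersection is finite; a family is ad if its distinct members are pairwise ad. For $\mathcal X\subseteq[S]^{\aleph_0}$ with $S=\bigcup\mathcal X$, $\mathcal F\subseteq\mathcal X$ is mad in $\mathcal X$ if it is ad and no $X\in\mathcal X$ is ad to all members of $\mathcal F$; $\mathfrak a(\mathcal X)=\min\{|\mathcal F|:|\mathcal F|\ge\aleph_0,\ \mathcal F\text{ mad in }\mathcal X\}$. For an ad family $\mathcal F$ on a countable set $S$, $\mathcal F^\perp=\{Y\in[S]^{\aleph_0}:|X\cap Y|<\aleph_0\ \forall X\in\mathcal F\}$ and $\mathfrak a^+(\mathcal F)=\mathfrak a(\mathcal F^\perp)$. For a cardinal $\lambda$, $\mathfrak a^+(\lambda)=\sup\{\mathfrak a^+(\mathcal F):\mathcal F\text{ an ad family on }\omega,\ |\mathcal F|\le\lambda\}$. $\mathrm{Fn}(\kappa,2)$ is the Cohen forcing adding $\kappa$ Cohen reals and $V^{\mathbb P}$ a generic extension of the ground model $V$. *)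

theory Defs
  imports Main
begin

text \<open>
  The ground model \<open>V\<close> is an arbitrary model of first-order ZFC: a type \<open>'v\<close> with a relation
  \<open>E\<close>, not assumed to be well-founded from outside and not assumed to satisfy the schemes for
  arbitrary predicates.  A statement proved for all of them is a theorem of ZFC, by completeness.
  All set-theoretic notions are written once, as formulas of the language of set theory, and
  are then either evaluated in \<open>V\<close> or forced.
\<close>

section \<open>The language of set theory\<close>

text \<open>
  Object variables are represented by HOL variables (higher-order abstract syntax), and the
  parameters of a formula are elements of \<open>V\<close>; in the forcing interpretation they serve as names.
\<close>

datatype 'v form =
    Mem 'v 'v  (infix "\<^bold>\<in>" 55)
  | Eq 'v 'v  (infix "\<^bold>=" 55)
  | Neg "'v form"  ("\<^bold>\<not> _" [50] 50)
  | Conj "'v form" "'v form"  (infixr "\<^bold>\<and>" 45)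
  | All "'v \<Rightarrow> 'v form"  (binder "\<^bold>\<forall>" 10)

definition Disj :: "'v form \<Rightarrow> 'v form \<Rightarrow> 'v form"  (infixr "\<^bold>\<or>" 40) where
  "(\<phi> \<^bold>\<or> \<psi>) = (\<^bold>\<not> (\<^bold>\<not> \<phi> \<^bold>\<and> \<^bold>\<not> \<psi>))"

definition Imp :: "'v form \<Rightarrow> 'v form \<Rightarrow> 'v form"  (infixr "\<^bold>\<longrightarrow>" 35) where
  "(\<phi> \<^bold>\<longrightarrow> \<psi>) = (\<^bold>\<not> (\<phi> \<^bold>\<and> \<^bold>\<not> \<psi>))"

definition Iff :: "'v form \<Rightarrow> 'v form \<Rightarrow> 'v form"  (infixr "\<^bold>\<longleftrightarrow>" 35) where
  "(\<phi> \<^bold>\<longleftrightarrow> \<psi>) = ((\<phi> \<^bold>\<longrightarrow> \<psi>) \<^bold>\<and> (\<psi> \<^bold>\<longrightarrow> \<phi>))"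

definition Ex :: "('v \<Rightarrow> 'v form) \<Rightarrow> 'v form"  (binder "\<^bold>\<exists>" 10) where
  "(\<^bold>\<exists>x. \<phi> x) = (\<^bold>\<not> (\<^bold>\<forall>x. \<^bold>\<not> \<phi> x))"

primrec sat :: "('v \<Rightarrow> 'v \<Rightarrow> bool) \<Rightarrow> 'v form \<Rightarrow> bool" where
  "sat E (x \<^bold>\<in> y) \<longleftrightarrow> E x y"
| "sat E (x \<^bold>= y) \<longleftrightarrow> x = y"
| "sat E (\<^bold>\<not> \<phi>) \<longleftrightarrow> \<not> sat E \<phi>"
| "sat E (\<phi> \<^bold>\<and> \<psi>) \<longleftrightarrow> sat E \<phi> \<and> sat E \<psi>"
| "sat E (All \<phi>) \<longleftrightarrow> (\<forall>x. sat E (\<phi> x))"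

text \<open>
  \<open>'v form\<close> also contains objects that are not first-order formulas, since the body of a quantifier
  may be any function.  \<open>first_order \<phi>\<close> says that \<open>\<phi>\<close>, as a function of the assignment of its
  variables \<open>v\<^sub>0, v\<^sub>1, \<dots>\<close>, is a genuine finitary formula; only these are admitted in the schemes.
\<close>

inductive first_order :: "((nat \<Rightarrow> 'v) \<Rightarrow> 'v form) \<Rightarrow> bool" where
  "first_order (\<lambda>e. e i \<^bold>\<in> e j)"
| "first_order (\<lambda>e. e i \<^bold>= e j)"
| "first_order \<phi> \<Longrightarrow> first_order (\<lambda>e. \<^bold>\<not> \<phi> e)"
| "first_order \<phi> \<Longrightarrow> first_order \<psi> \<Longrightarrow> first_order (\<lambda>e. \<phi> e \<^bold>\<and> \<psi> e)"
| "first_order \<phi> \<Longrightarrow> first_order (\<lambda>e. \<^bold>\<forall>x. \<phi> (e(i := x)))"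

section \<open>Basic set-theoretic notions\<close>

definition subset_of :: "'v \<Rightarrow> 'v \<Rightarrow> 'v form"  (infix "\<^bold>\<subseteq>" 55) where
  "x \<^bold>\<subseteq> y = (\<^bold>\<forall>z. z \<^bold>\<in> x \<^bold>\<longrightarrow> z \<^bold>\<in> y)"

definition is_empty :: "'v \<Rightarrow> 'v form" where
  "is_empty x = (\<^bold>\<forall>z. \<^bold>\<not> z \<^bold>\<in> x)"

definition is_inter :: "'v \<Rightarrow> 'v \<Rightarrow> 'v \<Rightarrow> 'v form" where
  "is_inter x y z = (\<^bold>\<forall>u. u \<^bold>\<in> z \<^bold>\<longleftrightarrow> u \<^bold>\<in> x \<^bold>\<and> u \<^bold>\<in> y)"

definition is_upair :: "'v \<Rightarrow> 'v \<Rightarrow> 'v \<Rightarrow> 'v form" where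
  "is_upair a b z = (\<^bold>\<forall>x. x \<^bold>\<in> z \<^bold>\<longleftrightarrow> x \<^bold>= a \<^bold>\<or> x \<^bold>= b)"

text \<open>\<open>z\<close> is the Kuratowski pair \<open>(a, b) = {{a}, {a, b}}\<close>.\<close>

definition is_pair :: "'v \<Rightarrow> 'v \<Rightarrow> 'v \<Rightarrow> 'v form" where
  "is_pair a b z = (\<^bold>\<forall>x. x \<^bold>\<in> z \<^bold>\<longleftrightarrow> is_upair a a x \<^bold>\<or> is_upair a b x)"

definition pair_in :: "'v \<Rightarrow> 'v \<Rightarrow> 'v \<Rightarrow> 'v form" where
  "pair_in a b r = (\<^bold>\<exists>z. is_pair a b z \<^bold>\<and> z \<^bold>\<in> r)"

definition is_partial_fun :: "'v \<Rightarrow> 'v \<Rightarrow> 'v \<Rightarrow> 'v form" where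
  "is_partial_fun f a b =
    ((\<^bold>\<forall>z. z \<^bold>\<in> f \<^bold>\<longrightarrow> (\<^bold>\<exists>x y. x \<^bold>\<in> a \<^bold>\<and> y \<^bold>\<in> b \<^bold>\<and> is_pair x y z)) \<^bold>\<and>
     (\<^bold>\<forall>x y y'. pair_in x y f \<^bold>\<and> pair_in x y' f \<^bold>\<longrightarrow> y \<^bold>= y'))"

definition is_fun :: "'v \<Rightarrow> 'v \<Rightarrow> 'v \<Rightarrow> 'v form" where
  "is_fun f a b =
    (is_partial_fun f a b \<^bold>\<and> (\<^bold>\<forall>x. x \<^bold>\<in> a \<^bold>\<longrightarrow> (\<^bold>\<exists>y. pair_in x y f)))"

definition is_inj :: "'v \<Rightarrow> 'v \<Rightarrow> 'v \<Rightarrow> 'v form" where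
  "is_inj f a b =
    (is_fun f a b \<^bold>\<and> (\<^bold>\<forall>x x' y. pair_in x y f \<^bold>\<and> pair_in x' y f \<^bold>\<longrightarrow> x \<^bold>= x'))"

definition is_bij :: "'v \<Rightarrow> 'v \<Rightarrow> 'v \<Rightarrow> 'v form" where
  "is_bij f a b = (is_inj f a b \<^bold>\<and> (\<^bold>\<forall>y. y \<^bold>\<in> b \<^bold>\<longrightarrow> (\<^bold>\<exists>x. pair_in x y f)))"

definition equipollent :: "'v \<Rightarrow> 'v \<Rightarrow> 'v form" where
  "equipollent a b = (\<^bold>\<exists>f. is_bij f a b)"

definition card_le :: "'v \<Rightarrow> 'v \<Rightarrow> 'v form" where
  "card_le a b = (\<^bold>\<exists>f. is_inj f a b)"

section \<open>Ordinals and cardinals\<close>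

definition is_transitive :: "'v \<Rightarrow> 'v form" where
  "is_transitive x = (\<^bold>\<forall>y. y \<^bold>\<in> x \<^bold>\<longrightarrow> y \<^bold>\<subseteq> x)"

text \<open>By Foundation, linearly ordered by membership implies well-ordered by membership.\<close>

definition is_ord :: "'v \<Rightarrow> 'v form" where
  "is_ord x = (is_transitive x \<^bold>\<and>
    (\<^bold>\<forall>y z. y \<^bold>\<in> x \<^bold>\<and> z \<^bold>\<in> x \<^bold>\<longrightarrow> y \<^bold>\<in> z \<^bold>\<or> y \<^bold>= z \<^bold>\<or> z \<^bold>\<in> y))"

definition is_succ :: "'v \<Rightarrow> 'v \<Rightarrow> 'v form" where
  "is_succ x y = (\<^bold>\<forall>z. z \<^bold>\<in> y \<^bold>\<longleftrightarrow> z \<^bold>\<in> x \<^bold>\<or> z \<^bold>= x)"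

definition is_limit :: "'v \<Rightarrow> 'v form" where
  "is_limit x = (is_ord x \<^bold>\<and> \<^bold>\<not> is_empty x \<^bold>\<and>
    (\<^bold>\<forall>y. y \<^bold>\<in> x \<^bold>\<longrightarrow> (\<^bold>\<exists>z. z \<^bold>\<in> x \<^bold>\<and> y \<^bold>\<in> z)))"

definition is_omega :: "'v \<Rightarrow> 'v form" where
  "is_omega w = (is_limit w \<^bold>\<and> (\<^bold>\<forall>x. x \<^bold>\<in> w \<^bold>\<longrightarrow> \<^bold>\<not> is_limit x))"

definition is_finite :: "'v \<Rightarrow> 'v form" where
  "is_finite a = (\<^bold>\<exists>w n. is_omega w \<^bold>\<and> n \<^bold>\<in> w \<^bold>\<and> equipollent a n)"

definition is_card :: "'v \<Rightarrow> 'v form" where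
  "is_card k = (is_ord k \<^bold>\<and> (\<^bold>\<forall>a. a \<^bold>\<in> k \<^bold>\<longrightarrow> \<^bold>\<not> equipollent a k))"

definition is_card_of :: "'v \<Rightarrow> 'v \<Rightarrow> 'v form" where
  "is_card_of a k = (is_card k \<^bold>\<and> equipollent a k)"

definition is_aleph1 :: "'v \<Rightarrow> 'v form" where
  "is_aleph1 k = (\<^bold>\<exists>w. is_omega w \<^bold>\<and> is_card k \<^bold>\<and> w \<^bold>\<in> k \<^bold>\<and>
    (\<^bold>\<forall>a. a \<^bold>\<in> k \<^bold>\<longrightarrow> card_le a w))"

text \<open>An infinite cardinal, no function into which from a smaller ordinal is unbounded.\<close>

definition is_regular :: "'v \<Rightarrow> 'v form" where
  "is_regular k = (is_card k \<^bold>\<and> (\<^bold>\<exists>w. is_omega w \<^bold>\<and> w \<^bold>\<subseteq> k) \<^bold>\<and>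
    (\<^bold>\<forall>a f. a \<^bold>\<in> k \<^bold>\<and> is_fun f a k \<^bold>\<longrightarrow>
      (\<^bold>\<exists>b. b \<^bold>\<in> k \<^bold>\<and> (\<^bold>\<forall>x y. pair_in x y f \<^bold>\<longrightarrow> y \<^bold>\<in> b))))"

section \<open>Almost disjoint families\<close>

text \<open>\<open>X\<close> belongs to \<open>[S]\<close> to the power \<open>\<aleph>\<^sub>0\<close>.\<close>

definition is_ctbl_subset :: "'v \<Rightarrow> 'v \<Rightarrow> 'v form" where
  "is_ctbl_subset S X = (X \<^bold>\<subseteq> S \<^bold>\<and> (\<^bold>\<exists>w. is_omega w \<^bold>\<and> equipollent X w))"

definition is_ad :: "'v \<Rightarrow> 'v \<Rightarrow> 'v form" where
  "is_ad X Y = (\<^bold>\<exists>z. is_inter X Y z \<^bold>\<and> is_finite z)"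

definition is_ad_family :: "'v \<Rightarrow> 'v form" where
  "is_ad_family F = (\<^bold>\<forall>X Y. X \<^bold>\<in> F \<^bold>\<and> Y \<^bold>\<in> F \<^bold>\<and> \<^bold>\<not> X \<^bold>= Y \<^bold>\<longrightarrow> is_ad X Y)"

definition is_ad_family_on :: "'v \<Rightarrow> 'v \<Rightarrow> 'v form" where
  "is_ad_family_on S F =
    ((\<^bold>\<forall>X. X \<^bold>\<in> F \<^bold>\<longrightarrow> is_ctbl_subset S X) \<^bold>\<and> is_ad_family F)"

definition is_mad_in :: "'v \<Rightarrow> 'v \<Rightarrow> 'v form" where
  "is_mad_in \<X> F = (F \<^bold>\<subseteq> \<X> \<^bold>\<and> is_ad_family F \<^bold>\<and>
    \<^bold>\<not> (\<^bold>\<exists>X. X \<^bold>\<in> \<X> \<^bold>\<and> (\<^bold>\<forall>Y. Y \<^bold>\<in> F \<^bold>\<longrightarrow> is_ad X Y)))"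

definition is_inf_mad_size :: "'v \<Rightarrow> 'v \<Rightarrow> 'v form" where
  "is_inf_mad_size \<X> m = (\<^bold>\<exists>F w. is_omega w \<^bold>\<and> card_le w F \<^bold>\<and> is_mad_in \<X> F \<^bold>\<and> is_card_of F m)"

text \<open>
  \<open>m = \<aa>(\<X>)\<close>, where the order of ordinals is inclusion.  No \<open>m\<close> satisfies this formula
  if there is no infinite family that is mad in \<open>\<X>\<close> (for instance, if \<open>\<X>\<close> is empty).
\<close>

definition is_a :: "'v \<Rightarrow> 'v \<Rightarrow> 'v form" where
  "is_a \<X> m = (is_inf_mad_size \<X> m \<^bold>\<and> (\<^bold>\<forall>n. is_inf_mad_size \<X> n \<^bold>\<longrightarrow> m \<^bold>\<subseteq> n))"

definition is_perp :: "'v \<Rightarrow> 'v \<Rightarrow> 'v \<Rightarrow> 'v form" where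
  "is_perp S F \<X> = (\<^bold>\<forall>Y. Y \<^bold>\<in> \<X> \<^bold>\<longleftrightarrow>
    is_ctbl_subset S Y \<^bold>\<and> (\<^bold>\<forall>X. X \<^bold>\<in> F \<^bold>\<longrightarrow> is_ad X Y))"

definition is_a_plus :: "'v \<Rightarrow> 'v \<Rightarrow> 'v \<Rightarrow> 'v form" where
  "is_a_plus S F m = (\<^bold>\<exists>\<X>. is_perp S F \<X> \<^bold>\<and> is_a \<X> m)"

definition is_a_plus_value :: "'v \<Rightarrow> 'v \<Rightarrow> 'v form" where
  "is_a_plus_value l m =
    (\<^bold>\<exists>w F. is_omega w \<^bold>\<and> is_ad_family_on w F \<^bold>\<and> card_le F l \<^bold>\<and> is_a_plus w F m)"

text \<open>
  \<open>s = \<aa>\<^sup>+(l)\<close> for a cardinal \<open>l\<close>.  The supremum is over those families \<open>F\<close> for which \<open>\<aa>\<^sup>+(F)\<close> is defined;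
  an \<open>F\<close> that is itself mad on \<open>\<omega>\<close> contributes nothing.
\<close>

definition is_a_plus_card :: "'v \<Rightarrow> 'v \<Rightarrow> 'v form" where
  "is_a_plus_card l s = (is_ord s \<^bold>\<and>
    (\<^bold>\<forall>m. is_a_plus_value l m \<^bold>\<longrightarrow> m \<^bold>\<subseteq> s) \<^bold>\<and>
    (\<^bold>\<forall>t. is_ord t \<^bold>\<and> (\<^bold>\<forall>m. is_a_plus_value l m \<^bold>\<longrightarrow> m \<^bold>\<subseteq> t) \<^bold>\<longrightarrow> s \<^bold>\<subseteq> t))"

definition a_plus_aleph1_ge :: "'v \<Rightarrow> 'v form" where
  "a_plus_aleph1_ge k = (\<^bold>\<exists>l s. is_aleph1 l \<^bold>\<and> is_a_plus_card l s \<^bold>\<and> k \<^bold>\<subseteq> s)"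

section \<open>Models of ZFC\<close>

definition ZFC_model :: "('v \<Rightarrow> 'v \<Rightarrow> bool) \<Rightarrow> bool" where
  "ZFC_model E \<longleftrightarrow>
    \<comment> \<open>Extensionality\<close>
    (\<forall>x y. (\<forall>z. E z x \<longleftrightarrow> E z y) \<longrightarrow> x = y) \<and>
    \<comment> \<open>Foundation\<close>
    (\<forall>x. (\<exists>y. E y x) \<longrightarrow> (\<exists>y. E y x \<and> \<not> (\<exists>z. E z y \<and> E z x))) \<and>
    \<comment> \<open>Pairing\<close>
    (\<forall>x y. \<exists>z. E x z \<and> E y z) \<and>
    \<comment> \<open>Union\<close>
    (\<forall>x. \<exists>u. \<forall>y z. E z y \<and> E y x \<longrightarrow> E z u) \<and>
    \<comment> \<open>Power set\<close>
    (\<forall>x. \<exists>u. \<forall>y. sat E (y \<^bold>\<subseteq> x) \<longrightarrow> E y u) \<and>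
    \<comment> \<open>Infinity\<close>
    (\<exists>w. (\<exists>x. E x w \<and> sat E (is_empty x)) \<and>
         (\<forall>x. E x w \<longrightarrow> (\<exists>y. E y w \<and> sat E (is_succ x y)))) \<and>
    \<comment> \<open>Choice: a disjoint family of nonempty sets has a transversal\<close>
    (\<forall>x. (\<forall>y. E y x \<longrightarrow> (\<exists>z. E z y)) \<and>
         (\<forall>y y' z. E y x \<and> E y' x \<and> E z y \<and> E z y' \<longrightarrow> y = y') \<longrightarrow>
         (\<exists>c. \<forall>y. E y x \<longrightarrow> (\<exists>!z. E z y \<and> E z c))) \<and>
    \<comment> \<open>Separation; the assignment \<open>e\<close> supplies the parameters\<close>
    (\<forall>\<phi> e a. first_order \<phi> \<longrightarrow>
         (\<exists>b. \<forall>x. E x b \<longleftrightarrow> E x a \<and> sat E (\<phi> (e(0 := x))))) \<and>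
    \<comment> \<open>Replacement\<close>
    (\<forall>\<phi> e a. first_order \<phi> \<and> (\<forall>x. E x a \<longrightarrow> (\<exists>!y. sat E (\<phi> (e(0 := x, 1 := y))))) \<longrightarrow>
         (\<exists>b. \<forall>x. E x a \<longrightarrow> (\<exists>y. E y b \<and> sat E (\<phi> (e(0 := x, 1 := y))))))"

section \<open>Forcing\<close>

text \<open>
  \<open>x\<close> is a \<open>P\<close>-name: all its elements are pairs \<open>(\<pi>, s)\<close> with \<open>\<pi>\<close> a \<open>P\<close>-name and \<open>s \<in> P\<close>.  The
  recursion is expressed by a set \<open>T\<close> that contains \<open>x\<close> and is closed in this sense.
\<close>

definition is_name :: "'v \<Rightarrow> 'v \<Rightarrow> 'v form" where
  "is_name P x = (\<^bold>\<exists>T. x \<^bold>\<in> T \<^bold>\<and> (\<^bold>\<forall>y z. y \<^bold>\<in> T \<^bold>\<and> z \<^bold>\<in> y \<^bold>\<longrightarrow>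
    (\<^bold>\<exists>\<pi> s. \<pi> \<^bold>\<in> T \<^bold>\<and> s \<^bold>\<in> P \<^bold>\<and> is_pair \<pi> s z)))"

text \<open>
  \<open>c\<close> is the canonical name of \<open>x\<close>, that is, the set of the pairs \<open>(c\<^sub>u, i)\<close> with \<open>u \<in> x\<close>, where
  \<open>c\<^sub>u\<close> is the canonical name of \<open>u\<close> and \<open>i\<close> the largest condition.  It is computed by a function
  \<open>f\<close> on a transitive set \<open>T\<close> containing \<open>x\<close>.
\<close>

definition is_check_name :: "'v \<Rightarrow> 'v \<Rightarrow> 'v \<Rightarrow> 'v form" where
  "is_check_name i x c = (\<^bold>\<exists>T B f. is_transitive T \<^bold>\<and> x \<^bold>\<in> T \<^bold>\<and> is_fun f T B \<^bold>\<and>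
    (\<^bold>\<forall>y d. pair_in y d f \<^bold>\<longrightarrow>
      (\<^bold>\<forall>z. z \<^bold>\<in> d \<^bold>\<longleftrightarrow> (\<^bold>\<exists>u v. u \<^bold>\<in> y \<^bold>\<and> pair_in u v f \<^bold>\<and> is_pair v i z))) \<^bold>\<and>
    pair_in x c f)"

text \<open>
  The forcing relation (as in Kunen's textbook) of a forcing notion with set of conditions \<open>P\<close> and
  order \<open>le\<close>, where \<open>le q p\<close> means that \<open>q\<close> is stronger than \<open>p\<close>.  Given the relation
  \<open>r \<tturnstile> \<pi> = \<rho>\<close>, the condition \<open>p\<close> forces \<open>\<pi> \<in> \<tau>\<close> iff densely many \<open>r\<close> below \<open>p\<close> satisfy \<open>r \<le> s\<close> and
  \<open>r \<tturnstile> \<pi> = \<rho>\<close> for some \<open>(\<rho>, s) \<in> \<tau>\<close>.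
\<close>

definition mem_clause ::
    "('v \<Rightarrow> 'v \<Rightarrow> bool) \<Rightarrow> 'v \<Rightarrow> ('v \<Rightarrow> 'v \<Rightarrow> bool) \<Rightarrow> ('v \<Rightarrow> 'v \<Rightarrow> 'v \<Rightarrow> bool) \<Rightarrow> 'v \<Rightarrow> 'v \<Rightarrow> 'v \<Rightarrow> bool" where
  "mem_clause E P le eq p \<pi> \<tau> \<longleftrightarrow>
    (\<forall>q. E q P \<and> le q p \<longrightarrow>
      (\<exists>r \<rho> s. E r P \<and> le r q \<and> sat E (pair_in \<rho> s \<tau>) \<and> le r s \<and> eq r \<pi> \<rho>))"

text \<open>
  \<open>p\<close> forces \<open>\<sigma> = \<tau>\<close> iff for every \<open>\<pi> \<in> dom(\<sigma>) \<union> dom(\<tau>)\<close>, the conditions below \<open>p\<close> that force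
  \<open>\<pi> \<in> \<sigma>\<close> are those that force \<open>\<pi> \<in> \<tau>\<close>.
\<close>

definition eq_clause ::
    "('v \<Rightarrow> 'v \<Rightarrow> bool) \<Rightarrow> 'v \<Rightarrow> ('v \<Rightarrow> 'v \<Rightarrow> bool) \<Rightarrow> ('v \<Rightarrow> 'v \<Rightarrow> 'v \<Rightarrow> bool) \<Rightarrow> 'v \<Rightarrow> 'v \<Rightarrow> 'v \<Rightarrow> bool" where
  "eq_clause E P le eq p \<sigma> \<tau> \<longleftrightarrow>
    (\<forall>\<pi> s q. (sat E (pair_in \<pi> s \<sigma>) \<or> sat E (pair_in \<pi> s \<tau>)) \<and> E q P \<and> le q p \<longrightarrow>
      (mem_clause E P le eq q \<pi> \<sigma> \<longleftrightarrow> mem_clause E P le eq q \<pi> \<tau>))"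

definition triple_in :: "('v \<Rightarrow> 'v \<Rightarrow> bool) \<Rightarrow> 'v \<Rightarrow> 'v \<Rightarrow> 'v \<Rightarrow> 'v \<Rightarrow> bool" where
  "triple_in E R p \<sigma> \<tau> \<longleftrightarrow> (\<exists>u. sat E (is_pair \<sigma> \<tau> u) \<and> sat E (pair_in p u R))"

text \<open>
  The two clauses define \<open>p \<tturnstile> \<sigma> = \<tau>\<close> by recursion on names.  The recursion takes place inside the
  model: a set \<open>R\<close> of the model obeys the recursive clause on a set \<open>T\<close> closed under passing from
  a name to the elements of its domain, and by Foundation in the model \<open>R\<close> is determined there.
\<close>

definition forces_eq ::
    "('v \<Rightarrow> 'v \<Rightarrow> bool) \<Rightarrow> 'v \<Rightarrow> ('v \<Rightarrow> 'v \<Rightarrow> bool) \<Rightarrow> 'v \<Rightarrow> 'v \<Rightarrow> 'v \<Rightarrow> bool" where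
  "forces_eq E P le p \<sigma> \<tau> \<longleftrightarrow>
    (\<exists>T R. E \<sigma> T \<and> E \<tau> T \<and> (\<forall>y \<pi> s. E y T \<and> sat E (pair_in \<pi> s y) \<longrightarrow> E \<pi> T) \<and>
      (\<forall>x y q. E x T \<and> E y T \<and> E q P \<longrightarrow>
        (triple_in E R q x y \<longleftrightarrow> eq_clause E P le (triple_in E R) q x y)) \<and>
      triple_in E R p \<sigma> \<tau>)"

primrec forces ::
    "('v \<Rightarrow> 'v \<Rightarrow> bool) \<Rightarrow> 'v \<Rightarrow> ('v \<Rightarrow> 'v \<Rightarrow> bool) \<Rightarrow> 'v form \<Rightarrow> 'v \<Rightarrow> bool" where
  "forces E P le (\<sigma> \<^bold>\<in> \<tau>) = (\<lambda>p. mem_clause E P le (forces_eq E P le) p \<sigma> \<tau>)"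
| "forces E P le (\<sigma> \<^bold>= \<tau>) = (\<lambda>p. forces_eq E P le p \<sigma> \<tau>)"
| "forces E P le (\<^bold>\<not> \<phi>) = (\<lambda>p. \<forall>q. E q P \<and> le q p \<longrightarrow> \<not> forces E P le \<phi> q)"
| "forces E P le (\<phi> \<^bold>\<and> \<psi>) = (\<lambda>p. forces E P le \<phi> p \<and> forces E P le \<psi> p)"
| "forces E P le (All \<phi>) = (\<lambda>p. \<forall>x. sat E (is_name P x) \<longrightarrow> forces E P le (\<phi> x) p)"

text \<open>\<open>\<phi>\<close> holds in every generic extension, that is, every condition forces \<open>\<phi>\<close>.\<close>

definition extension_models ::
    "('v \<Rightarrow> 'v \<Rightarrow> bool) \<Rightarrow> 'v \<Rightarrow> ('v \<Rightarrow> 'v \<Rightarrow> bool) \<Rightarrow> 'v form \<Rightarrow> bool" where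
  "extension_models E P le \<phi> \<longleftrightarrow> (\<forall>p. E p P \<longrightarrow> forces E P le \<phi> p)"

section \<open>Cohen forcing\<close>

definition is_two :: "'v \<Rightarrow> 'v form" where
  "is_two t = (\<^bold>\<exists>z i. is_empty z \<^bold>\<and> is_succ z i \<^bold>\<and> is_succ i t)"

text \<open>\<open>P = Fn(k, 2)\<close>, the set of finite partial functions from \<open>k\<close> to \<open>2\<close>.\<close>

definition is_Fn2 :: "'v \<Rightarrow> 'v \<Rightarrow> 'v form" where
  "is_Fn2 k P = (\<^bold>\<exists>t. is_two t \<^bold>\<and>
    (\<^bold>\<forall>p. p \<^bold>\<in> P \<^bold>\<longleftrightarrow> is_finite p \<^bold>\<and> is_partial_fun p k t))"

definition Fn_le :: "('v \<Rightarrow> 'v \<Rightarrow> bool) \<Rightarrow> 'v \<Rightarrow> 'v \<Rightarrow> bool" where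
  "Fn_le E q p \<longleftrightarrow> sat E (p \<^bold>\<subseteq> q)"

end

theory Submission
  imports Defs "HOL-Library.Countable" "HOL-Library.Infinite_Set"
begin

text \<open>
  Read off a real from the coordinates \<open>\<alpha> + n\<close> of the Cohen generic function, for each \<open>\<alpha> < \<kappa>\<close>, and let
  \<open>B\<^sub>\<alpha>\<close> and \<open>D\<^sub>\<alpha>\<close> be the sets of codes of the initial segments of this real and of its complement.  All these
  branches are pairwise almost disjoint.  Assume \<open>\<kappa> > \<omega>\<close> (else the theorem only says that the cardinals are infinite).  Take
  \<open>\<F> = {B\<^sub>\<alpha> | \<alpha> < \<omega>\<^sub>1}\<close>, so that every \<open>D\<^sub>\<beta>\<close> is in \<open>\<F>\<close>-perp.  A set that is almost
  disjoint from all \<open>B\<^sub>\<alpha>\<close> is nowhere dense in the binary tree, and this is witnessed by finite conditions.  If fewer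
  than \<open>\<kappa>\<close> such sets \<open>R\<^sub>i\<close> are given and no \<open>D\<^sub>\<beta>\<close> is almost disjoint from all of them, then each \<open>\<beta>\<close> has a condition
  below which \<open>D\<^sub>\<beta>\<close> meets some \<open>R\<^sub>i\<close> in an infinite set.  As \<open>\<kappa>\<close> is regular, \<open>\<kappa>\<close> many \<open>\<beta>\<close> have the same \<open>i\<close>, the same initial segment
  of \<open>D\<^sub>\<beta>\<close> and a common root of their conditions; extend the root to make \<open>R\<^sub>i\<close> miss a cone and then one of these
  conditions to lead \<open>D\<^sub>\<beta>\<close> into this cone, a contradiction.  So no infinite family of size less than \<open>\<kappa>\<close> is mad in
  \<open>\<F>\<close>-perp, whereas an infinite mad family is obtained by extending \<open>{D\<^sub>\<beta> | \<beta> < \<kappa>}\<close>.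

  No generic filter is available over an arbitrary model.  Instead, a sentence that is not forced fails in a countable
  term model of all the forced sentences; since the axioms are forced, every consequence of forced sentences in set
  theory is forced, and the combinatorics after the forcing takes place inside such a term model.
\<close>

section \<open>Formulas with de Bruijn indices and definability\<close>

text \<open>The ground model may be ill-founded from outside, so induction, separation and
  replacement are available only for relations definable in it. This shapes every statement:
  functions are HOL functions with a definable graph (\<open>dt\<close>), predicates are definable
  (\<open>df\<close>), and the uses of the axioms come with definability goals. In the term model,
  \<open>\<kappa>\<close> is known only as an ordinal, and \<open>\<F>\<close> as a family
  enumerated by an ordinal with countable members; both facts persist from the ground model. The
  aleph-one of the conclusion is that of the term model. \<open>\<F>\<close> is indexed by
  \<open>\<omega>\<^sub>1\<close> because the tree has countably many nodes and some node has to
  repeat for unboundedly many \<alpha>. Reading the sets \<open>D\<^sub>\<beta>\<close> as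
  complements on the same coordinates leaves all \<beta> < \<kappa> available for them. The indices
  are not restricted to limits, so the blocks of coordinates \<alpha> + n overlap; independence
  comes from picking an index whose whole block avoids a given condition.\<close>

datatype fm = FMem nat nat | FEq nat nat | FNeg fm | FConj fm fm | FAll fm

instance fm :: countable
  by countable_datatype

text \<open>The type \<open>form\<close> also contains objects with an arbitrary function under a
  quantifier. \<open>fm\<close> is the countable syntax behind the genuine formulas: it supports
  induction on formulas and their enumeration in \<open>henkin\<close>. Index 0 is the variable of
  the innermost quantifier.\<close>

primrec fform :: "fm \<Rightarrow> (nat \<Rightarrow> 'v) \<Rightarrow> 'v form" where
  "fform (FMem i j) e = (e i \<^bold>\<in> e j)"
| "fform (FEq i j) e = (e i \<^bold>= e j)"
| "fform (FNeg a) e = (\<^bold>\<not> fform a e)"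
| "fform (FConj a b) e = (fform a e \<^bold>\<and> fform b e)"
| "fform (FAll a) e = (\<^bold>\<forall>x. fform a (case_nat x e))"

primrec ren :: "(nat \<Rightarrow> nat) \<Rightarrow> fm \<Rightarrow> fm" where
  "ren f (FMem i j) = FMem (f i) (f j)"
| "ren f (FEq i j) = FEq (f i) (f j)"
| "ren f (FNeg a) = FNeg (ren f a)"
| "ren f (FConj a b) = FConj (ren f a) (ren f b)"
| "ren f (FAll a) = FAll (ren (case_nat 0 (\<lambda>n. Suc (f n))) a)"

text \<open>An upper bound of the free indices, kept coarse: it is not lowered by one under a
  quantifier. This is precise enough for \<open>fform_cong\<close>.\<close>

primrec fbound :: "fm \<Rightarrow> nat" where
  "fbound (FMem i j) = Suc (max i j)"
| "fbound (FEq i j) = Suc (max i j)"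
| "fbound (FNeg a) = fbound a"
| "fbound (FConj a b) = max (fbound a) (fbound b)"
| "fbound (FAll a) = fbound a"

lemma case_nat_comp: "(\<lambda>n. case_nat x e (case_nat 0 (\<lambda>n. Suc (f n)) n)) = case_nat x (\<lambda>n. e (f n))"
  by (auto split: nat.split)

lemma fform_ren: "fform (ren f a) e = fform a (\<lambda>n. e (f n))"
  by (induction a arbitrary: f e) (simp_all add: case_nat_comp)

lemma fform_cong: "(\<And>n. n < fbound a \<Longrightarrow> e n = e' n) \<Longrightarrow> fform a e = fform a e'"
proof (induction a arbitrary: e e')
  case (FAll a)
  have "fform a (case_nat x e) = fform a (case_nat x e')" for x
    by (rule FAll.IH) (use FAll.prems in \<open>auto split: nat.split\<close>)
  then show ?case by simp
next
  case (FNeg a)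
  show ?case using FNeg.IH[of e e'] FNeg.prems by simp
next
  case (FConj a b)
  show ?case using FConj.IH(1)[of e e'] FConj.IH(2)[of e e'] FConj.prems by simp
qed auto

lemma first_order_ren: "first_order (\<lambda>e. fform a (\<lambda>n. e (f n)))"
proof (induction a arbitrary: f)
  case (FAll a)
  \<comment> \<open>The quantifier of \<open>first_order\<close> binds a named variable, so a name
    is taken that is not the image of any index occurring in \<open>a\<close>.\<close>
  obtain i where i: "i \<notin> f ` {..fbound a}"
    using ex_new_if_finite[OF infinite_UNIV_nat, of "f ` {..fbound a}"] by auto
  have "fform a (case_nat x (\<lambda>n. e (f n))) = fform a (\<lambda>n. (e(i := x)) (case_nat i f n))" for x and e :: "nat \<Rightarrow> 'a"
    by (rule fform_cong) (use i in \<open>auto split: nat.split\<close>)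
  then show ?case using first_order.intros(5)[OF FAll, of i "case_nat i f"] by simp
qed (auto intro: first_order.intros)

lemma first_order_fform: "first_order (fform a)"
  using first_order_ren[of a "\<lambda>n. n"] by simp

text \<open>Even indices carry the variables and odd indices the parameters, so that one assignment
  has room for infinitely many of both.\<close>

definition comb :: "(nat \<Rightarrow> 'v) \<Rightarrow> (nat \<Rightarrow> 'v) \<Rightarrow> nat \<Rightarrow> 'v" where
  "comb e c n = (if even n then e (n div 2) else c (n div 2))"

lemma sat_simps [simp]:
  "sat E (\<phi> \<^bold>\<or> \<psi>) \<longleftrightarrow> sat E \<phi> \<or> sat E \<psi>"
  "sat E (\<phi> \<^bold>\<longrightarrow> \<psi>) \<longleftrightarrow> (sat E \<phi> \<longrightarrow> sat E \<psi>)"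
  "sat E (\<phi> \<^bold>\<longleftrightarrow> \<psi>) \<longleftrightarrow> (sat E \<phi> \<longleftrightarrow> sat E \<psi>)"
  "sat E (Ex \<Phi>) \<longleftrightarrow> (\<exists>x. sat E (\<Phi> x))"
  by (auto simp: Disj_def Imp_def Iff_def Ex_def)

section \<open>Relations and terms definable with parameters\<close>

locale emodel =
  fixes E :: "'v \<Rightarrow> 'v \<Rightarrow> bool"  (infix "\<epsilon>" 50)
begin

text \<open>Definable with parameters; the parameters are the values of \<open>c\<close>.\<close>

definition df :: "((nat \<Rightarrow> 'v) \<Rightarrow> bool) \<Rightarrow> bool" where
  "df R \<longleftrightarrow> (\<exists>a c. \<forall>e. R e \<longleftrightarrow> sat E (fform a (comb e c)))"

text \<open>Definability of the graph: index 0 stands for the value, and the arguments of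
  \<open>t\<close> are shifted up by one.\<close>

definition dt :: "((nat \<Rightarrow> 'v) \<Rightarrow> 'v) \<Rightarrow> bool" where
  "dt t \<longleftrightarrow> df (\<lambda>e. e 0 = t (\<lambda>n. e (Suc n)))"

named_theorems dfi

lemma df_ren: "df R \<Longrightarrow> df (\<lambda>e. R (\<lambda>n. e (f n)))"
proof -
  assume "df R"
  then obtain a c where *: "\<And>e. R e \<longleftrightarrow> sat E (fform a (comb e c))" unfolding df_def by blast
  let ?g = "\<lambda>n. if even n then 2 * f (n div 2) else n"
  have "(\<lambda>n. comb e c (?g n)) = comb (\<lambda>n. e (f n)) c" for e by (auto simp: comb_def)
  then have "sat E (fform (ren ?g a) (comb e c)) \<longleftrightarrow> R (\<lambda>n. e (f n))" for e
    by (simp add: fform_ren *)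
  then show ?thesis unfolding df_def by blast
qed

lemma df_not [dfi]: "df P \<Longrightarrow> df (\<lambda>e. \<not> P e)"
proof -
  assume "df P"
  then obtain a c where "\<And>e. P e \<longleftrightarrow> sat E (fform a (comb e c))" unfolding df_def by blast
  then have "\<And>e. (\<not> P e) \<longleftrightarrow> sat E (fform (FNeg a) (comb e c))" by simp
  then show ?thesis unfolding df_def by blast
qed

lemma df_conj [dfi]: assumes "df P" "df Q" shows "df (\<lambda>e. P e \<and> Q e)"
proof -
  obtain a c b d where *: "\<And>e. P e \<longleftrightarrow> sat E (fform a (comb e c))" "\<And>e. Q e \<longleftrightarrow> sat E (fform b (comb e d))"
    using assms unfolding df_def by blast
  \<comment> \<open>The two parameter sequences are merged into \<open>comb c d\<close>;
    \<open>?f\<close> and \<open>?g\<close> redirect the parameter indices to the respective half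
    and keep the variables.\<close>
  let ?f = "\<lambda>n. if even n then n else 2 * (2 * (n div 2)) + 1"
  let ?g = "\<lambda>n. if even n then n else 2 * (2 * (n div 2) + 1) + 1"
  have 1: "(\<lambda>n. comb e (comb c d) (?f n)) = comb e c" "(\<lambda>n. comb e (comb c d) (?g n)) = comb e d" for e
    by (auto simp add: comb_def fun_eq_iff elim!: oddE)
  have "\<And>e. (P e \<and> Q e) \<longleftrightarrow> sat E (fform (FConj (ren ?f a) (ren ?g b)) (comb e (comb c d)))"
    by (simp add: fform_ren 1 *)
  then show ?thesis unfolding df_def by blast
qed

lemma df_all [dfi]: assumes "df (\<lambda>e. Q (e 0) (\<lambda>n. e (Suc n)))" shows "df (\<lambda>e. \<forall>x. Q x e)"
proof -
  obtain a c where *: "\<And>e. Q (e 0) (\<lambda>n. e (Suc n)) \<longleftrightarrow> sat E (fform a (comb e c))"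
    using assms unfolding df_def by blast
  \<comment> \<open>Putting the bound variable in front moves the other variables to odd and the
    parameters to even positions; \<open>?g\<close> realigns them.\<close>
  let ?g = "\<lambda>n. if n = 0 then 0 else if even n then Suc (n - 2) else Suc n"
  have 1: "(\<lambda>n. case_nat x (comb e c) (?g n)) = comb (case_nat x e) c" for x e
    by (auto simp: comb_def fun_eq_iff elim!: evenE split: nat.split)
  have "Q x e \<longleftrightarrow> sat E (fform a (comb (case_nat x e) c))" for x e
    using *[of "case_nat x e"] by simp
  then have "\<And>e. (\<forall>x. Q x e) \<longleftrightarrow> sat E (fform (FAll (ren ?g a)) (comb e c))"
    by (simp add: fform_ren 1)
  then show ?thesis unfolding df_def by blast
qed

lemma df_mem_var: "df (\<lambda>e. e i \<epsilon> e j)"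
  unfolding df_def by (rule exI[of _ "FMem (2*i) (2*j)"]) (simp add: comb_def)

lemma df_eq_var: "df (\<lambda>e. e i = e j)"
  unfolding df_def by (rule exI[of _ "FEq (2*i) (2*j)"]) (simp add: comb_def)

lemma dt_const [dfi]: "dt (\<lambda>e. c)"
  unfolding dt_def df_def by (rule exI[of _ "FEq 0 1"], rule exI[of _ "\<lambda>_. c"]) (simp add: comb_def)

lemma dt_var [dfi]: "dt (\<lambda>e. e i)"
  unfolding dt_def by (rule df_eq_var)

lemma df_const [dfi]: "df (\<lambda>e. b)"
proof (cases b)
  case True
  have "df (\<lambda>e. e 0 = e 0)" by (rule df_eq_var)
  then show ?thesis using True by simp
next
  case False
  have "df (\<lambda>e. \<not> e 0 = e 0)" by (intro dfi df_eq_var)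
  then show ?thesis using False by simp
qed

lemma df_disj [dfi]: assumes "df P" "df Q" shows "df (\<lambda>e. P e \<or> Q e)"
proof -
  have "df (\<lambda>e. \<not> (\<not> P e \<and> \<not> Q e))" by (intro dfi assms)
  then show ?thesis by simp
qed

lemma df_imp [dfi]: assumes "df P" "df Q" shows "df (\<lambda>e. P e \<longrightarrow> Q e)"
proof -
  have "df (\<lambda>e. \<not> (P e \<and> \<not> Q e))" by (intro dfi assms)
  then show ?thesis by simp
qed

lemma df_iff [dfi]: assumes "df P" "df Q" shows "df (\<lambda>e. P e \<longleftrightarrow> Q e)"
proof -
  have "df (\<lambda>e. (P e \<longrightarrow> Q e) \<and> (Q e \<longrightarrow> P e))" by (intro dfi assms)
  then show ?thesis by (simp add: iff_conv_conj_imp)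
qed

lemma df_ex [dfi]: assumes "df (\<lambda>e. Q (e 0) (\<lambda>n. e (Suc n)))" shows "df (\<lambda>e. \<exists>x. Q x e)"
proof -
  have "df (\<lambda>e. \<not> (\<forall>x. \<not> Q x e))" by (intro dfi assms)
  then show ?thesis by simp
qed

lemma df_subst: assumes "df (\<lambda>e. Q (e 0) (\<lambda>n. e (Suc n)))" "dt t" shows "df (\<lambda>e. Q (t e) e)"
proof -
  have "df (\<lambda>e. \<exists>x. x = t e \<and> Q x e)"
    by (intro dfi assms(1) assms(2)[unfolded dt_def])
  then show ?thesis by simp
qed

lemma dt_subst: assumes "dt (\<lambda>e. h (e 0) (\<lambda>n. e (Suc n)))" "dt t" shows "dt (\<lambda>e. h (t e) e)"
proof -
  have 1: "df (\<lambda>e. e (Suc 0) = h (e 0) (\<lambda>n. e (Suc (Suc n))))"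
    using df_ren[OF assms(1)[unfolded dt_def], of "case_nat 1 (case_nat 0 (\<lambda>n. Suc (Suc n)))"] by simp
  have 2: "dt (\<lambda>e. t (\<lambda>n. e (Suc n)))"
    using df_ren[OF assms(2)[unfolded dt_def], of "case_nat 0 (\<lambda>n. Suc (Suc n))"] by (simp add: dt_def)
  show ?thesis unfolding dt_def
    by (rule df_subst[where Q = "\<lambda>y e. e 0 = h y (\<lambda>n. e (Suc n))", OF _ 2]) (rule 1)
qed

lemma dt_ren: "dt t \<Longrightarrow> dt (\<lambda>e. t (\<lambda>n. e (f n)))"
  unfolding dt_def using df_ren[of "\<lambda>e. e 0 = t (\<lambda>n. e (Suc n))" "case_nat 0 (\<lambda>n. Suc (f n))"] by simp

lemma dt_subst2:
  assumes "dt (\<lambda>e. h (e 0) (e (Suc 0)) (\<lambda>n. e (Suc (Suc n))))" "dt t" "dt s"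
  shows "dt (\<lambda>e. h (t e) (s e) e)"
proof -
  have "dt (\<lambda>e. h (t (\<lambda>n. e (Suc n))) (e 0) (\<lambda>n. e (Suc n)))"
  proof (rule dt_subst[where h = "\<lambda>x e. h x (e 0) (\<lambda>n. e (Suc n))"])
    show "dt (\<lambda>e. h (e 0) (e (Suc 0)) (\<lambda>n. e (Suc (Suc n))))" by (rule assms(1))
  qed (rule dt_ren[OF assms(2)])
  from dt_subst[where h = "\<lambda>x e. h (t e) x e", OF _ assms(3)] this show ?thesis by simp
qed

lemma df_subst2:
  assumes "df (\<lambda>e. Q (e 0) (e (Suc 0)) (\<lambda>n. e (Suc (Suc n))))" "dt t" "dt s"
  shows "df (\<lambda>e. Q (t e) (s e) e)"
proof -
  have "df (\<lambda>e. Q (t (\<lambda>n. e (Suc n))) (e 0) (\<lambda>n. e (Suc n)))"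
    by (rule df_subst[where Q = "\<lambda>x e. Q x (e 0) (\<lambda>n. e (Suc n))", OF _ dt_ren[OF assms(2)]]) (rule assms(1))
  from df_subst[where Q = "\<lambda>x e. Q (t e) x e", OF _ assms(3)] this show ?thesis by simp
qed

lemma df_mem [dfi]: "dt t \<Longrightarrow> dt s \<Longrightarrow> df (\<lambda>e. t e \<epsilon> s e)"
  by (rule df_subst2[where Q = "\<lambda>x y e. x \<epsilon> y"]) (rule df_mem_var)

lemma df_eq [dfi]: "dt t \<Longrightarrow> dt s \<Longrightarrow> df (\<lambda>e. t e = s e)"
  by (rule df_subst2[where Q = "\<lambda>x y e. x = y"]) (rule df_eq_var)

lemma df_ex1 [dfi]: assumes "df (\<lambda>e. Q (e 0) (\<lambda>n. e (Suc n)))" shows "df (\<lambda>e. \<exists>!x. Q x e)"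
proof -
  have "df (\<lambda>e. Q (e 0) (\<lambda>n. e (Suc (Suc n))))"
    using df_ren[OF assms, of "case_nat 0 (\<lambda>n. Suc (Suc n))"] by simp
  then have "df (\<lambda>e. \<exists>x. Q x e \<and> (\<forall>y. Q y e \<longrightarrow> y = x))" by (intro dfi assms)
  then show ?thesis by (simp add: Ex1_def)
qed

lemma dt_if [dfi]: assumes "df P" "dt t" "dt s" shows "dt (\<lambda>e. if P e then t e else s e)"
proof -
  have "df (\<lambda>e. (P (\<lambda>n. e (Suc n)) \<and> e 0 = t (\<lambda>n. e (Suc n))) \<or> (\<not> P (\<lambda>n. e (Suc n)) \<and> e 0 = s (\<lambda>n. e (Suc n))))"
    by (intro dfi df_ren[OF assms(1)] dt_ren[OF assms(2)] dt_ren[OF assms(3)])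
  then show ?thesis unfolding dt_def by (rule back_subst[of df]) auto
qed

text \<open>A definite description with a value that does not depend on the predicate when it is improper.\<close>

definition desc :: "('v \<Rightarrow> bool) \<Rightarrow> 'v" where
  "desc Q = (if \<exists>!x. Q x then THE x. Q x else undefined)"

lemma desc_eq: "(\<exists>!x. Q x) \<Longrightarrow> Q y \<Longrightarrow> desc Q = y"
  unfolding desc_def by (auto intro: the1_equality)

lemma descI: "\<exists>!x. Q x \<Longrightarrow> Q (desc Q)"
  unfolding desc_def by (simp add: theI')

lemma desc_iff: "y = desc Q \<longleftrightarrow> (\<exists>!x. Q x) \<and> Q y \<or> \<not> (\<exists>!x. Q x) \<and> y = undefined"
proof (cases "\<exists>!x. Q x")
  case True
  then show ?thesis using desc_eq[OF True, of y] descI[OF True] by blast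
qed (simp add: desc_def)

lemma dt_desc [dfi]: assumes "df (\<lambda>e. Q (e 0) (\<lambda>n. e (Suc n)))" shows "dt (\<lambda>e. desc (\<lambda>x. Q x e))"
proof -
  have "df (\<lambda>e. Q (e 0) (\<lambda>n. e (Suc (Suc n))))"
    using df_ren[OF assms, of "case_nat 0 (\<lambda>n. Suc (Suc n))"] by simp
  then have "df (\<lambda>e. ((\<exists>!x. Q x (\<lambda>n. e (Suc n))) \<and> Q (e 0) (\<lambda>n. e (Suc n))) \<or>
     (\<not> (\<exists>!x. Q x (\<lambda>n. e (Suc n))) \<and> e 0 = undefined))"
    by (intro dfi assms)
  then show ?thesis unfolding dt_def
    by (rule back_subst[of df], intro ext) (simp add: desc_iff)
qed

text \<open>A definable term for every definable predicate, denoting the collection only if that is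
  a set. Thus the definability of the operations below can be settled before their
  existence.\<close>

definition Col :: "('v \<Rightarrow> bool) \<Rightarrow> 'v" where
  "Col Q = desc (\<lambda>b. \<forall>x. x \<epsilon> b \<longleftrightarrow> Q x)"

lemma dt_Col [dfi]: assumes "df (\<lambda>e. Q (e 0) (\<lambda>n. e (Suc n)))" shows "dt (\<lambda>e. Col (\<lambda>x. Q x e))"
proof -
  have "df (\<lambda>e. Q (e 0) (\<lambda>n. e (Suc (Suc n))))"
    using df_ren[OF assms, of "case_nat 0 (\<lambda>n. Suc (Suc n))"] by simp
  then show ?thesis unfolding Col_def by (intro dfi)
qed

abbreviation df1 :: "('v \<Rightarrow> bool) \<Rightarrow> bool" where "df1 Q \<equiv> df (\<lambda>e. Q (e 0))"
abbreviation df2 :: "('v \<Rightarrow> 'v \<Rightarrow> bool) \<Rightarrow> bool" where "df2 Q \<equiv> df (\<lambda>e. Q (e 0) (e (Suc 0)))"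
abbreviation dt1 :: "('v \<Rightarrow> 'v) \<Rightarrow> bool" where "dt1 h \<equiv> dt (\<lambda>e. h (e 0))"
abbreviation dt2 :: "('v \<Rightarrow> 'v \<Rightarrow> 'v) \<Rightarrow> bool" where "dt2 h \<equiv> dt (\<lambda>e. h (e 0) (e (Suc 0)))"

lemma df1_app: "df1 Q \<Longrightarrow> dt t \<Longrightarrow> df (\<lambda>e. Q (t e))"
  by (rule df_subst[where Q = "\<lambda>x e. Q x"])
lemma df2_app: "df2 Q \<Longrightarrow> dt t \<Longrightarrow> dt s \<Longrightarrow> df (\<lambda>e. Q (t e) (s e))"
  by (rule df_subst2[where Q = "\<lambda>x y e. Q x y"])
lemma dt1_app: "dt1 h \<Longrightarrow> dt t \<Longrightarrow> dt (\<lambda>e. h (t e))"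
  by (rule dt_subst[where h = "\<lambda>x e. h x"])
lemma dt2_app: "dt2 h \<Longrightarrow> dt t \<Longrightarrow> dt s \<Longrightarrow> dt (\<lambda>e. h (t e) (s e))"
  by (rule dt_subst2[where h = "\<lambda>x y e. h x y"])

end

section \<open>Set theory inside a model\<close>

text \<open>Set theory without Choice, with the schemes indexed by \<open>fm\<close>: in this form
  the axioms can be verified for a term model formula by formula. Replacement only provides a set
  containing the values; exact images follow by separation.\<close>

locale zf = emodel E for E :: "'v \<Rightarrow> 'v \<Rightarrow> bool"  (infix "\<epsilon>" 50) +
  assumes exten: "(\<And>z. z \<epsilon> x \<longleftrightarrow> z \<epsilon> y) \<Longrightarrow> x = y"
    and found: "y \<epsilon> x \<Longrightarrow> \<exists>y. y \<epsilon> x \<and> \<not> (\<exists>z. z \<epsilon> y \<and> z \<epsilon> x)"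
    and pairing: "\<exists>z. x \<epsilon> z \<and> y \<epsilon> z"
    and union: "\<exists>u. \<forall>y z. z \<epsilon> y \<and> y \<epsilon> x \<longrightarrow> z \<epsilon> u"
    and power: "\<exists>u. \<forall>y. (\<forall>z. z \<epsilon> y \<longrightarrow> z \<epsilon> x) \<longrightarrow> y \<epsilon> u"
    and infinity: "\<exists>w. (\<exists>x. x \<epsilon> w \<and> (\<forall>z. \<not> z \<epsilon> x)) \<and>
         (\<forall>x. x \<epsilon> w \<longrightarrow> (\<exists>y. y \<epsilon> w \<and> (\<forall>z. z \<epsilon> y \<longleftrightarrow> z \<epsilon> x \<or> z = x)))"
    and separation: "\<exists>b. \<forall>x. x \<epsilon> b \<longleftrightarrow> x \<epsilon> a \<and> sat E (fform f (case_nat x e))"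
    and replacement: "(\<And>x. x \<epsilon> a \<Longrightarrow> \<exists>!y. sat E (fform f (case_nat x (case_nat y e)))) \<Longrightarrow>
         \<exists>b. \<forall>x. x \<epsilon> a \<longrightarrow> (\<exists>y. y \<epsilon> b \<and> sat E (fform f (case_nat x (case_nat y e))))"
begin

abbreviation sub :: "'v \<Rightarrow> 'v \<Rightarrow> bool" where "sub x y \<equiv> \<forall>z. z \<epsilon> x \<longrightarrow> z \<epsilon> y"

definition small :: "('v \<Rightarrow> bool) \<Rightarrow> bool" where "small Q \<longleftrightarrow> (\<exists>b. \<forall>x. x \<epsilon> b \<longleftrightarrow> Q x)"

lemma mem_Col: "small Q \<Longrightarrow> x \<epsilon> Col Q \<longleftrightarrow> Q x"
proof -
  assume "small Q"
  then have "\<exists>!b. \<forall>x. x \<epsilon> b \<longleftrightarrow> Q x" unfolding small_def by (metis exten)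
  from descI[OF this] show ?thesis unfolding Col_def by blast
qed

lemma sep_df:
  assumes "df1 Q" shows "\<exists>b. \<forall>x. x \<epsilon> b \<longleftrightarrow> x \<epsilon> a \<and> Q x"
proof -
  obtain f c where *: "\<And>e. Q (e 0) \<longleftrightarrow> sat E (fform f (comb e c))" using assms unfolding df_def by blast
  \<comment> \<open>The variable \<open>x\<close> in front shifts every position by one, so here the
    parameters sit at even positions.\<close>
  let ?u = "\<lambda>n. if odd n then undefined else c (n div 2)"
  have 1: "case_nat x ?u = comb (case_nat x (\<lambda>_. undefined)) c" for x
    by (rule HOL.ext) (auto simp: comb_def split: nat.split elim!: evenE)
  show ?thesis using separation[of a f ?u] *[of "case_nat _ (\<lambda>_. undefined)"] by (simp add: 1)
qed

lemma small_sub: "df1 Q \<Longrightarrow> (\<And>x. Q x \<Longrightarrow> x \<epsilon> a) \<Longrightarrow> small Q"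
  unfolding small_def using sep_df[of Q a] by metis

lemma repl_df:
  assumes "df2 Q" "\<And>x. x \<epsilon> a \<Longrightarrow> \<exists>!y. Q x y" shows "\<exists>b. \<forall>x. x \<epsilon> a \<longrightarrow> (\<exists>y. y \<epsilon> b \<and> Q x y)"
proof -
  obtain f c where *: "\<And>e. Q (e 0) (e (Suc 0)) \<longleftrightarrow> sat E (fform f (comb e c))"
    using assms(1) unfolding df_def by blast
  let ?e = "\<lambda>x y. case_nat x (case_nat y (\<lambda>_. undefined))"
  let ?u = "\<lambda>n. if even n then undefined else c (n div 2)"
  let ?g = "\<lambda>n::nat. if n = 0 then 0 else if n = 2 then 1 else Suc (Suc n)"
  have 1: "(\<lambda>n. case_nat x (case_nat y ?u) (?g n)) = comb (?e x y) c" for x y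
    by (rule HOL.ext) (auto simp: comb_def elim!: evenE split: nat.split)
  have 2: "sat E (fform (ren ?g f) (case_nat x (case_nat y ?u))) \<longleftrightarrow> Q x y" for x y
    using *[of "?e x y"] by (simp add: fform_ren 1)
  show ?thesis using replacement[of a "ren ?g f" ?u] assms(2) unfolding 2 by blast
qed

lemma small_image: assumes "dt1 f" shows "small (\<lambda>y. \<exists>x. x \<epsilon> a \<and> y = f x)"
proof -
  note [dfi] = dt1_app[OF assms]
  have "df2 (\<lambda>x y. y = f x)" by (intro dfi)
  from repl_df[OF this, of a] obtain b where "\<forall>x. x \<epsilon> a \<longrightarrow> (\<exists>y. y \<epsilon> b \<and> y = f x)" by auto
  moreover have "df1 (\<lambda>y. \<exists>x. x \<epsilon> a \<and> y = f x)" by (intro dfi)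
  ultimately show ?thesis by (intro small_sub[of _ b]) auto
qed

section \<open>Set operations as definable terms\<close>

definition emp where "emp = Col (\<lambda>x. False)"
definition upair where "upair a b = Col (\<lambda>x. x = a \<or> x = b)"
definition Uni where "Uni x = Col (\<lambda>z. \<exists>y. z \<epsilon> y \<and> y \<epsilon> x)"
definition Pw where "Pw x = Col (\<lambda>y. sub y x)"
definition Rep where "Rep a f = Col (\<lambda>y. \<exists>x. x \<epsilon> a \<and> y = f x)"
definition Sep where "Sep a Q = Col (\<lambda>x. x \<epsilon> a \<and> Q x)"
definition pr where "pr a b = upair (upair a a) (upair a b)"
definition un where "un a b = Col (\<lambda>x. x \<epsilon> a \<or> x \<epsilon> b)"
definition ins where "ins x a = Col (\<lambda>y. y = x \<or> y \<epsilon> a)"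
definition suc where "suc x = ins x x"
definition prod where "prod a b = Col (\<lambda>z. \<exists>x y. x \<epsilon> a \<and> y \<epsilon> b \<and> z = pr x y)"
definition Lam where "Lam a f = Rep a (\<lambda>x. pr x (f x))"
definition app where "app f x = desc (\<lambda>y. pr x y \<epsilon> f)"
definition el where "el a = {x. x \<epsilon> a}"

lemma dt_basic [dfi]:
  "dt (\<lambda>e. emp)"
  "dt s \<Longrightarrow> dt t \<Longrightarrow> dt (\<lambda>e. upair (s e) (t e))"
  "dt s \<Longrightarrow> dt t \<Longrightarrow> dt (\<lambda>e. pr (s e) (t e))"
  "dt s \<Longrightarrow> dt t \<Longrightarrow> dt (\<lambda>e. un (s e) (t e))"
  "dt s \<Longrightarrow> dt t \<Longrightarrow> dt (\<lambda>e. ins (s e) (t e))"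
  "dt s \<Longrightarrow> dt t \<Longrightarrow> dt (\<lambda>e. prod (s e) (t e))"
  "dt s \<Longrightarrow> dt t \<Longrightarrow> dt (\<lambda>e. app (s e) (t e))"
  "dt s \<Longrightarrow> dt (\<lambda>e. Uni (s e))"
  "dt s \<Longrightarrow> dt (\<lambda>e. Pw (s e))"
  "dt s \<Longrightarrow> dt (\<lambda>e. suc (s e))"
proof -
  show 1: "dt s \<Longrightarrow> dt t \<Longrightarrow> dt (\<lambda>e. upair (s e) (t e))" for s t
    by (rule dt2_app[of upair]) (unfold upair_def, intro dfi)
  show 2: "dt s \<Longrightarrow> dt t \<Longrightarrow> dt (\<lambda>e. pr (s e) (t e))" for s t
    by (rule dt2_app[of pr]) (unfold pr_def, intro dfi 1)
  show "dt s \<Longrightarrow> dt t \<Longrightarrow> dt (\<lambda>e. un (s e) (t e))"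
    by (rule dt2_app[of un]) (unfold un_def, intro dfi)
  show 3: "dt s \<Longrightarrow> dt t \<Longrightarrow> dt (\<lambda>e. ins (s e) (t e))" for s t
    by (rule dt2_app[of ins]) (unfold ins_def, intro dfi)
  show "dt s \<Longrightarrow> dt t \<Longrightarrow> dt (\<lambda>e. prod (s e) (t e))"
    by (rule dt2_app[of prod]) (unfold prod_def, intro dfi 2)
  show "dt s \<Longrightarrow> dt t \<Longrightarrow> dt (\<lambda>e. app (s e) (t e))"
    by (rule dt2_app[of app]) (unfold app_def, intro dfi 2)
  show "dt s \<Longrightarrow> dt (\<lambda>e. Uni (s e))"
    by (rule dt1_app[of Uni]) (unfold Uni_def, intro dfi)
  show "dt s \<Longrightarrow> dt (\<lambda>e. Pw (s e))"
    by (rule dt1_app[of Pw]) (unfold Pw_def, intro dfi)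
  show "dt s \<Longrightarrow> dt (\<lambda>e. suc (s e))"
    by (rule dt1_app[of suc]) (unfold suc_def, intro dfi 3)
qed (rule dt_const)

lemma dt_Rep [dfi]:
  assumes "dt a" "dt (\<lambda>e. f (e 0) (\<lambda>n. e (Suc n)))" shows "dt (\<lambda>e. Rep (a e) (\<lambda>x. f x e))"
proof -
  have 1: "dt (\<lambda>e. f (e 0) (\<lambda>n. e (Suc (Suc n))))"
    using dt_ren[OF assms(2), of "case_nat 0 (\<lambda>n. Suc (Suc n))"] by simp
  have "dt (\<lambda>e. a (\<lambda>n. e (Suc n)))" "dt (\<lambda>e. a (\<lambda>n. e (Suc (Suc n))))"
    using dt_ren[OF assms(1), of Suc] dt_ren[OF assms(1), of "\<lambda>n. Suc (Suc n)"] by simp_all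
  then show ?thesis unfolding Rep_def by (intro dfi 1)
qed

lemma dt_Sep [dfi]:
  assumes "dt a" "df (\<lambda>e. Q (e 0) (\<lambda>n. e (Suc n)))" shows "dt (\<lambda>e. Sep (a e) (\<lambda>x. Q x e))"
proof -
  have "dt (\<lambda>e. a (\<lambda>n. e (Suc n)))"
    using dt_ren[OF assms(1), of Suc] by simp
  then show ?thesis unfolding Sep_def by (intro dfi assms)
qed

lemma mem_emp [simp]: "\<not> x \<epsilon> emp"
proof -
  obtain w x where "\<forall>z. \<not> z \<epsilon> x" using infinity by blast
  then have "small (\<lambda>x. False)" unfolding small_def by blast
  then show ?thesis unfolding emp_def by (simp add: mem_Col)
qed

lemma mem_upair [simp]: "x \<epsilon> upair a b \<longleftrightarrow> x = a \<or> x = b"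
proof -
  obtain z where "a \<epsilon> z" "b \<epsilon> z" using pairing by blast
  then have "small (\<lambda>x. x = a \<or> x = b)" by (intro small_sub[of _ z]) (intro dfi, auto)
  then show ?thesis unfolding upair_def by (simp add: mem_Col)
qed

lemma mem_Uni [simp]: "x \<epsilon> Uni a \<longleftrightarrow> (\<exists>y. x \<epsilon> y \<and> y \<epsilon> a)"
proof -
  obtain u where "\<forall>y z. z \<epsilon> y \<and> y \<epsilon> a \<longrightarrow> z \<epsilon> u" using union by blast
  then have "small (\<lambda>z. \<exists>y. z \<epsilon> y \<and> y \<epsilon> a)" by (intro small_sub[of _ u]) (intro dfi, auto)
  then show ?thesis unfolding Uni_def by (simp add: mem_Col)
qed

lemma mem_Pw [simp]: "x \<epsilon> Pw a \<longleftrightarrow> sub x a"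
proof -
  obtain u where "\<forall>y. sub y a \<longrightarrow> y \<epsilon> u" using power by blast
  then have "small (\<lambda>y. sub y a)" by (intro small_sub[of _ u]) (intro dfi, auto)
  then show ?thesis unfolding Pw_def by (simp add: mem_Col)
qed

lemma mem_Rep: "dt1 f \<Longrightarrow> y \<epsilon> Rep a f \<longleftrightarrow> (\<exists>x. x \<epsilon> a \<and> y = f x)"
  unfolding Rep_def by (simp add: mem_Col small_image)

lemma mem_Sep: "df1 Q \<Longrightarrow> x \<epsilon> Sep a Q \<longleftrightarrow> x \<epsilon> a \<and> Q x"
  unfolding Sep_def by (simp add: mem_Col small_def sep_df)

lemma mem_un [simp]: "x \<epsilon> un a b \<longleftrightarrow> x \<epsilon> a \<or> x \<epsilon> b"
proof -
  have "small (\<lambda>x. x \<epsilon> a \<or> x \<epsilon> b)" by (intro small_sub[of _ "Uni (upair a b)"]) (intro dfi, auto)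
  then show ?thesis unfolding un_def by (simp add: mem_Col)
qed

lemma mem_ins [simp]: "x \<epsilon> ins a b \<longleftrightarrow> x = a \<or> x \<epsilon> b"
proof -
  have "small (\<lambda>x. x = a \<or> x \<epsilon> b)" by (intro small_sub[of _ "un (upair a a) b"]) (intro dfi, auto)
  then show ?thesis unfolding ins_def by (simp add: mem_Col)
qed

lemma mem_suc [simp]: "x \<epsilon> suc a \<longleftrightarrow> x = a \<or> x \<epsilon> a"
  by (simp add: suc_def)

lemma upair_eq: "upair a b = upair c d \<longleftrightarrow> a = c \<and> b = d \<or> a = d \<and> b = c"
proof
  assume "upair a b = upair c d"
  then have "x \<epsilon> upair a b \<longleftrightarrow> x \<epsilon> upair c d" for x by (rule arg_cong)
  then have "x = a \<or> x = b \<longleftrightarrow> x = c \<or> x = d" for x by simp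
  then show "a = c \<and> b = d \<or> a = d \<and> b = c" by metis
next
  assume *: "a = c \<and> b = d \<or> a = d \<and> b = c"
  show "upair a b = upair c d" by (rule exten) (use * in auto)
qed

lemma pr_inj [simp]: "pr a b = pr c d \<longleftrightarrow> a = c \<and> b = d"
  by (auto simp: pr_def upair_eq)

lemma mem_pr [simp]: "x \<epsilon> pr a b \<longleftrightarrow> x = upair a a \<or> x = upair a b"
  by (auto simp: pr_def)

lemma mem_prod [simp]: "z \<epsilon> prod a b \<longleftrightarrow> (\<exists>x y. x \<epsilon> a \<and> y \<epsilon> b \<and> z = pr x y)"
proof -
  have "pr x y \<epsilon> Pw (Pw (un a b))" if "x \<epsilon> a" "y \<epsilon> b" for x y
    using that by auto
  moreover have "df1 (\<lambda>z. \<exists>x y. x \<epsilon> a \<and> y \<epsilon> b \<and> z = pr x y)" by (intro dfi)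
  ultimately have "small (\<lambda>z. \<exists>x y. x \<epsilon> a \<and> y \<epsilon> b \<and> z = pr x y)"
    by (intro small_sub[of _ "Pw (Pw (un a b))"]) blast+
  then show ?thesis unfolding prod_def by (rule mem_Col)
qed

lemma mem_Lam: assumes "dt1 f" shows "z \<epsilon> Lam a f \<longleftrightarrow> (\<exists>x. x \<epsilon> a \<and> z = pr x (f x))"
  unfolding Lam_def by (rule mem_Rep) (intro dfi dt1_app[OF assms])

lemma app_Lam: assumes "dt1 f" "x \<epsilon> a" shows "app (Lam a f) x = f x"
proof -
  have "pr x y \<epsilon> Lam a f \<longleftrightarrow> y = f x" for y using assms(2) by (auto simp: mem_Lam[OF assms(1)])
  then show ?thesis by (simp add: app_def desc_eq)
qed

lemma app_eq: "pr x y \<epsilon> f \<Longrightarrow> (\<And>y'. pr x y' \<epsilon> f \<Longrightarrow> y' = y) \<Longrightarrow> app f x = y"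
  unfolding app_def by (rule desc_eq) blast+

lemma dt1_appf: "dt1 (app f)"
  by (intro dfi)

lemma not_mem_self [simp]: "\<not> x \<epsilon> x"
  using found[of x "upair x x"] by auto

lemma not_mem_sym: "x \<epsilon> y \<Longrightarrow> \<not> y \<epsilon> x"
  using found[of x "upair x y"] by auto

lemma suc_inj [simp]: "suc a = suc b \<longleftrightarrow> a = b"
proof
  assume "suc a = suc b"
  then have "x \<epsilon> suc a \<longleftrightarrow> x \<epsilon> suc b" for x by (rule arg_cong)
  then have "x = a \<or> x \<epsilon> a \<longleftrightarrow> x = b \<or> x \<epsilon> b" for x by simp
  from this[of a] this[of b] show "a = b" using not_mem_sym[of a b] by auto
qed simp

lemma suc_not_emp [simp]: "suc a \<noteq> emp" "emp \<noteq> suc a"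
proof -
  have "a \<epsilon> suc a" by simp
  then show "suc a \<noteq> emp" "emp \<noteq> suc a" using mem_emp[of a] by metis+
qed

lemma emp_iff: "x = emp \<longleftrightarrow> (\<forall>z. \<not> z \<epsilon> x)"
proof
  assume *: "\<forall>z. \<not> z \<epsilon> x"
  show "x = emp" by (rule exten) (simp add: *)
qed simp

section \<open>Natural numbers, transitive sets and membership induction\<close>

definition omega where "omega = Col (\<lambda>n. \<forall>i. emp \<epsilon> i \<and> (\<forall>x. x \<epsilon> i \<longrightarrow> suc x \<epsilon> i) \<longrightarrow> n \<epsilon> i)"

lemma mem_omega: "n \<epsilon> omega \<longleftrightarrow> (\<forall>i. emp \<epsilon> i \<and> (\<forall>x. x \<epsilon> i \<longrightarrow> suc x \<epsilon> i) \<longrightarrow> n \<epsilon> i)"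
proof -
  obtain w where w: "(\<exists>x. x \<epsilon> w \<and> (\<forall>z. \<not> z \<epsilon> x)) \<and>
         (\<forall>x. x \<epsilon> w \<longrightarrow> (\<exists>y. y \<epsilon> w \<and> (\<forall>z. z \<epsilon> y \<longleftrightarrow> z \<epsilon> x \<or> z = x)))" using infinity by blast
  then obtain x where "x \<epsilon> w" "x = emp" unfolding emp_iff by blast
  then have "emp \<epsilon> w" by simp
  moreover have "suc x \<epsilon> w" if x: "x \<epsilon> w" for x
  proof -
    obtain y where "y \<epsilon> w" "\<forall>z. z \<epsilon> y \<longleftrightarrow> z \<epsilon> x \<or> z = x" using w x by blast
    then have "z \<epsilon> y \<longleftrightarrow> z \<epsilon> suc x" for z by auto
    then have "y = suc x" by (rule exten)
    then show ?thesis using \<open>y \<epsilon> w\<close> by simp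
  qed
  moreover have df: "df1 (\<lambda>n. \<forall>i. emp \<epsilon> i \<and> (\<forall>x. x \<epsilon> i \<longrightarrow> suc x \<epsilon> i) \<longrightarrow> n \<epsilon> i)" by (intro dfi)
  ultimately have "small (\<lambda>n. \<forall>i. emp \<epsilon> i \<and> (\<forall>x. x \<epsilon> i \<longrightarrow> suc x \<epsilon> i) \<longrightarrow> n \<epsilon> i)"
    by (intro small_sub[of _ w, OF df]) simp
  then show ?thesis unfolding omega_def by (rule mem_Col)
qed

lemma emp_omega [simp]: "emp \<epsilon> omega" by (simp add: mem_omega)
lemma suc_omega [simp]: "n \<epsilon> omega \<Longrightarrow> suc n \<epsilon> omega" by (simp add: mem_omega)

lemma omega_induct [consumes 1]:
  assumes "n \<epsilon> omega" and Q: "df1 Q" and "Q emp" "\<And>n. n \<epsilon> omega \<Longrightarrow> Q n \<Longrightarrow> Q (suc n)"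
  shows "Q n"
proof -
  have "n \<epsilon> Sep omega Q"
    by (rule assms(1)[unfolded mem_omega, rule_format]) (use assms(3,4) in \<open>auto simp: mem_Sep[OF Q]\<close>)
  then show ?thesis by (simp add: mem_Sep[OF Q])
qed

text \<open>An initial segment of the sequence \<open>x, Uni x, Uni (Uni x), \<dots>\<close>, as a set in which every pair is justified by another one.\<close>

definition Un_seq where "Un_seq x f \<longleftrightarrow> (\<forall>k z. pr k z \<epsilon> f \<longrightarrow> (k = emp \<and> z = x) \<or>
   (\<exists>k' z'. k = suc k' \<and> z = Uni z' \<and> pr k' z' \<epsilon> f))"

definition Un_it where "Un_it x n y \<longleftrightarrow> (\<exists>f. Un_seq x f \<and> pr n y \<epsilon> f)"

text \<open>The union of the iterates x, \<open>Uni x\<close>, \<open>Uni (Uni x)\<close>, and so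
  on. The iteration is done by hand with the approximations \<open>Un_seq\<close>, because the
  recursion theorem below rests on transitive sets.\<close>

lemma ex_transitive: "\<exists>t. sub x t \<and> (\<forall>y. y \<epsilon> t \<longrightarrow> sub y t)"
proof -
  have df: "df2 (Un_it x)" unfolding Un_it_def Un_seq_def by (intro dfi)
  note [dfi] = df2_app[OF df]
  have 0: "Un_it x emp x"
    unfolding Un_it_def Un_seq_def by (rule exI[of _ "upair (pr emp x) (pr emp x)"]) simp
  have s: "Un_it x (suc n) (Uni y)" if y: "Un_it x n y" for n y
  proof -
    obtain f where "Un_seq x f" "pr n y \<epsilon> f" using y unfolding Un_it_def by blast
    then have "Un_seq x (ins (pr (suc n) (Uni y)) f)" unfolding Un_seq_def by (auto; blast)
    then show ?thesis unfolding Un_it_def using mem_ins by blast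
  qed
  have uniq: "\<exists>!y. Un_it x n y" if "n \<epsilon> omega" for n
    using that
  proof (induction rule: omega_induct)
    show "df1 (\<lambda>n. \<exists>!y. Un_it x n y)" by (intro dfi)
    show "\<exists>!y. Un_it x emp y"
      by (rule ex1I[of "Un_it x emp", OF 0]) (use suc_not_emp(2) in \<open>unfold Un_it_def Un_seq_def, blast\<close>)
    fix n assume n: "\<exists>!y. Un_it x n y"
    then obtain y where y: "Un_it x n y" by blast
    show "\<exists>!y. Un_it x (suc n) y"
    proof (rule ex1I[of "Un_it x (suc n)", OF s[OF y]])
      fix z assume "Un_it x (suc n) z"
      then obtain f where f: "Un_seq x f" "pr (suc n) z \<epsilon> f" unfolding Un_it_def by blast
      then obtain z' where "z = Uni z'" "pr n z' \<epsilon> f" unfolding Un_seq_def by fastforce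
      then show "z = Uni y" using n y f(1) unfolding Un_it_def by blast
    qed
  qed
  let ?F = "\<lambda>n. desc (Un_it x n)"
  have dF: "dt1 ?F" by (intro dfi)
  have F: "Un_it x n (?F n)" if "n \<epsilon> omega" for n by (rule descI[OF uniq[OF that]])
  have F0: "?F emp = x" by (rule desc_eq[OF uniq 0]) simp
  have Fs: "?F (suc n) = Uni (?F n)" if "n \<epsilon> omega" for n
    by (rule desc_eq[OF uniq s[OF F]]) (simp_all add: that)
  let ?t = "Uni (Rep omega ?F)"
  have t: "z \<epsilon> ?t \<longleftrightarrow> (\<exists>n. n \<epsilon> omega \<and> z \<epsilon> ?F n)" for z
    using mem_Rep[OF dF, of _ omega] by auto
  have "sub x ?t" unfolding t using F0 emp_omega by metis
  moreover have "z \<epsilon> ?t" if y: "y \<epsilon> ?t" "z \<epsilon> y" for z y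
  proof -
    obtain n where n: "n \<epsilon> omega" "y \<epsilon> ?F n" using y(1) unfolding t by metis
    then have "z \<epsilon> ?F (suc n)" using y(2) unfolding Fs[OF n(1)] mem_Uni by blast
    then show ?thesis unfolding t using suc_omega[OF n(1)] by metis
  qed
  ultimately show ?thesis by blast
qed

text \<open>Foundation speaks about sets only. A transitive set around \<open>x\<close> cuts the
  class of counterexamples down to a set whose minimal element is also minimal in the class.\<close>

lemma eps_induct:
  assumes Q: "df1 Q" and step: "\<And>x. (\<And>y. y \<epsilon> x \<Longrightarrow> Q y) \<Longrightarrow> Q x" shows "Q x"
proof (rule ccontr)
  assume x: "\<not> Q x"
  obtain t where t: "sub (upair x x) t" "\<forall>y. y \<epsilon> t \<longrightarrow> sub y t" using ex_transitive by blast
  have *: "z \<epsilon> Sep t (\<lambda>y. \<not> Q y) \<longleftrightarrow> z \<epsilon> t \<and> \<not> Q z" for z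
    by (rule mem_Sep) (intro dfi Q)
  have "x \<epsilon> Sep t (\<lambda>y. \<not> Q y)" using t x by (simp add: *)
  from found[OF this] obtain y where "y \<epsilon> t" "\<not> Q y" "\<And>z. z \<epsilon> y \<Longrightarrow> \<not> (z \<epsilon> t \<and> \<not> Q z)"
    unfolding * by blast
  then show False using step t(2) by blast
qed

subsection \<open>Recursion on membership\<close>

text \<open>Every pair in \<open>f\<close> is justified by a function that is contained in \<open>f\<close>.\<close>

definition justified where "justified H f \<longleftrightarrow> (\<forall>x z. pr x z \<epsilon> f \<longrightarrow> (\<exists>g. sub g f \<and> z = H x g \<and>
   (\<forall>p. p \<epsilon> g \<longrightarrow> (\<exists>y v. y \<epsilon> x \<and> p = pr y v)) \<and> (\<forall>y. y \<epsilon> x \<longrightarrow> (\<exists>!v. pr y v \<epsilon> g))))"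

definition rec where "rec H x = desc (\<lambda>z. \<exists>f. justified H f \<and> pr x z \<epsilon> f)"

lemma dt_rec [dfi]:
  assumes "dt (\<lambda>e. h (e 0) (e (Suc 0)) (\<lambda>n. e (Suc (Suc n))))" "dt t"
  shows "dt (\<lambda>e. rec (\<lambda>x g. h x g e) (t e))"
proof -
  have "dt (\<lambda>e. t (\<lambda>n. e (Suc n)))" "dt (\<lambda>e. t (\<lambda>n. e (Suc (Suc n))))"
    using dt_ren[OF assms(2), of Suc] dt_ren[OF assms(2), of "\<lambda>n. Suc (Suc n)"] by simp_all
  moreover have "dt (\<lambda>e. h (e i) (e j) (\<lambda>n. e (k + n)))" for i j k
    using dt_ren[OF assms(1), of "case_nat i (case_nat j (\<lambda>n. k + n))"] by simp
  from this[of 2 0 5] have "dt (\<lambda>e. h (e (Suc (Suc 0))) (e 0) (\<lambda>n. e (Suc (Suc (Suc (Suc (Suc n)))))))"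
    by (simp add: numeral_eq_Suc)
  ultimately show ?thesis unfolding rec_def justified_def by (intro dfi)
qed

text \<open>Justified values are unique by membership induction. For existence, the values on a
  transitive set are collected and the pair for \<open>x\<close> is added on top; the older pairs
  stay justified because the functions that justify them lie inside the collected set.\<close>

lemma rec_eq:
  assumes H: "dt2 H" shows "rec H x = H x (Lam x (rec H))"
proof -
  note [dfi] = dt2_app[OF H]
  let ?R = "\<lambda>x z. \<exists>f. justified H f \<and> pr x z \<epsilon> f"
  have dfJ: "df1 (justified H)" unfolding justified_def by (intro dfi)
  note [dfi] = df1_app[OF dfJ]
  have drec: "dt1 (rec H)" by (intro dfi)
  have uniq: "?R x z \<Longrightarrow> ?R x z' \<Longrightarrow> z = z'" for x z z'
  proof -
    have "\<forall>z z'. ?R x z \<and> ?R x z' \<longrightarrow> z = z'"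
    proof (rule eps_induct[of "\<lambda>x. \<forall>z z'. ?R x z \<and> ?R x z' \<longrightarrow> z = z'"], intro dfi, intro allI impI, elim conjE exE)
      fix x z z' f f'
      assume IH: "\<And>y. y \<epsilon> x \<Longrightarrow> \<forall>z z'. ?R y z \<and> ?R y z' \<longrightarrow> z = z'"
        and f: "justified H f" "pr x z \<epsilon> f" and f': "justified H f'" "pr x z' \<epsilon> f'"
      obtain g where g: "sub g f" "z = H x g" "\<And>p. p \<epsilon> g \<Longrightarrow> \<exists>y v. y \<epsilon> x \<and> p = pr y v" "\<And>y. y \<epsilon> x \<Longrightarrow> \<exists>!v. pr y v \<epsilon> g"
        using f unfolding justified_def by blast
      obtain g' where g': "sub g' f'" "z' = H x g'" "\<And>p. p \<epsilon> g' \<Longrightarrow> \<exists>y v. y \<epsilon> x \<and> p = pr y v" "\<And>y. y \<epsilon> x \<Longrightarrow> \<exists>!v. pr y v \<epsilon> g'"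
        using f' unfolding justified_def by blast
      have eq: "v = v'" if "y \<epsilon> x" "pr y v \<epsilon> g" "pr y v' \<epsilon> g'" for y v v'
        using IH[OF that(1)] that f(1) f'(1) g(1) g'(1) by blast
      have "p \<epsilon> g \<Longrightarrow> p \<epsilon> g'" for p using eq[of _ _ _] g(3)[of p] g'(4) by blast
      moreover have "p \<epsilon> g' \<Longrightarrow> p \<epsilon> g" for p using eq[of _ _ _] g'(3)[of p] g(4) by blast
      ultimately have "g = g'" by (intro exten) blast
      then show "z = z'" using g(2) g'(2) by simp
    qed
    then show "?R x z \<Longrightarrow> ?R x z' \<Longrightarrow> z = z'" by blast
  qed
  have recR: "?R x (rec H x)" if "?R x z" for x z
    unfolding rec_def by (rule descI) (use that uniq in blast)
  have ex: "\<exists>z. ?R x z" for x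
  proof (rule eps_induct[of "\<lambda>x. \<exists>z. ?R x z"], intro dfi)
    fix x assume IH: "\<And>y. y \<epsilon> x \<Longrightarrow> \<exists>z. ?R y z"
    obtain t where t: "sub x t" "\<forall>y. y \<epsilon> t \<longrightarrow> sub y t" using ex_transitive by blast
    \<comment> \<open>Only points with a justified value are kept; elsewhere \<open>rec H\<close>
      would be a mere default.\<close>
    let ?g = "Lam x (rec H)" and ?h = "Sep (Lam t (rec H)) (\<lambda>p. \<exists>y v. p = pr y v \<and> ?R y v)"
    let ?f = "ins (pr x (H x ?g)) ?h"
    have f0: "p \<epsilon> ?h \<longleftrightarrow> (\<exists>y. y \<epsilon> t \<and> ?R y (rec H y) \<and> p = pr y (rec H y))" for p
    proof -
      have "p \<epsilon> ?h \<longleftrightarrow> p \<epsilon> Lam t (rec H) \<and> (\<exists>y v. p = pr y v \<and> ?R y v)"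
        by (rule mem_Sep) (intro dfi)
      then show ?thesis by (auto simp: mem_Lam[OF drec])
    qed
    have "justified H ?f"
    proof (rule justified_def[THEN iffD2], intro allI impI)
      fix y z assume "pr y z \<epsilon> ?f"
      then consider "y = x" "z = H x ?g" | "y \<epsilon> t" "?R y z" by (auto simp: f0)
      then show "\<exists>g. sub g ?f \<and> z = H y g \<and> (\<forall>p. p \<epsilon> g \<longrightarrow> (\<exists>u v. u \<epsilon> y \<and> p = pr u v)) \<and> (\<forall>u. u \<epsilon> y \<longrightarrow> (\<exists>!v. pr u v \<epsilon> g))"
      proof cases
        case 1
        have "pr u (rec H u) \<epsilon> ?h" if "u \<epsilon> x" for u
          unfolding f0 using that t(1) IH[OF that] recR by blast
        then show ?thesis using 1 by (intro exI[of _ ?g]) (auto simp: mem_Lam[OF drec])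
      next
        case 2
        then obtain f1 where f1: "justified H f1" "pr y z \<epsilon> f1" by blast
        then obtain g where g: "sub g f1" "z = H y g" "\<And>p. p \<epsilon> g \<Longrightarrow> \<exists>u v. u \<epsilon> y \<and> p = pr u v" "\<And>u. u \<epsilon> y \<Longrightarrow> \<exists>!v. pr u v \<epsilon> g"
          unfolding justified_def by blast
        have "p \<epsilon> ?f" if p: "p \<epsilon> g" for p
        proof -
          obtain u v where uv: "u \<epsilon> y" "p = pr u v" using g(3)[OF p] by blast
          then have R: "?R u v" using p g(1) f1(1) by blast
          have "rec H u = v" by (rule uniq[OF recR[OF R] R])
          then show ?thesis using uv R t(2) 2(1) by (simp add: f0)
        qed
        then show ?thesis using g by blast
      qed
    qed
    then have "?R x (H x ?g)" using mem_ins by blast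
    then show "\<exists>z. ?R x z" by blast
  qed
  obtain f where f: "justified H f" "pr x (rec H x) \<epsilon> f" using recR ex by blast
  then obtain g where g: "sub g f" "rec H x = H x g" "\<And>p. p \<epsilon> g \<Longrightarrow> \<exists>u v. u \<epsilon> x \<and> p = pr u v" "\<And>u. u \<epsilon> x \<Longrightarrow> \<exists>!v. pr u v \<epsilon> g"
    unfolding justified_def by blast
  have 1: "v = rec H u" if "pr u v \<epsilon> g" for u v
    using uniq[of u v "rec H u"] recR ex that g(1) f(1) by blast
  have "g = Lam x (rec H)"
  proof (rule exten)
    fix p show "p \<epsilon> g \<longleftrightarrow> p \<epsilon> Lam x (rec H)"
      unfolding mem_Lam[OF drec] using 1 g(3)[of p] g(4) by blast
  qed
  then show ?thesis using g(2) by simp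
qed

end

context zf
begin

subsection \<open>Ordinals\<close>

definition Ord where "Ord x \<longleftrightarrow> (\<forall>y z. y \<epsilon> x \<and> z \<epsilon> y \<longrightarrow> z \<epsilon> x) \<and>
  (\<forall>y z. y \<epsilon> x \<and> z \<epsilon> x \<longrightarrow> y \<epsilon> z \<or> y = z \<or> z \<epsilon> y)"

lemma df_Ord [dfi]: "dt t \<Longrightarrow> df (\<lambda>e. Ord (t e))"
  by (rule df1_app[of Ord]) (unfold Ord_def, intro dfi)

lemma Ord_trans: "Ord x \<Longrightarrow> z \<epsilon> y \<Longrightarrow> y \<epsilon> x \<Longrightarrow> z \<epsilon> x"
  unfolding Ord_def by blast

lemma Ord_lin: "Ord x \<Longrightarrow> y \<epsilon> x \<Longrightarrow> z \<epsilon> x \<Longrightarrow> y \<epsilon> z \<or> y = z \<or> z \<epsilon> y"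
  unfolding Ord_def by blast

lemma OrdI: "(\<And>y z. y \<epsilon> x \<Longrightarrow> z \<epsilon> y \<Longrightarrow> z \<epsilon> x) \<Longrightarrow>
  (\<And>y z. y \<epsilon> x \<Longrightarrow> z \<epsilon> x \<Longrightarrow> y \<epsilon> z \<or> y = z \<or> z \<epsilon> y) \<Longrightarrow> Ord x"
  unfolding Ord_def by blast

lemma not_mem_3: "x \<epsilon> y \<Longrightarrow> y \<epsilon> z \<Longrightarrow> \<not> z \<epsilon> x"
  using found[of x "ins x (upair y z)"] by auto

lemma Ord_mem: assumes a: "Ord a" and b: "b \<epsilon> a" shows "Ord b"
proof -
  have sb: "y \<epsilon> a" if "y \<epsilon> b" for y using Ord_trans[OF a that b] .
  have "z \<epsilon> b" if "y \<epsilon> b" "z \<epsilon> y" for y z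
    using Ord_lin[OF a Ord_trans[OF a that(2) sb[OF that(1)]] b] that not_mem_3[of z y b] not_mem_sym[of y b] by blast
  then show ?thesis by (rule OrdI) (use Ord_lin[OF a] sb in blast)+
qed

text \<open>The least element of \<open>b\<close> outside \<open>a\<close> is \<open>a\<close>
  itself.\<close>

lemma Ord_sub_mem: assumes a: "Ord a" and b: "Ord b" and sb: "sub a b" and ne: "a \<noteq> b" shows "a \<epsilon> b"
proof -
  have D: "z \<epsilon> Sep b (\<lambda>z. \<not> z \<epsilon> a) \<longleftrightarrow> z \<epsilon> b \<and> \<not> z \<epsilon> a" for z by (rule mem_Sep) (intro dfi)
  have "\<exists>z. z \<epsilon> b \<and> \<not> z \<epsilon> a" using ne sb exten[of a b] by blast
  then obtain m where m: "m \<epsilon> b" "\<not> m \<epsilon> a" "\<And>z. z \<epsilon> m \<Longrightarrow> \<not> (z \<epsilon> b \<and> \<not> z \<epsilon> a)"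
    using found[of _ "Sep b (\<lambda>z. \<not> z \<epsilon> a)"] unfolding D by blast
  have "z \<epsilon> m \<longleftrightarrow> z \<epsilon> a" for z
  proof
    assume "z \<epsilon> m" then show "z \<epsilon> a" using m Ord_trans[OF b] by blast
  next
    assume z: "z \<epsilon> a"
    then have "z \<epsilon> m \<or> z = m \<or> m \<epsilon> z" using Ord_lin[OF b _ m(1)] sb by blast
    then show "z \<epsilon> m" using m(2) z Ord_trans[OF a, of m z] by blast
  qed
  then have "m = a" by (rule exten)
  then show ?thesis using m(1) by simp
qed

text \<open>The intersection is again an ordinal; if it were a proper part of both, it would belong
  to itself.\<close>

lemma Ord_linear: assumes a: "Ord a" and b: "Ord b" shows "a \<epsilon> b \<or> a = b \<or> b \<epsilon> a"
proof -
  let ?i = "Sep a (\<lambda>z. z \<epsilon> b)"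
  have i: "z \<epsilon> ?i \<longleftrightarrow> z \<epsilon> a \<and> z \<epsilon> b" for z by (rule mem_Sep) (intro dfi)
  have o: "Ord ?i" by (rule OrdI; unfold i) (use Ord_trans[OF a] Ord_trans[OF b] Ord_lin[OF a] in blast)+
  have "?i = a \<or> ?i \<epsilon> a" "?i = b \<or> ?i \<epsilon> b"
    using Ord_sub_mem[OF o a] Ord_sub_mem[OF o b] i by blast+
  moreover have "\<not> (?i \<epsilon> a \<and> ?i \<epsilon> b)" using i[of ?i] not_mem_self[of ?i] by blast
  ultimately have "?i = a \<and> ?i = b \<or> ?i = a \<and> ?i \<epsilon> b \<or> ?i = b \<and> ?i \<epsilon> a" by blast
  then show ?thesis by (elim disjE conjE) (simp_all only: simp_thms)
qed

lemma Ord_sub: assumes "Ord a" "Ord b" shows "sub a b \<longleftrightarrow> a \<epsilon> b \<or> a = b"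
  using Ord_sub_mem[OF assms] Ord_trans[OF assms(2), of _ a] by blast

lemma Ord_not_mem: assumes "Ord a" "Ord b" shows "\<not> a \<epsilon> b \<longleftrightarrow> sub b a"
  using Ord_linear[OF assms] Ord_sub[OF assms(2,1)] not_mem_self not_mem_sym by blast

lemma Ord_emp [simp]: "Ord emp" by (simp add: Ord_def)

lemma Ord_suc [simp]: "Ord a \<Longrightarrow> Ord (suc a)" unfolding Ord_def by auto

lemma Ord_Uni: assumes "\<And>x. x \<epsilon> a \<Longrightarrow> Ord x" shows "Ord (Uni a)"
proof -
  have "Ord y" if "y \<epsilon> Uni a" for y using that assms Ord_mem by auto
  moreover have "z \<epsilon> Uni a" if "y \<epsilon> Uni a" "z \<epsilon> y" for y z
    using that assms Ord_trans by (simp, blast)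
  ultimately show ?thesis using OrdI[of "Uni a"] Ord_linear by presburger
qed

text \<open>The least ordinal with the property. It serves as a choice operator that keeps
  definability.\<close>

definition lst where "lst Q = desc (\<lambda>b. Ord b \<and> Q b \<and> (\<forall>c. c \<epsilon> b \<longrightarrow> \<not> Q c))"

lemma dt_lst [dfi]: assumes "df (\<lambda>e. Q (e 0) (\<lambda>n. e (Suc n)))" shows "dt (\<lambda>e. lst (\<lambda>x. Q x e))"
proof -
  have "df (\<lambda>e. Q (e 0) (\<lambda>n. e (Suc (Suc n))))"
    using df_ren[OF assms, of "case_nat 0 (\<lambda>n. Suc (Suc n))"] by simp
  then show ?thesis unfolding lst_def by (intro dfi assms)
qed

lemma lst:
  assumes Q: "df1 Q" and a: "Ord a" "Q a"
  shows "Ord (lst Q)" "Q (lst Q)" "\<And>c. c \<epsilon> lst Q \<Longrightarrow> \<not> Q c"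
proof -
  have D: "z \<epsilon> Sep (suc a) Q \<longleftrightarrow> z \<epsilon> suc a \<and> Q z" for z by (rule mem_Sep[OF Q])
  have "a \<epsilon> Sep (suc a) Q" using a by (simp add: D)
  from found[OF this] obtain b where b: "b \<epsilon> suc a" "Q b" "\<And>z. z \<epsilon> b \<Longrightarrow> \<not> (z \<epsilon> suc a \<and> Q z)"
    unfolding D by blast
  have "Ord b" using b(1) a Ord_mem by auto
  moreover have "\<not> Q c" if c: "c \<epsilon> b" for c
    using b(3)[OF c] c Ord_trans[OF Ord_suc[OF a(1)] c b(1)] by blast
  ultimately have ex: "Ord b \<and> Q b \<and> (\<forall>c. c \<epsilon> b \<longrightarrow> \<not> Q c)" using b(2) by blast
  have "\<exists>!b. Ord b \<and> Q b \<and> (\<forall>c. c \<epsilon> b \<longrightarrow> \<not> Q c)"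
  proof (rule ex1I, rule ex)
    fix c assume c: "Ord c \<and> Q c \<and> (\<forall>d. d \<epsilon> c \<longrightarrow> \<not> Q d)"
    show "c = b" using Ord_linear[of c b] ex c by blast
  qed
  from descI[OF this] show "Ord (lst Q)" "Q (lst Q)" "\<And>c. c \<epsilon> lst Q \<Longrightarrow> \<not> Q c"
    unfolding lst_def by blast+
qed

lemma lst_sub: assumes "df1 Q" "Ord a" "Q a" shows "sub (lst Q) a"
  using lst[OF assms] Ord_not_mem[of a "lst Q"] assms by blast

definition Lim where "Lim x \<longleftrightarrow> Ord x \<and> x \<noteq> emp \<and> (\<forall>y. y \<epsilon> x \<longrightarrow> (\<exists>z. z \<epsilon> x \<and> y \<epsilon> z))"

lemma Lim_suc: assumes "Lim x" "y \<epsilon> x" shows "suc y \<epsilon> x"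
proof -
  obtain z where z: "z \<epsilon> x" "y \<epsilon> z" using assms unfolding Lim_def by blast
  have o: "Ord x" "Ord y" "Ord z" using assms z Ord_mem unfolding Lim_def by blast+
  then have "sub (suc y) z" using z(2) Ord_trans[OF o(3) _ z(2)] unfolding mem_suc by blast
  then have "suc y \<epsilon> z \<or> suc y = z" using Ord_sub[OF Ord_suc[OF o(2)] o(3)] by blast
  then show ?thesis using z(1) Ord_trans[OF o(1) _ z(1)] by (elim disjE) simp_all
qed

lemma Ord_omega_mem: "n \<epsilon> omega \<Longrightarrow> Ord n"
  by (induction rule: omega_induct) (intro dfi, auto)

lemma omega_trans: "n \<epsilon> omega \<Longrightarrow> sub n omega"
  by (induction rule: omega_induct) (intro dfi, auto)

lemma Ord_omega [simp]: "Ord omega"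
  by (rule OrdI) (use omega_trans Ord_linear Ord_omega_mem in blast)+

lemma Lim_omega: "Lim omega"
proof -
  have "y \<epsilon> suc y" "suc y \<epsilon> omega" if "y \<epsilon> omega" for y using that by auto
  moreover have "omega \<noteq> emp" using emp_omega by (intro notI) (simp del: emp_omega)
  ultimately show ?thesis unfolding Lim_def using Ord_omega by blast
qed

lemma omega_cases: "n \<epsilon> omega \<Longrightarrow> n = emp \<or> (\<exists>m. m \<epsilon> omega \<and> n = suc m)"
  by (induction rule: omega_induct) (intro dfi, auto)

lemma not_Lim: assumes "n \<epsilon> omega" shows "\<not> Lim n"
proof
  assume n: "Lim n"
  then have "n \<noteq> emp" unfolding Lim_def by blast
  then obtain m where m: "n = suc m" using omega_cases[OF assms] by blast
  then have "suc m \<epsilon> n" using Lim_suc[OF n, of m] by simp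
  then show False using m by simp
qed

lemma Lim_omega_iff: "Lim w \<and> (\<forall>x. x \<epsilon> w \<longrightarrow> \<not> Lim x) \<longleftrightarrow> w = omega"
proof
  assume w: "Lim w \<and> (\<forall>x. x \<epsilon> w \<longrightarrow> \<not> Lim x)"
  then have "Ord w" unfolding Lim_def by blast
  from Ord_linear[OF this Ord_omega] show "w = omega" using w not_Lim[of w] Lim_omega by blast
next
  assume "w = omega"
  then show "Lim w \<and> (\<forall>x. x \<epsilon> w \<longrightarrow> \<not> Lim x)" using not_Lim Lim_omega by blast
qed

lemma emp_mem: assumes "Ord x" "x \<noteq> emp" shows "emp \<epsilon> x"
  using Ord_linear[OF assms(1) Ord_emp] assms(2) by auto

subsection \<open>Injections and bijections\<close>

definition is_map where "is_map f a b \<longleftrightarrow> (\<forall>z. z \<epsilon> f \<longrightarrow> (\<exists>x y. x \<epsilon> a \<and> y \<epsilon> b \<and> z = pr x y)) \<and>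
  (\<forall>x y y'. pr x y \<epsilon> f \<and> pr x y' \<epsilon> f \<longrightarrow> y = y') \<and> (\<forall>x. x \<epsilon> a \<longrightarrow> (\<exists>y. pr x y \<epsilon> f))"
definition is_injm where "is_injm f a b \<longleftrightarrow> is_map f a b \<and> (\<forall>x x' y. pr x y \<epsilon> f \<and> pr x' y \<epsilon> f \<longrightarrow> x = x')"
definition cle where "cle a b \<longleftrightarrow> (\<exists>f. is_injm f a b)"
definition eqp where "eqp a b \<longleftrightarrow> (\<exists>f. is_injm f a b \<and> (\<forall>y. y \<epsilon> b \<longrightarrow> (\<exists>x. pr x y \<epsilon> f)))"
definition fin where "fin a \<longleftrightarrow> (\<exists>n. n \<epsilon> omega \<and> eqp a n)"

lemma df_maps [dfi]:
  "dt f \<Longrightarrow> dt a \<Longrightarrow> dt b \<Longrightarrow> df (\<lambda>e. is_map (f e) (a e) (b e))"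
  "dt f \<Longrightarrow> dt a \<Longrightarrow> dt b \<Longrightarrow> df (\<lambda>e. is_injm (f e) (a e) (b e))"
  "dt a \<Longrightarrow> dt b \<Longrightarrow> df (\<lambda>e. cle (a e) (b e))"
  "dt a \<Longrightarrow> dt b \<Longrightarrow> df (\<lambda>e. eqp (a e) (b e))"
  "dt a \<Longrightarrow> df (\<lambda>e. fin (a e))"
proof -
  have r: "dt t \<Longrightarrow> dt (\<lambda>e. t (\<lambda>n. e (Suc n)))" "dt t \<Longrightarrow> dt (\<lambda>e. t (\<lambda>n. e (Suc (Suc n))))"
    "dt t \<Longrightarrow> dt (\<lambda>e. t (\<lambda>n. e (Suc (Suc (Suc n)))))" for t
    using dt_ren[of t Suc] dt_ren[of t "\<lambda>n. Suc (Suc n)"] dt_ren[of t "\<lambda>n. Suc (Suc (Suc n))"] by auto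
  show 1: "dt f \<Longrightarrow> dt a \<Longrightarrow> dt b \<Longrightarrow> df (\<lambda>e. is_map (f e) (a e) (b e))" for f a b
    unfolding is_map_def by (intro dfi r)
  show 2: "dt f \<Longrightarrow> dt a \<Longrightarrow> dt b \<Longrightarrow> df (\<lambda>e. is_injm (f e) (a e) (b e))" for f a b
    unfolding is_injm_def by (intro dfi r 1)
  show "dt a \<Longrightarrow> dt b \<Longrightarrow> df (\<lambda>e. cle (a e) (b e))"
    unfolding cle_def by (intro dfi r 2)
  show 3: "dt a \<Longrightarrow> dt b \<Longrightarrow> df (\<lambda>e. eqp (a e) (b e))" for a b
    unfolding eqp_def by (intro dfi r 2)
  show "dt a \<Longrightarrow> df (\<lambda>e. fin (a e))"
    unfolding fin_def by (intro dfi r 3)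
qed

lemma is_map_app: assumes "is_map f a b" "x \<epsilon> a" shows "app f x \<epsilon> b" "pr x y \<epsilon> f \<longleftrightarrow> y = app f x"
proof -
  have ex: "\<exists>!y. pr x y \<epsilon> f" using assms unfolding is_map_def by blast
  then have p: "pr x (app f x) \<epsilon> f" unfolding app_def by (rule descI)
  then obtain u v where "u \<epsilon> a" "v \<epsilon> b" "pr x (app f x) = pr u v" using assms(1) unfolding is_map_def by blast
  then show "app f x \<epsilon> b" unfolding pr_inj by blast
  show "pr x y \<epsilon> f \<longleftrightarrow> y = app f x" using ex p by blast
qed

lemma is_map_dom: "is_map f a b \<Longrightarrow> pr x y \<epsilon> f \<Longrightarrow> x \<epsilon> a"
proof -
  assume "is_map f a b" "pr x y \<epsilon> f"
  then obtain u v where "u \<epsilon> a" "v \<epsilon> b" "pr x y = pr u v" unfolding is_map_def by blast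
  then show ?thesis by simp
qed

lemma mem_el [simp]: "x \<in> el a \<longleftrightarrow> x \<epsilon> a" by (simp add: el_def)

lemma el_simps [simp]: "el emp = {}" "el (ins x a) = insert x (el a)" "el (un a b) = el a \<union> el b"
  by (auto simp: el_def)

lemma is_map_Lam: assumes f: "dt1 f" and "\<And>x. x \<epsilon> a \<Longrightarrow> f x \<epsilon> b" shows "is_map (Lam a f) a b"
  unfolding is_map_def mem_Lam[OF f] using assms(2) by auto

lemma is_injm_iff: "is_injm f a b \<longleftrightarrow> is_map f a b \<and> inj_on (app f) (el a)"
proof (cases "is_map f a b")
  case True
  have 1: "pr x y \<epsilon> f \<longleftrightarrow> x \<epsilon> a \<and> y = app f x" for x y
    using is_map_app(2)[OF True] is_map_dom[OF True] by blast
  show ?thesis using True unfolding is_injm_def inj_on_def 1 by auto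
qed (simp add: is_injm_def)

lemma cle_iff: "cle a b \<longleftrightarrow> (\<exists>f. dt1 f \<and> inj_on f (el a) \<and> (\<forall>x. x \<epsilon> a \<longrightarrow> f x \<epsilon> b))"
proof
  assume "cle a b"
  then obtain f where f: "is_injm f a b" unfolding cle_def by blast
  then show "\<exists>f. dt1 f \<and> inj_on f (el a) \<and> (\<forall>x. x \<epsilon> a \<longrightarrow> f x \<epsilon> b)"
    using dt1_appf[of f] is_map_app(1) unfolding is_injm_iff by blast
next
  assume "\<exists>f. dt1 f \<and> inj_on f (el a) \<and> (\<forall>x. x \<epsilon> a \<longrightarrow> f x \<epsilon> b)"
  then obtain f where f: "dt1 f" "inj_on f (el a)" "\<And>x. x \<epsilon> a \<Longrightarrow> f x \<epsilon> b" by blast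
  have "inj_on (app (Lam a f)) (el a)"
    using f(2) app_Lam[OF f(1), of _ a] by (simp add: inj_on_def)
  then show "cle a b" unfolding cle_def is_injm_iff using is_map_Lam[OF f(1,3)] by blast
qed

lemma eqp_iff: "eqp a b \<longleftrightarrow> (\<exists>f. dt1 f \<and> bij_betw f (el a) (el b))"
proof
  assume "eqp a b"
  then obtain f where f: "is_injm f a b" "\<forall>y. y \<epsilon> b \<longrightarrow> (\<exists>x. pr x y \<epsilon> f)" unfolding eqp_def by blast
  then have m: "is_map f a b" unfolding is_injm_def by blast
  have "bij_betw (app f) (el a) (el b)" unfolding bij_betw_def
  proof
    show "app f ` el a = el b" using f(2) is_map_dom[OF m] is_map_app[OF m] by fastforce
  qed (use f(1) is_injm_iff in blast)
  then show "\<exists>f. dt1 f \<and> bij_betw f (el a) (el b)" using dt1_appf by blast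
next
  assume "\<exists>f. dt1 f \<and> bij_betw f (el a) (el b)"
  then obtain f where f: "dt1 f" "bij_betw f (el a) (el b)" by blast
  have fb: "f x \<epsilon> b" if "x \<epsilon> a" for x using f(2) that by (auto simp: bij_betw_def)
  have "inj_on (app (Lam a f)) (el a)"
    using f(2) app_Lam[OF f(1), of _ a] by (simp add: inj_on_def bij_betw_def)
  moreover have "\<exists>x. pr x y \<epsilon> Lam a f" if "y \<epsilon> b" for y
  proof -
    have "y \<in> f ` el a" using f(2) that by (simp add: bij_betw_def)
    then show ?thesis by (auto simp: mem_Lam[OF f(1)])
  qed
  ultimately show "eqp a b" unfolding eqp_def is_injm_iff using is_map_Lam[OF f(1) fb] by blast
qed

lemma eqpI: "dt1 f \<Longrightarrow> bij_betw f (el a) (el b) \<Longrightarrow> eqp a b" unfolding eqp_iff by blast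
lemma cleI: "dt1 f \<Longrightarrow> inj_on f (el a) \<Longrightarrow> (\<And>x. x \<epsilon> a \<Longrightarrow> f x \<epsilon> b) \<Longrightarrow> cle a b" unfolding cle_iff by blast

lemma cle_sub: "sub a b \<Longrightarrow> cle a b"
  by (rule cleI[of "\<lambda>x. x"]) (intro dfi, auto)

lemma eqp_refl: "eqp a a"
  by (rule eqpI[of "\<lambda>x. x"]) (intro dfi, auto simp: bij_betw_def)

lemma eqp_sym: assumes "eqp a b" shows "eqp b a"
proof -
  obtain f where f: "dt1 f" "bij_betw f (el a) (el b)" using assms unfolding eqp_iff by blast
  note [dfi] = dt1_app[OF f(1)]
  let ?g = "\<lambda>y. desc (\<lambda>x. x \<epsilon> a \<and> f x = y)"
  have g: "?g (f x) = x" if "x \<epsilon> a" for x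
    by (rule desc_eq) (use that f(2) in \<open>auto simp: bij_betw_def inj_on_def\<close>)
  have "bij_betw ?g (el b) (el a)"
  proof (rule bij_betw_byWitness[of _ f])
    have "?g y \<epsilon> a \<and> f (?g y) = y" if "y \<epsilon> b" for y
    proof -
      have "y \<in> f ` el a" using f(2) that by (simp add: bij_betw_def)
      then obtain x where x: "x \<epsilon> a" "f x = y" by auto
      show ?thesis using g[OF x(1)] x by simp
    qed
    then show "\<forall>y\<in>el b. f (?g y) = y" "?g ` el b \<subseteq> el a" by auto
  qed (use g f(2) in \<open>auto simp: bij_betw_def\<close>)
  moreover have "dt1 ?g" by (intro dfi)
  ultimately show ?thesis by (rule eqpI[rotated])
qed

lemma dt1_comp: assumes "dt1 f" "dt1 g" shows "dt1 (\<lambda>x. g (f x))"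
  by (intro dt1_app[OF assms(2)] assms(1))

lemma eqp_trans: assumes "eqp a b" "eqp b c" shows "eqp a c"
proof -
  obtain f g where f: "dt1 f" "bij_betw f (el a) (el b)" "dt1 g" "bij_betw g (el b) (el c)"
    using assms unfolding eqp_iff by blast
  show ?thesis by (rule eqpI[OF dt1_comp[OF f(1,3)]]) (use bij_betw_trans[OF f(2,4)] in \<open>simp add: comp_def\<close>)
qed

lemma eqp_cle: "eqp a b \<Longrightarrow> cle a b" unfolding eqp_def cle_def by blast

lemma cle_trans: assumes "cle a b" "cle b c" shows "cle a c"
proof -
  obtain f g where f: "dt1 f" "inj_on f (el a)" "\<And>x. x \<epsilon> a \<Longrightarrow> f x \<epsilon> b" "dt1 g" "inj_on g (el b)" "\<And>x. x \<epsilon> b \<Longrightarrow> g x \<epsilon> c"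
    using assms unfolding cle_iff by blast
  show ?thesis by (rule cleI[OF dt1_comp[OF f(1,4)]]) (use f(2,3,5,6) in \<open>auto simp: inj_on_def\<close>)
qed

lemma cle_image: assumes "cle a b" shows "\<exists>c. sub c b \<and> eqp a c"
proof -
  obtain f where f: "dt1 f" "inj_on f (el a)" "\<And>x. x \<epsilon> a \<Longrightarrow> f x \<epsilon> b"
    using assms unfolding cle_iff by blast
  have "bij_betw f (el a) (el (Rep a f))"
    using f(2) by (auto simp: bij_betw_def mem_Rep[OF f(1)])
  then have "eqp a (Rep a f)" by (rule eqpI[OF f(1)])
  moreover have "sub (Rep a f) b" using f(3) by (auto simp: mem_Rep[OF f(1)])
  ultimately show ?thesis by blast
qed

lemma eqp_emp: "eqp a emp \<longleftrightarrow> a = emp"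
proof
  assume "eqp a emp"
  then have "el a = {}" by (auto simp: eqp_iff bij_betw_def)
  then show "a = emp" unfolding emp_iff el_def by blast
qed (simp add: eqp_refl)

lemma eqp_ins: assumes "eqp a b" "\<not> x \<epsilon> a" "\<not> y \<epsilon> b" shows "eqp (ins x a) (ins y b)"
proof -
  obtain f where f: "dt1 f" "bij_betw f (el a) (el b)" using assms unfolding eqp_iff by blast
  note [dfi] = dt1_app[OF f(1)]
  have "dt1 (\<lambda>z. if z = x then y else f z)" by (intro dfi)
  moreover have "bij_betw (\<lambda>z. if z = x then y else f z) (el (ins x a)) (el (ins y b))"
  proof -
    have "z \<noteq> x" if "z \<in> el a" for z using that assms(2) by auto
    then have "bij_betw (\<lambda>z. if z = x then y else f z) (el a) (el b)"
      using f(2) bij_betw_cong[of "el a" f "\<lambda>z. if z = x then y else f z" "el b"] by simp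
    then show ?thesis using notIn_Un_bij_betw[of x "el a" "\<lambda>z. if z = x then y else f z" "el b"] assms(2,3) by simp
  qed
  ultimately show ?thesis by (rule eqpI)
qed

definition del where "del x a = Sep a (\<lambda>y. y \<noteq> x)"

lemma mem_del [simp]: "y \<epsilon> del x a \<longleftrightarrow> y \<epsilon> a \<and> y \<noteq> x"
  unfolding del_def by (rule mem_Sep) (intro dfi)

lemma ins_del: "x \<epsilon> a \<Longrightarrow> ins x (del x a) = a"
  by (rule exten) auto

lemma fin_emp [simp]: "fin emp" unfolding fin_def using eqp_refl emp_omega by blast

lemma fin_ins [simp]: assumes "fin a" shows "fin (ins x a)"
proof (cases "x \<epsilon> a")
  case True
  have "ins x a = a" by (rule exten) (use True in auto)
  then show ?thesis using assms by simp
next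
  case False
  obtain n where n: "n \<epsilon> omega" "eqp a n" using assms unfolding fin_def by blast
  have "eqp (ins x a) (suc n)" unfolding suc_def using eqp_ins[OF n(2) False] by simp
  then show ?thesis unfolding fin_def using suc_omega[OF n(1)] by blast
qed

text \<open>Induction on the size: from a bijection with \<open>suc n\<close> the preimage of
  \<open>n\<close> is removed.\<close>

lemma fin_induct [consumes 1]:
  assumes a: "fin a" and Q: "df1 Q" and "Q emp" and step: "\<And>x a. fin a \<Longrightarrow> Q a \<Longrightarrow> \<not> x \<epsilon> a \<Longrightarrow> Q (ins x a)"
  shows "Q a"
proof -
  note [dfi] = df1_app[OF Q]
  have "\<forall>a. eqp a n \<longrightarrow> Q a" if "n \<epsilon> omega" for n
    using that
  proof (induction rule: omega_induct)
    show "df1 (\<lambda>n. \<forall>a. eqp a n \<longrightarrow> Q a)" by (intro dfi)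
    show "\<forall>a. eqp a emp \<longrightarrow> Q a" using assms(3) by (simp add: eqp_emp)
    fix n assume n: "n \<epsilon> omega" and IH: "\<forall>a. eqp a n \<longrightarrow> Q a"
    show "\<forall>a. eqp a (suc n) \<longrightarrow> Q a"
    proof (intro allI impI)
      fix a assume "eqp a (suc n)"
      then obtain f where f: "dt1 f" "bij_betw f (el a) (el (suc n))" unfolding eqp_iff by blast
      have "n \<in> f ` el a" using f(2) by (simp add: bij_betw_def)
      then obtain x where x: "x \<epsilon> a" "f x = n" by auto
      have "f ` el (del x a) = el n"
      proof -
        have "el (del x a) = el a - {x}" by auto
        moreover have "f ` (el a - {x}) = el (suc n) - {n}"
          using f(2) x unfolding bij_betw_def inj_on_def by (auto simp del: mem_suc)
        ultimately show ?thesis by auto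
      qed
      then have "bij_betw f (el (del x a)) (el n)"
        using f(2) by (auto simp: bij_betw_def inj_on_def)
      then have e: "eqp (del x a) n" by (rule eqpI[OF f(1)])
      then have "Q (ins x (del x a))" using IH n by (intro step) (auto simp: fin_def)
      then show "Q a" using x(1) by (simp add: ins_del)
    qed
  qed
  then show ?thesis using a unfolding fin_def by blast
qed

lemma fin_sub: assumes "fin a" "sub b a" shows "fin b"
proof -
  have "\<forall>b. sub b a \<longrightarrow> fin b" using assms(1)
  proof (induction rule: fin_induct)
    show "df1 (\<lambda>a. \<forall>b. sub b a \<longrightarrow> fin b)" by (intro dfi)
    show "\<forall>b. sub b emp \<longrightarrow> fin b"
      by (intro allI impI, subst emp_iff[THEN iffD2]) simp_all
    fix x a assume IH: "\<forall>b. sub b a \<longrightarrow> fin b"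
    show "\<forall>b. sub b (ins x a) \<longrightarrow> fin b"
    proof (intro allI impI)
      fix b assume b: "sub b (ins x a)"
      have "sub (del x b) a" using b by auto
      then have "fin (ins x (del x b))" using IH by simp
      then have "x \<epsilon> b \<Longrightarrow> fin b" by (simp only: ins_del)
      moreover have "\<not> x \<epsilon> b \<Longrightarrow> sub b a" using b by auto
      ultimately show "fin b" using IH by blast
    qed
  qed
  then show ?thesis using assms(2) by blast
qed

lemma fin_cle: assumes "cle a b" "fin b" shows "fin a"
proof -
  obtain c where "sub c b" "eqp a c" using cle_image[OF assms(1)] by blast
  then show ?thesis using fin_sub[OF assms(2)] eqp_trans unfolding fin_def by blast
qed

lemma fin_un: assumes "fin a" "fin b" shows "fin (un a b)"
  using assms(1)
proof (induction rule: fin_induct)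
  show "df1 (\<lambda>a. fin (un a b))" by (intro dfi)
  have "un emp b = b" by (rule exten) simp
  then show "fin (un emp b)" using assms(2) by simp
  fix x a assume IH: "fin (un a b)"
  have "un (ins x a) b = ins x (un a b)" by (rule exten) simp
  then show "fin (un (ins x a) b)" using IH by simp
qed

lemma fin_UN: assumes "fin a" and f: "dt1 f" and "\<And>x. x \<epsilon> a \<Longrightarrow> fin (f x)" shows "fin (Uni (Rep a f))"
proof -
  note [dfi] = dt1_app[OF f]
  have "(\<forall>x. x \<epsilon> a \<longrightarrow> fin (f x)) \<longrightarrow> fin (Uni (Rep a f))" using assms(1)
  proof (induction rule: fin_induct)
    show "df1 (\<lambda>a. (\<forall>x. x \<epsilon> a \<longrightarrow> fin (f x)) \<longrightarrow> fin (Uni (Rep a f)))" by (intro dfi)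
    have "Uni (Rep emp f) = emp" by (simp add: emp_iff mem_Rep[OF f])
    then show "(\<forall>x. x \<epsilon> emp \<longrightarrow> fin (f x)) \<longrightarrow> fin (Uni (Rep emp f))" by simp
    fix x a assume IH: "(\<forall>x. x \<epsilon> a \<longrightarrow> fin (f x)) \<longrightarrow> fin (Uni (Rep a f))"
    have "Uni (Rep (ins x a) f) = un (f x) (Uni (Rep a f))" by (rule exten) (auto simp: mem_Rep[OF f])
    then show "(\<forall>y. y \<epsilon> ins x a \<longrightarrow> fin (f y)) \<longrightarrow> fin (Uni (Rep (ins x a) f))" using IH fin_un by simp
  qed
  then show ?thesis using assms(3) by blast
qed

lemma fin_Rep: assumes "fin a" and f: "dt1 f" shows "fin (Rep a f)"
proof -
  have 1: "dt1 (\<lambda>x. ins (f x) emp)" by (intro dfi dt1_app[OF f])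
  have "Uni (Rep a (\<lambda>x. ins (f x) emp)) = Rep a f"
    by (rule exten) (simp add: mem_Rep[OF f] mem_Rep[OF 1], metis mem_emp mem_ins)
  then show ?thesis using fin_UN[OF assms(1) 1] by simp
qed

lemma fin_Pw: assumes "fin a" shows "fin (Pw a)"
  using assms
proof (induction rule: fin_induct)
  show "df1 (\<lambda>a. fin (Pw a))" by (intro dfi)
  have "Pw emp = ins emp emp" by (rule exten) (simp add: emp_iff)
  then show "fin (Pw emp)" by simp
  fix x a assume IH: "fin (Pw a)"
  have d: "dt1 (ins x)" by (intro dfi)
  have "z \<epsilon> Pw (ins x a) \<longleftrightarrow> z \<epsilon> un (Pw a) (Rep (Pw a) (ins x))" for z
  proof
    assume z: "z \<epsilon> Pw (ins x a)"
    show "z \<epsilon> un (Pw a) (Rep (Pw a) (ins x))"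
    proof (cases "x \<epsilon> z")
      case True
      then have "del x z \<epsilon> Pw a" "z = ins x (del x z)" using z ins_del[of x z] by auto
      then show ?thesis unfolding mem_un mem_Rep[OF d] by blast
    next
      case False
      then have "z \<epsilon> Pw a" using z by auto
      then show ?thesis by simp
    qed
  qed (auto simp: mem_Rep[OF d])
  then have "Pw (ins x a) = un (Pw a) (Rep (Pw a) (ins x))" by (rule exten)
  then show "fin (Pw (ins x a))" using IH fin_un fin_Rep[OF IH d] by simp
qed

lemma fin_omega_mem: "n \<epsilon> omega \<Longrightarrow> fin n" unfolding fin_def using eqp_refl by blast

text \<open>Only the part of \<open>a\<close> below \<open>l\<close> counts. In \<open>root\<close>
  the finite set consists of coordinates below \<kappa>, while \<open>l\<close> may be
  \<open>om1\<close>.\<close>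

lemma fin_bounded: assumes "fin a" "Lim l" shows "\<exists>m. m \<epsilon> l \<and> (\<forall>x. x \<epsilon> a \<and> x \<epsilon> l \<longrightarrow> x \<epsilon> m)"
  using assms(1)
proof (induction rule: fin_induct)
  show "df1 (\<lambda>a. \<exists>m. m \<epsilon> l \<and> (\<forall>x. x \<epsilon> a \<and> x \<epsilon> l \<longrightarrow> x \<epsilon> m))" by (intro dfi)
  show "\<exists>m. m \<epsilon> l \<and> (\<forall>x. x \<epsilon> emp \<and> x \<epsilon> l \<longrightarrow> x \<epsilon> m)"
    using assms(2) emp_mem unfolding Lim_def by auto
  fix y a assume "\<exists>m. m \<epsilon> l \<and> (\<forall>x. x \<epsilon> a \<and> x \<epsilon> l \<longrightarrow> x \<epsilon> m)"
  then obtain m where m: "m \<epsilon> l" "\<And>x. x \<epsilon> a \<Longrightarrow> x \<epsilon> l \<Longrightarrow> x \<epsilon> m" by blast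
  show "\<exists>m. m \<epsilon> l \<and> (\<forall>x. x \<epsilon> ins y a \<and> x \<epsilon> l \<longrightarrow> x \<epsilon> m)"
  proof (cases "y \<epsilon> l")
    case True
    have o: "Ord l" "Ord m" "Ord y" using assms(2) Ord_mem m(1) True unfolding Lim_def by blast+
    show ?thesis
    proof (cases "y \<epsilon> m")
      case True then show ?thesis using m by (intro exI[of _ m]) auto
    next
      case False
      then have "sub m (suc y)" using Ord_not_mem[OF o(3,2)] by simp
      then show ?thesis using m Lim_suc[OF assms(2) True] by (intro exI[of _ "suc y"]) auto
    qed
  next
    case False then show ?thesis using m by (intro exI[of _ m]) auto
  qed
qed

lemma not_fin_unbounded: assumes "sub a omega" "\<And>n. n \<epsilon> omega \<Longrightarrow> \<exists>k. k \<epsilon> a \<and> \<not> k \<epsilon> n" shows "\<not> fin a"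
  using fin_bounded[OF _ Lim_omega, of a] assms by blast

lemma omega_not_fin: "\<not> fin omega"
  by (rule not_fin_unbounded) (auto intro: not_mem_self)

lemma fin_bounded_omega: assumes "fin a" "sub a omega" shows "\<exists>m. m \<epsilon> omega \<and> sub a m"
  using fin_bounded[OF assms(1) Lim_omega] assms(2) by blast

lemma Cantor: "\<not> cle (Pw x) x"
proof
  assume "cle (Pw x) x"
  then obtain f where f: "dt1 f" "inj_on f (el (Pw x))" "\<And>s. sub s x \<Longrightarrow> f s \<epsilon> x" unfolding cle_iff by auto
  note [dfi] = dt1_app[OF f(1)]
  let ?D = "Sep x (\<lambda>y. \<exists>s. sub s x \<and> f s = y \<and> \<not> y \<epsilon> s)"
  have D: "y \<epsilon> ?D \<longleftrightarrow> y \<epsilon> x \<and> (\<exists>s. sub s x \<and> f s = y \<and> \<not> y \<epsilon> s)" for y by (rule mem_Sep) (intro dfi)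
  have sD: "sub ?D x" by (simp add: D)
  have inj: "s = ?D" if "sub s x" "f s = f ?D" for s
    by (rule inj_onD[OF f(2) that(2)]) (use that(1) sD in simp_all)
  show False
  proof (cases "f ?D \<epsilon> ?D")
    case True
    then obtain s where s: "sub s x" "f s = f ?D" "\<not> f ?D \<epsilon> s" unfolding D[of "f ?D"] by blast
    from inj[OF s(1,2)] s(3) True show False by (simp only: simp_thms)
  next
    case False
    then show False using D[of "f ?D"] f(3)[OF sD] sD by blast
  qed
qed

end

section \<open>The meaning of the object-language formulas in a model\<close>

lemma (in zf) sat_is_upair [simp]: "sat E (is_upair a b z) \<longleftrightarrow> z = upair a b"
proof
  assume "sat E (is_upair a b z)"
  then show "z = upair a b" by (intro exten) (simp add: is_upair_def)
qed (simp add: is_upair_def)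

lemma (in zf) sat_is_pair [simp]: "sat E (is_pair a b z) \<longleftrightarrow> z = pr a b"
proof
  assume "sat E (is_pair a b z)"
  then show "z = pr a b" by (intro exten) (simp add: is_pair_def)
qed (simp add: is_pair_def)

context zf
begin

lemma sat_pair_in [simp]: "sat E (pair_in a b r) \<longleftrightarrow> pr a b \<epsilon> r"
  unfolding pair_in_def by simp

lemma sat_subset_of [simp]: "sat E (subset_of a b) \<longleftrightarrow> sub a b"
  unfolding subset_of_def by simp

lemma sat_is_empty [simp]: "sat E (is_empty x) \<longleftrightarrow> x = emp"
  unfolding is_empty_def by (simp add: emp_iff)

lemma sat_is_succ [simp]: "sat E (is_succ x y) \<longleftrightarrow> y = suc x"
proof
  assume "sat E (is_succ x y)"
  then show "y = suc x" by (intro exten) (simp add: is_succ_def disj_commute)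
qed (auto simp: is_succ_def)

lemma sat_is_ord [simp]: "sat E (is_ord x) \<longleftrightarrow> Ord x"
  unfolding is_ord_def is_transitive_def Ord_def by auto

lemma sat_is_omega [simp]: "sat E (is_omega w) \<longleftrightarrow> w = omega"
proof -
  have "sat E (is_limit x) \<longleftrightarrow> Lim x" for x unfolding is_limit_def Lim_def by auto
  then show ?thesis unfolding is_omega_def using Lim_omega_iff by simp
qed

lemma sat_is_inj [simp]: "sat E (is_inj f a b) \<longleftrightarrow> is_injm f a b"
  unfolding is_inj_def is_injm_def is_fun_def is_partial_fun_def is_map_def by simp

lemma sat_card_le [simp]: "sat E (card_le a b) \<longleftrightarrow> cle a b"
  unfolding card_le_def cle_def by simp

lemma sat_equipollent [simp]: "sat E (equipollent a b) \<longleftrightarrow> eqp a b"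
  unfolding equipollent_def eqp_def is_bij_def by simp

lemma sat_is_finite [simp]: "sat E (is_finite a) \<longleftrightarrow> fin a"
  unfolding is_finite_def fin_def by simp

end

context zf
begin

subsection \<open>Order types, the cumulative hierarchy, collection\<close>

lemma mem_UN: "dt1 f \<Longrightarrow> z \<epsilon> Uni (Rep a f) \<longleftrightarrow> (\<exists>x. x \<epsilon> a \<and> z \<epsilon> f x)"
  unfolding mem_Uni by (auto simp: mem_Rep)

text \<open>The transitive collapse of \<open>B\<close>, where \<open>c x\<close> is the order type
  of the part of \<open>B\<close> below \<open>x\<close>. By induction \<open>c x\<close> is
  contained in \<open>x\<close>, so the order type of \<open>B\<close> does not exceed
  \<open>d\<close>.\<close>

lemma collapse: assumes d: "Ord d" and B: "sub B d" shows "\<exists>r. Ord r \<and> sub r d \<and> eqp B r"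
proof -
  let ?H = "\<lambda>x g. Rep (Sep x (\<lambda>y. y \<epsilon> B)) (app g)"
  define c where "c = rec ?H"
  have dc: "dt1 c" unfolding c_def by (intro dfi)
  note [dfi] = dt1_app[OF dc]
  have H: "dt2 ?H" by (intro dfi)
  have S: "y \<epsilon> Sep x (\<lambda>y. y \<epsilon> B) \<longleftrightarrow> y \<epsilon> x \<and> y \<epsilon> B" for x y by (rule mem_Sep) (intro dfi)
  have c: "z \<epsilon> c x \<longleftrightarrow> (\<exists>y. y \<epsilon> x \<and> y \<epsilon> B \<and> z = c y)" for x z
  proof -
    have "c x = Rep (Sep x (\<lambda>y. y \<epsilon> B)) (app (Lam x c))"
      using rec_eq[OF H, of x] unfolding c_def .
    then have "z \<epsilon> c x \<longleftrightarrow> (\<exists>y. (y \<epsilon> x \<and> y \<epsilon> B) \<and> z = app (Lam x c) y)"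
      by (simp only: mem_Rep[OF dt1_appf] S)
    then show ?thesis using app_Lam[OF dc, of _ x] by (metis (no_types, lifting))
  qed
  have lin: "c y \<epsilon> c y' \<or> c y = c y' \<or> c y' \<epsilon> c y" if "Ord x" "y \<epsilon> x" "y \<epsilon> B" "y' \<epsilon> x" "y' \<epsilon> B" for x y y'
  proof -
    have "y \<epsilon> y' \<or> y = y' \<or> y' \<epsilon> y" by (rule Ord_lin) (use that in auto)
    then show ?thesis using c[of "c y" y'] c[of "c y'" y] that by blast
  qed
  have oc: "Ord (c x)" if x: "Ord x" for x
  proof (rule OrdI)
    fix y z assume "y \<epsilon> c x" "z \<epsilon> y"
    then obtain u where "u \<epsilon> x" "u \<epsilon> B" "z \<epsilon> c u" unfolding c[of _ x] by blast
    moreover then obtain v where "v \<epsilon> u" "v \<epsilon> B" "z = c v" unfolding c[of _ u] by blast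
    ultimately have "u \<epsilon> x" "v \<epsilon> u" "v \<epsilon> B" "z = c v" by blast+
    then show "z \<epsilon> c x" unfolding c[of _ x] using Ord_trans[OF x] by blast
  next
    fix y z assume "y \<epsilon> c x" "z \<epsilon> c x"
    then obtain u v where "u \<epsilon> x" "u \<epsilon> B" "v \<epsilon> x" "v \<epsilon> B" "y = c u" "z = c v" unfolding c[of _ x] by blast
    then show "y \<epsilon> z \<or> y = z \<or> z \<epsilon> y" using lin[OF x, of u v] by simp
  qed
  have sc: "Ord x \<longrightarrow> sub (c x) x" for x
  proof (rule eps_induct[of "\<lambda>x. Ord x \<longrightarrow> sub (c x) x"], intro dfi, intro allI impI)
    fix x z assume IH: "\<And>y. y \<epsilon> x \<Longrightarrow> Ord y \<longrightarrow> sub (c y) y" and x: "Ord x" and "z \<epsilon> c x"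
    then obtain y where y: "y \<epsilon> x" "y \<epsilon> B" "z = c y" unfolding c[of _ x] by blast
    have "Ord y" using Ord_mem[OF x y(1)] .
    moreover then have "sub (c y) y" using IH[OF y(1)] by blast
    ultimately have "c y \<epsilon> y \<or> c y = y" using Ord_sub[OF oc, of y y] by blast
    then show "z \<epsilon> x" using Ord_trans[OF x _ y(1)] y by auto
  qed
  have "bij_betw c (el B) (el (c d))" unfolding bij_betw_def
  proof
    show "inj_on c (el B)"
    proof (rule inj_onI)
      fix x y assume xy: "x \<in> el B" "y \<in> el B" "c x = c y"
      then have "\<not> x \<epsilon> y" "\<not> y \<epsilon> x"
        using c[of "c x" y] c[of "c y" x] not_mem_self by auto
      moreover have "Ord x" "Ord y" using xy B Ord_mem[OF d] by auto
      ultimately show "x = y" using Ord_linear by blast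
    qed
    show "c ` el B = el (c d)" using B unfolding el_def c[of _ d] by blast
  qed
  then have "eqp B (c d)" by (rule eqpI[OF dc])
  then show ?thesis using oc[OF d] sc d by blast
qed

text \<open>The order type of \<open>X\<close> is at most \<omega>, and a smaller one would make
  \<open>X\<close> finite and hence bounded.\<close>

lemma eqp_omega: assumes "sub X omega" "\<And>n. n \<epsilon> omega \<Longrightarrow> \<exists>k. k \<epsilon> X \<and> \<not> k \<epsilon> n" shows "eqp X omega"
proof -
  obtain r where r: "Ord r" "sub r omega" "eqp X r" using collapse[OF Ord_omega assms(1)] by blast
  have "\<not> r \<epsilon> omega"
  proof
    assume "r \<epsilon> omega"
    then have "fin X" using r(3) unfolding fin_def by blast
    then show False using not_fin_unbounded[OF assms] by blast
  qed
  then have "r = omega" using Ord_sub[OF r(1) Ord_omega] r(2) by blast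
  then show ?thesis using r(3) by simp
qed

definition Vs where "Vs = rec (\<lambda>x g. Uni (Rep x (\<lambda>y. Pw (app g y))))"

lemma dt_Vs [dfi]: "dt t \<Longrightarrow> dt (\<lambda>e. Vs (t e))"
  by (rule dt1_app[of Vs]) (unfold Vs_def, intro dfi)

lemma mem_Vs: "z \<epsilon> Vs x \<longleftrightarrow> (\<exists>y. y \<epsilon> x \<and> sub z (Vs y))"
proof -
  have "Vs x = Uni (Rep x (\<lambda>y. Pw (app (Lam x Vs) y)))"
    unfolding Vs_def by (rule rec_eq[of "\<lambda>x g. Uni (Rep x (\<lambda>y. Pw (app g y)))"]) (intro dfi)
  moreover have "z \<epsilon> Uni (Rep x (\<lambda>y. Pw (app (Lam x Vs) y))) \<longleftrightarrow> (\<exists>y. y \<epsilon> x \<and> z \<epsilon> Pw (app (Lam x Vs) y))"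
    by (rule mem_UN) (intro dfi)
  ultimately have "z \<epsilon> Vs x \<longleftrightarrow> (\<exists>y. y \<epsilon> x \<and> z \<epsilon> Pw (app (Lam x Vs) y))" by (simp only:)
  moreover have "app (Lam x Vs) y = Vs y" if "y \<epsilon> x" for y by (rule app_Lam) (intro dfi, rule that)
  ultimately show ?thesis by auto
qed

lemma Vs_trans: "z \<epsilon> Vs x \<Longrightarrow> w \<epsilon> z \<Longrightarrow> w \<epsilon> Vs x"
proof -
  have "\<forall>z w. z \<epsilon> Vs x \<and> w \<epsilon> z \<longrightarrow> w \<epsilon> Vs x"
  proof (rule eps_induct[of "\<lambda>x. \<forall>z w. z \<epsilon> Vs x \<and> w \<epsilon> z \<longrightarrow> w \<epsilon> Vs x"], intro dfi, intro allI impI, elim conjE)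
    fix x z w assume IH: "\<And>y. y \<epsilon> x \<Longrightarrow> \<forall>z w. z \<epsilon> Vs y \<and> w \<epsilon> z \<longrightarrow> w \<epsilon> Vs y" and "z \<epsilon> Vs x" "w \<epsilon> z"
    then obtain y where "y \<epsilon> x" "w \<epsilon> Vs y" unfolding mem_Vs[of z x] by blast
    then show "w \<epsilon> Vs x" unfolding mem_Vs[of w x] using IH by blast
  qed
  then show "z \<epsilon> Vs x \<Longrightarrow> w \<epsilon> z \<Longrightarrow> w \<epsilon> Vs x" by blast
qed

lemma Vs_mono: assumes "Ord b" "a \<epsilon> b" "z \<epsilon> Vs a" shows "z \<epsilon> Vs b"
  using assms(3) Ord_trans[OF assms(1) _ assms(2)] unfolding mem_Vs[of z] by blast

lemma ex_Vs: "\<exists>a. Ord a \<and> z \<epsilon> Vs a"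
proof (rule eps_induct[of "\<lambda>z. \<exists>a. Ord a \<and> z \<epsilon> Vs a"], intro dfi)
  fix z assume IH: "\<And>y. y \<epsilon> z \<Longrightarrow> \<exists>a. Ord a \<and> y \<epsilon> Vs a"
  let ?a = "\<lambda>u. lst (\<lambda>a. u \<epsilon> Vs a)"
  have a: "Ord (?a u)" "u \<epsilon> Vs (?a u)" if u: "u \<epsilon> z" for u
  proof -
    obtain a where a: "Ord a" "u \<epsilon> Vs a" using IH[OF u] by blast
    have d: "df1 (\<lambda>a. u \<epsilon> Vs a)" by (intro dfi)
    show "Ord (?a u)" "u \<epsilon> Vs (?a u)" using lst[OF d a] by blast+
  qed
  have ds: "dt1 (\<lambda>u. suc (?a u))" by (intro dfi)
  let ?b = "Uni (Rep z (\<lambda>u. suc (?a u)))"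
  have b: "Ord ?b" by (rule Ord_Uni) (use a in \<open>auto simp: mem_Rep[OF ds]\<close>)
  have "u \<epsilon> Vs ?b" if u: "u \<epsilon> z" for u
  proof (rule Vs_mono[OF b _ a(2)[OF u]])
    show "?a u \<epsilon> ?b" unfolding mem_Uni mem_Rep[OF ds] using u by (intro exI[of _ "suc (?a u)"]) auto
  qed
  then have "z \<epsilon> Vs (suc ?b)" unfolding mem_Vs[of z] by (intro exI[of _ ?b]) simp
  then show "\<exists>a. Ord a \<and> z \<epsilon> Vs a" using Ord_suc[OF b] by blast
qed

text \<open>Scott's trick: for each \<open>x\<close> take the whole first level of the hierarchy
  that contains a witness, so that no choice is made.\<close>

lemma collection: assumes Q: "df2 Q" and ex: "\<And>x. x \<epsilon> a \<Longrightarrow> \<exists>y. Q x y"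
  shows "\<exists>b. \<forall>x. x \<epsilon> a \<longrightarrow> (\<exists>y. y \<epsilon> b \<and> Q x y)"
proof -
  note [dfi] = df2_app[OF Q]
  let ?a = "\<lambda>x. lst (\<lambda>c. \<exists>y. y \<epsilon> Vs c \<and> Q x y)"
  have dV: "dt1 (\<lambda>x. Vs (?a x))" by (intro dfi)
  have "\<exists>y. y \<epsilon> Vs (?a x) \<and> Q x y" if x: "x \<epsilon> a" for x
  proof -
    obtain y where y: "Q x y" using ex[OF x] by blast
    obtain c where c: "Ord c" "y \<epsilon> Vs c" using ex_Vs by blast
    have d: "df1 (\<lambda>c. \<exists>y. y \<epsilon> Vs c \<and> Q x y)" by (intro dfi)
    from lst(2)[OF d c(1)] y c(2) show ?thesis by blast
  qed
  then have "\<exists>y. y \<epsilon> Uni (Rep a (\<lambda>x. Vs (?a x))) \<and> Q x y" if "x \<epsilon> a" for x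
    unfolding mem_Uni mem_Rep[OF dV] using that by blast
  then show ?thesis by blast
qed

definition card_in where "card_in k \<longleftrightarrow> Ord k \<and> (\<forall>a. a \<epsilon> k \<longrightarrow> \<not> eqp a k)"

lemma sat_is_card [simp]: "sat E (is_card k) \<longleftrightarrow> card_in k"
  unfolding is_card_def card_in_def by simp

text \<open>The injection into \<open>\<omega>\<close> maps \<open>x\<close> to the size of the finite set of the predecessors of \<open>x\<close> in the
  lexicographic order of \<open>\<rho> x\<close> and an index of \<open>x\<close>.\<close>

lemma finite_to_one:
  assumes f: "dt1 f" "inj_on f (el X)" "\<And>x. x \<epsilon> X \<Longrightarrow> Ord (f x)"
    and r: "dt1 \<rho>" "\<And>x. x \<epsilon> X \<Longrightarrow> \<rho> x \<epsilon> omega"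
    and fib: "\<And>k. k \<epsilon> omega \<Longrightarrow> fin (Sep X (\<lambda>x. \<rho> x = k))"
  shows "cle X omega"
proof -
  note [dfi] = dt1_app[OF f(1)] dt1_app[OF r(1)]
  have Sf: "x \<epsilon> Sep X (\<lambda>x. \<rho> x = k) \<longleftrightarrow> x \<epsilon> X \<and> \<rho> x = k" for x k by (rule mem_Sep) (intro dfi)
  let ?L = "\<lambda>y x. \<rho> y \<epsilon> \<rho> x \<or> (\<rho> y = \<rho> x \<and> f y \<epsilon> f x)"
  let ?S = "\<lambda>x. Sep X (\<lambda>y. ?L y x)"
  have S: "y \<epsilon> ?S x \<longleftrightarrow> y \<epsilon> X \<and> ?L y x" for x y by (rule mem_Sep) (intro dfi)
  have or: "Ord (\<rho> x)" if "x \<epsilon> X" for x using r(2)[OF that] Ord_omega_mem by blast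
  have finS: "fin (?S x)" if x: "x \<epsilon> X" for x
  proof -
    have d: "dt1 (\<lambda>k. Sep X (\<lambda>x. \<rho> x = k))" by (intro dfi)
    have "fin (Uni (Rep (suc (\<rho> x)) (\<lambda>k. Sep X (\<lambda>x. \<rho> x = k))))"
    proof (rule fin_UN[OF _ d])
      show "fin (suc (\<rho> x))" using fin_omega_mem r(2)[OF x] by auto
      show "fin (Sep X (\<lambda>x. \<rho> x = k))" if "k \<epsilon> suc (\<rho> x)" for k
        by (rule fib) (use that r(2)[OF x] omega_trans[of "\<rho> x"] in auto)
    qed
    moreover have "sub (?S x) (Uni (Rep (suc (\<rho> x)) (\<lambda>k. Sep X (\<lambda>x. \<rho> x = k))))"
      unfolding S mem_UN[OF d] Sf by auto
    ultimately show ?thesis by (rule fin_sub)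
  qed
  let ?Q = "\<lambda>x n. n \<epsilon> omega \<and> cle (?S x) n"
  let ?h = "\<lambda>x. lst (?Q x)"
  have h: "?h x \<epsilon> omega" "cle (?S x) (?h x)" "\<And>m. m \<epsilon> ?h x \<Longrightarrow> \<not> cle (?S x) m" if x: "x \<epsilon> X" for x
  proof -
    obtain n where n: "n \<epsilon> omega" "eqp (?S x) n" using finS[OF x] unfolding fin_def by blast
    then have q: "?Q x n" using eqp_cle by blast
    have d: "df1 (?Q x)" by (intro dfi)
    note l = lst[OF d Ord_omega_mem[OF n(1)] q]
    show "?h x \<epsilon> omega" "cle (?S x) (?h x)" using l(2) by blast+
    then show "\<not> cle (?S x) m" if "m \<epsilon> ?h x" for m
      using l(3)[OF that] omega_trans[of "?h x"] that by blast
  qed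
  have lt: "?h x \<noteq> ?h x'" if x: "x \<epsilon> X" "x' \<epsilon> X" and L: "?L x x'" for x x'
  proof
    assume eq: "?h x = ?h x'"
    have sb: "y \<epsilon> ?S x'" if "y \<epsilon> ?S x" for y
    proof -
      have y: "y \<epsilon> X" "?L y x" using that unfolding S by blast+
      have "?L y x'"
        using L y(2) Ord_trans[OF or[OF x(2)], of "\<rho> y" "\<rho> x"] Ord_trans[OF f(3)[OF x(2)], of "f y" "f x"]
        by (elim disjE conjE) simp_all
      then show ?thesis using y(1) S by blast
    qed
    have "x \<epsilon> ?S x'" using S x(1) L by blast
    obtain g where g: "dt1 g" "inj_on g (el (?S x'))" "\<And>y. y \<epsilon> ?S x' \<Longrightarrow> g y \<epsilon> ?h x'"
      using h(2)[OF x(2)] unfolding cle_iff by blast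
    note [dfi] = dt1_app[OF g(1)]
    have "?h x' \<noteq> emp" using g(3)[OF \<open>x \<epsilon> ?S x'\<close>] by auto
    then obtain k where k: "k \<epsilon> omega" "?h x' = suc k" using omega_cases[OF h(1)[OF x(2)]] by blast
    \<comment> \<open>\<open>x\<close> lies in \<open>?S x'\<close> but not in \<open>?S x\<close>,
      so the value \<open>g x\<close> is free and replaces the largest value \<open>k\<close>. Thus
      \<open>?S x\<close> injects into \<open>k\<close>, against the minimality of
      \<open>?h x\<close>.\<close>
    let ?g = "\<lambda>y. if g y = k then g x else g y"
    have nx: "\<not> x \<epsilon> ?S x" unfolding S by simp
    have "cle (?S x) k"
    proof (rule cleI)
      show "dt1 ?g" by (intro dfi)
      have gx: "g y \<noteq> g x" if "y \<epsilon> ?S x" for y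
        using inj_onD[OF g(2), of y x] sb[OF that] \<open>x \<epsilon> ?S x'\<close> nx that by auto
      show "inj_on ?g (el (?S x))"
      proof (rule inj_onI)
        fix y z assume yz: "y \<in> el (?S x)" "z \<in> el (?S x)" and e: "?g y = ?g z"
        then have "g y = g z" using gx[of y] gx[of z] by (auto split: if_splits)
        then show "y = z" using inj_onD[OF g(2)] sb yz by simp
      qed
      show "?g y \<epsilon> k" if y: "y \<epsilon> ?S x" for y
        using g(3)[OF sb[OF y]] g(3)[OF \<open>x \<epsilon> ?S x'\<close>] gx[OF y] unfolding k(2) by auto
    qed
    then show False using h(3)[OF x(1), of k] k(2) eq by simp
  qed
  show ?thesis
  proof (rule cleI)
    show "dt1 ?h" by (intro dfi)
    show "inj_on ?h (el X)"
    proof (rule inj_onI)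
      fix x x' assume x: "x \<in> el X" "x' \<in> el X" and eq: "?h x = ?h x'"
      have "\<not> ?L x x'" "\<not> ?L x' x" using lt[of x x'] lt[of x' x] x eq by auto
      then have "f x = f x'"
        using Ord_linear[OF or or, of x x'] Ord_linear[OF f(3) f(3), of x x'] x by auto
      then show "x = x'" using inj_onD[OF f(2)] x by blast
    qed
    show "?h x \<epsilon> omega" if "x \<epsilon> X" for x using h(1)[OF that] .
  qed
qed

text \<open>Zermelo's theorem: enumerate \<open>x\<close> along the ordinals with a choice function until it is exhausted.\<close>

lemma Zermelo:
  assumes choice: "\<And>x. (\<And>y. y \<epsilon> x \<Longrightarrow> \<exists>z. z \<epsilon> y) \<Longrightarrow>
         (\<And>y y' z. y \<epsilon> x \<Longrightarrow> y' \<epsilon> x \<Longrightarrow> z \<epsilon> y \<Longrightarrow> z \<epsilon> y' \<Longrightarrow> y = y') \<Longrightarrow>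
         \<exists>c. \<forall>y. y \<epsilon> x \<longrightarrow> (\<exists>!z. z \<epsilon> y \<and> z \<epsilon> c)"
  shows "\<exists>d f. Ord d \<and> (\<forall>y. y \<epsilon> x \<longrightarrow> (\<exists>i. i \<epsilon> d \<and> pr i y \<epsilon> f)) \<and> (\<forall>i y y'. pr i y \<epsilon> f \<and> pr i y' \<epsilon> f \<longrightarrow> y = y')"
proof -
  let ?N = "Sep (Pw x) (\<lambda>y. y \<noteq> emp)"
  have N: "y \<epsilon> ?N \<longleftrightarrow> sub y x \<and> y \<noteq> emp" for y
    by (subst mem_Sep) (intro dfi, simp)
  \<comment> \<open>Choice is assumed for disjoint families, so each nonempty subset
    \<open>y\<close> is replaced by the product of its singleton with \<open>y\<close>.\<close>
  have d: "dt1 (\<lambda>y. prod (ins y emp) y)" by (intro dfi)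
  have "\<exists>c. \<forall>y. y \<epsilon> Rep ?N (\<lambda>y. prod (ins y emp) y) \<longrightarrow> (\<exists>!z. z \<epsilon> y \<and> z \<epsilon> c)"
  proof (rule choice)
    fix y assume "y \<epsilon> Rep ?N (\<lambda>y. prod (ins y emp) y)"
    then obtain u where u: "y = prod (ins u emp) u" "u \<noteq> emp" unfolding mem_Rep[OF d] N by blast
    then obtain v where "v \<epsilon> u" unfolding emp_iff by blast
    then show "\<exists>z. z \<epsilon> y" unfolding u(1) by (intro exI[of _ "pr u v"]) auto
  next
    fix y y' z assume "y \<epsilon> Rep ?N (\<lambda>y. prod (ins y emp) y)" "y' \<epsilon> Rep ?N (\<lambda>y. prod (ins y emp) y)" "z \<epsilon> y" "z \<epsilon> y'"
    moreover then obtain u u' where u: "y = prod (ins u emp) u" "y' = prod (ins u' emp) u'" unfolding mem_Rep[OF d] by blast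
    ultimately have "z \<epsilon> prod (ins u emp) u" "z \<epsilon> prod (ins u' emp) u'" by simp_all
    then have "\<exists>v. z = pr u v" "\<exists>v. z = pr u' v" unfolding mem_prod mem_ins by (blast dest: mem_emp[THEN notE])+
    then have "u = u'" by auto
    then show "y = y'" using u by simp
  qed
  then obtain c where c0: "\<forall>y. y \<epsilon> Rep ?N (\<lambda>y. prod (ins y emp) y) \<longrightarrow> (\<exists>!z. z \<epsilon> y \<and> z \<epsilon> c)" ..
  have c: "\<exists>!z. z \<epsilon> prod (ins y emp) y \<and> z \<epsilon> c" if "y \<epsilon> ?N" for y
  proof -
    have "prod (ins y emp) y \<epsilon> Rep ?N (\<lambda>y. prod (ins y emp) y)" unfolding mem_Rep[OF d] using that by blast
    then show ?thesis using c0 by blast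
  qed
  let ?ch = "\<lambda>y. desc (\<lambda>u. u \<epsilon> y \<and> pr y u \<epsilon> c)"
  have ch: "?ch y \<epsilon> y" if "sub y x" "y \<noteq> emp" for y
  proof -
    have "\<exists>!z. z \<epsilon> prod (ins y emp) y \<and> z \<epsilon> c" by (rule c) (use that N in blast)
    then obtain z where z: "z \<epsilon> prod (ins y emp) y" "z \<epsilon> c" "\<And>z'. z' \<epsilon> prod (ins y emp) y \<Longrightarrow> z' \<epsilon> c \<Longrightarrow> z' = z" by blast
    obtain u where u: "u \<epsilon> y" "z = pr y u" using z(1) by auto
    have "v = u" if "v \<epsilon> y" "pr y v \<epsilon> c" for v using z(3)[of "pr y v"] that u by auto
    then have "\<exists>!u. u \<epsilon> y \<and> pr y u \<epsilon> c" using u z(2) by blast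
    from descI[OF this] show ?thesis by blast
  qed
  let ?T = "\<lambda>a g. Sep x (\<lambda>u. \<forall>i. i \<epsilon> a \<longrightarrow> app g i \<noteq> u)"
  \<comment> \<open>The default \<open>x\<close> is not a member of \<open>x\<close>, so after
    exhaustion it marks no element as used.\<close>
  let ?H = "\<lambda>a g. if ?T a g = emp then x else ?ch (?T a g)"
  have H: "dt2 ?H" by (intro dfi)
  define F where "F = rec ?H"
  have dF: "dt1 F" unfolding F_def by (intro dfi)
  note [dfi] = dt1_app[OF dF]
  let ?R = "\<lambda>a. Sep x (\<lambda>u. \<forall>i. i \<epsilon> a \<longrightarrow> F i \<noteq> u)"
  have R: "u \<epsilon> ?R a \<longleftrightarrow> u \<epsilon> x \<and> (\<forall>i. i \<epsilon> a \<longrightarrow> F i \<noteq> u)" for u a by (rule mem_Sep) (intro dfi)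
  have TR: "?T a (Lam a F) = ?R a" for a
  proof (rule exten)
    fix z
    have "z \<epsilon> ?T a (Lam a F) \<longleftrightarrow> z \<epsilon> x \<and> (\<forall>i. i \<epsilon> a \<longrightarrow> app (Lam a F) i \<noteq> z)" by (rule mem_Sep) (intro dfi)
    then show "z \<epsilon> ?T a (Lam a F) \<longleftrightarrow> z \<epsilon> ?R a" unfolding R using app_Lam[OF dF, of _ a] by auto
  qed
  have F: "F a = (if ?R a = emp then x else ?ch (?R a))" for a
    using rec_eq[OF H, of a] unfolding F_def[symmetric] TR .
  have "\<exists>a. Ord a \<and> ?R a = emp"
  proof (rule ccontr)
    assume "\<not> (\<exists>a. Ord a \<and> ?R a = emp)"
    then have FR: "F a \<epsilon> ?R a" if "Ord a" for a using F[of a] ch[of "?R a"] that R by auto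
    have inj: "a = b" if "Ord a" "Ord b" "F a = F b" for a b
      using Ord_linear[OF that(1,2)] FR[OF that(1)] FR[OF that(2)] that(3) unfolding R by metis
    let ?G = "\<lambda>u. desc (\<lambda>a. Ord a \<and> F a = u)"
    have G: "?G (F a) = a" if "Ord a" for a by (rule desc_eq) (use that inj in blast)+
    have dG: "dt1 ?G" by (intro dfi)
    let ?A = "Sep x (\<lambda>u. \<exists>a. Ord a \<and> F a = u)"
    have A: "u \<epsilon> ?A \<longleftrightarrow> u \<epsilon> x \<and> (\<exists>a. Ord a \<and> F a = u)" for u by (rule mem_Sep) (intro dfi)
    have W: "a \<epsilon> Rep ?A ?G \<longleftrightarrow> Ord a" for a
    proof
      assume "a \<epsilon> Rep ?A ?G" then show "Ord a" unfolding mem_Rep[OF dG] A using G by auto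
    next
      assume a: "Ord a"
      then have "F a \<epsilon> ?A" using FR[OF a] unfolding R A by blast
      then show "a \<epsilon> Rep ?A ?G" unfolding mem_Rep[OF dG] using G[OF a] by (intro exI[of _ "F a"]) simp
    qed
    \<comment> \<open>By replacement along the inverse of \<open>F\<close> the ordinals would form a
      set; the successor of its union refutes this.\<close>
    have "Ord (Uni (Rep ?A ?G))" by (rule Ord_Uni) (use W in blast)
    then have "suc (Uni (Rep ?A ?G)) \<epsilon> Rep ?A ?G" unfolding W by simp
    then have "Uni (Rep ?A ?G) \<epsilon> Uni (Rep ?A ?G)" unfolding mem_Uni[of _ "Rep ?A ?G"]
      by (intro exI[of _ "suc (Uni (Rep ?A ?G))"]) simp
    then show False by simp
  qed
  then obtain a where a: "Ord a" "?R a = emp" by blast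
  have "\<exists>i. i \<epsilon> a \<and> pr i y \<epsilon> Lam a F" if "y \<epsilon> x" for y
  proof -
    have "\<not> y \<epsilon> ?R a" by (simp add: a(2))
    then show ?thesis using that unfolding R mem_Lam[OF dF] by blast
  qed
  moreover have "\<forall>i y y'. pr i y \<epsilon> Lam a F \<and> pr i y' \<epsilon> Lam a F \<longrightarrow> y = y'" unfolding mem_Lam[OF dF] by auto
  ultimately show ?thesis using a(1) by blast
qed

end

section \<open>Consequences of well-ordering: choice, cardinals, the first uncountable
  ordinal\<close>

locale zfwo = zf +
  assumes wo: "\<exists>d f. Ord d \<and> (\<forall>y. y \<epsilon> x \<longrightarrow> (\<exists>i. i \<epsilon> d \<and> pr i y \<epsilon> f)) \<and> (\<forall>i y y'. pr i y \<epsilon> f \<and> pr i y' \<epsilon> f \<longrightarrow> y = y')"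
begin

lemma wo_fun: "\<exists>d g. Ord d \<and> dt1 g \<and> (\<forall>y. y \<epsilon> x \<longrightarrow> (\<exists>i. i \<epsilon> d \<and> g i = y))"
proof -
  obtain d f where f: "Ord d" "\<And>y. y \<epsilon> x \<Longrightarrow> \<exists>i. i \<epsilon> d \<and> pr i y \<epsilon> f" "\<And>i y y'. pr i y \<epsilon> f \<Longrightarrow> pr i y' \<epsilon> f \<Longrightarrow> y = y'"
    using wo[of x] by blast
  then have "\<exists>i. i \<epsilon> d \<and> app f i = y" if "y \<epsilon> x" for y using that app_eq[of _ y f] by blast
  then show ?thesis using f(1) dt1_appf by blast
qed

text \<open>Collection confines the witnesses to a set; the witness with the least index in an
  enumeration of this set is definable from the enumeration.\<close>

lemma choice: assumes Q: "df2 Q" and ex: "\<And>x. x \<epsilon> a \<Longrightarrow> \<exists>y. Q x y"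
  shows "\<exists>f. dt1 f \<and> (\<forall>x. x \<epsilon> a \<longrightarrow> Q x (f x))"
proof -
  obtain b where b: "\<And>x. x \<epsilon> a \<Longrightarrow> \<exists>y. y \<epsilon> b \<and> Q x y" using collection[OF Q, of a] ex by blast
  obtain d g where g: "Ord d" "dt1 g" "\<And>y. y \<epsilon> b \<Longrightarrow> \<exists>i. i \<epsilon> d \<and> g i = y" using wo_fun[of b] by blast
  note [dfi] = df2_app[OF Q] dt1_app[OF g(2)]
  have "Q x (g (lst (\<lambda>i. Q x (g i))))" if x: "x \<epsilon> a" for x
  proof -
    obtain i where i: "i \<epsilon> d" "Q x (g i)" using b[OF x] g(3) by blast
    have "df1 (\<lambda>i. Q x (g i))" by (intro dfi)
    from lst(2)[OF this Ord_mem[OF g(1) i(1)]] i(2) show ?thesis by blast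
  qed
  then show ?thesis
    by (intro exI[of _ "\<lambda>x. g (lst (\<lambda>i. Q x (g i)))"] conjI allI impI) (intro dfi)
qed

text \<open>The least indices in an enumeration of \<open>x\<close> form a set of ordinals, which is
  then collapsed.\<close>

lemma eqp_Ord: "\<exists>d. Ord d \<and> eqp x d"
proof -
  obtain d g where g: "Ord d" "dt1 g" "\<And>y. y \<epsilon> x \<Longrightarrow> \<exists>i. i \<epsilon> d \<and> g i = y" using wo_fun[of x] by blast
  note [dfi] = dt1_app[OF g(2)]
  let ?B = "Sep d (\<lambda>i. g i \<epsilon> x \<and> (\<forall>j. j \<epsilon> i \<longrightarrow> g j \<noteq> g i))"
  have B: "i \<epsilon> ?B \<longleftrightarrow> i \<epsilon> d \<and> g i \<epsilon> x \<and> (\<forall>j. j \<epsilon> i \<longrightarrow> g j \<noteq> g i)" for i by (rule mem_Sep) (intro dfi)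
  have "bij_betw g (el ?B) (el x)" unfolding bij_betw_def
  proof
    show "inj_on g (el ?B)"
    proof (rule inj_onI)
      fix i j assume ij: "i \<in> el ?B" "j \<in> el ?B" "g i = g j"
      then have "i \<epsilon> d" "j \<epsilon> d" "\<not> i \<epsilon> j" "\<not> j \<epsilon> i" unfolding mem_el B by auto
      then show "i = j" using Ord_lin[OF g(1)] by blast
    qed
    have "\<exists>i. i \<epsilon> ?B \<and> g i = y" if y: "y \<epsilon> x" for y
    proof -
      obtain i where i: "i \<epsilon> d" "g i = y" using g(3)[OF y] by blast
      have "df1 (\<lambda>i. g i = y)" by (intro dfi)
      note l = lst[OF this Ord_mem[OF g(1) i(1)] i(2)] lst_sub[OF this Ord_mem[OF g(1) i(1)] i(2)]
      have "lst (\<lambda>i. g i = y) \<epsilon> i \<or> lst (\<lambda>i. g i = y) = i" using l(4) Ord_sub[OF l(1) Ord_mem[OF g(1) i(1)]] by blast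
      then have "lst (\<lambda>i. g i = y) \<epsilon> d" using i(1) Ord_trans[OF g(1) _ i(1)] by auto
      then show ?thesis using l(2,3) y unfolding B by (intro exI[of _ "lst (\<lambda>i. g i = y)"]) auto
    qed
    moreover have "g i \<epsilon> x" if "i \<epsilon> ?B" for i using that unfolding B by blast
    ultimately show "g ` el ?B = el x" by (fastforce simp: el_def)
  qed
  then have "eqp ?B x" by (rule eqpI[OF g(2)])
  moreover obtain r where "Ord r" "eqp ?B r" using collapse[OF g(1), of ?B] B by blast
  ultimately show ?thesis using eqp_sym eqp_trans by blast
qed

lemma ex_card: "\<exists>k. card_in k \<and> eqp x k"
proof -
  obtain d where d: "Ord d" "eqp x d" using eqp_Ord by blast
  have "df1 (\<lambda>k. eqp x k)" by (intro dfi)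
  note l = lst[OF this d]
  have "card_in (lst (\<lambda>k. eqp x k))" unfolding card_in_def
    using l(1) l(3) eqp_trans[OF l(2) eqp_sym] by blast
  then show ?thesis using l(2) by blast
qed

lemma Hartogs: "\<exists>d. Ord d \<and> \<not> cle d x"
proof -
  obtain d where d: "Ord d" "eqp (Pw x) d" using eqp_Ord by blast
  then show ?thesis using Cantor[of x] cle_trans[OF eqp_cle[OF d(2)]] by blast
qed

definition om1 where "om1 = lst (\<lambda>d. \<not> cle d omega)"

lemma om1: "Ord om1" "\<not> cle om1 omega" "\<And>a. a \<epsilon> om1 \<Longrightarrow> cle a omega"
proof -
  obtain d where d: "Ord d" "\<not> cle d omega" using Hartogs by blast
  have "df1 (\<lambda>d. \<not> cle d omega)" by (intro dfi)
  note l = lst[OF this d]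
  show "Ord om1" "\<not> cle om1 omega" "\<And>a. a \<epsilon> om1 \<Longrightarrow> cle a omega" unfolding om1_def using l by blast+
qed

lemma om1I: assumes "Ord a" "cle a omega" shows "a \<epsilon> om1"
  using Ord_not_mem[OF assms(1) om1(1)] om1(2) cle_trans[OF cle_sub assms(2)] by blast

lemma cle_suc_omega: assumes "cle a omega" shows "cle (suc a) omega"
proof -
  obtain f where f: "dt1 f" "inj_on f (el a)" "\<And>x. x \<epsilon> a \<Longrightarrow> f x \<epsilon> omega" using assms unfolding cle_iff by blast
  note [dfi] = dt1_app[OF f(1)]
  show ?thesis
  proof (rule cleI)
    show "dt1 (\<lambda>x. if x = a then emp else suc (f x))" by (intro dfi)
    show "inj_on (\<lambda>x. if x = a then emp else suc (f x)) (el (suc a))"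
      using f(2) by (auto simp: inj_on_def)
  qed (use f(3) in auto)
qed

lemma omega_om1: "omega \<epsilon> om1" by (rule om1I[OF Ord_omega cle_sub]) simp

lemma Lim_om1: "Lim om1"
proof -
  have "suc a \<epsilon> om1" if "a \<epsilon> om1" for a
    using om1I[OF Ord_suc[OF Ord_mem[OF om1(1) that]]] cle_suc_omega om1(3)[OF that] by blast
  moreover have "om1 \<noteq> emp" using omega_om1 by (intro notI) simp
  ultimately show ?thesis unfolding Lim_def using om1(1) mem_suc by blast
qed

lemma sat_is_aleph1: "sat E (is_aleph1 om1)"
proof -
  have "\<not> eqp a om1" if "a \<epsilon> om1" for a
    using om1(2) om1(3)[OF that] cle_trans[OF eqp_cle[OF eqp_sym]] by blast
  then show ?thesis unfolding is_aleph1_def by (simp add: card_in_def om1 omega_om1)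
qed

text \<open>A countable union of countable ordinals is countable: a point gets the maximum of the
  index of the first ordinal containing it and of its number there, and only finitely many points
  share a value. The maximum of two natural numbers is their union.\<close>

lemma om1_regular: assumes f: "dt1 f" and fn: "\<And>n. n \<epsilon> omega \<Longrightarrow> f n \<epsilon> om1"
  shows "\<exists>b. b \<epsilon> om1 \<and> (\<forall>n. n \<epsilon> omega \<longrightarrow> f n \<epsilon> b)"
proof -
  note [dfi] = dt1_app[OF f]
  let ?J = "Uni (Rep omega f)"
  have J: "x \<epsilon> ?J \<longleftrightarrow> (\<exists>n. n \<epsilon> omega \<and> x \<epsilon> f n)" for x by (auto simp: mem_Rep[OF f])
  have of: "Ord (f n)" if "n \<epsilon> omega" for n using Ord_mem[OF om1(1) fn[OF that]] .
  have oJ: "Ord ?J" by (rule Ord_Uni) (use of in \<open>auto simp: mem_Rep[OF f]\<close>)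
  obtain G where G: "dt1 G" "\<And>n. n \<epsilon> omega \<Longrightarrow> is_injm (G n) (f n) omega"
  proof -
    have "df2 (\<lambda>n g. is_injm g (f n) omega)" by (intro dfi)
    from choice[OF this, of omega] om1(3)[OF fn] that show thesis unfolding cle_def by blast
  qed
  note [dfi] = dt1_app[OF G(1)]
  let ?N = "\<lambda>x. lst (\<lambda>n. n \<epsilon> omega \<and> x \<epsilon> f n)"
  let ?r = "\<lambda>x. un (?N x) (app (G (?N x)) x)"
  have N: "?N x \<epsilon> omega" "x \<epsilon> f (?N x)" if x: "x \<epsilon> ?J" for x
  proof -
    obtain n where n: "n \<epsilon> omega \<and> x \<epsilon> f n" using x J by blast
    have "df1 (\<lambda>n. n \<epsilon> omega \<and> x \<epsilon> f n)" by (intro dfi)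
    from lst(2)[OF this _ n] n Ord_omega_mem show "?N x \<epsilon> omega" "x \<epsilon> f (?N x)" by blast+
  qed
  have un: "un a b = a \<or> un a b = b" if ab: "a \<epsilon> omega" "b \<epsilon> omega" for a b
  proof -
    have o: "Ord a" "Ord b" using ab Ord_omega_mem by auto
    have "a \<epsilon> b \<or> a = b \<or> b \<epsilon> a" by (rule Ord_linear[OF o])
    then have "sub a b \<or> sub b a" using Ord_sub[OF o] Ord_sub[OF o(2,1)] by blast
    then show ?thesis
    proof
      assume "sub a b" then have "un a b = b" by (intro exten) auto then show ?thesis ..
    next
      assume "sub b a" then have "un a b = a" by (intro exten) auto then show ?thesis ..
    qed
  qed
  have inj: "inj_on (app (G n)) (el (f n))" "\<And>x. x \<epsilon> f n \<Longrightarrow> app (G n) x \<epsilon> omega" if "n \<epsilon> omega" for n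
    using G(2)[OF that] is_map_app(1)[of "G n"] unfolding is_injm_iff by auto
  have "cle ?J omega"
  proof (rule finite_to_one[of "\<lambda>x. x" _ ?r])
    show "Ord x" if "x \<epsilon> ?J" for x using Ord_mem[OF oJ that] .
    show "?r x \<epsilon> omega" if x: "x \<epsilon> ?J" for x
      using un[OF N(1)[OF x] inj(2)[OF N[OF x]]] N(1)[OF x] inj(2)[OF N[OF x]] by auto
    show "dt1 ?r" by (intro dfi)
    fix k assume k: "k \<epsilon> omega"
    let ?C = "\<lambda>n. Sep (f n) (\<lambda>x. app (G n) x \<epsilon> suc k)"
    have C: "x \<epsilon> ?C n \<longleftrightarrow> x \<epsilon> f n \<and> app (G n) x \<epsilon> suc k" for x n by (rule mem_Sep) (intro dfi)
    have dC: "dt1 ?C" by (intro dfi)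
    have "fin (Uni (Rep (suc k) ?C))"
    proof (rule fin_UN[OF _ dC])
      show "fin (suc k)" using k fin_omega_mem by auto
      fix n assume "n \<epsilon> suc k"
      then have n: "n \<epsilon> omega" using k omega_trans[of k] by auto
      have "cle (?C n) (suc k)"
        by (rule cleI[of "app (G n)"]) (rule dt1_appf, use inj(1)[OF n] C in \<open>auto simp: inj_on_def\<close>)
      then show "fin (?C n)" using fin_cle fin_omega_mem[OF suc_omega[OF k]] by blast
    qed
    moreover have "x \<epsilon> Uni (Rep (suc k) ?C)" if x: "x \<epsilon> Sep ?J (\<lambda>x. ?r x = k)" for x
    proof -
      have "x \<epsilon> Sep ?J (\<lambda>x. ?r x = k) \<longleftrightarrow> x \<epsilon> ?J \<and> ?r x = k" by (rule mem_Sep) (intro dfi)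
      then have xJ: "x \<epsilon> ?J" and rk: "?r x = k" using x by blast+
      have o: "Ord k" "Ord (?N x)" "Ord (app (G (?N x)) x)"
        using k N(1)[OF xJ] inj(2)[OF N[OF xJ]] Ord_omega_mem by blast+
      have "sub (?N x) k" "sub (app (G (?N x)) x) k" using rk by auto
      then have "?N x \<epsilon> suc k" "app (G (?N x)) x \<epsilon> suc k"
        using Ord_sub[OF o(2,1)] Ord_sub[OF o(3,1)] by auto
      then show ?thesis unfolding mem_Uni mem_Rep[OF dC]
        using N(2)[OF xJ] C by (intro exI[of _ "?C (?N x)"]) auto
    qed
    ultimately show "fin (Sep ?J (\<lambda>x. ?r x = k))" using fin_sub by blast
  qed (rule dt_var, simp)
  then have "suc ?J \<epsilon> om1" using om1I[OF Ord_suc[OF oJ]] cle_suc_omega by blast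
  moreover have "f n \<epsilon> suc ?J" if "n \<epsilon> omega" for n
  proof -
    have "sub (f n) ?J" unfolding J using that by blast
    then show ?thesis using Ord_sub[OF of[OF that] oJ] unfolding mem_suc by blast
  qed
  ultimately show ?thesis by blast
qed

end

section \<open>From \<open>ZFC_model\<close> to the working locales\<close>

lemma (in emodel) ZFC_model_zf: assumes "ZFC_model E" shows "zf E"
proof -
  have m1: "sat E (y \<^bold>\<subseteq> x) \<longleftrightarrow> (\<forall>z. z \<epsilon> y \<longrightarrow> z \<epsilon> x)" for x y by (simp add: subset_of_def)
  have m2: "sat E (is_empty x) \<longleftrightarrow> (\<forall>z. \<not> z \<epsilon> x)" for x by (simp add: is_empty_def)
  have m3: "sat E (is_succ x y) \<longleftrightarrow> (\<forall>z. z \<epsilon> y \<longleftrightarrow> z \<epsilon> x \<or> z = x)" for x y by (simp add: is_succ_def)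
  note Z = assms[unfolded ZFC_model_def m1 m2 m3]
  note Z2 = Z[THEN conjunct2] note Z3 = Z2[THEN conjunct2] note Z4 = Z3[THEN conjunct2] note Z5 = Z4[THEN conjunct2]
  note Z6 = Z5[THEN conjunct2] note Z8 = Z6[THEN conjunct2, THEN conjunct2]
  have e0: "(case_nat u e)(0 := x) = case_nat x e" for u x and e :: "nat \<Rightarrow> 'v"
    by (auto split: nat.split)
  have e1: "(case_nat u (case_nat v e))(0 := x, 1 := y) = case_nat x (case_nat y e)" for u v x y and e :: "nat \<Rightarrow> 'v"
    by (auto split: nat.split)
  show ?thesis
  proof (unfold_locales)
    show "(\<And>z. z \<epsilon> x \<longleftrightarrow> z \<epsilon> y) \<Longrightarrow> x = y" for x y using Z[THEN conjunct1] by blast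
    show "y \<epsilon> x \<Longrightarrow> \<exists>y. y \<epsilon> x \<and> \<not> (\<exists>z. z \<epsilon> y \<and> z \<epsilon> x)" for x y using Z2[THEN conjunct1] by blast
    show "\<exists>z. x \<epsilon> z \<and> y \<epsilon> z" for x y using Z3[THEN conjunct1] by blast
    show "\<exists>u. \<forall>y z. z \<epsilon> y \<and> y \<epsilon> x \<longrightarrow> z \<epsilon> u" for x using Z4[THEN conjunct1] by blast
    show "\<exists>u. \<forall>y. (\<forall>z. z \<epsilon> y \<longrightarrow> z \<epsilon> x) \<longrightarrow> y \<epsilon> u" for x using Z5[THEN conjunct1] by blast
    show "\<exists>w. (\<exists>x. x \<epsilon> w \<and> (\<forall>z. \<not> z \<epsilon> x)) \<and>
         (\<forall>x. x \<epsilon> w \<longrightarrow> (\<exists>y. y \<epsilon> w \<and> (\<forall>z. z \<epsilon> y \<longleftrightarrow> z \<epsilon> x \<or> z = x)))" using Z6[THEN conjunct1] by blast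
    have sep: "\<And>\<phi> e a. first_order \<phi> \<Longrightarrow> \<exists>b. \<forall>x. x \<epsilon> b \<longleftrightarrow> x \<epsilon> a \<and> sat E (\<phi> (e(0 := x)))" using Z8[THEN conjunct1] by blast
    show "\<exists>b. \<forall>x. x \<epsilon> b \<longleftrightarrow> x \<epsilon> a \<and> sat E (fform f (case_nat x e))" for a f e
      using sep[OF first_order_fform[of f], of a "case_nat undefined e"] unfolding e0 .
    have rep: "\<And>\<phi> e a. first_order \<phi> \<Longrightarrow> (\<forall>x. x \<epsilon> a \<longrightarrow> (\<exists>!y. sat E (\<phi> (e(0 := x, 1 := y))))) \<Longrightarrow>
         (\<exists>b. \<forall>x. x \<epsilon> a \<longrightarrow> (\<exists>y. y \<epsilon> b \<and> sat E (\<phi> (e(0 := x, 1 := y)))))" using Z8[THEN conjunct2] by blast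
    show "(\<And>x. x \<epsilon> a \<Longrightarrow> \<exists>!y. sat E (fform f (case_nat x (case_nat y e)))) \<Longrightarrow>
         \<exists>b. \<forall>x. x \<epsilon> a \<longrightarrow> (\<exists>y. y \<epsilon> b \<and> sat E (fform f (case_nat x (case_nat y e))))" for a f e
      using rep[OF first_order_fform[of f], of a "case_nat undefined (case_nat undefined e)"] unfolding e1 by blast
  qed
qed

lemma ZFC_model_zfwo: assumes "ZFC_model E" shows "zfwo E"
proof -
  interpret zf E using emodel.ZFC_model_zf[OF assms] .
  have ch: "\<forall>x. (\<forall>y. E y x \<longrightarrow> (\<exists>z. E z y)) \<and>
         (\<forall>y y' z. E y x \<and> E y' x \<and> E z y \<and> E z y' \<longrightarrow> y = y') \<longrightarrow>
         (\<exists>c. \<forall>y. E y x \<longrightarrow> (\<exists>!z. E z y \<and> E z c))" using assms unfolding ZFC_model_def by (elim conjE) assumption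
  show ?thesis
    by (unfold_locales, rule Zermelo) (use ch in blast)
qed

section \<open>The forcing relation\<close>

text \<open>The order is a definable relation on the universe rather than a set of pairs, in
  accordance with \<open>Fn_le\<close>.\<close>

locale forcing = zfwo E for E :: "'v \<Rightarrow> 'v \<Rightarrow> bool"  (infix "\<epsilon>" 50) +
  fixes P one :: 'v and le :: "'v \<Rightarrow> 'v \<Rightarrow> bool"
  assumes le_refl [simp]: "le p p"
    and le_trans: "le r q \<Longrightarrow> le q p \<Longrightarrow> le r p"
    and one [simp]: "one \<epsilon> P" "le p one"
    and df_le: "df2 le"
begin

lemma df_le' [dfi]: "dt s \<Longrightarrow> dt t \<Longrightarrow> df (\<lambda>e. le (s e) (t e))"
  by (rule df2_app[OF df_le])

abbreviation feq where "feq \<equiv> forces_eq E P le"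
abbreviation fmem where "fmem \<equiv> mem_clause E P le feq"
abbreviation tri where "tri R p s t \<equiv> pr p (pr s t) \<epsilon> R"

lemma mem_clause: "mem_clause E P le eq p \<pi> \<tau> \<longleftrightarrow>
    (\<forall>q. q \<epsilon> P \<and> le q p \<longrightarrow> (\<exists>r \<rho> s. r \<epsilon> P \<and> le r q \<and> pr \<rho> s \<epsilon> \<tau> \<and> le r s \<and> eq r \<pi> \<rho>))"
  unfolding mem_clause_def sat_pair_in by blast

lemma eq_clause: "eq_clause E P le eq p \<sigma> \<tau> \<longleftrightarrow>
    (\<forall>\<pi> s q. (pr \<pi> s \<epsilon> \<sigma> \<or> pr \<pi> s \<epsilon> \<tau>) \<and> q \<epsilon> P \<and> le q p \<longrightarrow>
      (mem_clause E P le eq q \<pi> \<sigma> \<longleftrightarrow> mem_clause E P le eq q \<pi> \<tau>))"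
  unfolding eq_clause_def sat_pair_in by blast

lemma triple_in_eq: "triple_in E R = tri R"
  by (intro HOL.ext) (simp add: triple_in_def)

section \<open>Existence and uniqueness for the recursion behind forced equality\<close>

definition sol where "sol T R \<longleftrightarrow> (\<forall>y \<pi> s. y \<epsilon> T \<and> pr \<pi> s \<epsilon> y \<longrightarrow> \<pi> \<epsilon> T) \<and>
  (\<forall>x y q. x \<epsilon> T \<and> y \<epsilon> T \<and> q \<epsilon> P \<longrightarrow> (tri R q x y \<longleftrightarrow> eq_clause E P le (tri R) q x y))"

lemma solD:
  "sol T R \<Longrightarrow> y \<epsilon> T \<Longrightarrow> pr \<pi> s \<epsilon> y \<Longrightarrow> \<pi> \<epsilon> T"
  "sol T R \<Longrightarrow> x \<epsilon> T \<Longrightarrow> y \<epsilon> T \<Longrightarrow> q \<epsilon> P \<Longrightarrow> tri R q x y \<longleftrightarrow> eq_clause E P le (tri R) q x y"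
  unfolding sol_def by blast+

lemma feq_def: "feq p \<sigma> \<tau> \<longleftrightarrow> (\<exists>T R. \<sigma> \<epsilon> T \<and> \<tau> \<epsilon> T \<and> sol T R \<and> tri R p \<sigma> \<tau>)"
  unfolding forces_eq_def triple_in_eq sat_pair_in sol_def by blast

lemma df_feq [dfi]: "dt p \<Longrightarrow> dt s \<Longrightarrow> dt t \<Longrightarrow> df (\<lambda>e. feq (p e) (s e) (t e))"
proof -
  assume *: "dt p" "dt s" "dt t"
  have "df (\<lambda>e. feq (e 0) (e (Suc 0)) (e (Suc (Suc 0))))"
    unfolding feq_def sol_def eq_clause mem_clause by (intro dfi)
  then have "df (\<lambda>e. feq (p (\<lambda>n. e (Suc (Suc n)))) (e 0) (e (Suc 0)))"
    using df_subst[where Q = "\<lambda>x e. feq x (e 0) (e (Suc 0))" and t = "\<lambda>e. p (\<lambda>n. e (Suc (Suc n)))", OF _ dt_ren[OF *(1)]] by simp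
  from df_subst2[where Q = "\<lambda>x y e. feq (p e) x y", OF _ *(2,3)] this show ?thesis by simp
qed

lemma df_fmem [dfi]: "dt p \<Longrightarrow> dt s \<Longrightarrow> dt t \<Longrightarrow> df (\<lambda>e. fmem (p e) (s e) (t e))"
proof -
  assume *: "dt p" "dt s" "dt t"
  have "df (\<lambda>e. fmem (e 0) (e (Suc 0)) (e (Suc (Suc 0))))"
    unfolding mem_clause by (intro dfi)
  then have "df (\<lambda>e. fmem (p (\<lambda>n. e (Suc (Suc n)))) (e 0) (e (Suc 0)))"
    using df_subst[where Q = "\<lambda>x e. fmem x (e 0) (e (Suc 0))" and t = "\<lambda>e. p (\<lambda>n. e (Suc (Suc n)))", OF _ dt_ren[OF *(1)]] by simp
  from df_subst2[where Q = "\<lambda>x y e. fmem (p e) x y", OF _ *(2,3)] this show ?thesis by simp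
qed

lemma mem_clause_cong:
  assumes "\<And>r \<rho> s. r \<epsilon> P \<Longrightarrow> pr \<rho> s \<epsilon> \<tau> \<Longrightarrow> eq r \<pi> \<rho> \<longleftrightarrow> eq' r \<pi> \<rho>"
  shows "mem_clause E P le eq p \<pi> \<tau> \<longleftrightarrow> mem_clause E P le eq' p \<pi> \<tau>"
  unfolding mem_clause using assms by blast

lemma eq_clause_cong:
  assumes "\<And>r \<pi> \<rho>. r \<epsilon> P \<Longrightarrow> \<exists>s. pr \<pi> s \<epsilon> \<sigma> \<or> pr \<pi> s \<epsilon> \<tau> \<Longrightarrow> \<exists>s. pr \<rho> s \<epsilon> \<sigma> \<or> pr \<rho> s \<epsilon> \<tau> \<Longrightarrow> eq r \<pi> \<rho> \<longleftrightarrow> eq' r \<pi> \<rho>"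
  shows "eq_clause E P le eq p \<sigma> \<tau> \<longleftrightarrow> eq_clause E P le eq' p \<sigma> \<tau>"
proof -
  have "mem_clause E P le eq q \<pi> \<sigma> = mem_clause E P le eq' q \<pi> \<sigma>" "mem_clause E P le eq q \<pi> \<tau> = mem_clause E P le eq' q \<pi> \<tau>"
    if \<pi>: "pr \<pi> s \<epsilon> \<sigma> \<or> pr \<pi> s \<epsilon> \<tau>" for \<pi> s q
  proof -
    have e: "eq r \<pi> \<rho> \<longleftrightarrow> eq' r \<pi> \<rho>" if "r \<epsilon> P" "pr \<rho> t \<epsilon> \<sigma> \<or> pr \<rho> t \<epsilon> \<tau>" for r \<rho> t
      by (rule assms[OF that(1)]) (use \<pi> that(2) in blast)+
    show "mem_clause E P le eq q \<pi> \<sigma> = mem_clause E P le eq' q \<pi> \<sigma>"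
      by (rule mem_clause_cong) (use e in blast)
    show "mem_clause E P le eq q \<pi> \<tau> = mem_clause E P le eq' q \<pi> \<tau>"
      by (rule mem_clause_cong) (use e in blast)
  qed
  then show ?thesis unfolding eq_clause by (metis (no_types, lifting))
qed

lemma pr_fst_Vs: assumes "pr \<pi> s \<epsilon> \<sigma>" "sub \<sigma> (Vs b)" shows "\<pi> \<epsilon> Vs b"
proof -
  have "upair \<pi> \<pi> \<epsilon> pr \<pi> s" "\<pi> \<epsilon> upair \<pi> \<pi>" by simp_all
  then show ?thesis using Vs_trans assms by blast
qed

text \<open>The recursion descends from two names to members of both domains; a common rank turns
  this into induction on a single ordinal.\<close>

lemma Vs_dom: assumes a: "Ord a" and "\<sigma> \<epsilon> Vs a" "\<tau> \<epsilon> Vs a"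
  shows "\<exists>d. d \<epsilon> a \<and> (\<forall>\<pi> s. pr \<pi> s \<epsilon> \<sigma> \<or> pr \<pi> s \<epsilon> \<tau> \<longrightarrow> \<pi> \<epsilon> Vs d)"
proof -
  obtain b c where bc: "b \<epsilon> a" "sub \<sigma> (Vs b)" "c \<epsilon> a" "sub \<tau> (Vs c)" using assms(2,3) mem_Vs by blast
  have o: "Ord b" "Ord c" using bc Ord_mem[OF a] by blast+
  from Ord_lin[OF a bc(1,3)] obtain d where d: "d \<epsilon> a" "sub (Vs b) (Vs d)" "sub (Vs c) (Vs d)"
    using Vs_mono[OF o(1)] Vs_mono[OF o(2)] bc by blast
  show ?thesis using d bc(2,4) pr_fst_Vs[of _ _ \<sigma> d] pr_fst_Vs[of _ _ \<tau> d] by blast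
qed

lemma sol_agree:
  assumes "sol T R" "sol T' R'" "\<sigma> \<epsilon> T" "\<tau> \<epsilon> T" "\<sigma> \<epsilon> T'" "\<tau> \<epsilon> T'" "q \<epsilon> P"
  shows "tri R q \<sigma> \<tau> \<longleftrightarrow> tri R' q \<sigma> \<tau>"
proof -
  let ?Q = "\<lambda>a. Ord a \<longrightarrow> (\<forall>\<sigma> \<tau> q. \<sigma> \<epsilon> T \<and> \<tau> \<epsilon> T \<and> \<sigma> \<epsilon> T' \<and> \<tau> \<epsilon> T' \<and> q \<epsilon> P \<and> \<sigma> \<epsilon> Vs a \<and> \<tau> \<epsilon> Vs a \<longrightarrow>
    (tri R q \<sigma> \<tau> \<longleftrightarrow> tri R' q \<sigma> \<tau>))"
  have Q: "?Q a" for a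
  proof (rule eps_induct[of ?Q], intro dfi, intro impI allI, elim conjE)
    fix a \<sigma> \<tau> q assume IH: "\<And>y. y \<epsilon> a \<Longrightarrow> ?Q y" and a: "Ord a"
      and T: "\<sigma> \<epsilon> T" "\<tau> \<epsilon> T" "\<sigma> \<epsilon> T'" "\<tau> \<epsilon> T'" and q: "q \<epsilon> P" and V: "\<sigma> \<epsilon> Vs a" "\<tau> \<epsilon> Vs a"
    obtain d where d: "d \<epsilon> a" "\<And>\<pi> s. pr \<pi> s \<epsilon> \<sigma> \<or> pr \<pi> s \<epsilon> \<tau> \<Longrightarrow> \<pi> \<epsilon> Vs d" using Vs_dom[OF a V] by blast
    have dT: "\<pi> \<epsilon> T" "\<pi> \<epsilon> T'" "\<pi> \<epsilon> Vs d" if "\<exists>s. pr \<pi> s \<epsilon> \<sigma> \<or> pr \<pi> s \<epsilon> \<tau>" for \<pi>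
      using that solD(1)[OF assms(1) T(1)] solD(1)[OF assms(1) T(2)] solD(1)[OF assms(2) T(3)] solD(1)[OF assms(2) T(4)] d(2)
      by blast+
    have "eq_clause E P le (tri R) q \<sigma> \<tau> \<longleftrightarrow> eq_clause E P le (tri R') q \<sigma> \<tau>"
    proof (rule eq_clause_cong)
      fix r \<pi> \<rho> assume "r \<epsilon> P" and m: "\<exists>s. pr \<pi> s \<epsilon> \<sigma> \<or> pr \<pi> s \<epsilon> \<tau>" "\<exists>s. pr \<rho> s \<epsilon> \<sigma> \<or> pr \<rho> s \<epsilon> \<tau>"
      then show "tri R r \<pi> \<rho> \<longleftrightarrow> tri R' r \<pi> \<rho>"
        using IH[OF d(1)] Ord_mem[OF a d(1)] dT[OF m(1)] dT[OF m(2)] by simp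
    qed
    then show "tri R q \<sigma> \<tau> \<longleftrightarrow> tri R' q \<sigma> \<tau>"
      using solD(2)[OF assms(1) T(1,2) q] solD(2)[OF assms(2) T(3,4) q] by simp
  qed
  obtain a b where a: "Ord a" "\<sigma> \<epsilon> Vs a" and b: "Ord b" "\<tau> \<epsilon> Vs b" using ex_Vs by metis
  from Ord_linear[OF a(1) b(1)] obtain c where "Ord c" "\<sigma> \<epsilon> Vs c" "\<tau> \<epsilon> Vs c"
  proof (elim disjE)
    assume "a \<epsilon> b" then show thesis using that[OF b(1) Vs_mono[OF b(1) _ a(2)] b(2)] by blast
  next
    assume "a = b" then show thesis using that[OF a] b(2) by simp
  next
    assume "b \<epsilon> a" then show thesis using that[OF a Vs_mono[OF a(1) _ b(2)]] by blast
  qed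
  then show ?thesis using Q[of c] assms(3-) by blast
qed

lemma sol_feq: assumes "sol T R" "\<sigma> \<epsilon> T" "\<tau> \<epsilon> T" "q \<epsilon> P"
  shows "feq q \<sigma> \<tau> \<longleftrightarrow> tri R q \<sigma> \<tau>" "feq q \<sigma> \<tau> \<longleftrightarrow> eq_clause E P le feq q \<sigma> \<tau>"
proof -
  have feq: "feq q \<sigma> \<tau> \<longleftrightarrow> tri R q \<sigma> \<tau>" if "\<sigma> \<epsilon> T" "\<tau> \<epsilon> T" "q \<epsilon> P" for \<sigma> \<tau> q
    unfolding feq_def using sol_agree[OF assms(1) _ that(1,2) _ _ that(3)] assms(1) that by blast
  show "feq q \<sigma> \<tau> \<longleftrightarrow> tri R q \<sigma> \<tau>" by (rule feq[OF assms(2-)])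
  have dT: "\<pi> \<epsilon> T" if "\<exists>s. pr \<pi> s \<epsilon> \<sigma> \<or> pr \<pi> s \<epsilon> \<tau>" for \<pi>
    using that solD(1)[OF assms(1,2)] solD(1)[OF assms(1,3)] by blast
  have "eq_clause E P le feq q \<sigma> \<tau> \<longleftrightarrow> eq_clause E P le (tri R) q \<sigma> \<tau>"
    by (rule eq_clause_cong) (rule feq[OF dT dT])
  then show "feq q \<sigma> \<tau> \<longleftrightarrow> eq_clause E P le feq q \<sigma> \<tau>"
    using feq[OF assms(2-)] solD(2)[OF assms] by simp
qed

text \<open>The clause is evaluated with \<open>feq\<close> itself, which by induction already obeys
  the recursion at lower ranks. Hence one application of separation gives a solution on all of
  \<open>Vs a\<close>.\<close>

lemma ex_sol: "Ord a \<longrightarrow> (\<exists>R. sol (Vs a) R)"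
proof (rule eps_induct[of "\<lambda>a. Ord a \<longrightarrow> (\<exists>R. sol (Vs a) R)"])
  show "df1 (\<lambda>a. Ord a \<longrightarrow> (\<exists>R. sol (Vs a) R))"
    unfolding sol_def eq_clause mem_clause by (intro dfi)
next
  fix a assume IH: "\<And>b. b \<epsilon> a \<Longrightarrow> Ord b \<longrightarrow> (\<exists>R. sol (Vs b) R)"
  show "Ord a \<longrightarrow> (\<exists>R. sol (Vs a) R)"
  proof
    assume a: "Ord a"
    let ?X = "prod P (prod (Vs a) (Vs a))"
    let ?R = "Sep ?X (\<lambda>z. \<exists>p \<sigma> \<tau>. z = pr p (pr \<sigma> \<tau>) \<and> eq_clause E P le feq p \<sigma> \<tau>)"
    have "z \<epsilon> ?R \<longleftrightarrow> z \<epsilon> ?X \<and> (\<exists>p \<sigma> \<tau>. z = pr p (pr \<sigma> \<tau>) \<and> eq_clause E P le feq p \<sigma> \<tau>)" for z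
      by (rule mem_Sep) (unfold eq_clause, intro dfi)
    then have R: "tri ?R q \<sigma> \<tau> \<longleftrightarrow> eq_clause E P le feq q \<sigma> \<tau>" if "q \<epsilon> P" "\<sigma> \<epsilon> Vs a" "\<tau> \<epsilon> Vs a" for q \<sigma> \<tau>
      using that by simp
    have "sol (Vs a) ?R" unfolding sol_def[of "Vs a"]
    proof (intro conjI allI impI; elim conjE)
      fix y \<pi> s assume "y \<epsilon> Vs a" "pr \<pi> s \<epsilon> y"
      then show "\<pi> \<epsilon> Vs a" using pr_fst_Vs Vs_trans by blast
    next
      fix x y q assume xy: "x \<epsilon> Vs a" "y \<epsilon> Vs a" and q: "q \<epsilon> P"
      obtain d where d: "d \<epsilon> a" "\<And>\<pi> s. pr \<pi> s \<epsilon> x \<or> pr \<pi> s \<epsilon> y \<Longrightarrow> \<pi> \<epsilon> Vs d" using Vs_dom[OF a xy] by blast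
      obtain R' where R': "sol (Vs d) R'" using IH[OF d(1)] Ord_mem[OF a d(1)] by blast
      have "eq_clause E P le (tri ?R) q x y \<longleftrightarrow> eq_clause E P le feq q x y"
      proof (rule eq_clause_cong)
        fix r \<pi> \<rho> assume r: "r \<epsilon> P" and "\<exists>s. pr \<pi> s \<epsilon> x \<or> pr \<pi> s \<epsilon> y" "\<exists>s. pr \<rho> s \<epsilon> x \<or> pr \<rho> s \<epsilon> y"
        then have V: "\<pi> \<epsilon> Vs d" "\<rho> \<epsilon> Vs d" using d(2) by blast+
        then have V': "\<pi> \<epsilon> Vs a" "\<rho> \<epsilon> Vs a" using Vs_mono[OF a d(1)] by blast+
        show "tri ?R r \<pi> \<rho> \<longleftrightarrow> feq r \<pi> \<rho>" unfolding R[OF r V'] using sol_feq(2)[OF R' V r] by blast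
      qed
      then show "tri ?R q x y \<longleftrightarrow> eq_clause E P le (tri ?R) q x y" unfolding R[OF q xy] by blast
    qed
    then show "\<exists>R. sol (Vs a) R" by blast
  qed
qed

lemma feq_iff: assumes "p \<epsilon> P"
  shows "feq p \<sigma> \<tau> \<longleftrightarrow> (\<forall>\<pi> s q. (pr \<pi> s \<epsilon> \<sigma> \<or> pr \<pi> s \<epsilon> \<tau>) \<and> q \<epsilon> P \<and> le q p \<longrightarrow> (fmem q \<pi> \<sigma> \<longleftrightarrow> fmem q \<pi> \<tau>))"
proof -
  obtain a where a: "Ord a" "ins \<sigma> (ins \<tau> emp) \<epsilon> Vs a" using ex_Vs by blast
  then have "\<sigma> \<epsilon> Vs a" "\<tau> \<epsilon> Vs a" using Vs_trans[OF a(2)] by simp_all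
  then show ?thesis using ex_sol[of a] a(1) sol_feq(2) assms unfolding eq_clause by blast
qed

section \<open>Monotonicity, density and equality laws for forced atomic formulas\<close>

lemma fmem_mono: "fmem p \<pi> \<tau> \<Longrightarrow> le q p \<Longrightarrow> fmem q \<pi> \<tau>"
  unfolding mem_clause using le_trans by blast

lemma feq_mono: assumes "feq p \<sigma> \<tau>" "p \<epsilon> P" "q \<epsilon> P" "le q p" shows "feq q \<sigma> \<tau>"
  using assms(1) le_trans[OF _ assms(4)] unfolding feq_iff[OF assms(2)] feq_iff[OF assms(3)] by blast

lemma feq_refl [simp]: "p \<epsilon> P \<Longrightarrow> feq p \<sigma> \<sigma>"
  by (simp add: feq_iff)

lemma feq_sym: "p \<epsilon> P \<Longrightarrow> feq p \<sigma> \<tau> \<Longrightarrow> feq p \<tau> \<sigma>"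
  unfolding feq_iff by blast

lemma fmem_dense: assumes "\<And>q. q \<epsilon> P \<Longrightarrow> le q p \<Longrightarrow> \<exists>r. r \<epsilon> P \<and> le r q \<and> fmem r \<pi> \<tau>" shows "fmem p \<pi> \<tau>"
  unfolding mem_clause
proof (intro allI impI, elim conjE)
  fix q assume "q \<epsilon> P" "le q p"
  then obtain r where r: "r \<epsilon> P" "le r q" "fmem r \<pi> \<tau>" using assms by blast
  then obtain r' \<rho> s where "r' \<epsilon> P" "le r' r" "pr \<rho> s \<epsilon> \<tau>" "le r' s" "feq r' \<pi> \<rho>" unfolding mem_clause using le_refl by blast
  then show "\<exists>r \<rho> s. r \<epsilon> P \<and> le r q \<and> pr \<rho> s \<epsilon> \<tau> \<and> le r s \<and> feq r \<pi> \<rho>" using le_trans[OF _ r(2)] by blast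
qed

lemma feq_dense: assumes p: "p \<epsilon> P" and d: "\<And>q. q \<epsilon> P \<Longrightarrow> le q p \<Longrightarrow> \<exists>r. r \<epsilon> P \<and> le r q \<and> feq r \<sigma> \<tau>"
  shows "feq p \<sigma> \<tau>"
  unfolding feq_iff[OF p]
proof (intro allI impI, elim conjE)
  fix \<pi> s q assume m: "pr \<pi> s \<epsilon> \<sigma> \<or> pr \<pi> s \<epsilon> \<tau>" and q: "q \<epsilon> P" "le q p"
  have *: "\<exists>r. r \<epsilon> P \<and> le r q' \<and> (fmem r \<pi> \<sigma> \<longleftrightarrow> fmem r \<pi> \<tau>)" if "q' \<epsilon> P" "le q' q" for q'
    using d[OF that(1) le_trans[OF that(2) q(2)]] m le_refl unfolding feq_iff by (metis feq_iff)
  have "fmem q \<pi> x" if "{x, y} = {\<sigma>, \<tau>}" "fmem q \<pi> y" for x y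
  proof (rule fmem_dense)
    fix q' assume q': "q' \<epsilon> P" "le q' q"
    obtain r where r: "r \<epsilon> P" "le r q'" "fmem r \<pi> \<sigma> \<longleftrightarrow> fmem r \<pi> \<tau>" using *[OF q'] by blast
    have "fmem r \<pi> y" using fmem_mono[OF that(2)] le_trans[OF r(2) q'(2)] by blast
    then have "fmem r \<pi> x" using r(3) that(1) by (auto simp: doubleton_eq_iff)
    then show "\<exists>r. r \<epsilon> P \<and> le r q' \<and> fmem r \<pi> x" using r by blast
  qed
  then show "fmem q \<pi> \<sigma> \<longleftrightarrow> fmem q \<pi> \<tau>" by (metis insert_commute)
qed

lemma fmemI: "pr \<pi> s \<epsilon> \<tau> \<Longrightarrow> le p s \<Longrightarrow> fmem p \<pi> \<tau>"
  unfolding mem_clause using le_trans feq_refl le_refl by blast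

lemma fmemD: assumes "fmem p \<pi> \<tau>" "p \<epsilon> P"
  obtains r \<rho> s where "r \<epsilon> P" "le r p" "pr \<rho> s \<epsilon> \<tau>" "le r s" "feq r \<pi> \<rho>"
  using assms le_refl unfolding mem_clause by blast

text \<open>Transitivity on \<open>V\<^sub>a\<close>; if it holds below, then \<open>fmem\<close> respects \<open>feq\<close> in its right argument.\<close>

lemma feq_trans: assumes p: "p \<epsilon> P" and "feq p \<sigma> \<tau>" "feq p \<tau> \<upsilon>" shows "feq p \<sigma> \<upsilon>"
proof -
  let ?Q = "\<lambda>a. Ord a \<longrightarrow> (\<forall>p \<sigma> \<tau> \<upsilon>. p \<epsilon> P \<and> \<sigma> \<epsilon> Vs a \<and> \<tau> \<epsilon> Vs a \<and> \<upsilon> \<epsilon> Vs a \<and> feq p \<sigma> \<tau> \<and> feq p \<tau> \<upsilon> \<longrightarrow> feq p \<sigma> \<upsilon>)"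
  have Q: "?Q a" for a
  proof (rule eps_induct[of ?Q], intro dfi, intro impI allI, elim conjE)
    fix a p \<sigma> \<tau> \<upsilon> assume IH: "\<And>y. y \<epsilon> a \<Longrightarrow> ?Q y" and a: "Ord a" and p: "p \<epsilon> P"
      and V: "\<sigma> \<epsilon> Vs a" "\<tau> \<epsilon> Vs a" "\<upsilon> \<epsilon> Vs a" and eq: "feq p \<sigma> \<tau>" "feq p \<tau> \<upsilon>"
    obtain d1 d2 where d12: "d1 \<epsilon> a" "\<And>\<pi> s. pr \<pi> s \<epsilon> \<sigma> \<or> pr \<pi> s \<epsilon> \<tau> \<Longrightarrow> \<pi> \<epsilon> Vs d1"
      "d2 \<epsilon> a" "\<And>\<pi> s. pr \<pi> s \<epsilon> \<tau> \<or> pr \<pi> s \<epsilon> \<upsilon> \<Longrightarrow> \<pi> \<epsilon> Vs d2" using Vs_dom[OF a V(1,2)] Vs_dom[OF a V(2,3)] by blast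
    have o: "Ord d1" "Ord d2" using d12 Ord_mem[OF a] by blast+
    obtain d where d: "d \<epsilon> a" "\<And>\<pi> s. pr \<pi> s \<epsilon> \<sigma> \<or> pr \<pi> s \<epsilon> \<tau> \<or> pr \<pi> s \<epsilon> \<upsilon> \<Longrightarrow> \<pi> \<epsilon> Vs d"
      using Ord_lin[OF a d12(1,3)] Vs_mono[OF o(1), of d2] Vs_mono[OF o(2), of d1] d12 by metis
    have tr: "feq r x z" if "r \<epsilon> P" "x \<epsilon> Vs d" "y \<epsilon> Vs d" "z \<epsilon> Vs d" "feq r x y" "feq r y z" for r x y z
      using IH[OF d(1)] Ord_mem[OF a d(1)] that by blast
    have m1: "fmem q \<pi> y" if xy: "feq p x y" "x \<in> {\<sigma>,\<tau>,\<upsilon>}" "y \<in> {\<sigma>,\<tau>,\<upsilon>}" and q: "q \<epsilon> P" "le q p" and \<pi>: "\<pi> \<epsilon> Vs d" and m: "fmem q \<pi> x" for x y q \<pi>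
    proof (rule fmem_dense)
      fix q' assume q': "q' \<epsilon> P" "le q' q"
      obtain r \<rho> s where r: "r \<epsilon> P" "le r q'" "pr \<rho> s \<epsilon> x" "le r s" "feq r \<pi> \<rho>"
        using fmem_mono[OF m q'(2)] q'(1) by (rule fmemD)
      have "le r p" using r(2) q'(2) q(2) le_trans by blast
      then have "fmem r \<rho> x \<longleftrightarrow> fmem r \<rho> y" using xy(1) r(1,3) unfolding feq_iff[OF p] by blast
      then have "fmem r \<rho> y" using fmemI[OF r(3,4)] by blast
      then obtain r' \<rho>' s' where r': "r' \<epsilon> P" "le r' r" "pr \<rho>' s' \<epsilon> y" "le r' s'" "feq r' \<rho> \<rho>'"
        using r(1) by (rule fmemD)
      have "feq r' \<pi> \<rho>'"
        by (rule tr[of _ _ \<rho>]) (use r' r xy(2,3) d(2) \<pi> feq_mono[OF r(5,1) r'(1,2)] in auto)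
      then have "fmem r' \<pi> y" unfolding mem_clause
        using feq_mono[OF _ r'(1)] r'(3) le_trans[OF _ r'(4)] le_refl by blast
      then show "\<exists>r. r \<epsilon> P \<and> le r q' \<and> fmem r \<pi> y" using r'(1) le_trans[OF r'(2) r(2)] by blast
    qed
    note e = eq feq_sym[OF p eq(1)] feq_sym[OF p eq(2)]
    show "feq p \<sigma> \<upsilon>" unfolding feq_iff[OF p]
    proof (intro allI impI, elim conjE)
      fix \<pi> s q assume "pr \<pi> s \<epsilon> \<sigma> \<or> pr \<pi> s \<epsilon> \<upsilon>" and q: "q \<epsilon> P" "le q p"
      then have \<pi>: "\<pi> \<epsilon> Vs d" using d(2) by blast
      show "fmem q \<pi> \<sigma> \<longleftrightarrow> fmem q \<pi> \<upsilon>"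
        using m1[OF e(1) _ _ q \<pi>] m1[OF e(2) _ _ q \<pi>] m1[OF e(3) _ _ q \<pi>] m1[OF e(4) _ _ q \<pi>] by blast
    qed
  qed
  obtain a where a: "Ord a" "ins \<sigma> (ins \<tau> (ins \<upsilon> emp)) \<epsilon> Vs a" using ex_Vs by blast
  then have "\<sigma> \<epsilon> Vs a" "\<tau> \<epsilon> Vs a" "\<upsilon> \<epsilon> Vs a" using Vs_trans[OF a(2)] by simp_all
  then show ?thesis using Q[of a] a(1) assms by blast
qed

lemma fmem_feq1: assumes p: "p \<epsilon> P" and "feq p \<pi> \<rho>" "fmem p \<pi> \<tau>" shows "fmem p \<rho> \<tau>"
  unfolding mem_clause
proof (intro allI impI, elim conjE)
  fix q assume q: "q \<epsilon> P" "le q p"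
  then obtain r \<rho>' s where r: "r \<epsilon> P" "le r q" "pr \<rho>' s \<epsilon> \<tau>" "le r s" "feq r \<pi> \<rho>'" using assms(3) unfolding mem_clause by blast
  have "feq r \<rho> \<pi>" using feq_sym[OF p assms(2)] feq_mono[OF _ p r(1)] le_trans[OF r(2) q(2)] by blast
  then show "\<exists>r \<rho>' s. r \<epsilon> P \<and> le r q \<and> pr \<rho>' s \<epsilon> \<tau> \<and> le r s \<and> feq r \<rho> \<rho>'" using r feq_trans[OF r(1)] by blast
qed

lemma fmem_feq2: assumes p: "p \<epsilon> P" and e: "feq p \<sigma> \<tau>" and m: "fmem p \<pi> \<sigma>" shows "fmem p \<pi> \<tau>"
proof (rule fmem_dense)
  fix q assume q: "q \<epsilon> P" "le q p"
  obtain r \<rho> s where r: "r \<epsilon> P" "le r q" "pr \<rho> s \<epsilon> \<sigma>" "le r s" "feq r \<pi> \<rho>"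
    using fmem_mono[OF m q(2)] q(1) by (rule fmemD)
  have "fmem r \<rho> \<sigma> \<longleftrightarrow> fmem r \<rho> \<tau>" using e r(1,3) le_trans[OF r(2) q(2)] unfolding feq_iff[OF p] by blast
  then have "fmem r \<pi> \<tau>" using fmemI[OF r(3,4)] fmem_feq1[OF r(1) feq_sym[OF r(1,5)]] by blast
  then show "\<exists>r. r \<epsilon> P \<and> le r q \<and> fmem r \<pi> \<tau>" using r by blast
qed

section \<open>Names and the forcing of compound formulas\<close>

abbreviation fo where "fo \<phi> p \<equiv> forces E P le \<phi> p"

definition name where "name x \<longleftrightarrow> sat E (is_name P x)"

lemma sat_name [simp]: "sat E (is_name P x) \<longleftrightarrow> name x" by (simp add: name_def)

lemma name_unfold: "name x \<longleftrightarrow> (\<exists>T. x \<epsilon> T \<and> (\<forall>y z. y \<epsilon> T \<and> z \<epsilon> y \<longrightarrow> (\<exists>\<pi> s. \<pi> \<epsilon> T \<and> s \<epsilon> P \<and> z = pr \<pi> s)))"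
  unfolding name_def is_name_def by simp

lemma df_name [dfi]: "dt t \<Longrightarrow> df (\<lambda>e. name (t e))"
  by (rule df1_app[of name]) (unfold name_unfold, intro dfi)

lemma nameD: assumes "name x" "z \<epsilon> x" obtains \<pi> s where "z = pr \<pi> s" "name \<pi>" "s \<epsilon> P"
proof -
  obtain T where T: "x \<epsilon> T" "\<And>y z. y \<epsilon> T \<Longrightarrow> z \<epsilon> y \<Longrightarrow> \<exists>\<pi> s. \<pi> \<epsilon> T \<and> s \<epsilon> P \<and> z = pr \<pi> s"
    using assms(1) unfolding name_unfold by blast
  obtain \<pi> s where ps: "\<pi> \<epsilon> T" "s \<epsilon> P" "z = pr \<pi> s" using T(2)[OF T(1) assms(2)] by blast
  then have "name \<pi>" unfolding name_unfold using T(2) by blast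
  then show thesis using that ps by blast
qed

lemma name_dom: assumes "name x" "pr \<pi> s \<epsilon> x" shows "name \<pi>" "s \<epsilon> P"
proof -
  obtain a b where "pr \<pi> s = pr a b" "name a" "b \<epsilon> P" using assms by (rule nameD)
  then show "name \<pi>" "s \<epsilon> P" by simp_all
qed

text \<open>A transitive set around \<open>x\<close>, cut down to \<open>x\<close> and the names in
  it, is closed in the sense demanded by \<open>is_name\<close>.\<close>

lemma nameI: assumes "\<And>z. z \<epsilon> x \<Longrightarrow> \<exists>\<pi> s. name \<pi> \<and> s \<epsilon> P \<and> z = pr \<pi> s" shows "name x"
proof -
  obtain t where t: "sub (ins x emp) t" "\<forall>y. y \<epsilon> t \<longrightarrow> sub y t" using ex_transitive by blast
  let ?T = "Sep t (\<lambda>y. y = x \<or> name y)"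
  have T: "y \<epsilon> ?T \<longleftrightarrow> y \<epsilon> t \<and> (y = x \<or> name y)" for y by (rule mem_Sep) (intro dfi)
  have "x \<epsilon> ?T" unfolding T using t(1) by simp
  moreover have "\<exists>\<pi> s. \<pi> \<epsilon> ?T \<and> s \<epsilon> P \<and> z = pr \<pi> s" if y: "y \<epsilon> ?T" "z \<epsilon> y" for y z
  proof -
    obtain \<pi> s where ps: "name \<pi>" "s \<epsilon> P" "z = pr \<pi> s"
      using y assms unfolding T by (metis nameD)
    have "upair \<pi> \<pi> \<epsilon> z" "\<pi> \<epsilon> upair \<pi> \<pi>" unfolding ps(3) by simp_all
    then have "\<pi> \<epsilon> t" using y t(2) unfolding T by blast
    then show ?thesis using ps T by blast
  qed
  ultimately show ?thesis unfolding name_unfold by blast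
qed

lemma fo_mono: "fo \<phi> p \<Longrightarrow> p \<epsilon> P \<Longrightarrow> q \<epsilon> P \<Longrightarrow> le q p \<Longrightarrow> fo \<phi> q"
proof (induction \<phi> arbitrary: p q)
  case (Mem x y) then show ?case using fmem_mono by simp
next
  case (Eq x y) then show ?case using feq_mono by simp
next
  case (Neg \<phi>) then show ?case using le_trans by (simp, blast)
next
  case (All \<phi>) then show ?case by (simp, blast)
qed auto

lemma fo_dense: "p \<epsilon> P \<Longrightarrow> (\<And>q. q \<epsilon> P \<Longrightarrow> le q p \<Longrightarrow> \<exists>r. r \<epsilon> P \<and> le r q \<and> fo \<phi> r) \<Longrightarrow> fo \<phi> p"
proof (induction \<phi> arbitrary: p)
  case (Mem x y) then show ?case using fmem_dense by simp
next
  case (Eq x y) then show ?case using feq_dense by simp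
next
  case (Neg \<phi>)
  show ?case unfolding forces.simps
  proof (intro allI impI notI, elim conjE)
    fix q assume q: "q \<epsilon> P" "le q p" "fo \<phi> q"
    then obtain r where r: "r \<epsilon> P" "le r q" "fo (\<^bold>\<not> \<phi>) r" using Neg.prems(2) by blast
    then show False using fo_mono[OF q(3,1) r(1,2)] le_refl by simp
  qed
next
  case (Conj \<phi> \<psi>) then show ?case by (simp, metis)
next
  case (All \<phi>)
  show ?case unfolding forces.simps
  proof (intro allI impI)
    fix x assume "sat E (is_name P x)"
    then show "fo (\<phi> x) p" using All.IH[of "\<phi> x" p] All.prems by fastforce
  qed
qed

lemma fo_Imp: assumes p: "p \<epsilon> P" shows "fo (\<phi> \<^bold>\<longrightarrow> \<psi>) p \<longleftrightarrow> (\<forall>q. q \<epsilon> P \<and> le q p \<and> fo \<phi> q \<longrightarrow> fo \<psi> q)"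
proof
  assume h: "fo (\<phi> \<^bold>\<longrightarrow> \<psi>) p"
  show "\<forall>q. q \<epsilon> P \<and> le q p \<and> fo \<phi> q \<longrightarrow> fo \<psi> q"
  proof (intro allI impI, elim conjE)
    fix q assume q: "q \<epsilon> P" "le q p" "fo \<phi> q"
    show "fo \<psi> q"
    proof (rule fo_dense[OF q(1)])
      fix q' assume q': "q' \<epsilon> P" "le q' q"
      then have "fo \<phi> q'" "le q' p" using fo_mono q le_trans by blast+
      then show "\<exists>r. r \<epsilon> P \<and> le r q' \<and> fo \<psi> r" using h q'(1) unfolding Imp_def by auto
    qed
  qed
next
  assume "\<forall>q. q \<epsilon> P \<and> le q p \<and> fo \<phi> q \<longrightarrow> fo \<psi> q"
  then show "fo (\<phi> \<^bold>\<longrightarrow> \<psi>) p" unfolding Imp_def by simp (blast intro: le_refl)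
qed

lemma fo_Ex: assumes p: "p \<epsilon> P" shows "fo (Ex \<phi>) p \<longleftrightarrow> (\<forall>q. q \<epsilon> P \<and> le q p \<longrightarrow> (\<exists>r x. r \<epsilon> P \<and> le r q \<and> name x \<and> fo (\<phi> x) r))"
  unfolding Ex_def by (auto, blast+)

lemma fo_Disj: assumes p: "p \<epsilon> P" shows "fo (\<phi> \<^bold>\<or> \<psi>) p \<longleftrightarrow> (\<forall>q. q \<epsilon> P \<and> le q p \<longrightarrow> (\<exists>r. r \<epsilon> P \<and> le r q \<and> (fo \<phi> r \<or> fo \<psi> r)))"
  unfolding Disj_def by auto

lemma fo_Iff: assumes p: "p \<epsilon> P" shows "fo (\<phi> \<^bold>\<longleftrightarrow> \<psi>) p \<longleftrightarrow> (\<forall>q. q \<epsilon> P \<and> le q p \<longrightarrow> (fo \<phi> q \<longleftrightarrow> fo \<psi> q))"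
  unfolding Iff_def by (auto simp: fo_Imp[OF p])

lemma fo_decide: assumes "p \<epsilon> P" shows "\<exists>q. q \<epsilon> P \<and> le q p \<and> (fo \<phi> q \<or> fo (\<^bold>\<not> \<phi>) q)"
  using assms le_refl by (cases "\<exists>q. q \<epsilon> P \<and> le q p \<and> fo \<phi> q") auto

lemma fo_fform_cong: assumes "p \<epsilon> P" "\<And>n. feq p (e n) (e' n)" shows "fo (fform a e) p \<longleftrightarrow> fo (fform a e') p"
  using assms
proof (induction a arbitrary: p e e')
  case (FMem i j)
  have "fmem p (e i) (e j) \<Longrightarrow> fmem p (e' i) (e' j)" "fmem p (e' i) (e' j) \<Longrightarrow> fmem p (e i) (e j)"
    using fmem_feq1 fmem_feq2 feq_sym FMem by blast+
  then show ?case by auto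
next
  case (FEq i j)
  have "feq p (e i) (e j) \<Longrightarrow> feq p (e' i) (e' j)" "feq p (e' i) (e' j) \<Longrightarrow> feq p (e i) (e j)"
    using feq_trans feq_sym FEq by blast+
  then show ?case by auto
next
  case (FNeg a)
  have "fo (fform a e) q \<longleftrightarrow> fo (fform a e') q" if "q \<epsilon> P" "le q p" for q
    by (rule FNeg.IH[OF that(1)]) (use feq_mono FNeg.prems that in blast)
  then show ?case by auto
next
  case (FConj a b) then show ?case by (simp, metis)
next
  case (FAll a)
  have "fo (fform a (case_nat x e)) p \<longleftrightarrow> fo (fform a (case_nat x e')) p" for x
    by (rule FAll.IH[OF FAll.prems(1)]) (use FAll.prems in \<open>auto split: nat.split\<close>)
  then show ?case by simp
qed

text \<open>The formula \<open>a\<close> is fixed outside the model, and the definition of its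
  forcing is built along it. Thus separation and collection of the ground model apply to forced
  statements.\<close>

lemma df_fo: assumes "\<And>n. dt (\<lambda>e. h e n)" "dt u" shows "df (\<lambda>e. fo (fform a (h e)) (u e))"
  using assms
proof (induction a arbitrary: h u)
  case (FNeg a)
  have "df (\<lambda>e. fo (fform a (h (\<lambda>n. e (Suc n)))) (e 0))"
    by (rule FNeg.IH) (rule dt_ren[OF FNeg.prems(1)], rule dt_var)
  then show ?case unfolding fform.simps forces.simps by (intro dfi FNeg.prems dt_ren[OF FNeg.prems(2)])
next
  case (FConj a b)
  show ?case unfolding fform.simps forces.simps
    by (intro df_conj FConj.IH FConj.prems)
next
  case (FAll a)
  have "dt (\<lambda>e. case_nat (e 0) (h (\<lambda>n. e (Suc n))) n)" for n
    by (cases n) (simp_all add: dt_var dt_ren[OF FAll.prems(1)])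
  from FAll.IH[OF this dt_ren[OF FAll.prems(2)]]
  have "df (\<lambda>e. fo (fform a (case_nat (e 0) (h (\<lambda>n. e (Suc n))))) (u (\<lambda>n. e (Suc n))))" .
  then show ?case unfolding fform.simps forces.simps sat_name by (intro dfi)
qed (simp_all add: dfi)

end

section \<open>A countable model of the forced sentences\<close>

text \<open>Two readings of one \<open>fm\<close> formula over different universes: forcing takes
  place over \<open>'v\<close>, truth in the term model over the natural numbers. The rules
  \<open>fori\<close> recover the syntax from formulas in quantifier notation.\<close>

definition forel :: "((nat \<Rightarrow> 'v) \<Rightarrow> 'v form) \<Rightarrow> ((nat \<Rightarrow> 'u) \<Rightarrow> 'u form) \<Rightarrow> bool" where
  "forel \<phi> \<psi> \<longleftrightarrow> (\<exists>a. \<phi> = fform a \<and> \<psi> = fform a)"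

named_theorems fori

lemma forel_Mem [fori]: "forel (\<lambda>e. e i \<^bold>\<in> e j) (\<lambda>e. e i \<^bold>\<in> e j)"
  unfolding forel_def by (intro exI[of _ "FMem i j"]) auto

lemma forel_Eq [fori]: "forel (\<lambda>e. e i \<^bold>= e j) (\<lambda>e. e i \<^bold>= e j)"
  unfolding forel_def by (intro exI[of _ "FEq i j"]) auto

lemma forel_Neg [fori]: "forel \<phi> \<psi> \<Longrightarrow> forel (\<lambda>e. \<^bold>\<not> \<phi> e) (\<lambda>e. \<^bold>\<not> \<psi> e)"
  unfolding forel_def by (elim exE, rename_tac a) (rule_tac x = "FNeg a" in exI, auto)

lemma forel_Conj [fori]: "forel \<phi> \<psi> \<Longrightarrow> forel \<phi>' \<psi>' \<Longrightarrow> forel (\<lambda>e. \<phi> e \<^bold>\<and> \<phi>' e) (\<lambda>e. \<psi> e \<^bold>\<and> \<psi>' e)"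
  unfolding forel_def by (elim exE, rename_tac a b) (rule_tac x = "FConj a b" in exI, auto)

lemma forel_All [fori]:
  assumes "forel (\<lambda>e. \<phi> (e 0) (\<lambda>n. e (Suc n))) (\<lambda>e. \<psi> (e 0) (\<lambda>n. e (Suc n)))"
  shows "forel (\<lambda>e. \<^bold>\<forall>x. \<phi> x e) (\<lambda>e. \<^bold>\<forall>x. \<psi> x e)"
proof -
  obtain a where a: "(\<lambda>e. \<phi> (e 0) (\<lambda>n. e (Suc n))) = fform a" "(\<lambda>e. \<psi> (e 0) (\<lambda>n. e (Suc n))) = fform a"
    using assms unfolding forel_def by blast
  have "\<phi> x e = fform a (case_nat x e)" for x e using fun_cong[OF a(1), of "case_nat x e"] by simp
  moreover have "\<psi> x e = fform a (case_nat x e)" for x e using fun_cong[OF a(2), of "case_nat x e"] by simp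
  ultimately show ?thesis unfolding forel_def by (intro exI[of _ "FAll a"]) (simp add: fun_eq_iff)
qed

lemma forel_connectives [fori]:
  "forel \<phi> \<psi> \<Longrightarrow> forel \<phi>' \<psi>' \<Longrightarrow> forel (\<lambda>e. \<phi> e \<^bold>\<or> \<phi>' e) (\<lambda>e. \<psi> e \<^bold>\<or> \<psi>' e)"
  "forel \<phi> \<psi> \<Longrightarrow> forel \<phi>' \<psi>' \<Longrightarrow> forel (\<lambda>e. \<phi> e \<^bold>\<longrightarrow> \<phi>' e) (\<lambda>e. \<psi> e \<^bold>\<longrightarrow> \<psi>' e)"
  "forel \<phi> \<psi> \<Longrightarrow> forel \<phi>' \<psi>' \<Longrightarrow> forel (\<lambda>e. \<phi> e \<^bold>\<longleftrightarrow> \<phi>' e) (\<lambda>e. \<psi> e \<^bold>\<longleftrightarrow> \<psi>' e)"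
  unfolding Disj_def Imp_def Iff_def by (intro fori; assumption)+

lemma forel_Ex [fori]:
  assumes "forel (\<lambda>e. \<phi> (e 0) (\<lambda>n. e (Suc n))) (\<lambda>e. \<psi> (e 0) (\<lambda>n. e (Suc n)))"
  shows "forel (\<lambda>e. \<^bold>\<exists>x. \<phi> x e) (\<lambda>e. \<^bold>\<exists>x. \<psi> x e)"
  unfolding Ex_def by (intro fori assms)

lemma forel_fform:
  assumes "\<And>n. \<exists>i. (\<forall>e. h e n = e i) \<and> (\<forall>e. h' e n = e i)"
  shows "forel (\<lambda>e. fform a (h e)) (\<lambda>e. fform a (h' e))"
proof -
  obtain f where "\<And>n. (\<forall>e. h e n = e (f n)) \<and> (\<forall>e. h' e n = e (f n))" using assms by metis
  then have h: "h = (\<lambda>e n. e (f n))" "h' = (\<lambda>e n. e (f n))" by (intro HOL.ext; simp)+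
  show ?thesis unfolding forel_def h by (intro exI[of _ "ren f a"] conjI HOL.ext) (simp_all add: fform_ren)
qed

context forcing
begin

lemma dom_induct:
  assumes Q: "df1 Q" and step: "\<And>x. (\<And>\<pi> s. pr \<pi> s \<epsilon> x \<Longrightarrow> Q \<pi>) \<Longrightarrow> Q x" shows "Q x"
proof -
  note [dfi] = df1_app[OF Q]
  have "Ord a \<longrightarrow> (\<forall>x. x \<epsilon> Vs a \<longrightarrow> Q x)" for a
  proof (rule eps_induct[of "\<lambda>a. Ord a \<longrightarrow> (\<forall>x. x \<epsilon> Vs a \<longrightarrow> Q x)"], intro dfi, intro impI allI)
    fix a x assume IH: "\<And>b. b \<epsilon> a \<Longrightarrow> Ord b \<longrightarrow> (\<forall>x. x \<epsilon> Vs b \<longrightarrow> Q x)" and a: "Ord a" and x: "x \<epsilon> Vs a"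
    obtain d where d: "d \<epsilon> a" "\<And>\<pi> s. pr \<pi> s \<epsilon> x \<Longrightarrow> \<pi> \<epsilon> Vs d" using Vs_dom[OF a x x] by blast
    show "Q x" by (rule step) (use IH[OF d(1)] Ord_mem[OF a d(1)] d(2) in blast)
  qed
  then show ?thesis using ex_Vs[of x] by blast
qed

text \<open>If \<open>x\<close> is forced into itself, a stronger condition forces it equal to a
  member of its domain, which is then forced into itself as well. In \<open>henkin\<close> this
  makes the term model infinite.\<close>

lemma fmem_irrefl: assumes "q \<epsilon> P" shows "\<not> fmem q x x"
proof -
  have "\<forall>q. q \<epsilon> P \<longrightarrow> \<not> fmem q x x"
  proof (rule dom_induct[of "\<lambda>x. \<forall>q. q \<epsilon> P \<longrightarrow> \<not> fmem q x x"], intro dfi, intro allI impI notI)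
    fix x q assume IH: "\<And>\<pi> s. pr \<pi> s \<epsilon> x \<Longrightarrow> \<forall>q. q \<epsilon> P \<longrightarrow> \<not> fmem q \<pi> \<pi>" and "q \<epsilon> P" "fmem q x x"
    then obtain r \<rho> s where r: "r \<epsilon> P" "le r q" "pr \<rho> s \<epsilon> x" "le r s" "feq r x \<rho>" by (elim fmemD)
    then have "fmem r \<rho> \<rho>" using fmem_feq2[OF r(1,5) fmemI[OF r(3,4)]] by blast
    then show False using IH r by blast
  qed
  then show ?thesis using assms by blast
qed

lemma ex_neg_forced: assumes "p \<epsilon> P" "\<not> fo \<phi> p" shows "\<exists>q. q \<epsilon> P \<and> le q p \<and> fo (\<^bold>\<not> \<phi>) q"
  using fo_dense[OF assms(1), of \<phi>] assms(2) unfolding forces.simps by blast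

text \<open>One stage of \<open>henkin\<close>. A refuted universal formula receives a
  counterexample, as the quantifier clause of the truth lemma demands.\<close>

lemma henkin_step:
  assumes "p \<epsilon> P" "\<And>n. name (h n)"
  shows "\<exists>q x. q \<epsilon> P \<and> le q p \<and> name x \<and> (fo (fform a h) q \<or> (fo (fform (FNeg a) h) q \<and>
    (\<forall>b. a = FAll b \<longrightarrow> fo (fform (FNeg b) (case_nat x h)) q)))"
proof -
  obtain q where q: "q \<epsilon> P" "le q p" "fo (fform a h) q \<or> fo (\<^bold>\<not> fform a h) q" using fo_decide[OF assms(1)] by blast
  show ?thesis
  proof (cases "fo (fform a h) q \<or> (\<forall>b. a \<noteq> FAll b)")
    case True then show ?thesis using q assms(2)[of 0] by auto
  next
    case False
    then obtain b where b: "a = FAll b" "\<not> fo (fform a h) q" by blast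
    then obtain x where x: "name x" "\<not> fo (fform b (case_nat x h)) q" by auto
    obtain r where r: "r \<epsilon> P" "le r q" "fo (\<^bold>\<not> fform b (case_nat x h)) r" using ex_neg_forced[OF q(1) x(2)] by blast
    moreover have "fo (\<^bold>\<not> fform a h) r" using q(3) b(2) fo_mono[OF _ q(1) r(1,2)] by blast
    ultimately show ?thesis using b(1) x(1) le_trans[OF r(2) q(2)]
      by (intro exI[of _ r] exI[of _ x]) (simp only: fform.simps fm.inject, blast)
  qed
qed

text \<open>A descending sequence of conditions decides all formulas about a countable list
  \<open>H\<close> of names; only countably many requirements have to be met, which is possible over
  any ground model. Positions are identified when a condition of the sequence forces equality, and
  the classes are renumbered by the natural numbers.\<close>

lemma henkin:
  assumes p0: "p0 \<epsilon> P" and e0: "\<And>n. name (e0 n)" and nf: "\<not> fo (fform a0 e0) p0"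
  obtains E' :: "nat \<Rightarrow> nat \<Rightarrow> bool" and e' :: "nat \<Rightarrow> nat" where
    "\<And>b e. (\<And>e p. (\<And>n. name (e n)) \<Longrightarrow> p \<epsilon> P \<Longrightarrow> fo (fform b e) p) \<Longrightarrow> sat E' (fform b e)"
    "\<And>b. (\<And>p. p \<epsilon> P \<Longrightarrow> fo (fform b e0) p) \<Longrightarrow> sat E' (fform b e')"
    "\<not> sat E' (fform a0 e')"
proof -
  \<comment> \<open>Even positions hold the given names for good. Position 2 * n + 1 is overwritten
    at stage \<open>n\<close>, with a counterexample if one is called for.\<close>
  let ?h = "\<lambda>n::nat. if even n then e0 (n div 2) else e0 0"
  let ?I = "\<lambda>n S. fst S \<epsilon> P \<and> (\<forall>n. name (snd S n)) \<and> (\<forall>n. snd S (2 * n) = e0 n) \<and> fo (fform (FNeg a0) e0) (fst S)"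
  let ?fm = "\<lambda>n::nat. from_nat (fst (prod_decode n)) :: fm"
  let ?S = "\<lambda>n S S'. le (fst S') (fst S) \<and> (\<exists>x. snd S' = (snd S)(2 * n + 1 := x) \<and>
     (fo (fform (?fm n) (snd S)) (fst S') \<or> (fo (fform (FNeg (?fm n)) (snd S)) (fst S') \<and>
       (\<forall>b. ?fm n = FAll b \<longrightarrow> fo (fform (FNeg b) (case_nat x (snd S))) (fst S')))))"
  have "\<exists>f. \<forall>n. ?I n (f n) \<and> ?S n (f n) (f (Suc n))"
  proof (rule dependent_nat_choice)
    obtain q where "q \<epsilon> P" "fo (\<^bold>\<not> fform a0 e0) q" using ex_neg_forced[OF p0 nf] by blast
    then show "\<exists>S. ?I 0 S" using e0 by (intro exI[of _ "(q, ?h)"]) simp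
  next
    fix S n assume S: "?I n S"
    obtain q x where q: "q \<epsilon> P" "le q (fst S)" "name x" "fo (fform (?fm n) (snd S)) q \<or> (fo (fform (FNeg (?fm n)) (snd S)) q \<and>
       (\<forall>b. ?fm n = FAll b \<longrightarrow> fo (fform (FNeg b) (case_nat x (snd S))) q))"
      using henkin_step[of "fst S" "snd S" "?fm n"] S by blast
    have "2 * m \<noteq> 2 * n + 1" for m :: nat by presburger
    moreover have "fo (fform (FNeg a0) e0) q" using S fo_mono[OF _ _ q(1,2)] by blast
    ultimately show "\<exists>S'. ?I (Suc n) S' \<and> ?S n S S'"
      using S q by (intro exI[of _ "(q, (snd S)(2 * n + 1 := x))"]) (simp only: fst_conv snd_conv fun_upd_apply, auto)
  qed
  then obtain f where fI: "\<And>n. ?I n (f n)" and fS: "\<And>n. ?S n (f n) (f (Suc n))" by blast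
  define p where "p n = fst (f n)" for n
  define h where "h n = snd (f n)" for n
  define H where "H i = h (Suc (i div 2)) i" for i
  have pP: "p n \<epsilon> P" for n using fI p_def by simp
  have pdec: "le (p m) (p n)" if "n \<le> m" for m n
    using that
  proof (induction m rule: dec_induct)
    case (step m)
    have "le (p (Suc m)) (p m)" using fS[of m] unfolding p_def by blast
    then show ?case using le_trans step by blast
  qed simp
  have h_eq: "h n i = H i" if "i < 2 * n + 1" for n i
  proof (cases "even i")
    case True then show ?thesis using fI[of n] fI[of "Suc (i div 2)"] unfolding H_def h_def by (elim evenE) simp
  next
    case False
    have st: "h n i = h (Suc (i div 2)) i" if "Suc (i div 2) \<le> n" for n
      using that
    proof (induction n rule: dec_induct)
      case (step n)
      obtain x where "h (Suc n) = (h n)(2 * n + 1 := x)" using fS[of n] unfolding h_def by blast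
      moreover have "i \<noteq> 2 * n + 1" using step(1) by auto
      ultimately show ?case using step by simp
    qed simp
    have "Suc (i div 2) \<le> n" using that False by presburger
    then show ?thesis unfolding H_def by (rule st)
  qed
  have Hn: "name (H i)" for i using fI[of "Suc (i div 2)"] unfolding H_def h_def by blast
  have He: "H (2 * n) = e0 n" for n using fI[of "Suc n"] by (simp add: H_def h_def)
  define S where "S a g \<longleftrightarrow> (\<exists>n. fo (fform a (\<lambda>i. H (g i))) (p n))" for a g
  have Smono: "fo \<phi> (p m)" if "fo \<phi> (p n)" "n \<le> m" for \<phi> m n using fo_mono[OF that(1) pP pP pdec[OF that(2)]] .
  have dec: "\<exists>n. fo (fform a H) (p n) \<or> (fo (fform (FNeg a) H) (p n) \<and> (\<forall>b. a = FAll b \<longrightarrow> (\<exists>i. fo (fform (FNeg b) (case_nat (H i) H)) (p n))))" for a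
  proof -
    \<comment> \<open>The second component is a delay: the stage is at least
      \<open>fbound a\<close>, so the variables of \<open>a\<close> refer to positions that are
      already final.\<close>
    define k where "k = prod_encode (to_nat a, fbound a)"
    have a: "?fm k = a" "fbound a \<le> k" by (simp_all add: k_def le_prod_encode_2)
    obtain x where x: "h (Suc k) = (h k)(2 * k + 1 := x)" "fo (fform a (h k)) (p (Suc k)) \<or> (fo (fform (FNeg a) (h k)) (p (Suc k)) \<and>
       (\<forall>b. a = FAll b \<longrightarrow> fo (fform (FNeg b) (case_nat x (h k))) (p (Suc k))))"
      using fS[of k] unfolding a(1) p_def h_def by blast
    have xH: "x = H (2 * k + 1)" using h_eq[of "2 * k + 1" "Suc k"] x(1) by simp
    have 1: "fform a (h k) = fform a H" by (rule fform_cong, rule h_eq) (use a(2) in simp)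
    have 2: "fform b (case_nat x (h k)) = fform b (case_nat x H)" if "a = FAll b" for b
      by (rule fform_cong) (use that a(2) h_eq[of _ k] in \<open>auto split: nat.split\<close>)
    have 3: "fo (fform (FNeg b) (case_nat (H (2 * k + 1)) H)) (p (Suc k))" if "a = FAll b" "\<not> fo (fform a H) (p (Suc k))" for b
    proof -
      have "fo (fform (FNeg b) (case_nat x (h k))) (p (Suc k))" using x(2) that unfolding 1 by blast
      then show ?thesis unfolding fform.simps 2[OF that(1)] xH[symmetric] .
    qed
    show ?thesis
      using x(2) 3 unfolding fform.simps 1 by (intro exI[of _ "Suc k"]) blast
  qed
  have ren: "fform (ren g a) H = fform a (\<lambda>i. H (g i))" for a g by (simp add: fform_ren)
  have S_neg: "S (FNeg a) g \<longleftrightarrow> \<not> S a g" for a g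
  proof
    assume "S (FNeg a) g"
    then obtain n where n: "fo (\<^bold>\<not> fform a (\<lambda>i. H (g i))) (p n)" unfolding S_def by auto
    show "\<not> S a g"
    proof
      assume "S a g"
      then obtain m where m: "fo (fform a (\<lambda>i. H (g i))) (p m)" unfolding S_def by auto
      show False using Smono[OF n, of "max n m"] Smono[OF m, of "max n m"] pP[of "max n m"] le_refl[of "p (max n m)"] by simp
    qed
  next
    assume "\<not> S a g"
    then show "S (FNeg a) g" using dec[of "ren g a"] unfolding S_def ren fform.simps by auto
  qed
  have S_conj: "S (FConj a b) g \<longleftrightarrow> S a g \<and> S b g" for a b g
  proof
    assume "S a g \<and> S b g"
    then obtain n m where m: "fo (fform a (\<lambda>i. H (g i))) (p n)" "fo (fform b (\<lambda>i. H (g i))) (p m)" unfolding S_def by blast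
    then have "fo (fform (FConj a b) (\<lambda>i. H (g i))) (p (max n m))"
      using Smono[OF m(1), of "max n m"] Smono[OF m(2), of "max n m"] by simp
    then show "S (FConj a b) g" unfolding S_def by blast
  qed (auto simp: S_def)
  have cn: "(\<lambda>n. H (case_nat i g n)) = case_nat (H i) (\<lambda>n. H (g n))" for i g by (auto split: nat.split)
  have S_all: "S (FAll a) g \<longleftrightarrow> (\<forall>i. S a (case_nat i g))" for a g
  proof
    assume "S (FAll a) g" then show "\<forall>i. S a (case_nat i g)" unfolding S_def cn using Hn by auto
  next
    assume all: "\<forall>i. S a (case_nat i g)"
    let ?b = "ren (case_nat 0 (\<lambda>n. Suc (g n))) a"
    have fb: "fform ?b (case_nat x H) = fform a (case_nat x (\<lambda>n. H (g n)))" for x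
      by (simp add: fform_ren case_nat_comp)
    show "S (FAll a) g"
    proof (rule ccontr)
      assume "\<not> S (FAll a) g"
      then have "\<not> fo (fform (ren g (FAll a)) H) (p n)" for n unfolding S_def ren by blast
      then obtain n i where "fo (fform (FNeg ?b) (case_nat (H i) H)) (p n)" using dec[of "ren g (FAll a)"] by auto
      then have "S (FNeg a) (case_nat i g)" unfolding S_def cn fform.simps fb by blast
      then show False using all S_neg by blast
    qed
  qed
  define Q where "Q i j \<longleftrightarrow> (\<exists>n. feq (p n) (H i) (H j))" for i j
  define M where "M i j \<longleftrightarrow> (\<exists>n. fmem (p n) (H i) (H j))" for i j
  have S_atom: "S (FEq i j) g \<longleftrightarrow> Q (g i) (g j)" "S (FMem i j) g \<longleftrightarrow> M (g i) (g j)" for i j g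
    unfolding S_def Q_def M_def by simp_all
  have Q_refl: "Q i i" for i unfolding Q_def using feq_refl[OF pP] by blast
  have Q_sym: "Q i j \<Longrightarrow> Q j i" for i j unfolding Q_def using feq_sym[OF pP] by blast
  have Scong: "S a (case_nat i g) \<longleftrightarrow> S a (case_nat j g)" if "Q i j" for a i j g
  proof -
    obtain n where n: "feq (p n) (H i) (H j)" using \<open>Q i j\<close> unfolding Q_def by blast
    have *: "fo (fform a (case_nat (H i) (\<lambda>n. H (g n)))) (p m) \<longleftrightarrow> fo (fform a (case_nat (H j) (\<lambda>n. H (g n)))) (p m)" if "n \<le> m" for m
      by (rule fo_fform_cong[OF pP]) (use feq_mono[OF n pP pP pdec[OF that]] feq_refl[OF pP] in \<open>simp split: nat.split\<close>)
    have "S a (case_nat k g) \<longleftrightarrow> (\<exists>m. n \<le> m \<and> fo (fform a (case_nat (H k) (\<lambda>n. H (g n)))) (p m))" for k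
      unfolding S_def cn using Smono[of _ _ "max n _"] by (metis max.cobounded1 max.cobounded2)
    then show ?thesis using * by blast
  qed
  have Q_trans: "Q i k" if "Q i j" "Q j k" for i j k
    using Scong[OF that(1), of "FEq 0 1" "\<lambda>_. k"] that(2) by (simp add: S_atom)
  define R where "R = {n. \<forall>m<n. \<not> Q m n}"
  have rep: "\<exists>r\<in>R. Q r i" for i
  proof -
    let ?r = "LEAST r. Q r i"
    have r: "Q ?r i" by (rule LeastI[of "\<lambda>r. Q r i", OF Q_refl])
    have "\<not> Q m ?r" if "m < ?r" for m using not_less_Least[OF that] Q_trans[OF _ r] by blast
    then show ?thesis using r unfolding R_def by blast
  qed
  have Sforced: "S b g" if "\<And>e p. (\<And>n. name (e n)) \<Longrightarrow> p \<epsilon> P \<Longrightarrow> fo (fform b e) p" for b g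
    unfolding S_def using that[of "\<lambda>i. H (g i)" "p 0"] Hn pP by blast
  have irrefl: "\<not> M i i" for i unfolding M_def using fmem_irrefl[OF pP] by blast
  have infR: "infinite R"
  proof
    assume fin: "finite R"
    \<comment> \<open>This says that for all x and y there is z with x in z and y contained in z.
      With finitely many classes, some set would contain all of them and hence itself.\<close>
    let ?b = "FAll (FAll (FNeg (FAll (FNeg (FConj (FMem 2 0) (FAll (FNeg (FConj (FMem 0 2) (FNeg (FMem 0 1)))))))))) "
    have b: "S ?b (\<lambda>i. i)"
    proof (rule Sforced)
      fix e :: "nat \<Rightarrow> 'v" and q assume q: "q \<epsilon> P"
      have "\<exists>z. name z \<and> fmem q x z \<and> (\<forall>u q'. q' \<epsilon> P \<and> fmem q' u y \<longrightarrow> fmem q' u z)" if "name x" "name y" "q \<epsilon> P" for x y q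
      proof (intro exI conjI allI impI; (elim conjE)?)
        let ?z = "ins (pr x one) y"
        show "name ?z" by (rule nameI) (use that(1,2) nameD one(1) in \<open>metis mem_ins\<close>)
        show "fmem q x ?z" by (rule fmemI[of _ one]) simp_all
        fix u q' assume "q' \<epsilon> P" "fmem q' u y"
        then show "fmem q' u ?z" unfolding mem_clause by (meson mem_ins)
      qed
      then show "fo (fform ?b e) q"
        using q by (auto simp: numeral_eq_Suc) (metis le_refl)
    qed
    have step: "\<exists>k. M i k \<and> (\<forall>u. M u j \<longrightarrow> M u k)" for i j
      using b by (auto simp: S_all S_neg S_conj S_atom numeral_eq_Suc)
    have "\<exists>j. \<forall>i\<in>F. M i j" if "finite F" for F
      using that
    proof induction
      case (insert x F) then show ?case using step by (metis insert_iff)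
    qed simp
    then obtain j where j: "\<forall>i\<in>R. M i j" using fin by blast
    obtain r where r: "r \<in> R" "Q r j" using rep by blast
    have "M r r" using j r(1) Scong[OF r(2), of "FMem 1 0" "\<lambda>_. r"] by (simp add: S_atom)
    then show False using irrefl by blast
  qed
  define c where "c = enumerate R"
  have c: "bij_betw c UNIV R" unfolding c_def by (rule bij_enumerate[OF infR])
  have cQ: "Q (c i) (c j) \<longleftrightarrow> i = j" for i j
  proof
    assume q: "Q (c i) (c j)"
    have "c i \<in> R" "c j \<in> R" using c by (auto simp: bij_betw_def)
    then have "\<not> c i < c j" "\<not> c j < c i" using q Q_sym unfolding R_def by blast+
    then have "c i = c j" by simp
    then show "i = j" using c by (auto simp: bij_betw_def inj_on_def)
  qed (simp add: Q_refl)
  have c_rep: "\<exists>i. Q (c i) j" for j using rep[of j] c unfolding bij_betw_def by (metis imageE)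
  define E' where "E' i j \<longleftrightarrow> M (c i) (c j)" for i j
  have truth: "sat E' (fform a e) \<longleftrightarrow> S a (\<lambda>i. c (e i))" for a e
  proof (induction a arbitrary: e)
    case (FAll a)
    have "(\<lambda>i. c (case_nat x e i)) = case_nat (c x) (\<lambda>i. c (e i))" for x by (auto split: nat.split)
    then have "sat E' (fform (FAll a) e) \<longleftrightarrow> (\<forall>x. S a (case_nat (c x) (\<lambda>i. c (e i))))"
      using FAll.IH by simp
    also have "\<dots> \<longleftrightarrow> (\<forall>j. S a (case_nat j (\<lambda>i. c (e i))))" using c_rep Scong by metis
    finally show ?case by (simp add: S_all)
  qed (simp_all add: S_atom S_neg S_conj cQ E'_def)
  have "\<exists>e'. \<forall>n. Q (c (e' n)) (2 * n)" using c_rep by (intro choice_iff[THEN iffD1]) blast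
  then obtain e' where e': "\<And>n. Q (c (e' n)) (2 * n)" by blast
  have S': "S b (\<lambda>n. c (e' n)) \<longleftrightarrow> (\<exists>n. fo (fform b e0) (p n))" for b
  proof -
    \<comment> \<open>A formula has finitely many variables, so a single condition of the sequence
      forces all relevant identifications of \<open>e'\<close> with \<open>e0\<close>.\<close>
    have "\<exists>N. \<forall>n<k. feq (p N) (H (c (e' n))) (e0 n)" for k
    proof (induction k)
      case (Suc k)
      then obtain N where N: "\<forall>n<k. feq (p N) (H (c (e' n))) (e0 n)" by blast
      obtain N' where N': "feq (p N') (H (c (e' k))) (e0 k)" using e'[of k] unfolding Q_def He by blast
      have "feq (p (max N N')) (H (c (e' n))) (e0 n)" if "n < Suc k" for n
      proof (cases "n = k")
        case True then show ?thesis using feq_mono[OF N' pP pP pdec] by simp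
      next
        case False
        then have "feq (p N) (H (c (e' n))) (e0 n)" using N that by simp
        then show ?thesis using feq_mono[OF _ pP pP pdec] by simp
      qed
      then show ?case by blast
    qed simp
    then obtain N where N: "\<forall>n<fbound b. feq (p N) (H (c (e' n))) (e0 n)" by blast
    let ?e = "\<lambda>n. if n < fbound b then e0 n else H (c (e' n))"
    have eb: "fform b ?e = fform b e0" by (rule fform_cong) simp
    have *: "fo (fform b (\<lambda>n. H (c (e' n)))) (p m) \<longleftrightarrow> fo (fform b e0) (p m)" if "N \<le> m" for m
      unfolding eb[symmetric] by (rule fo_fform_cong[OF pP]) (use N feq_mono[OF _ pP pP pdec[OF that]] feq_refl[OF pP] in simp)
    show ?thesis unfolding S_def using * Smono[of _ _ "max N _"] by (metis max.cobounded1 max.cobounded2)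
  qed
  show thesis
  proof (rule that[of E' e'])
    show "sat E' (fform b e)" if "\<And>e p. (\<And>n. name (e n)) \<Longrightarrow> p \<epsilon> P \<Longrightarrow> fo (fform b e) p" for b e
      unfolding truth by (rule Sforced[OF that])
    show "sat E' (fform b e')" if "\<And>p. p \<epsilon> P \<Longrightarrow> fo (fform b e0) p" for b
      unfolding truth S' using that pP by blast
    have "fo (fform (FNeg a0) e0) (p 0)" using fI[of 0] unfolding p_def by blast
    then have "S (FNeg a0) (\<lambda>n. c (e' n))" unfolding S' by blast
    then show "\<not> sat E' (fform a0 e')" unfolding truth using S_neg by blast
  qed
qed

end

section \<open>The axioms are forced\<close>

definition ax_ext :: "'v form" where "ax_ext = (\<^bold>\<forall>x y. (\<^bold>\<forall>z. z \<^bold>\<in> x \<^bold>\<longleftrightarrow> z \<^bold>\<in> y) \<^bold>\<longrightarrow> x \<^bold>= y)"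
definition ax_found :: "'v form" where
  "ax_found = (\<^bold>\<forall>x y. y \<^bold>\<in> x \<^bold>\<longrightarrow> (\<^bold>\<exists>y. y \<^bold>\<in> x \<^bold>\<and> \<^bold>\<not> (\<^bold>\<exists>z. z \<^bold>\<in> y \<^bold>\<and> z \<^bold>\<in> x)))"
definition ax_pair :: "'v form" where "ax_pair = (\<^bold>\<forall>x y. \<^bold>\<exists>z. x \<^bold>\<in> z \<^bold>\<and> y \<^bold>\<in> z)"
definition ax_union :: "'v form" where "ax_union = (\<^bold>\<forall>x. \<^bold>\<exists>u. \<^bold>\<forall>y z. z \<^bold>\<in> y \<^bold>\<and> y \<^bold>\<in> x \<^bold>\<longrightarrow> z \<^bold>\<in> u)"
definition ax_power :: "'v form" where "ax_power = (\<^bold>\<forall>x. \<^bold>\<exists>u. \<^bold>\<forall>y. (\<^bold>\<forall>z. z \<^bold>\<in> y \<^bold>\<longrightarrow> z \<^bold>\<in> x) \<^bold>\<longrightarrow> y \<^bold>\<in> u)"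
definition ax_inf :: "'v form" where
  "ax_inf = (\<^bold>\<exists>w. (\<^bold>\<exists>x. x \<^bold>\<in> w \<^bold>\<and> (\<^bold>\<forall>z. \<^bold>\<not> z \<^bold>\<in> x)) \<^bold>\<and>
     (\<^bold>\<forall>x. x \<^bold>\<in> w \<^bold>\<longrightarrow> (\<^bold>\<exists>y. y \<^bold>\<in> w \<^bold>\<and> (\<^bold>\<forall>z. z \<^bold>\<in> y \<^bold>\<longleftrightarrow> z \<^bold>\<in> x \<^bold>\<or> z \<^bold>= x))))"
definition ax_sep :: "fm \<Rightarrow> (nat \<Rightarrow> 'v) \<Rightarrow> 'v form" where
  "ax_sep f e = (\<^bold>\<forall>a. \<^bold>\<exists>b. \<^bold>\<forall>x. x \<^bold>\<in> b \<^bold>\<longleftrightarrow> x \<^bold>\<in> a \<^bold>\<and> fform f (case_nat x e))"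
text \<open>Collection rather than replacement, because the names of witnesses found below different
  conditions are not unique.\<close>

definition ax_coll :: "fm \<Rightarrow> (nat \<Rightarrow> 'v) \<Rightarrow> 'v form" where
  "ax_coll f e = (\<^bold>\<forall>a. (\<^bold>\<forall>x. x \<^bold>\<in> a \<^bold>\<longrightarrow> (\<^bold>\<exists>y. fform f (case_nat x (case_nat y e)))) \<^bold>\<longrightarrow>
     (\<^bold>\<exists>b. \<^bold>\<forall>x. x \<^bold>\<in> a \<^bold>\<longrightarrow> (\<^bold>\<exists>y. y \<^bold>\<in> b \<^bold>\<and> fform f (case_nat x (case_nat y e)))))"

lemma forel_axs:
  "forel (\<lambda>e. ax_ext) (\<lambda>e. ax_ext)" "forel (\<lambda>e. ax_found) (\<lambda>e. ax_found)" "forel (\<lambda>e. ax_pair) (\<lambda>e. ax_pair)"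
  "forel (\<lambda>e. ax_union) (\<lambda>e. ax_union)" "forel (\<lambda>e. ax_power) (\<lambda>e. ax_power)" "forel (\<lambda>e. ax_inf) (\<lambda>e. ax_inf)"
  unfolding ax_ext_def ax_found_def ax_pair_def ax_union_def ax_power_def ax_inf_def by (intro fori)+

lemma forel_ax_sep: "forel (\<lambda>e. ax_sep f e) (\<lambda>e. ax_sep f e)"
  unfolding ax_sep_def
  by (intro fori forel_fform, case_tac n) (auto intro: exI[of _ "0::nat"] exI[of _ "Suc (Suc (Suc _))"])

lemma forel_ax_coll: "forel (\<lambda>e. ax_coll f e) (\<lambda>e. ax_coll f e)"
  unfolding ax_coll_def
proof (intro fori forel_fform)
  fix n :: nat
  show "\<exists>i. (\<forall>e. case_nat (e (Suc 0)) (case_nat (e 0) (\<lambda>n. e (Suc (Suc (Suc n))))) n = e i) \<and>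
      (\<forall>e. case_nat (e (Suc 0)) (case_nat (e 0) (\<lambda>n. e (Suc (Suc (Suc n))))) n = e i)"
    by (rule exI[of _ "case_nat 1 (case_nat 0 (\<lambda>n. Suc (Suc (Suc n)))) n"]) (simp split: nat.split)
  show "\<exists>i. (\<forall>e. case_nat (e (Suc 0)) (case_nat (e 0) (\<lambda>n. e (Suc (Suc (Suc (Suc n)))))) n = e i) \<and>
      (\<forall>e. case_nat (e (Suc 0)) (case_nat (e 0) (\<lambda>n. e (Suc (Suc (Suc (Suc n)))))) n = e i)"
    by (rule exI[of _ "case_nat 1 (case_nat 0 (\<lambda>n. Suc (Suc (Suc (Suc n))))) n"]) (simp split: nat.split)
qed

context forcing
begin

text \<open>The name of the set of the values of the names \<open>f u\<close> with \<open>u \<in> a\<close>.\<close>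

definition sn where "sn a f = Rep a (\<lambda>u. pr (f u) one)"

lemma dt_sn [dfi]:
  assumes "dt a" "dt (\<lambda>e. f (e 0) (\<lambda>n. e (Suc n)))" shows "dt (\<lambda>e. sn (a e) (\<lambda>x. f x e))"
  unfolding sn_def by (intro dfi assms)

lemma mem_sn: assumes "dt1 f" shows "z \<epsilon> sn a f \<longleftrightarrow> (\<exists>u. u \<epsilon> a \<and> z = pr (f u) one)"
  unfolding sn_def by (rule mem_Rep) (intro dfi dt1_app[OF assms])

lemma name_sn: assumes "dt1 f" "\<And>u. u \<epsilon> a \<Longrightarrow> name (f u)" shows "name (sn a f)"
  by (rule nameI) (use assms(2) one(1) in \<open>auto simp: mem_sn[OF assms(1)]\<close>)

lemma fmem_sn: assumes f: "dt1 f"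
  shows "fmem p \<sigma> (sn a f) \<longleftrightarrow> (\<forall>q. q \<epsilon> P \<and> le q p \<longrightarrow> (\<exists>r u. r \<epsilon> P \<and> le r q \<and> u \<epsilon> a \<and> feq r \<sigma> (f u)))"
  unfolding mem_clause mem_sn[OF f] pr_inj using one(2) by blast

lemma fmem_snI: assumes f: "dt1 f" and "u \<epsilon> a" "p \<epsilon> P" shows "fmem p (f u) (sn a f)"
  by (rule fmemI[of _ one]) (use assms(2,3) in \<open>auto simp: mem_sn[OF f]\<close>)

text \<open>All names in \<open>a\<close>, attached to the largest condition. Pairing, union, power
  set and collection in the forms above ask for sufficiently large sets, and such names provide
  them.\<close>

definition nms where "nms a = sn (Sep a name) (\<lambda>x. x)"

lemma name_nms: "name (nms a)"
proof -
  have "x \<epsilon> Sep a name \<longleftrightarrow> x \<epsilon> a \<and> name x" for x by (rule mem_Sep) (intro dfi)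
  then show ?thesis unfolding nms_def by (intro name_sn dt_var) blast
qed

lemma fmem_nms: assumes "x \<epsilon> a" "name x" "p \<epsilon> P" shows "fmem p x (nms a)"
proof -
  have "x \<epsilon> Sep a name" using assms by (subst mem_Sep) (intro dfi, simp)
  then show ?thesis unfolding nms_def using fmem_snI[OF dt_var, of x "Sep a name" p] assms(3) by simp
qed

text \<open>A superset of the domain of a name, containing also the conditions of its pairs; it is
  used as a bounding set.\<close>

definition dom where "dom x = Uni (Uni x)"

lemma mem_dom: "pr \<pi> s \<epsilon> x \<Longrightarrow> \<pi> \<epsilon> dom x"
proof -
  assume "pr \<pi> s \<epsilon> x"
  moreover have "upair \<pi> \<pi> \<epsilon> pr \<pi> s" "\<pi> \<epsilon> upair \<pi> \<pi>" by simp_all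
  ultimately show ?thesis unfolding dom_def mem_Uni by blast
qed

lemma feqI: assumes p: "p \<epsilon> P" and "name x" "name y"
  and "\<And>z q. name z \<Longrightarrow> q \<epsilon> P \<Longrightarrow> le q p \<Longrightarrow> fmem q z x \<longleftrightarrow> fmem q z y" shows "feq p x y"
  unfolding feq_iff[OF p] using assms(4) name_dom(1)[OF assms(2)] name_dom(1)[OF assms(3)] by blast

text \<open>The name for \<open>{z \<in> a. Q z}\<close>, where \<open>Q z s\<close> means that \<open>s\<close> forces \<open>Q z\<close>.\<close>

definition seln where "seln a Q = Sep (prod (dom a) P) (\<lambda>w. \<exists>\<pi> s. w = pr \<pi> s \<and> (\<exists>t. pr \<pi> t \<epsilon> a) \<and> fmem s \<pi> a \<and> Q \<pi> s)"

lemma mem_seln: assumes "df2 Q"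
  shows "pr \<pi> s \<epsilon> seln a Q \<longleftrightarrow> s \<epsilon> P \<and> (\<exists>t. pr \<pi> t \<epsilon> a) \<and> fmem s \<pi> a \<and> Q \<pi> s" "z \<epsilon> seln a Q \<Longrightarrow> \<exists>\<pi> s. z = pr \<pi> s"
proof -
  note [dfi] = df2_app[OF assms]
  have *: "w \<epsilon> seln a Q \<longleftrightarrow> w \<epsilon> prod (dom a) P \<and> (\<exists>\<pi> s. w = pr \<pi> s \<and> (\<exists>t. pr \<pi> t \<epsilon> a) \<and> fmem s \<pi> a \<and> Q \<pi> s)" for w
    unfolding seln_def by (rule mem_Sep) (intro dfi)
  show "pr \<pi> s \<epsilon> seln a Q \<longleftrightarrow> s \<epsilon> P \<and> (\<exists>t. pr \<pi> t \<epsilon> a) \<and> fmem s \<pi> a \<and> Q \<pi> s"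
    unfolding * using mem_dom[of \<pi> _ a] by auto
  show "z \<epsilon> seln a Q \<Longrightarrow> \<exists>\<pi> s. z = pr \<pi> s" unfolding * by blast
qed

lemma name_seln: assumes "df2 Q" "name a" shows "name (seln a Q)"
proof (rule nameI)
  fix z assume z: "z \<epsilon> seln a Q"
  then obtain \<pi> s where "z = pr \<pi> s" using mem_seln(2)[OF assms(1)] by blast
  then show "\<exists>\<pi> s. name \<pi> \<and> s \<epsilon> P \<and> z = pr \<pi> s" using z mem_seln(1)[OF assms(1)] name_dom(1)[OF assms(2)] by blast
qed

text \<open>The closure conditions on \<open>Q\<close> are those of a forced formula: it persists to
  stronger conditions, respects forced equality, and holds where it holds densely.\<close>

lemma fmem_seln:
  assumes Q: "df2 Q"
    and mono: "\<And>x p q. p \<epsilon> P \<Longrightarrow> q \<epsilon> P \<Longrightarrow> le q p \<Longrightarrow> Q x p \<Longrightarrow> Q x q"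
    and cong: "\<And>x y p. p \<epsilon> P \<Longrightarrow> feq p x y \<Longrightarrow> Q x p \<Longrightarrow> Q y p"
    and dense: "\<And>x p. p \<epsilon> P \<Longrightarrow> (\<And>q. q \<epsilon> P \<Longrightarrow> le q p \<Longrightarrow> \<exists>r. r \<epsilon> P \<and> le r q \<and> Q x r) \<Longrightarrow> Q x p"
    and p: "p \<epsilon> P"
  shows "fmem p x (seln a Q) \<longleftrightarrow> fmem p x a \<and> Q x p"
proof
  assume m: "fmem p x (seln a Q)"
  have *: "\<exists>r. r \<epsilon> P \<and> le r q \<and> fmem r x a \<and> Q x r" if q: "q \<epsilon> P" "le q p" for q
  proof -
    obtain r \<pi> s where r: "r \<epsilon> P" "le r q" "pr \<pi> s \<epsilon> seln a Q" "le r s" "feq r x \<pi>"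
      using fmem_mono[OF m q(2)] q(1) by (rule fmemD)
    then have s: "s \<epsilon> P" "fmem s \<pi> a" "Q \<pi> s" unfolding mem_seln(1)[OF Q] by blast+
    have "fmem r x a" by (rule fmem_feq1[OF r(1) feq_sym[OF r(1,5)] fmem_mono[OF s(2) r(4)]])
    moreover have "Q x r" by (rule cong[OF r(1) feq_sym[OF r(1,5)] mono[OF s(1) r(1,4) s(3)]])
    ultimately show ?thesis using r by blast
  qed
  have "fmem p x a" by (rule fmem_dense) (use * in blast)
  moreover have "Q x p" by (rule dense[OF p]) (use * in blast)
  ultimately show "fmem p x a \<and> Q x p" ..
next
  assume a: "fmem p x a \<and> Q x p"
  show "fmem p x (seln a Q)"
  proof (rule fmem_dense)
    fix q assume q: "q \<epsilon> P" "le q p"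
    obtain r \<pi> s where r: "r \<epsilon> P" "le r q" "pr \<pi> s \<epsilon> a" "le r s" "feq r x \<pi>"
      using fmem_mono[OF a[THEN conjunct1] q(2)] q(1) by (rule fmemD)
    have "Q \<pi> r" by (rule cong[OF r(1,5) mono[OF p r(1) le_trans[OF r(2) q(2)]]]) (use a in blast)
    then have "pr \<pi> r \<epsilon> seln a Q" unfolding mem_seln(1)[OF Q] using r fmemI[OF r(3,4)] by blast
    then have "fmem r x (seln a Q)" using fmem_feq1[OF r(1) feq_sym[OF r(1,5)] fmemI[OF _ le_refl]] by blast
    then show "\<exists>r. r \<epsilon> P \<and> le r q \<and> fmem r x (seln a Q)" using r by blast
  qed
qed

section \<open>Verification of the individual axioms\<close>

lemma fo_ext: "p \<epsilon> P \<Longrightarrow> fo ax_ext p"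
  unfolding ax_ext_def by (auto simp: fo_Imp fo_Iff intro!: feqI)

text \<open>Minimal elements are found by induction on names: where \<open>y\<close> is not forced
  to be minimal in \<open>x\<close>, a stronger condition forces some member of the domain of
  \<open>y\<close> into \<open>x\<close>.\<close>

lemma fo_found: assumes p: "p \<epsilon> P" shows "fo ax_found p"
proof -
  let ?\<psi> = "\<lambda>x y. y \<^bold>\<in> x \<^bold>\<and> \<^bold>\<not> (\<^bold>\<exists>z. z \<^bold>\<in> y \<^bold>\<and> z \<^bold>\<in> x)"
  have main: "\<exists>r y. r \<epsilon> P \<and> le r q \<and> name y \<and> fo (?\<psi> x y) r" if "name x" "name y" "q \<epsilon> P" "fmem q y x" for x y q
  proof -
    let ?Q = "\<lambda>y. \<forall>q. name y \<and> q \<epsilon> P \<and> fmem q y x \<longrightarrow> (\<exists>r y. r \<epsilon> P \<and> le r q \<and> name y \<and> fo (?\<psi> x y) r)"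
    have Qy: "?Q y"
    proof (rule dom_induct[of ?Q])
      show "df1 ?Q" unfolding Ex_def forces.simps sat_name by (intro dfi)
    next
      fix y assume IH: "\<And>\<pi> s. pr \<pi> s \<epsilon> y \<Longrightarrow> ?Q \<pi>"
      show "?Q y"
      proof (intro allI impI, elim conjE)
        fix q assume y: "name y" and q: "q \<epsilon> P" and m: "fmem q y x"
        show "\<exists>r y. r \<epsilon> P \<and> le r q \<and> name y \<and> fo (?\<psi> x y) r"
        proof (cases "fo (?\<psi> x y) q")
          case True then show ?thesis using q y le_refl by blast
        next
          case False
          then have "\<not> fo (\<^bold>\<not> (\<^bold>\<exists>z. z \<^bold>\<in> y \<^bold>\<and> z \<^bold>\<in> x)) q" using m by simp
          then obtain q1 where q1: "q1 \<epsilon> P" "le q1 q" "fo (\<^bold>\<exists>z. z \<^bold>\<in> y \<^bold>\<and> z \<^bold>\<in> x) q1" by (auto simp: forces.simps(3))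
          then obtain r z where r: "r \<epsilon> P" "le r q1" "name z" "fmem r z y" "fmem r z x"
            unfolding fo_Ex[OF q1(1)] using le_refl by fastforce
          obtain r' \<pi> s where r': "r' \<epsilon> P" "le r' r" "pr \<pi> s \<epsilon> y" "le r' s" "feq r' z \<pi>" using r(4,1) by (rule fmemD)
          have "fmem r' \<pi> x" by (rule fmem_feq1[OF r'(1,5) fmem_mono[OF r(5) r'(2)]])
          then obtain r2 v where "r2 \<epsilon> P" "le r2 r'" "name v" "fo (?\<psi> x v) r2"
            using IH[OF r'(3)] name_dom(1)[OF y r'(3)] r'(1) by blast
          then show ?thesis using le_trans r'(2) r(2) q1(2) by blast
        qed
      qed
    qed
    show ?thesis by (rule Qy[rule_format]) (use that in simp)
  qed
  show ?thesis unfolding ax_found_def forces.simps sat_name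
  proof (intro allI impI)
    fix x y assume xy: "name x" "name y"
    show "fo (y \<^bold>\<in> x \<^bold>\<longrightarrow> Ex (?\<psi> x)) p" unfolding fo_Imp[OF p]
    proof (intro allI impI, elim conjE)
      fix q assume q: "q \<epsilon> P" "fo (y \<^bold>\<in> x) q"
      show "fo (Ex (?\<psi> x)) q" unfolding fo_Ex[OF q(1)]
      proof (intro allI impI, elim conjE)
        fix q' assume q': "q' \<epsilon> P" "le q' q"
        have "fmem q' y x" using q(2) fmem_mono[OF _ q'(2)] by simp
        from main[OF xy q'(1) this] show "\<exists>r y. r \<epsilon> P \<and> le r q' \<and> name y \<and> fo (?\<psi> x y) r" .
      qed
    qed
  qed
qed

lemma fo_ExI: assumes "p \<epsilon> P" "name x" "fo (\<phi> x) p" shows "fo (Ex \<phi>) p"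
  unfolding fo_Ex[OF assms(1)] using assms fo_mono[OF assms(3,1)] le_refl by blast

lemma fo_pair: assumes p: "p \<epsilon> P" shows "fo ax_pair p"
proof -
  have "fo (\<^bold>\<exists>z. x \<^bold>\<in> z \<^bold>\<and> y \<^bold>\<in> z) p" if "name x" "name y" for x y
    by (rule fo_ExI[OF p name_nms[of "upair x y"]]) (use fmem_nms that p in simp)
  then show ?thesis unfolding ax_pair_def by simp
qed

lemma fo_union: assumes p: "p \<epsilon> P" shows "fo ax_union p"
proof -
  have "fo (\<^bold>\<exists>u. \<^bold>\<forall>y z. z \<^bold>\<in> y \<^bold>\<and> y \<^bold>\<in> x \<^bold>\<longrightarrow> z \<^bold>\<in> u) p" if x: "name x" for x
  proof (rule fo_ExI[OF p name_nms[of "dom (Uni (dom x))"]])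
    have "fmem q z (nms (dom (Uni (dom x))))" if q: "q \<epsilon> P" and m: "fmem q z y" "fmem q y x" for q y z
    proof (rule fmem_dense)
      fix q' assume q': "q' \<epsilon> P" "le q' q"
      obtain r \<pi> s where r: "r \<epsilon> P" "le r q'" "pr \<pi> s \<epsilon> x" "le r s" "feq r y \<pi>"
        using fmem_mono[OF m(2) q'(2)] q'(1) by (rule fmemD)
      have "fmem r z \<pi>" using fmem_feq2[OF r(1,5)] fmem_mono[OF m(1) le_trans[OF r(2) q'(2)]] by blast
      then obtain t \<rho> s' where t: "t \<epsilon> P" "le t r" "pr \<rho> s' \<epsilon> \<pi>" "le t s'" "feq t z \<rho>" using r(1) by (rule fmemD)
      have "pr \<rho> s' \<epsilon> Uni (dom x)" using t(3) mem_dom[OF r(3)] by auto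
      then have "fmem t \<rho> (nms (dom (Uni (dom x))))"
        using fmem_nms[OF mem_dom _ t(1)] name_dom(1)[OF name_dom(1)[OF x r(3)] t(3)] by blast
      then show "\<exists>r. r \<epsilon> P \<and> le r q' \<and> fmem r z (nms (dom (Uni (dom x))))"
        using fmem_feq1[OF t(1) feq_sym[OF t(1,5)]] t(1) le_trans[OF t(2) r(2)] by blast
    qed
    then show "fo (\<^bold>\<forall>y z. z \<^bold>\<in> y \<^bold>\<and> y \<^bold>\<in> x \<^bold>\<longrightarrow> z \<^bold>\<in> nms (dom (Uni (dom x)))) p"
      unfolding forces.simps fo_Imp[OF p] by blast
  qed
  then show ?thesis unfolding ax_union_def by simp
qed

text \<open>A name forced to be a subset of \<open>x\<close> is forced equal to \<open>?s\<close>,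
  whose pairs are taken from the domain of \<open>x\<close> and \<open>P\<close>. Hence the names in
  one power set of the ground model suffice.\<close>

lemma fo_power: assumes p: "p \<epsilon> P" shows "fo ax_power p"
proof -
  have "fo (\<^bold>\<exists>u. \<^bold>\<forall>y. (\<^bold>\<forall>z. z \<^bold>\<in> y \<^bold>\<longrightarrow> z \<^bold>\<in> x) \<^bold>\<longrightarrow> y \<^bold>\<in> u) p" if x: "name x" for x
  proof (rule fo_ExI[OF p name_nms[of "Pw (prod (dom x) P)"]])
    have main: "fmem q y (nms (Pw (prod (dom x) P)))" if y: "name y" and q: "q \<epsilon> P"
      and m: "\<And>z r. name z \<Longrightarrow> r \<epsilon> P \<Longrightarrow> le r q \<Longrightarrow> fmem r z y \<Longrightarrow> fmem r z x" for q y
    proof -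
      let ?Q = "\<lambda>\<pi> s. fmem s \<pi> y"
      let ?s = "seln x ?Q"
      have Q: "df2 ?Q" by (intro dfi)
      have ms: "fmem r z ?s \<longleftrightarrow> fmem r z x \<and> fmem r z y" if "r \<epsilon> P" for r z
        by (rule fmem_seln[OF Q _ _ _ that]) (use fmem_mono fmem_feq1 fmem_dense in blast)+
      have ns: "name ?s" by (rule name_seln[OF Q x])
      have "feq q ?s y" by (rule feqI[OF q ns y]) (use ms m in blast)
      moreover have "?s \<epsilon> Pw (prod (dom x) P)" unfolding mem_Pw
      proof (intro allI impI)
        fix z assume z: "z \<epsilon> ?s"
        then obtain \<pi> s where "z = pr \<pi> s" using mem_seln(2)[OF Q] by blast
        then show "z \<epsilon> prod (dom x) P" using z mem_seln(1)[OF Q] mem_dom by auto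
      qed
      ultimately show ?thesis using fmem_feq1[OF q] fmem_nms[OF _ ns q] by blast
    qed
    show "fo (\<^bold>\<forall>y. (\<^bold>\<forall>z. z \<^bold>\<in> y \<^bold>\<longrightarrow> z \<^bold>\<in> x) \<^bold>\<longrightarrow> y \<^bold>\<in> nms (Pw (prod (dom x) P))) p"
      unfolding forces.simps sat_name fo_Imp[OF p]
    proof (intro allI impI, elim conjE)
      fix y q assume y: "name y" and q: "q \<epsilon> P" and h: "\<forall>z. name z \<longrightarrow> fo (z \<^bold>\<in> y \<^bold>\<longrightarrow> z \<^bold>\<in> x) q"
      show "fmem q y (nms (Pw (prod (dom x) P)))"
        by (rule main[OF y q]) (use h in \<open>simp add: fo_Imp[OF q]\<close>)
    qed
  qed
  then show ?thesis unfolding ax_power_def by simp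
qed

lemma fo_sep: assumes p: "p \<epsilon> P" and e: "\<And>n. name (e n)" shows "fo (ax_sep f e) p"
proof -
  have "fo (\<^bold>\<exists>b. \<^bold>\<forall>x. x \<^bold>\<in> b \<^bold>\<longleftrightarrow> x \<^bold>\<in> a \<^bold>\<and> fform f (case_nat x e)) p" if a: "name a" for a
  proof -
    let ?Q = "\<lambda>x s. fo (fform f (case_nat x e)) s"
    have Q: "df2 ?Q"
    proof (rule df_fo)
      show "dt (\<lambda>u. case_nat (u 0) e n)" for n by (cases n) (simp_all add: dfi)
    qed (rule dt_var)
    have ms: "fmem r z (seln a ?Q) \<longleftrightarrow> fmem r z a \<and> ?Q z r" if r: "r \<epsilon> P" for r z
    proof (rule fmem_seln[OF Q _ _ _ r])
      show "fo (fform f (case_nat y e)) p" if "p \<epsilon> P" "feq p x y" "fo (fform f (case_nat x e)) p" for x y p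
        using fo_fform_cong[OF that(1), of "case_nat x e" "case_nat y e" f] that by (auto split: nat.split)
    qed (use fo_mono fo_dense in blast)+
    show ?thesis by (rule fo_ExI[OF p name_seln[OF Q a]]) (use ms p in \<open>simp add: fo_Iff\<close>)
  qed
  then show ?thesis unfolding ax_sep_def by simp
qed

text \<open>Collection in the ground model is applied to the pairs of a name and a condition that
  forces some witness for it. The set \<open>B\<close> of names so obtained provides witnesses
  densely below each condition that forces the hypothesis.\<close>

lemma fo_coll: assumes p: "p \<epsilon> P" and e: "\<And>n. name (e n)" shows "fo (ax_coll f e) p"
proof -
  let ?\<phi> = "\<lambda>x y. fform f (case_nat x (case_nat y e))"
  have c: "fo (?\<phi> x z) q \<longleftrightarrow> fo (?\<phi> y z) q" if "q \<epsilon> P" "feq q x y" for q x y z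
    by (rule fo_fform_cong[OF that(1)]) (use that in \<open>simp split: nat.split\<close>)
  have "fo ((\<^bold>\<forall>x. x \<^bold>\<in> a \<^bold>\<longrightarrow> (\<^bold>\<exists>y. ?\<phi> x y)) \<^bold>\<longrightarrow> (\<^bold>\<exists>b. \<^bold>\<forall>x. x \<^bold>\<in> a \<^bold>\<longrightarrow> (\<^bold>\<exists>y. y \<^bold>\<in> b \<^bold>\<and> ?\<phi> x y))) p" if a: "name a" for a
    unfolding fo_Imp[OF p]
  proof (intro allI impI, elim conjE)
    fix q assume q: "q \<epsilon> P" and h: "fo (\<^bold>\<forall>x. x \<^bold>\<in> a \<^bold>\<longrightarrow> (\<^bold>\<exists>y. ?\<phi> x y)) q"
    let ?Q = "\<lambda>z y. \<exists>\<pi> s. z = pr \<pi> s \<and> name y \<and> fo (?\<phi> \<pi> y) s"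
    have "df (\<lambda>u. fo (?\<phi> (u i) (u j)) (u k))" for i j k
    proof (rule df_fo)
      show "dt (\<lambda>u. case_nat (u i) (case_nat (u j) e) n)" for n
        by (cases n; cases "n - 1") (simp_all add: dfi)
    qed (rule dt_var)
    note [dfi] = this
    have Q: "df2 ?Q" by (intro dfi)
    note [dfi] = df2_app[OF Q]
    let ?W = "Sep (prod (dom a) P) (\<lambda>z. \<exists>y. ?Q z y)"
    have "df1 (\<lambda>z. \<exists>y. ?Q z y)" by (rule df_ex, rule df_ren[OF Q, of "case_nat 1 (\<lambda>_. 0)", simplified])
    then have W: "z \<epsilon> ?W \<longleftrightarrow> z \<epsilon> prod (dom a) P \<and> (\<exists>y. ?Q z y)" for z by (rule mem_Sep)
    obtain B where B: "\<And>z. z \<epsilon> ?W \<Longrightarrow> \<exists>y. y \<epsilon> B \<and> ?Q z y" using collection[OF Q, of ?W] W by blast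
    show "fo (\<^bold>\<exists>b. \<^bold>\<forall>x. x \<^bold>\<in> a \<^bold>\<longrightarrow> (\<^bold>\<exists>y. y \<^bold>\<in> b \<^bold>\<and> ?\<phi> x y)) q"
    proof (rule fo_ExI[OF q name_nms[of B]])
      have "fo (\<^bold>\<exists>y. y \<^bold>\<in> nms B \<^bold>\<and> ?\<phi> x y) q'" if x: "name x" and q': "q' \<epsilon> P" "le q' q" and m: "fmem q' x a" for x q'
        unfolding fo_Ex[OF q'(1)]
      proof (intro allI impI, elim conjE)
        fix q2 assume q2: "q2 \<epsilon> P" "le q2 q'"
        obtain r \<pi> s where r: "r \<epsilon> P" "le r q2" "pr \<pi> s \<epsilon> a" "le r s" "feq r x \<pi>"
          using fmem_mono[OF m q2(2)] q2(1) by (rule fmemD)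
        have "fo (\<^bold>\<exists>y. ?\<phi> x y) q'" using h x q q' m by (simp add: fo_Imp)
        then obtain t y where t: "t \<epsilon> P" "le t r" "name y" "fo (?\<phi> x y) t"
          using r(1) le_trans[OF r(2) q2(2)] unfolding fo_Ex[OF q'(1)] by blast
        have eq: "feq t x \<pi>" using feq_mono[OF r(5,1) t(1,2)] .
        then have "fo (?\<phi> \<pi> y) t" using c[OF t(1)] t(4) by blast
        then have "pr \<pi> t \<epsilon> ?W" unfolding W using mem_dom[OF r(3)] t(1,3) by auto
        then obtain y' where y': "y' \<epsilon> B" "name y'" "fo (?\<phi> \<pi> y') t" using B by fastforce
        then have "fo (y' \<^bold>\<in> nms B \<^bold>\<and> ?\<phi> x y') t" using c[OF t(1) eq] fmem_nms[OF y'(1,2) t(1)] by simp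
        then show "\<exists>r y. r \<epsilon> P \<and> le r q2 \<and> name y \<and> fo (y \<^bold>\<in> nms B \<^bold>\<and> ?\<phi> x y) r"
          using y'(2) t(1) le_trans[OF t(2) r(2)] by blast
      qed
      then show "fo (\<^bold>\<forall>x. x \<^bold>\<in> a \<^bold>\<longrightarrow> (\<^bold>\<exists>y. y \<^bold>\<in> nms B \<^bold>\<and> ?\<phi> x y)) q" using q by (simp add: fo_Imp)
    qed
  qed
  then show ?thesis unfolding ax_coll_def by simp
qed

subsection \<open>Check names\<close>

definition chk where "chk = rec (\<lambda>x g. sn x (app g))"

lemma dt_chk [dfi]: "dt t \<Longrightarrow> dt (\<lambda>e. chk (t e))"
  by (rule dt1_app[of chk]) (unfold chk_def, intro dfi)

lemma dt1_chk: "dt1 chk" by (intro dfi)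

lemma mem_chk: "z \<epsilon> chk x \<longleftrightarrow> (\<exists>u. u \<epsilon> x \<and> z = pr (chk u) one)"
proof -
  have "chk x = sn x (app (Lam x chk))"
    unfolding chk_def by (rule rec_eq[of "\<lambda>x g. sn x (app g)"]) (intro dfi)
  then have "z \<epsilon> chk x \<longleftrightarrow> (\<exists>u. u \<epsilon> x \<and> z = pr (app (Lam x chk) u) one)"
    by (simp only: mem_sn[OF dt1_appf])
  then show ?thesis using app_Lam[OF dt1_chk, of _ x] by auto
qed

lemma chk_sn: "chk x = sn x chk"
  by (rule exten) (simp only: mem_chk mem_sn[OF dt1_chk])

lemma name_chk [simp]: "name (chk x)"
proof (rule eps_induct[of "\<lambda>x. name (chk x)"], intro dfi)
  fix x assume "\<And>y. y \<epsilon> x \<Longrightarrow> name (chk y)"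
  then show "name (chk x)" unfolding chk_sn[of x] by (intro name_sn dt1_chk)
qed

lemmas fmem_chk = fmem_sn[OF dt1_chk, folded chk_sn]

lemma fmem_chkI: "u \<epsilon> x \<Longrightarrow> p \<epsilon> P \<Longrightarrow> fmem p (chk u) (chk x)"
  using fmem_snI[OF dt1_chk, folded chk_sn] .

lemma chk_inj: assumes "p \<epsilon> P" "feq p (chk x) (chk y)" shows "x = y"
proof -
  let ?Q = "\<lambda>x. \<forall>y p. p \<epsilon> P \<and> feq p (chk x) (chk y) \<longrightarrow> x = y"
  have "?Q x"
  proof (rule eps_induct[of ?Q], intro dfi, intro allI impI, elim conjE)
    fix x y p assume IH: "\<And>u. u \<epsilon> x \<Longrightarrow> ?Q u" and p: "p \<epsilon> P" and eq: "feq p (chk x) (chk y)"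
    show "x = y"
    proof (rule exten)
      fix u
      show "u \<epsilon> x \<longleftrightarrow> u \<epsilon> y"
      proof
        assume u: "u \<epsilon> x"
        have "fmem p (chk u) (chk y)" by (rule fmem_feq2[OF p eq fmem_chkI[OF u p]])
        then obtain r v where "r \<epsilon> P" "v \<epsilon> y" "feq r (chk u) (chk v)" unfolding fmem_chk using p le_refl by blast
        then show "u \<epsilon> y" using IH[OF u] by auto
      next
        assume u: "u \<epsilon> y"
        have "fmem p (chk u) (chk x)" by (rule fmem_feq2[OF p feq_sym[OF p eq] fmem_chkI[OF u p]])
        then obtain r v where r: "r \<epsilon> P" "v \<epsilon> x" "feq r (chk u) (chk v)" unfolding fmem_chk using p le_refl by blast
        then have "v = u" using IH[OF r(2)] feq_sym[OF r(1,3)] by blast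
        then show "u \<epsilon> x" using r(2) by simp
      qed
    qed
  qed
  then show ?thesis using assms by blast
qed

lemma feq_chk [simp]: "p \<epsilon> P \<Longrightarrow> feq p (chk x) (chk y) \<longleftrightarrow> x = y"
  using chk_inj by auto

lemma fmem_chk_chk [simp]: assumes "p \<epsilon> P" shows "fmem p (chk x) (chk y) \<longleftrightarrow> x \<epsilon> y"
proof
  assume "fmem p (chk x) (chk y)"
  then obtain r v where "r \<epsilon> P" "v \<epsilon> y" "feq r (chk x) (chk v)" unfolding fmem_chk using assms le_refl by blast
  then show "x \<epsilon> y" by simp
qed (simp add: fmem_chkI assms)

lemma is_check_name: assumes "sat E (is_check_name one x c)" shows "c = chk x"
proof -
  have "\<exists>T B f. (\<forall>y. y \<epsilon> T \<longrightarrow> sub y T) \<and> x \<epsilon> T \<and> sat E (is_fun f T B) \<and>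
      (\<forall>y d. pr y d \<epsilon> f \<longrightarrow> (\<forall>z. z \<epsilon> d \<longleftrightarrow> (\<exists>u v. u \<epsilon> y \<and> pr u v \<epsilon> f \<and> z = pr v one))) \<and> pr x c \<epsilon> f"
    using assms unfolding is_check_name_def is_transitive_def
    by (simp only: sat_simps sat.simps sat_pair_in sat_is_pair sat_subset_of)
  then obtain T B f where T: "\<And>y z. y \<epsilon> T \<Longrightarrow> z \<epsilon> y \<Longrightarrow> z \<epsilon> T" "x \<epsilon> T" and f: "sat E (is_fun f T B)"
    and fd: "\<And>y d z. pr y d \<epsilon> f \<Longrightarrow> z \<epsilon> d \<longleftrightarrow> (\<exists>u v. u \<epsilon> y \<and> pr u v \<epsilon> f \<and> z = pr v one)" and xc: "pr x c \<epsilon> f"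
    by (elim exE conjE) (rule that, blast+)
  have tot: "\<exists>v. pr u v \<epsilon> f" if "u \<epsilon> T" for u using f that unfolding is_fun_def by simp
  let ?Q = "\<lambda>y. y \<epsilon> T \<longrightarrow> (\<forall>d. pr y d \<epsilon> f \<longrightarrow> d = chk y)"
  have "?Q x"
  proof (rule eps_induct[of ?Q], intro dfi, intro impI allI)
    fix y d assume IH: "\<And>u. u \<epsilon> y \<Longrightarrow> ?Q u" and y: "y \<epsilon> T" "pr y d \<epsilon> f"
    show "d = chk y"
      by (rule exten) (unfold fd[OF y(2)] mem_chk, use IH T(1)[OF y(1)] tot in blast)
  qed
  then show ?thesis using T(2) xc by blast
qed

lemma fo_inf: assumes p: "p \<epsilon> P" shows "fo ax_inf p"
proof -
  have suc: "fmem q z (chk (suc u)) \<longleftrightarrow> fo (z \<^bold>\<in> chk u \<^bold>\<or> z \<^bold>= chk u) q" if q: "q \<epsilon> P" for q z u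
  proof
    assume m: "fmem q z (chk (suc u))"
    show "fo (z \<^bold>\<in> chk u \<^bold>\<or> z \<^bold>= chk u) q" unfolding fo_Disj[OF q]
    proof (intro allI impI, elim conjE)
      fix q' assume "q' \<epsilon> P" "le q' q"
      then obtain r v where r: "r \<epsilon> P" "le r q'" "v \<epsilon> suc u" "feq r z (chk v)" using m unfolding fmem_chk by blast
      have "v \<epsilon> u \<Longrightarrow> fmem r z (chk u)" using fmem_feq1[OF r(1) feq_sym[OF r(1,4)] fmem_chkI[OF _ r(1)]] by blast
      then have "fo (z \<^bold>\<in> chk u) r \<or> fo (z \<^bold>= chk u) r" using r(3,4) by auto
      then show "\<exists>r. r \<epsilon> P \<and> le r q' \<and> (fo (z \<^bold>\<in> chk u) r \<or> fo (z \<^bold>= chk u) r)" using r by blast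
    qed
  next
    assume m: "fo (z \<^bold>\<in> chk u \<^bold>\<or> z \<^bold>= chk u) q"
    show "fmem q z (chk (suc u))"
    proof (rule fmem_dense)
      fix q' assume "q' \<epsilon> P" "le q' q"
      then obtain r where r: "r \<epsilon> P" "le r q'" "fmem r z (chk u) \<or> feq r z (chk u)" using m unfolding fo_Disj[OF q] by auto
      have "fmem r z (chk u) \<Longrightarrow> fmem r z (chk (suc u))" unfolding fmem_chk by (meson mem_suc)
      moreover have "feq r z (chk u) \<Longrightarrow> fmem r z (chk (suc u))"
        using fmem_feq1[OF r(1) feq_sym[OF r(1)] fmem_chkI[OF _ r(1)]] by simp
      ultimately show "\<exists>r. r \<epsilon> P \<and> le r q' \<and> fmem r z (chk (suc u))" using r by blast
    qed
  qed
  have "\<not> fmem q z (chk emp)" if "q \<epsilon> P" for q z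
    using that le_refl[of q] mem_emp unfolding fmem_chk by blast
  then have "fo (\<^bold>\<exists>x. x \<^bold>\<in> chk omega \<^bold>\<and> (\<^bold>\<forall>z. \<^bold>\<not> z \<^bold>\<in> x)) p"
    by (intro fo_ExI[OF p name_chk[of emp]]) (simp add: p)
  moreover have "fo (\<^bold>\<forall>x. x \<^bold>\<in> chk omega \<^bold>\<longrightarrow> (\<^bold>\<exists>y. y \<^bold>\<in> chk omega \<^bold>\<and> (\<^bold>\<forall>z. z \<^bold>\<in> y \<^bold>\<longleftrightarrow> z \<^bold>\<in> x \<^bold>\<or> z \<^bold>= x))) p"
    unfolding forces.simps sat_name
  proof (intro allI impI)
    fix x assume x: "name x"
    let ?\<psi> = "\<lambda>x y. y \<^bold>\<in> chk omega \<^bold>\<and> (\<^bold>\<forall>z. z \<^bold>\<in> y \<^bold>\<longleftrightarrow> z \<^bold>\<in> x \<^bold>\<or> z \<^bold>= x)"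
    show "fo (x \<^bold>\<in> chk omega \<^bold>\<longrightarrow> Ex (?\<psi> x)) p" unfolding fo_Imp[OF p]
    proof (intro allI impI, elim conjE)
      fix q assume q: "q \<epsilon> P" and m: "fo (x \<^bold>\<in> chk omega) q"
      show "fo (Ex (?\<psi> x)) q" unfolding fo_Ex[OF q]
      proof (intro allI impI, elim conjE)
        fix q' assume "q' \<epsilon> P" "le q' q"
        then obtain r u where r: "r \<epsilon> P" "le r q'" "u \<epsilon> omega" "feq r x (chk u)" using m unfolding forces.simps fmem_chk by blast
        have eqv: "fo (z \<^bold>\<in> chk u \<^bold>\<or> z \<^bold>= chk u) t \<longleftrightarrow> fo (z \<^bold>\<in> x \<^bold>\<or> z \<^bold>= x) t" if t: "t \<epsilon> P" "le t r" for z t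
        proof -
          have A: "fmem t' z (chk u) \<longleftrightarrow> fmem t' z x" "feq t' z (chk u) \<longleftrightarrow> feq t' z x" if t': "t' \<epsilon> P" "le t' t" for t'
          proof -
            have e: "feq t' x (chk u)" using feq_mono[OF r(4,1) t'(1)] le_trans[OF t'(2) t(2)] by blast
            show "fmem t' z (chk u) \<longleftrightarrow> fmem t' z x" using fmem_feq2[OF t'(1) e] fmem_feq2[OF t'(1) feq_sym[OF t'(1) e]] by blast
            show "feq t' z (chk u) \<longleftrightarrow> feq t' z x" using feq_trans[OF t'(1) _ e] feq_trans[OF t'(1) _ feq_sym[OF t'(1) e]] by blast
          qed
          have "(\<exists>t'. t' \<epsilon> P \<and> le t' s \<and> (fmem t' z (chk u) \<or> feq t' z (chk u))) \<longleftrightarrow>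
              (\<exists>t'. t' \<epsilon> P \<and> le t' s \<and> (fmem t' z x \<or> feq t' z x))" if "le s t" for s
            using A le_trans[OF _ that] by blast
          then show ?thesis unfolding fo_Disj[OF t(1)] forces.simps by blast
        qed
        have "fo (z \<^bold>\<in> chk (suc u) \<^bold>\<longleftrightarrow> z \<^bold>\<in> x \<^bold>\<or> z \<^bold>= x) r" for z
          unfolding fo_Iff[OF r(1)] using suc eqv by simp
        then have "fo (?\<psi> x (chk (suc u))) r" using r(1,3) by simp
        then show "\<exists>r y. r \<epsilon> P \<and> le r q' \<and> name y \<and> fo (?\<psi> x y) r" using r(1,2) name_chk by blast
      qed
    qed
  qed
  ultimately have "fo ((\<^bold>\<exists>x. x \<^bold>\<in> chk omega \<^bold>\<and> (\<^bold>\<forall>z. \<^bold>\<not> z \<^bold>\<in> x)) \<^bold>\<and>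
     (\<^bold>\<forall>x. x \<^bold>\<in> chk omega \<^bold>\<longrightarrow> (\<^bold>\<exists>y. y \<^bold>\<in> chk omega \<^bold>\<and> (\<^bold>\<forall>z. z \<^bold>\<in> y \<^bold>\<longleftrightarrow> z \<^bold>\<in> x \<^bold>\<or> z \<^bold>= x)))) p" by simp
  then show ?thesis unfolding ax_inf_def by (rule fo_ExI[OF p name_chk[of omega]])
qed

section \<open>Term models of set theory and forced consequences\<close>

lemma henkin_zf:
  assumes p0: "p0 \<epsilon> P" and e0: "\<And>n. name (e0 n)" and nf: "\<not> fo (\<Phi> e0) p0" and \<Phi>: "forel \<Phi> \<Phi>'"
  obtains E' :: "nat \<Rightarrow> nat \<Rightarrow> bool" and e' :: "nat \<Rightarrow> nat" where "zf E'" "\<not> sat E' (\<Phi>' e')"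
    "\<And>\<phi> \<psi> e. forel \<phi> \<psi> \<Longrightarrow> (\<And>e p. (\<And>n. name (e n)) \<Longrightarrow> p \<epsilon> P \<Longrightarrow> fo (\<phi> e) p) \<Longrightarrow> sat E' (\<psi> e)"
    "\<And>\<phi> \<psi>. forel \<phi> \<psi> \<Longrightarrow> (\<And>p. p \<epsilon> P \<Longrightarrow> fo (\<phi> e0) p) \<Longrightarrow> sat E' (\<psi> e')"
proof -
  obtain a0 where a0: "\<Phi> = fform a0" "\<Phi>' = fform a0" using \<Phi> unfolding forel_def by blast
  obtain E' :: "nat \<Rightarrow> nat \<Rightarrow> bool" and e' :: "nat \<Rightarrow> nat" where
    1: "\<And>b e. (\<And>e p. (\<And>n. name (e n)) \<Longrightarrow> p \<epsilon> P \<Longrightarrow> fo (fform b e) p) \<Longrightarrow> sat E' (fform b e)"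
    and 2: "\<And>b. (\<And>p. p \<epsilon> P \<Longrightarrow> fo (fform b e0) p) \<Longrightarrow> sat E' (fform b e')"
    and 3: "\<not> sat E' (fform a0 e')"
    using henkin[OF p0 e0 nf[unfolded a0(1)]] by metis
  have A: "sat E' (\<psi> e)" if "forel \<phi> \<psi>" "\<And>e p. (\<And>n. name (e n)) \<Longrightarrow> p \<epsilon> P \<Longrightarrow> fo (\<phi> e) p" for \<phi> \<psi> e
  proof -
    obtain a where a: "\<phi> = fform a" "\<psi> = fform a" using \<open>forel \<phi> \<psi>\<close> unfolding forel_def by blast
    show ?thesis unfolding a(2) by (rule 1) (use that(2) a(1) in blast)
  qed
  have B: "sat E' (\<psi> e')" if "forel \<phi> \<psi>" "\<And>p. p \<epsilon> P \<Longrightarrow> fo (\<phi> e0) p" for \<phi> \<psi>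
  proof -
    obtain a where a: "\<phi> = fform a" "\<psi> = fform a" using \<open>forel \<phi> \<psi>\<close> unfolding forel_def by blast
    show ?thesis unfolding a(2) by (rule 2) (use that(2) a(1) in blast)
  qed
  have "zf E'"
  proof
    fix x y assume "\<And>z. E' z x = E' z y"
    then show "x = y" using A[OF forel_axs(1) fo_ext] by (simp add: ax_ext_def)
  next
    fix x y assume "E' y x"
    then show "\<exists>y. E' y x \<and> \<not> (\<exists>z. E' z y \<and> E' z x)" using A[OF forel_axs(2) fo_found] unfolding ax_found_def by (simp, blast)
  next
    show "\<exists>z. E' x z \<and> E' y z" for x y using A[OF forel_axs(3) fo_pair] by (simp add: ax_pair_def)
    show "\<exists>u. \<forall>y z. E' z y \<and> E' y x \<longrightarrow> E' z u" for x using A[OF forel_axs(4) fo_union] by (simp add: ax_union_def)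
    show "\<exists>u. \<forall>y. (\<forall>z. E' z y \<longrightarrow> E' z x) \<longrightarrow> E' y u" for x using A[OF forel_axs(5) fo_power] by (simp add: ax_power_def)
    show "\<exists>w. (\<exists>x. E' x w \<and> (\<forall>z. \<not> E' z x)) \<and> (\<forall>x. E' x w \<longrightarrow> (\<exists>y. E' y w \<and> (\<forall>z. E' z y \<longleftrightarrow> E' z x \<or> z = x)))"
      using A[OF forel_axs(6) fo_inf] by (simp add: ax_inf_def)
    show "\<exists>b. \<forall>x. E' x b \<longleftrightarrow> E' x a \<and> sat E' (fform f (case_nat x e))" for a f e
      using A[OF forel_ax_sep fo_sep, of f e] by (simp add: ax_sep_def)
    show "(\<And>x. E' x a \<Longrightarrow> \<exists>!y. sat E' (fform f (case_nat x (case_nat y e)))) \<Longrightarrow>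
         \<exists>b. \<forall>x. E' x a \<longrightarrow> (\<exists>y. E' y b \<and> sat E' (fform f (case_nat x (case_nat y e))))" for a f e
    proof -
      assume h: "\<And>x. E' x a \<Longrightarrow> \<exists>!y. sat E' (fform f (case_nat x (case_nat y e)))"
      have "\<forall>a. (\<forall>x. E' x a \<longrightarrow> (\<exists>y. sat E' (fform f (case_nat x (case_nat y e))))) \<longrightarrow>
          (\<exists>b. \<forall>x. E' x a \<longrightarrow> (\<exists>y. E' y b \<and> sat E' (fform f (case_nat x (case_nat y e)))))"
      proof -
        have "sat E' (ax_coll f e)" by (rule A[OF forel_ax_coll], rule fo_coll) assumption+
        then show ?thesis unfolding ax_coll_def by simp
      qed
      then have "(\<forall>x. E' x a \<longrightarrow> (\<exists>y. sat E' (fform f (case_nat x (case_nat y e))))) \<longrightarrow>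
          (\<exists>b. \<forall>x. E' x a \<longrightarrow> (\<exists>y. E' y b \<and> sat E' (fform f (case_nat x (case_nat y e)))))" by (rule spec)
      moreover have "\<forall>x. E' x a \<longrightarrow> (\<exists>y. sat E' (fform f (case_nat x (case_nat y e))))"
        using h by (intro allI impI ex1_implies_ex)
      ultimately show ?thesis by (rule mp)
    qed
  qed
  then show thesis
  proof (rule that[of E' e'])
    show "\<not> sat E' (\<Phi>' e')" using 3 unfolding a0(2) .
    show "sat E' (\<psi> e)" if "forel \<phi> \<psi>" "\<And>e p. (\<And>n. name (e n)) \<Longrightarrow> p \<epsilon> P \<Longrightarrow> fo (\<phi> e) p" for \<phi> \<psi> e
      by (rule A[OF that])
    show "sat E' (\<psi> e')" if "forel \<phi> \<psi>" "\<And>p. p \<epsilon> P \<Longrightarrow> fo (\<phi> e0) p" for \<phi> \<psi>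
      by (rule B[OF that])
  qed
qed

text \<open>If the formula were not forced, a term model satisfying the axioms would refute it. This
  yields the pairing property in \<open>opn_inj\<close> without a computation with names, and it
  closes the final argument.\<close>

lemma fo_zf_valid:
  assumes "forel \<phi> \<psi>" "\<And>(E' :: nat \<Rightarrow> nat \<Rightarrow> bool) e. zf E' \<Longrightarrow> sat E' (\<psi> e)" "\<And>n. name (e n)" "p \<epsilon> P"
  shows "fo (\<phi> e) p"
proof (rule ccontr)
  assume nf: "\<not> fo (\<phi> e) p"
  show False
  proof (rule henkin_zf[of p e \<phi> \<psi>])
    fix E' :: "nat \<Rightarrow> nat \<Rightarrow> bool" and e' assume "zf E'" "\<not> sat E' (\<psi> e')"
    then show False using assms(2) by blast
  qed (use assms nf in auto)
qed

end

section \<open>Cohen conditions\<close>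

context zf
begin

lemma cle_del: assumes "cle x (suc n)" "z \<epsilon> x" shows "cle (del z x) n"
proof -
  obtain g where g: "dt1 g" "inj_on g (el x)" "\<And>y. y \<epsilon> x \<Longrightarrow> g y \<epsilon> suc n" using assms(1) unfolding cle_iff by blast
  note [dfi] = dt1_app[OF g(1)]
  let ?g = "\<lambda>y. if g y = n then g z else g y"
  have gz: "g y \<noteq> g z" if "y \<epsilon> del z x" for y
    using inj_onD[OF g(2), of y z] that assms(2) by auto
  show ?thesis
  proof (rule cleI)
    show "dt1 ?g" by (intro dfi)
    show "inj_on ?g (el (del z x))"
    proof (rule inj_onI)
      fix y u assume yu: "y \<in> el (del z x)" "u \<in> el (del z x)" and e: "?g y = ?g u"
      then have "g y = g u" using gz[of y] gz[of u] by (auto split: if_splits)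
      then show "y = u" using inj_onD[OF g(2)] yu by simp
    qed
    show "?g y \<epsilon> n" if y: "y \<epsilon> del z x" for y
      using g(3)[of y] g(3)[OF assms(2)] gz[OF y] y by auto
  qed
qed

lemma sat_is_fun [simp]: "sat E (is_fun f a b) \<longleftrightarrow> is_map f a b"
  unfolding is_fun_def is_partial_fun_def is_map_def by simp

section \<open>Blocks of coordinates and nodes of the binary tree\<close>

definition add where "add a = rec (\<lambda>x g. un a (Rep x (app g)))"

lemma dt_add [dfi]: "dt s \<Longrightarrow> dt t \<Longrightarrow> dt (\<lambda>e. add (s e) (t e))"
  by (rule dt2_app[of add]) (unfold add_def, intro dfi)

lemma mem_add: "z \<epsilon> add a i \<longleftrightarrow> z \<epsilon> a \<or> (\<exists>j. j \<epsilon> i \<and> z = add a j)"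
proof -
  have d: "dt1 (add a)" by (intro dfi)
  have "add a i = un a (Rep i (app (Lam i (add a))))"
    unfolding add_def by (rule rec_eq[of "\<lambda>x g. un a (Rep x (app g))"]) (intro dfi)
  then have "z \<epsilon> add a i \<longleftrightarrow> z \<epsilon> a \<or> (\<exists>j. j \<epsilon> i \<and> z = app (Lam i (add a)) j)"
    by (simp only: mem_un mem_Rep[OF dt1_appf])
  then show ?thesis using app_Lam[OF d, of _ i] by auto
qed

lemma add_emp: "add a emp = a" by (rule exten) (simp add: mem_add)

lemma add_suc: "add a (suc i) = suc (add a i)"
  by (rule exten) (auto simp: mem_add[of _ a "suc i"] mem_add[of _ a i])

lemma add_mem: assumes "Lim l" "a \<epsilon> l" "i \<epsilon> omega" shows "add a i \<epsilon> l"
  using assms(3)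
proof (induction rule: omega_induct)
  show "df1 (\<lambda>i. add a i \<epsilon> l)" by (intro dfi)
qed (simp_all add: add_emp add_suc assms(2) Lim_suc[OF assms(1)])

lemma add_inj: assumes "i \<epsilon> omega" "j \<epsilon> omega" "add a i = add a j" shows "i = j"
proof -
  have "\<not> i \<epsilon> j" "\<not> j \<epsilon> i" using mem_add[of "add a i" a j] mem_add[of "add a j" a i] assms(3) not_mem_self by auto
  then show ?thesis using Ord_lin[OF Ord_omega assms(1,2)] by blast
qed

text \<open>Blocks of different indices may overlap, but at equal offsets their coordinates differ;
  this is what separates two branches.\<close>

lemma add_inj2: assumes "i \<epsilon> omega" "add a i = add b i" shows "a = b"
proof -
  have "add a i = add b i \<longrightarrow> a = b" using assms(1)
    by (induction rule: omega_induct) (intro dfi, simp_all add: add_emp add_suc)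
  then show ?thesis using assms(2) by blast
qed

lemma add_not_mem: "\<not> add a i \<epsilon> a"
  using mem_add[of "add a i" a i] not_mem_self by blast

definition pfst where "pfst z = desc (\<lambda>x. \<exists>y. z = pr x y)"
definition psnd where "psnd z = desc (\<lambda>y. \<exists>x. z = pr x y)"

lemma dt_proj [dfi]: "dt t \<Longrightarrow> dt (\<lambda>e. pfst (t e))" "dt t \<Longrightarrow> dt (\<lambda>e. psnd (t e))"
proof -
  have "dt1 pfst" "dt1 psnd" unfolding pfst_def psnd_def by (intro dfi)+
  then show "dt t \<Longrightarrow> dt (\<lambda>e. pfst (t e))" "dt t \<Longrightarrow> dt (\<lambda>e. psnd (t e))" by (auto intro: dt1_app)
qed

lemma proj [simp]: "pfst (pr a b) = a" "psnd (pr a b) = b"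
  unfolding pfst_def psnd_def by (rule desc_eq; auto)+

definition nodes where "nodes = Sep (prod omega (Pw omega)) (\<lambda>t. \<exists>n a. t = pr n a \<and> sub a n)"

lemma mem_nodes: "t \<epsilon> nodes \<longleftrightarrow> (\<exists>n a. t = pr n a \<and> n \<epsilon> omega \<and> sub a n)"
proof -
  have "t \<epsilon> nodes \<longleftrightarrow> t \<epsilon> prod omega (Pw omega) \<and> (\<exists>n a. t = pr n a \<and> sub a n)"
    unfolding nodes_def by (rule mem_Sep) (intro dfi)
  moreover have "a \<epsilon> Pw omega" if "n \<epsilon> omega" "sub a n" for n a using that omega_trans[OF that(1)] by simp
  ultimately show ?thesis unfolding mem_prod by auto
qed

lemma pr_nodes: "pr n a \<epsilon> nodes \<longleftrightarrow> n \<epsilon> omega \<and> sub a n" unfolding mem_nodes by auto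

end

context zfwo
begin

lemma nodes_countable: "cle nodes omega"
proof -
  obtain d where d: "Ord d" "eqp nodes d" using eqp_Ord by blast
  then obtain f where f: "dt1 f" "bij_betw f (el nodes) (el d)" unfolding eqp_iff by blast
  show ?thesis
  proof (rule finite_to_one[OF f(1), of _ pfst])
    show "inj_on f (el nodes)" using f(2) by (simp add: bij_betw_def)
    show "Ord (f x)" if "x \<epsilon> nodes" for x
    proof -
      have "f x \<in> el d" using f(2) that by (auto simp: bij_betw_def)
      then show ?thesis using Ord_mem[OF d(1)] by simp
    qed
    show "dt1 pfst" by (intro dfi)
    show "pfst x \<epsilon> omega" if "x \<epsilon> nodes" for x using that unfolding mem_nodes by auto
    fix k assume k: "k \<epsilon> omega"
    have dk: "dt1 (pr k)" by (intro dfi)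
    have "x \<epsilon> Sep nodes (\<lambda>x. pfst x = k) \<longleftrightarrow> x \<epsilon> nodes \<and> pfst x = k" for x by (rule mem_Sep) (intro dfi)
    then have "sub (Sep nodes (\<lambda>x. pfst x = k)) (Rep (Pw k) (pr k))" unfolding mem_Rep[OF dk] mem_nodes by auto
    then show "fin (Sep nodes (\<lambda>x. pfst x = k))"
      using fin_sub[OF fin_Rep[OF fin_Pw[OF fin_omega_mem[OF k]] dk]] by blast
  qed
qed

text \<open>The external choice picks an element of the model, which then acts as a parameter, so
  \<open>code\<close> is definable.\<close>

definition code where "code = app (SOME f. is_injm f nodes omega)"

lemma code: "dt1 code" "inj_on code (el nodes)" "t \<epsilon> nodes \<Longrightarrow> code t \<epsilon> omega"
proof -
  have "is_injm (SOME f. is_injm f nodes omega) nodes omega"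
    using nodes_countable unfolding cle_def by (rule someI_ex)
  then show "dt1 code" "inj_on code (el nodes)" "t \<epsilon> nodes \<Longrightarrow> code t \<epsilon> omega"
    unfolding code_def is_injm_iff using dt1_appf is_map_app(1) by blast+
qed

lemma dt_code [dfi]: "dt t \<Longrightarrow> dt (\<lambda>e. code (t e))" by (rule dt1_app[OF code(1)])

text \<open>Only finitely many nodes are shorter than \<open>n\<close>. Together with
  \<open>code_above\<close> this translates between bounds for codes and bounds for lengths.\<close>

lemma code_below: assumes "n \<epsilon> omega" shows "\<exists>N. N \<epsilon> omega \<and> (\<forall>m b. pr m b \<epsilon> nodes \<and> m \<epsilon> n \<longrightarrow> code (pr m b) \<epsilon> N)"
proof -
  have d: "dt1 (\<lambda>m. Rep (Pw m) (\<lambda>b. code (pr m b)))" by (intro dfi)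
  have d': "dt1 (\<lambda>b. code (pr m b))" for m by (intro dfi)
  have "fin (Uni (Rep n (\<lambda>m. Rep (Pw m) (\<lambda>b. code (pr m b)))))"
  proof (rule fin_UN[OF fin_omega_mem[OF assms] d])
    fix m assume "m \<epsilon> n"
    then have "m \<epsilon> omega" using omega_trans[OF assms] by blast
    then show "fin (Rep (Pw m) (\<lambda>b. code (pr m b)))" by (intro fin_Rep fin_Pw fin_omega_mem d')
  qed
  then obtain N where N: "N \<epsilon> omega" "\<And>x. x \<epsilon> Uni (Rep n (\<lambda>m. Rep (Pw m) (\<lambda>b. code (pr m b)))) \<Longrightarrow> x \<epsilon> omega \<Longrightarrow> x \<epsilon> N"
    using fin_bounded[OF _ Lim_omega] by blast
  have "code (pr m b) \<epsilon> N" if "pr m b \<epsilon> nodes" "m \<epsilon> n" for m b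
    by (rule N(2)) (use that code(3) in \<open>unfold mem_UN[OF d] mem_Rep[OF d'] pr_nodes mem_Pw, blast+\<close>)
  then show ?thesis using N(1) by blast
qed

lemma code_above: assumes "N \<epsilon> omega" shows "\<exists>n. n \<epsilon> omega \<and> (\<forall>m b. pr m b \<epsilon> nodes \<and> sub n m \<longrightarrow> \<not> code (pr m b) \<epsilon> N)"
proof -
  let ?X = "Sep nodes (\<lambda>t. code t \<epsilon> N)"
  have X: "t \<epsilon> ?X \<longleftrightarrow> t \<epsilon> nodes \<and> code t \<epsilon> N" for t by (rule mem_Sep) (intro dfi)
  have "cle ?X N" by (rule cleI[OF code(1)]) (use code(2) X in \<open>auto simp: inj_on_def\<close>)
  then have "fin ?X" using fin_cle fin_omega_mem[OF assms] by blast
  have dp: "dt1 pfst" by (intro dfi)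
  obtain n where n: "n \<epsilon> omega" "\<And>m. m \<epsilon> Rep ?X pfst \<Longrightarrow> m \<epsilon> omega \<Longrightarrow> m \<epsilon> n"
    using fin_bounded[OF fin_Rep[OF \<open>fin ?X\<close> dp] Lim_omega] by blast
  have "\<not> code (pr m b) \<epsilon> N" if t: "pr m b \<epsilon> nodes" "sub n m" for m b
  proof
    assume "code (pr m b) \<epsilon> N"
    then have "pr m b \<epsilon> ?X" using t(1) X by blast
    then have "m \<epsilon> Rep ?X pfst" unfolding mem_Rep[OF dp] by (intro exI[of _ "pr m b"]) simp
    then have "m \<epsilon> n" using n(2) t(1) pr_nodes by blast
    then show False using t(2) by (blast intro: not_mem_self[THEN notE])
  qed
  then show ?thesis using n(1) by blast
qed

section \<open>Pigeonhole principle and maximal roots\<close>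

definition unb where "unb l S \<longleftrightarrow> (\<forall>b. b \<epsilon> l \<longrightarrow> (\<exists>a. a \<epsilon> l \<and> \<not> a \<epsilon> b \<and> S a))"

text \<open>Unboundedness in \<open>l\<close> plays the role of having \<open>l\<close> many
  indices. If every fiber of \<open>h\<close> were bounded, \<open>reg\<close> would give a common
  bound for all indices in \<open>S\<close>.\<close>

lemma pigeon:
  assumes l: "Ord l" and reg: "\<And>f. dt1 f \<Longrightarrow> (\<And>n. n \<epsilon> L \<Longrightarrow> f n \<epsilon> l) \<Longrightarrow> \<exists>b. b \<epsilon> l \<and> (\<forall>n. n \<epsilon> L \<longrightarrow> f n \<epsilon> b)"
    and S: "df1 S" "unb l S" and h: "dt1 h" "\<And>a. a \<epsilon> l \<Longrightarrow> S a \<Longrightarrow> h a \<epsilon> L"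
  shows "\<exists>n. n \<epsilon> L \<and> unb l (\<lambda>a. S a \<and> h a = n)"
proof (rule ccontr)
  assume no: "\<not> (\<exists>n. n \<epsilon> L \<and> unb l (\<lambda>a. S a \<and> h a = n))"
  note [dfi] = df1_app[OF S(1)] dt1_app[OF h(1)]
  let ?Q = "\<lambda>n b. b \<epsilon> l \<and> (\<forall>a. a \<epsilon> l \<and> S a \<and> h a = n \<longrightarrow> a \<epsilon> b)"
  have Q: "df2 ?Q" by (intro dfi)
  have "\<exists>b. ?Q n b" if "n \<epsilon> L" for n using no that unfolding unb_def by blast
  then obtain f where f: "dt1 f" "\<And>n. n \<epsilon> L \<Longrightarrow> ?Q n (f n)" using choice[OF Q, of L] by blast
  obtain b where b: "b \<epsilon> l" "\<And>n. n \<epsilon> L \<Longrightarrow> f n \<epsilon> b" using reg[OF f(1)] f(2) by blast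
  obtain a where a: "a \<epsilon> l" "\<not> a \<epsilon> b" "S a" using S(2) b(1) unfolding unb_def by blast
  have "a \<epsilon> f (h a)" "f (h a) \<epsilon> b" using f(2)[OF h(2)[OF a(1,3)]] a b(2)[OF h(2)[OF a(1,3)]] by blast+
  then show False using Ord_trans[OF Ord_mem[OF l b(1)]] a(2) by blast
qed

text \<open>After thinning to one size \<open>n\<close>, a set contained in unboundedly many
  \<open>r a\<close> has at most \<open>n\<close> elements, so some such set is maximal. Maximality
  replaces the disjointness of a Delta-system: any further element occurs together with the root
  only for a bounded set of indices.\<close>

lemma max_root:
  assumes l: "Ord l" "l \<noteq> emp" and reg: "\<And>f. dt1 f \<Longrightarrow> (\<And>n. n \<epsilon> omega \<Longrightarrow> f n \<epsilon> l) \<Longrightarrow> \<exists>b. b \<epsilon> l \<and> (\<forall>n. n \<epsilon> omega \<longrightarrow> f n \<epsilon> b)"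
    and S: "df1 S" "unb l S" and r: "dt1 r" "\<And>a. a \<epsilon> l \<Longrightarrow> S a \<Longrightarrow> fin (r a)"
  obtains S' \<rho> where "df1 S'" "\<And>a. S' a \<Longrightarrow> S a" "unb l (\<lambda>a. S' a \<and> sub \<rho> (r a))"
    "\<And>z. \<not> z \<epsilon> \<rho> \<Longrightarrow> \<not> unb l (\<lambda>a. S' a \<and> sub (ins z \<rho>) (r a))"
proof -
  note [dfi] = df1_app[OF S(1)] dt1_app[OF r(1)]
  let ?h = "\<lambda>a. lst (\<lambda>n. n \<epsilon> omega \<and> cle (r a) n)"
  have dh: "dt1 ?h" by (intro dfi)
  have h: "?h a \<epsilon> omega \<and> cle (r a) (?h a)" if a: "a \<epsilon> l" "S a" for a
  proof -
    obtain n where n: "n \<epsilon> omega" "eqp (r a) n" using r(2)[OF a] unfolding fin_def by blast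
    have d: "df1 (\<lambda>n. n \<epsilon> omega \<and> cle (r a) n)" by (intro dfi)
    show ?thesis by (rule lst(2)[OF d Ord_omega_mem[OF n(1)]]) (use n eqp_cle in blast)
  qed
  obtain n where n: "n \<epsilon> omega" "unb l (\<lambda>a. S a \<and> ?h a = n)"
    using pigeon[OF l(1) reg S dh] h by blast
  define S' where "S' a \<longleftrightarrow> S a \<and> ?h a = n" for a
  have dS': "df1 S'" unfolding S'_def by (intro dfi)
  note [dfi] = df1_app[OF dS']
  define U where "U \<rho> \<longleftrightarrow> unb l (\<lambda>a. S' a \<and> sub \<rho> (r a))" for \<rho>
  have dU: "df1 U" unfolding U_def unb_def by (intro dfi)
  note [dfi] = df1_app[OF dU]
  have D: "z \<epsilon> Sep (r a) (\<lambda>z. \<not> z \<epsilon> \<rho>) \<longleftrightarrow> z \<epsilon> r a \<and> \<not> z \<epsilon> \<rho>" for z a \<rho> by (rule mem_Sep) (intro dfi)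
  have "\<exists>\<rho>. U \<rho> \<and> (\<forall>z. \<not> z \<epsilon> \<rho> \<longrightarrow> \<not> U (ins z \<rho>))"
  proof (rule ccontr)
    assume no: "\<not> ?thesis"
    \<comment> \<open>If every such set could be enlarged, then for each of them and each
      \<open>k\<close> some \<open>r a\<close> would have more than \<open>k\<close> elements
      outside it. For the empty set and \<open>k = n\<close> this is absurd.\<close>
    have step: "\<forall>\<rho>. U \<rho> \<longrightarrow> (\<exists>a. a \<epsilon> l \<and> S' a \<and> sub \<rho> (r a) \<and> \<not> cle (Sep (r a) (\<lambda>z. \<not> z \<epsilon> \<rho>)) k)" if "k \<epsilon> omega" for k
      using that
    proof (induction rule: omega_induct)
      show "df1 (\<lambda>k. \<forall>\<rho>. U \<rho> \<longrightarrow> (\<exists>a. a \<epsilon> l \<and> S' a \<and> sub \<rho> (r a) \<and> \<not> cle (Sep (r a) (\<lambda>z. \<not> z \<epsilon> \<rho>)) k))"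
        by (intro dfi)
      show "\<forall>\<rho>. U \<rho> \<longrightarrow> (\<exists>a. a \<epsilon> l \<and> S' a \<and> sub \<rho> (r a) \<and> \<not> cle (Sep (r a) (\<lambda>z. \<not> z \<epsilon> \<rho>)) emp)"
      proof (intro allI impI)
        fix \<rho> assume "U \<rho>"
        then obtain z where z: "\<not> z \<epsilon> \<rho>" "U (ins z \<rho>)" using no by blast
        then obtain a where a: "a \<epsilon> l" "S' a" "sub (ins z \<rho>) (r a)"
          using emp_mem[OF l] unfolding U_def unb_def by blast
        then have "z \<epsilon> Sep (r a) (\<lambda>z. \<not> z \<epsilon> \<rho>)" unfolding D using z(1) by simp
        then have "\<not> cle (Sep (r a) (\<lambda>z. \<not> z \<epsilon> \<rho>)) emp" unfolding cle_iff by auto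
        then show "\<exists>a. a \<epsilon> l \<and> S' a \<and> sub \<rho> (r a) \<and> \<not> cle (Sep (r a) (\<lambda>z. \<not> z \<epsilon> \<rho>)) emp" using a by auto
      qed
      fix k assume k: "\<forall>\<rho>. U \<rho> \<longrightarrow> (\<exists>a. a \<epsilon> l \<and> S' a \<and> sub \<rho> (r a) \<and> \<not> cle (Sep (r a) (\<lambda>z. \<not> z \<epsilon> \<rho>)) k)"
      show "\<forall>\<rho>. U \<rho> \<longrightarrow> (\<exists>a. a \<epsilon> l \<and> S' a \<and> sub \<rho> (r a) \<and> \<not> cle (Sep (r a) (\<lambda>z. \<not> z \<epsilon> \<rho>)) (suc k))"
      proof (intro allI impI)
        fix \<rho> assume "U \<rho>"
        then obtain z where z: "\<not> z \<epsilon> \<rho>" "U (ins z \<rho>)" using no by blast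
        then obtain a where a: "a \<epsilon> l" "S' a" "sub (ins z \<rho>) (r a)" "\<not> cle (Sep (r a) (\<lambda>y. \<not> y \<epsilon> ins z \<rho>)) k" using k by blast
        have "Sep (r a) (\<lambda>y. \<not> y \<epsilon> ins z \<rho>) = del z (Sep (r a) (\<lambda>z. \<not> z \<epsilon> \<rho>))"
          by (rule exten) (simp only: D mem_del, auto)
        moreover have "z \<epsilon> Sep (r a) (\<lambda>z. \<not> z \<epsilon> \<rho>)" unfolding D using z(1) a(3) by simp
        ultimately have "\<not> cle (Sep (r a) (\<lambda>z. \<not> z \<epsilon> \<rho>)) (suc k)" using a(4) cle_del by metis
        then show "\<exists>a. a \<epsilon> l \<and> S' a \<and> sub \<rho> (r a) \<and> \<not> cle (Sep (r a) (\<lambda>z. \<not> z \<epsilon> \<rho>)) (suc k)" using a(1-3) by auto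
      qed
    qed
    have "U emp" using n(2) unfolding U_def S'_def by simp
    then obtain a where a: "a \<epsilon> l" "S' a" "\<not> cle (Sep (r a) (\<lambda>z. \<not> z \<epsilon> emp)) n" using step[OF n(1)] by blast
    have "cle (r a) n" using h[OF a(1)] a(2) unfolding S'_def by blast
    then show False using a(3) cle_trans[OF cle_sub[of _ "r a"]] D by blast
  qed
  then obtain \<rho> where \<rho>: "U \<rho>" "\<And>z. \<not> z \<epsilon> \<rho> \<Longrightarrow> \<not> U (ins z \<rho>)" by blast
  show thesis by (rule that[of S' \<rho>]) (use dS' \<rho> in \<open>simp_all only: U_def S'_def simp_thms\<close>)
qed

end

section \<open>Finite conditions and the segments of branches they decide\<close>

locale cohen = zfwo E for E :: "'v \<Rightarrow> 'v \<Rightarrow> bool"  (infix "\<epsilon>" 50) +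
  fixes \<kappa> P :: 'v
  assumes kappa_reg: "sat E (is_regular \<kappa>)" and Fn: "sat E (is_Fn2 \<kappa> P)"
begin

definition bit where "bit b \<longleftrightarrow> b = emp \<or> b = suc emp"
definition flip where "flip b = (if b = emp then suc emp else emp)"

lemma dt_flip [dfi]: "dt t \<Longrightarrow> dt (\<lambda>e. flip (t e))" unfolding flip_def by (intro dfi)

lemma flip [simp]: "bit (flip b)" "flip b \<noteq> b" "bit b \<Longrightarrow> flip (flip b) = b" "bit emp" "bit (suc emp)"
  by (auto simp: flip_def bit_def)

lemma bit_cases: "bit b \<Longrightarrow> bit c \<Longrightarrow> c \<noteq> b \<Longrightarrow> c = flip b"
  by (auto simp: flip_def bit_def)

lemma P_iff: "p \<epsilon> P \<longleftrightarrow> fin p \<and> (\<forall>z. z \<epsilon> p \<longrightarrow> (\<exists>x y. x \<epsilon> \<kappa> \<and> bit y \<and> z = pr x y)) \<and>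
   (\<forall>x y y'. pr x y \<epsilon> p \<and> pr x y' \<epsilon> p \<longrightarrow> y = y')"
proof -
  have "y \<epsilon> suc (suc emp) \<longleftrightarrow> bit y" for y by (auto simp: bit_def)
  then show ?thesis using Fn unfolding is_Fn2_def is_two_def is_partial_fun_def by simp
qed

lemma P_fin: "p \<epsilon> P \<Longrightarrow> fin p" and P_mem: "p \<epsilon> P \<Longrightarrow> pr x y \<epsilon> p \<Longrightarrow> x \<epsilon> \<kappa> \<and> bit y"
  and P_pair: "p \<epsilon> P \<Longrightarrow> z \<epsilon> p \<Longrightarrow> \<exists>x y. z = pr x y" and P_fun: "p \<epsilon> P \<Longrightarrow> pr x y \<epsilon> p \<Longrightarrow> pr x y' \<epsilon> p \<Longrightarrow> y = y'"
proof -
  show "p \<epsilon> P \<Longrightarrow> fin p" unfolding P_iff by blast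
  show "p \<epsilon> P \<Longrightarrow> z \<epsilon> p \<Longrightarrow> \<exists>x y. z = pr x y" unfolding P_iff by blast
  show "p \<epsilon> P \<Longrightarrow> pr x y \<epsilon> p \<Longrightarrow> pr x y' \<epsilon> p \<Longrightarrow> y = y'" unfolding P_iff by blast
  show "x \<epsilon> \<kappa> \<and> bit y" if p: "p \<epsilon> P" "pr x y \<epsilon> p"
  proof -
    obtain u v where "u \<epsilon> \<kappa>" "bit v" "pr x y = pr u v" using p unfolding P_iff by blast
    then show ?thesis by simp
  qed
qed

lemma P_un: assumes "p \<epsilon> P" "q \<epsilon> P" "\<And>x y y'. pr x y \<epsilon> p \<Longrightarrow> pr x y' \<epsilon> q \<Longrightarrow> y = y'" shows "un p q \<epsilon> P"
  unfolding P_iff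
proof (intro conjI allI impI)
  show "fin (un p q)" using fin_un P_fin assms by blast
  show "\<exists>x y. x \<epsilon> \<kappa> \<and> bit y \<and> z = pr x y" if "z \<epsilon> un p q" for z
    using that assms(1,2) unfolding P_iff mem_un by blast
  show "y = y'" if "pr x y \<epsilon> un p q \<and> pr x y' \<epsilon> un p q" for x y y'
    using that P_fun[OF assms(1)] P_fun[OF assms(2)] assms(3) unfolding mem_un by blast
qed

lemma P_emp: "emp \<epsilon> P" unfolding P_iff by simp

lemma P_ins: assumes "p \<epsilon> P" "x \<epsilon> \<kappa>" "bit b" "\<And>y. \<not> pr x y \<epsilon> p" shows "ins (pr x b) p \<epsilon> P"
  unfolding P_iff
proof (intro conjI allI impI)
  show "fin (ins (pr x b) p)" using P_fin[OF assms(1)] by simp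
  show "\<exists>x y. x \<epsilon> \<kappa> \<and> bit y \<and> z = pr x y" if "z \<epsilon> ins (pr x b) p" for z
    using that assms unfolding P_iff mem_ins by blast
  show "y = y'" if "pr u y \<epsilon> ins (pr x b) p \<and> pr u y' \<epsilon> ins (pr x b) p" for u y y'
    using that P_fun[OF assms(1), of u y y'] assms(4) by auto
qed

lemma kappa: "card_in \<kappa>" "sub omega \<kappa>" "dt1 f \<Longrightarrow> a \<epsilon> \<kappa> \<Longrightarrow> (\<And>x. x \<epsilon> a \<Longrightarrow> f x \<epsilon> \<kappa>) \<Longrightarrow> \<exists>b. b \<epsilon> \<kappa> \<and> (\<forall>x. x \<epsilon> a \<longrightarrow> f x \<epsilon> b)"
proof -
  have K: "card_in \<kappa> \<and> sub omega \<kappa> \<and> (\<forall>a f. a \<epsilon> \<kappa> \<and> is_map f a \<kappa> \<longrightarrow> (\<exists>b. b \<epsilon> \<kappa> \<and> (\<forall>x y. pr x y \<epsilon> f \<longrightarrow> y \<epsilon> b)))"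
    using kappa_reg unfolding is_regular_def by simp
  then show "card_in \<kappa>" "sub omega \<kappa>" by blast+
  assume f: "dt1 f" and a: "a \<epsilon> \<kappa>" "\<And>x. x \<epsilon> a \<Longrightarrow> f x \<epsilon> \<kappa>"
  then obtain b where "b \<epsilon> \<kappa>" "\<forall>x y. pr x y \<epsilon> Lam a f \<longrightarrow> y \<epsilon> b" using K is_map_Lam[OF f] by blast
  then show "\<exists>b. b \<epsilon> \<kappa> \<and> (\<forall>x. x \<epsilon> a \<longrightarrow> f x \<epsilon> b)" unfolding mem_Lam[OF f] by blast
qed

lemma Ord_kappa: "Ord \<kappa>" using kappa(1) unfolding card_in_def by blast

lemma Lim_kappa: "Lim \<kappa>"
proof -
  have "\<exists>z. z \<epsilon> \<kappa> \<and> y \<epsilon> z" if "y \<epsilon> \<kappa>" for y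
    using kappa(3)[of "\<lambda>_. y" "suc emp"] kappa(2) suc_omega[OF emp_omega] that by (auto intro: dt_const)
  moreover have "\<kappa> \<noteq> emp" using kappa(2) emp_omega by (intro notI) simp
  ultimately show ?thesis unfolding Lim_def using Ord_kappa by blast
qed

text \<open>The node \<open>(n, a)\<close> with \<open>a \<subseteq> n\<close> stands for the sequence of length \<open>n\<close> whose \<open>i\<close>-th entry tells whether \<open>i \<in> a\<close>;
  \<open>cnd v \<alpha> n a\<close> says that this is the beginning of the \<open>\<alpha>\<close>-th generic real (if \<open>v = 0\<close>) or of its complement (if \<open>v = 1\<close>).\<close>

definition bt where "bt v i a = (if i \<epsilon> a then flip v else v)"
definition cnd where "cnd v \<alpha> n a = Rep n (\<lambda>i. pr (add \<alpha> i) (bt v i a))"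

lemma dt_bt [dfi]: "dt v \<Longrightarrow> dt i \<Longrightarrow> dt a \<Longrightarrow> dt (\<lambda>e. bt (v e) (i e) (a e))" unfolding bt_def by (intro dfi)

lemma dt_cnd [dfi]: assumes "dt v" "dt x" "dt n" "dt a" shows "dt (\<lambda>e. cnd (v e) (x e) (n e) (a e))"
proof -
  have "dt (\<lambda>e. v (\<lambda>n. e (Suc n)))" "dt (\<lambda>e. x (\<lambda>n. e (Suc n)))" "dt (\<lambda>e. a (\<lambda>n. e (Suc n)))"
    using assms dt_ren[of _ Suc] by auto
  then show ?thesis unfolding cnd_def by (intro dfi assms)
qed

lemma mem_cnd: "z \<epsilon> cnd v \<alpha> n a \<longleftrightarrow> (\<exists>i. i \<epsilon> n \<and> z = pr (add \<alpha> i) (bt v i a))"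
  unfolding cnd_def by (rule mem_Rep) (intro dfi)

lemma bit_bt: "bit v \<Longrightarrow> bit (bt v i a)" by (simp add: bt_def)

lemma bt_eq: assumes "bit v" shows "bt v i a = bt v i b \<longleftrightarrow> (i \<epsilon> a \<longleftrightarrow> i \<epsilon> b)"
  using flip(2)[of v] unfolding bt_def by (metis (full_types))

lemma cnd_P: assumes "bit v" "\<alpha> \<epsilon> \<kappa>" "n \<epsilon> omega" shows "cnd v \<alpha> n a \<epsilon> P"
  unfolding P_iff
proof (intro conjI allI impI)
  show "fin (cnd v \<alpha> n a)" unfolding cnd_def by (intro fin_Rep fin_omega_mem assms) (intro dfi)
  have n: "i \<epsilon> omega" if "i \<epsilon> n" for i using omega_trans[OF assms(3)] that by blast
  show "\<exists>x y. x \<epsilon> \<kappa> \<and> bit y \<and> z = pr x y" if "z \<epsilon> cnd v \<alpha> n a" for z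
    using that n add_mem[OF Lim_kappa assms(2)] bit_bt[OF assms(1)] unfolding mem_cnd by blast
  show "y = y'" if "pr x y \<epsilon> cnd v \<alpha> n a \<and> pr x y' \<epsilon> cnd v \<alpha> n a" for x y y'
    using that add_inj[OF n n, of _ _ \<alpha>] unfolding mem_cnd by auto
qed

text \<open>With \<open>n\<close> the length of the decided segment of a branch, this leaves its
  continuation free; \<open>off \<alpha> emp p\<close> says that the whole block is
  untouched.\<close>

definition off where "off \<alpha> n p \<longleftrightarrow> (\<forall>i y. i \<epsilon> omega \<and> \<not> i \<epsilon> n \<longrightarrow> \<not> pr (add \<alpha> i) y \<epsilon> p)"

lemma df_off [dfi]: assumes "dt a" "dt n" "dt p" shows "df (\<lambda>e. off (a e) (n e) (p e))"
proof -
  have r: "dt t \<Longrightarrow> dt (\<lambda>e. t (\<lambda>n. e (Suc (Suc n))))" for t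
    using dt_ren[of t "\<lambda>n. Suc (Suc n)"] by auto
  show ?thesis unfolding off_def by (intro dfi r assms)
qed

lemma off_ex: assumes "p \<epsilon> P" shows "\<exists>n. n \<epsilon> omega \<and> off \<alpha> n p"
proof -
  let ?I = "Sep omega (\<lambda>i. \<exists>y. pr (add \<alpha> i) y \<epsilon> p)"
  have I: "i \<epsilon> ?I \<longleftrightarrow> i \<epsilon> omega \<and> (\<exists>y. pr (add \<alpha> i) y \<epsilon> p)" for i by (rule mem_Sep) (intro dfi)
  have "cle ?I p"
  proof (rule cleI)
    show "dt1 (\<lambda>i. pr (add \<alpha> i) (app p (add \<alpha> i)))" by (intro dfi)
    show "inj_on (\<lambda>i. pr (add \<alpha> i) (app p (add \<alpha> i))) (el ?I)"
      by (rule inj_onI) (use add_inj I in auto)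
    show "pr (add \<alpha> i) (app p (add \<alpha> i)) \<epsilon> p" if i: "i \<epsilon> ?I" for i
    proof -
      obtain y where y: "pr (add \<alpha> i) y \<epsilon> p" using i I by blast
      then have "app p (add \<alpha> i) = y" by (rule app_eq) (use P_fun[OF assms] y in blast)
      then show ?thesis using y by simp
    qed
  qed
  then have "fin ?I" using fin_cle P_fin[OF assms] by blast
  then obtain n where "n \<epsilon> omega" "sub ?I n" using fin_bounded_omega[of ?I] I by blast
  then show ?thesis unfolding off_def using I by blast
qed

lemma omega_max: assumes "n \<epsilon> omega" "m \<epsilon> omega" shows "\<exists>k. k \<epsilon> omega \<and> sub n k \<and> sub m k"
proof -
  have o: "Ord n" "Ord m" using assms Ord_omega_mem by blast+
  then show ?thesis using Ord_linear[OF o] Ord_trans[OF o(1)] Ord_trans[OF o(2)] assms by blast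
qed

text \<open>The length \<open>n\<close> exceeds all offsets of the block used by \<open>p\<close>,
  and the undecided coordinates below it are filled with 0. The result decides the branch exactly up
  to length \<open>n\<close>.\<close>

lemma extend:
  assumes p: "p \<epsilon> P" and v: "bit v" and \<alpha>: "\<alpha> \<epsilon> \<kappa>" and n0: "n0 \<epsilon> omega"
  obtains q n a where "q \<epsilon> P" "sub p q" "n \<epsilon> omega" "sub n0 n" "sub a n" "sub (cnd v \<alpha> n a) q" "off \<alpha> n q"
    "\<And>x y. pr x y \<epsilon> q \<Longrightarrow> pr x y \<epsilon> p \<or> (\<exists>i. i \<epsilon> omega \<and> x = add \<alpha> i)"
proof -
  obtain m where m: "m \<epsilon> omega" "off \<alpha> m p" using off_ex[OF p] by blast
  obtain n where n: "n \<epsilon> omega" "sub n0 n" "sub m n" using omega_max[OF n0 m(1)] by blast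
  have nw: "i \<epsilon> omega" if "i \<epsilon> n" for i using omega_trans[OF n(1)] that by blast
  let ?J = "Sep n (\<lambda>i. \<forall>y. \<not> pr (add \<alpha> i) y \<epsilon> p)"
  have J: "i \<epsilon> ?J \<longleftrightarrow> i \<epsilon> n \<and> (\<forall>y. \<not> pr (add \<alpha> i) y \<epsilon> p)" for i by (rule mem_Sep) (intro dfi)
  have dR: "dt1 (\<lambda>i. pr (add \<alpha> i) emp)" by (intro dfi)
  let ?s = "Rep ?J (\<lambda>i. pr (add \<alpha> i) emp)"
  have s: "z \<epsilon> ?s \<longleftrightarrow> (\<exists>i. i \<epsilon> n \<and> (\<forall>y. \<not> pr (add \<alpha> i) y \<epsilon> p) \<and> z = pr (add \<alpha> i) emp)" for z
    unfolding mem_Rep[OF dR] J by blast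
  have "sub ?s (cnd emp \<alpha> n emp)" unfolding s mem_cnd by (auto simp: bt_def)
  moreover have cP: "cnd emp \<alpha> n emp \<epsilon> P" by (rule cnd_P[OF _ \<alpha> n(1)]) simp
  ultimately have sP: "?s \<epsilon> P" using fin_sub[OF P_fin[OF cP]] unfolding P_iff by blast
  let ?q = "un p ?s"
  have q: "?q \<epsilon> P" by (rule P_un[OF p sP]) (auto simp: s)
  have qd: "pr x y \<epsilon> p \<or> (\<exists>i. i \<epsilon> n \<and> x = add \<alpha> i)" if "pr x y \<epsilon> ?q" for x y
    using that unfolding mem_un s by auto
  \<comment> \<open>\<open>bt\<close> takes the value \<open>flip v\<close> exactly on the node, so
    the node is read off from the coordinates with this value.\<close>
  let ?a = "Sep n (\<lambda>i. pr (add \<alpha> i) (flip v) \<epsilon> ?q)"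
  have a: "i \<epsilon> ?a \<longleftrightarrow> i \<epsilon> n \<and> pr (add \<alpha> i) (flip v) \<epsilon> ?q" for i by (rule mem_Sep) (intro dfi)
  show thesis
  proof (rule that[of ?q n ?a])
    show "sub ?a n" using a by blast
    have "pr (add \<alpha> i) (bt v i ?a) \<epsilon> ?q" if i: "i \<epsilon> n" for i
    proof -
      have "\<exists>y. pr (add \<alpha> i) y \<epsilon> ?q" unfolding mem_un s using i by blast
      then obtain y where y: "pr (add \<alpha> i) y \<epsilon> ?q" by blast
      have "y = bt v i ?a"
      proof (cases "y = flip v")
        case True then show ?thesis using a i y unfolding bt_def by simp
      next
        case False
        then have "\<not> i \<epsilon> ?a" using a P_fun[OF q y] by blast
        moreover have "y = flip (flip v)" by (rule bit_cases) (use P_mem[OF q y] False in simp_all)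
        ultimately show ?thesis using v unfolding bt_def by simp
      qed
      then show ?thesis using y by simp
    qed
    then show "sub (cnd v \<alpha> n ?a) ?q" unfolding mem_cnd by blast
    show "off \<alpha> n ?q" unfolding off_def
    proof (intro allI impI notI, elim conjE)
      fix i y assume i: "i \<epsilon> omega" "\<not> i \<epsilon> n" "pr (add \<alpha> i) y \<epsilon> ?q"
      then have "\<not> i \<epsilon> m" using n(3) by blast
      then have "\<not> pr (add \<alpha> i) y \<epsilon> p" using m(2) i(1) unfolding off_def by blast
      then obtain j where "j \<epsilon> n" "add \<alpha> i = add \<alpha> j" using qd[OF i(3)] by blast
      then show False using add_inj[OF i(1) nw] i(2) by blast
    qed
    show "pr x y \<epsilon> p \<or> (\<exists>i. i \<epsilon> omega \<and> x = add \<alpha> i)" if "pr x y \<epsilon> ?q" for x y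
      using qd[OF that] nw by blast
  qed (use q n in simp_all)
qed

text \<open>Below \<open>n\<close> the new node agrees with the decided one, and from
  \<open>n\<close> on the block is untouched; so the branch can be led into any node above the
  decided one.\<close>

lemma extend_cnd:
  assumes q: "q \<epsilon> P" and v: "bit v" and \<alpha>: "\<alpha> \<epsilon> \<kappa>" and c: "sub (cnd v \<alpha> n a) q" and off: "off \<alpha> n q"
    and n': "n' \<epsilon> omega" "sub n n'" "\<And>i. i \<epsilon> n \<Longrightarrow> i \<epsilon> a \<longleftrightarrow> i \<epsilon> a'"
  shows "un q (cnd v \<alpha> n' a') \<epsilon> P"
proof (rule P_un[OF q cnd_P[OF v \<alpha> n'(1)]])
  fix x y y' assume x: "pr x y \<epsilon> q" "pr x y' \<epsilon> cnd v \<alpha> n' a'"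
  then obtain i where i: "i \<epsilon> n'" "x = add \<alpha> i" "y' = bt v i a'" unfolding mem_cnd by auto
  have "i \<epsilon> omega" using omega_trans[OF n'(1)] i(1) by blast
  then have "i \<epsilon> n" using off x(1) i(2) unfolding off_def by blast
  then have "pr x (bt v i a) \<epsilon> q" using c i(2) unfolding mem_cnd by blast
  then have "y = bt v i a" using P_fun[OF q x(1)] by blast
  then show "y = y'" using i(3) n'(3)[OF \<open>i \<epsilon> n\<close>] unfolding bt_def by simp
qed

lemma cnd_agree: assumes r: "r \<epsilon> P" and v: "bit v" and "sub (cnd v \<alpha> n a) r" "sub (cnd v \<alpha> m b) r" "i \<epsilon> n" "i \<epsilon> m"
  shows "i \<epsilon> a \<longleftrightarrow> i \<epsilon> b"
proof -
  have "pr (add \<alpha> i) (bt v i a) \<epsilon> r" "pr (add \<alpha> i) (bt v i b) \<epsilon> r" using assms(3-) unfolding mem_cnd by blast+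
  then have "bt v i a = bt v i b" using P_fun[OF r] by blast
  then show ?thesis using bt_eq[OF v] by blast
qed

lemma cnd_sub: "sub m n \<Longrightarrow> (\<And>i. i \<epsilon> m \<Longrightarrow> i \<epsilon> a \<longleftrightarrow> i \<epsilon> b) \<Longrightarrow> sub (cnd v \<alpha> m a) (cnd v \<alpha> n b)"
  unfolding mem_cnd bt_def by auto

text \<open>For equal indices the two readings are complementary and differ at 0. For different
  indices an offset \<open>m\<close> beyond the traces of \<open>p\<close> on both blocks is used:
  the coordinates \<alpha> + m and \<beta> + m are distinct even if the blocks overlap.\<close>

lemma split:
  assumes p: "p \<epsilon> P" and v: "bit v" "bit v'" and \<alpha>: "\<alpha> \<epsilon> \<kappa>" "\<beta> \<epsilon> \<kappa>" and ne: "\<alpha> \<noteq> \<beta> \<or> v \<noteq> v'"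
  obtains r n a a' i where "r \<epsilon> P" "sub p r" "n \<epsilon> omega" "sub (cnd v \<alpha> n a) r" "sub (cnd v' \<beta> n a') r"
    "i \<epsilon> n" "\<not> (i \<epsilon> a \<longleftrightarrow> i \<epsilon> a')"
proof (cases "\<alpha> = \<beta>")
  case True
  then have v': "v' = flip v" "v = flip v'" using bit_cases v ne by blast+
  obtain q n a where q: "q \<epsilon> P" "sub p q" "n \<epsilon> omega" "sub (suc emp) n" "sub a n" "sub (cnd v \<alpha> n a) q"
    using extend[OF p v(1) \<alpha>(1) suc_omega[OF emp_omega]] by metis
  have a': "i \<epsilon> Sep n (\<lambda>i. \<not> i \<epsilon> a) \<longleftrightarrow> i \<epsilon> n \<and> \<not> i \<epsilon> a" for i by (rule mem_Sep) (intro dfi)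
  have "bt v' i (Sep n (\<lambda>i. \<not> i \<epsilon> a)) = bt v i a" if "i \<epsilon> n" for i
    using that v(1) unfolding bt_def a' v'(1) by simp
  then have "sub (cnd v' \<beta> n (Sep n (\<lambda>i. \<not> i \<epsilon> a))) q" using q(6) True unfolding mem_cnd by metis
  moreover have "emp \<epsilon> n" using q(4) by simp
  ultimately show thesis using that[OF q(1-3,6), of _ emp] a' by blast
next
  case False
  obtain m1 m2 where m12: "m1 \<epsilon> omega" "off \<alpha> m1 p" "m2 \<epsilon> omega" "off \<beta> m2 p" using off_ex[OF p] by metis
  obtain m where m: "m \<epsilon> omega" "sub m1 m" "sub m2 m" using omega_max[OF m12(1,3)] by blast
  have nm: "\<not> pr (add \<alpha> m) y \<epsilon> p" "\<not> pr (add \<beta> m) y \<epsilon> p" for y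
    using m12(2,4) m not_mem_self[of m] unfolding off_def by blast+
  have ne': "add \<alpha> m \<noteq> add \<beta> m" using add_inj2[OF m(1)] False by blast
  \<comment> \<open>These values put \<open>m\<close> into the node on the first branch and keep it
    out of the node on the second.\<close>
  let ?p = "ins (pr (add \<alpha> m) (flip v)) (ins (pr (add \<beta> m) v') p)"
  have p': "?p \<epsilon> P"
    by (intro P_ins p add_mem[OF Lim_kappa] \<alpha> m(1) v flip(1)) (use nm ne' in auto)
  obtain q n a where q: "q \<epsilon> P" "sub ?p q" "n \<epsilon> omega" "sub (suc m) n" "sub (cnd v \<alpha> n a) q"
    using extend[OF p' v(1) \<alpha>(1) suc_omega[OF m(1)]] by metis
  obtain r n' b where r: "r \<epsilon> P" "sub q r" "n' \<epsilon> omega" "sub n n'" "sub (cnd v' \<beta> n' b) r"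
    using extend[OF q(1) v(2) \<alpha>(2) q(3)] by metis
  have mn: "m \<epsilon> n" "m \<epsilon> n'" using q(4) r(4) by simp_all
  have "pr (add \<alpha> m) (bt v m a) \<epsilon> r" "pr (add \<alpha> m) (flip v) \<epsilon> r"
    using q(2,5) r(2) mn unfolding mem_cnd by (blast, simp)
  then have "bt v m a = flip v" using P_fun[OF r(1)] by blast
  then have ma: "m \<epsilon> a" unfolding bt_def using flip(2)[of v] by (metis (full_types))
  have "pr (add \<beta> m) (bt v' m b) \<epsilon> r" "pr (add \<beta> m) v' \<epsilon> r"
    using q(2) r(2,5) mn unfolding mem_cnd by (blast, simp)
  then have "bt v' m b = v'" using P_fun[OF r(1)] by blast
  then have mb: "\<not> m \<epsilon> b" unfolding bt_def using flip(2)[of v'] by (metis (full_types))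
  have "sub (cnd v' \<beta> n b) (cnd v' \<beta> n' b)" by (rule cnd_sub[OF r(4)]) simp
  then have "sub (cnd v' \<beta> n b) r" using r(5) by blast
  then show thesis using that[OF r(1) _ q(3) _ _ mn(1), of a b] q(2,5) r(2) ma mb by auto
qed

text \<open>What is left of the Delta-system lemma: the root can be extended arbitrarily, and the
  extension will still be compatible with some \<open>r a\<close>.\<close>

lemma root:
  assumes l: "Lim l" and reg: "\<And>f. dt1 f \<Longrightarrow> (\<And>n. n \<epsilon> omega \<Longrightarrow> f n \<epsilon> l) \<Longrightarrow> \<exists>b. b \<epsilon> l \<and> (\<forall>n. n \<epsilon> omega \<longrightarrow> f n \<epsilon> b)"
    and S: "df1 S" "unb l S" and r: "dt1 r" "\<And>a. a \<epsilon> l \<Longrightarrow> S a \<Longrightarrow> r a \<epsilon> P \<and> sub q (r a)"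
  obtains \<rho> where "\<rho> \<epsilon> P" "sub q \<rho>"
    "\<And>s. s \<epsilon> P \<Longrightarrow> sub \<rho> s \<Longrightarrow> \<exists>a. a \<epsilon> l \<and> S a \<and> un (r a) s \<epsilon> P \<and> (\<forall>n y. \<not> pr (add a n) y \<epsilon> s \<or> \<not> n \<epsilon> omega)"
proof -
  note [dfi] = dt1_app[OF r(1)]
  have ol: "Ord l" "l \<noteq> emp" using l unfolding Lim_def by blast+
  obtain S' \<rho> where S': "df1 S'" "\<And>a. S' a \<Longrightarrow> S a" "unb l (\<lambda>a. S' a \<and> sub \<rho> (r a))"
    and mx: "\<And>z. \<not> z \<epsilon> \<rho> \<Longrightarrow> \<not> unb l (\<lambda>a. S' a \<and> sub (ins z \<rho>) (r a))"
    using max_root[OF ol reg S r(1)] r(2) P_fin by blast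
  note [dfi] = df1_app[OF S'(1)]
  obtain a0 where a0: "a0 \<epsilon> l" "S' a0" "sub \<rho> (r a0)" using S'(3) emp_mem[OF ol] unfolding unb_def by blast
  have r0: "r a0 \<epsilon> P" using r(2) a0 S'(2) by blast
  have \<rho>: "\<rho> \<epsilon> P" using r0 a0(3) fin_sub[OF P_fin[OF r0] a0(3)] unfolding P_iff by blast
  \<comment> \<open>Every \<open>r a\<close> contains \<open>q\<close>, so an element of
    \<open>q\<close> outside the root could be added to it.\<close>
  have q\<rho>: "sub q \<rho>"
  proof (intro allI impI, rule ccontr)
    fix z assume z: "z \<epsilon> q" "\<not> z \<epsilon> \<rho>"
    have "unb l (\<lambda>a. S' a \<and> sub (ins z \<rho>) (r a))"
      using S'(2,3) r(2) z(1) unfolding unb_def mem_ins by metis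
    then show False using mx[OF z(2)] by blast
  qed
  have main: "\<exists>a. a \<epsilon> l \<and> S a \<and> un (r a) s \<epsilon> P \<and> (\<forall>n y. \<not> pr (add a n) y \<epsilon> s \<or> \<not> n \<epsilon> omega)" if s: "s \<epsilon> P" "sub \<rho> s" for s
  proof -
    \<comment> \<open>The pairs contradicting \<open>s\<close>. None of them is in the root, so by
      maximality each occurs in \<open>r a\<close> only for a bounded set of indices; beyond these
      finitely many bounds \<open>r a\<close> is compatible with \<open>s\<close>.\<close>
    let ?c = "\<lambda>z. pr (pfst z) (flip (psnd z))"
    have dc: "dt1 ?c" by (intro dfi)
    let ?Q = "\<lambda>z b. b \<epsilon> l \<and> (\<not> z \<epsilon> \<rho> \<longrightarrow> (\<forall>a. a \<epsilon> l \<and> S' a \<and> sub (ins z \<rho>) (r a) \<longrightarrow> a \<epsilon> b))"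
    have "df2 ?Q" by (intro dfi)
    moreover have "\<exists>b. ?Q z b" if "z \<epsilon> Rep s ?c" for z using mx[of z] a0(1) unfolding unb_def by blast
    ultimately obtain f where f: "dt1 f" "\<And>z. z \<epsilon> Rep s ?c \<Longrightarrow> ?Q z (f z)" using choice[of ?Q "Rep s ?c"] by blast
    have "fin (Rep (Rep s ?c) f)" by (intro fin_Rep P_fin[OF s(1)] dc f(1))
    then obtain b where b: "b \<epsilon> l" "\<And>x. x \<epsilon> Rep (Rep s ?c) f \<Longrightarrow> x \<epsilon> l \<Longrightarrow> x \<epsilon> b" using fin_bounded[OF _ l] by blast
    have dp: "dt1 pfst" by (intro dfi)
    \<comment> \<open>An index \<open>a\<close> beyond the coordinates of \<open>s\<close> that lie
      below \<open>l\<close> has a block missing \<open>s\<close>, because \<open>add a n\<close> is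
      below \<open>l\<close> but not below \<open>a\<close>.\<close>
    obtain c where c: "c \<epsilon> l" "\<And>x. x \<epsilon> Rep s pfst \<Longrightarrow> x \<epsilon> l \<Longrightarrow> x \<epsilon> c"
      using fin_bounded[OF fin_Rep[OF P_fin[OF s(1)] dp] l] by blast
    have ob: "Ord b" "Ord c" using Ord_mem[OF ol(1)] b(1) c(1) by blast+
    obtain d where d: "d \<epsilon> l" "sub b d" "sub c d"
      using Ord_linear[OF ob] Ord_trans[OF ob(1)] Ord_trans[OF ob(2)] b(1) c(1) by blast
    obtain a where a: "a \<epsilon> l" "\<not> a \<epsilon> d" "S' a" "sub \<rho> (r a)" using S'(3) d(1) unfolding unb_def by blast
    have ra: "r a \<epsilon> P" using r(2) a(1,3) S'(2) by blast
    have oa: "Ord a" "Ord d" using Ord_mem[OF ol(1)] a(1) d(1) by blast+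
    have da: "sub d a" using Ord_not_mem[OF oa] a(2) by blast
    have "un (r a) s \<epsilon> P"
    proof (rule P_un[OF ra s(1)])
      fix x y y' assume x: "pr x y \<epsilon> r a" "pr x y' \<epsilon> s"
      show "y = y'"
      proof (rule ccontr)
        assume ne: "y \<noteq> y'"
        then have y: "y = flip y'" using bit_cases P_mem[OF ra x(1)] P_mem[OF s(1) x(2)] by blast
        have "?c (pr x y') \<epsilon> Rep s ?c" unfolding mem_Rep[OF dc] using x(2) by blast
        then have z: "pr x y \<epsilon> Rep s ?c" using y by simp
        have "\<not> pr x y \<epsilon> \<rho>" using s(2) P_fun[OF s(1) _ x(2)] ne by blast
        then have "a \<epsilon> f (pr x y)" using f(2)[OF z] a x(1) by auto
        moreover have "f (pr x y) \<epsilon> b" by (rule b(2)) (use f(2)[OF z] z in \<open>unfold mem_Rep[OF f(1)], blast+\<close>)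
        ultimately have "a \<epsilon> d" using Ord_trans[OF ob(1)] d(2) by blast
        then show False using a(2) by blast
      qed
    qed
    moreover have "\<not> pr (add a n) y \<epsilon> s" if n: "n \<epsilon> omega" for n y
    proof
      assume m: "pr (add a n) y \<epsilon> s"
      have "add a n \<epsilon> Rep s pfst" unfolding mem_Rep[OF dp] using m by (intro exI[of _ "pr (add a n) y"]) simp
      then have "add a n \<epsilon> a" using c(2) add_mem[OF l a(1) n] d(3) da by blast
      then show False using add_not_mem by blast
    qed
    ultimately show ?thesis using a(1,3) S'(2) by blast
  qed
  show thesis by (rule that[OF \<rho> q\<rho> main])
qed

end

section \<open>Forcing statements about pairs and check names\<close>

text \<open>A variant of \<open>is_ord\<close> with guarded quantifiers only, the shape for which
  the rules \<open>absi\<close> evaluate forcing on check names.\<close>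

definition ordf :: "'v \<Rightarrow> 'v form" where
  "ordf x = ((\<^bold>\<forall>y. y \<^bold>\<in> x \<^bold>\<longrightarrow> (\<^bold>\<forall>z. z \<^bold>\<in> y \<^bold>\<longrightarrow> z \<^bold>\<in> x)) \<^bold>\<and>
    (\<^bold>\<forall>y. y \<^bold>\<in> x \<^bold>\<longrightarrow> (\<^bold>\<forall>z. z \<^bold>\<in> x \<^bold>\<longrightarrow> y \<^bold>\<in> z \<^bold>\<or> y \<^bold>= z \<^bold>\<or> z \<^bold>\<in> y)))"
definition omf :: "'v \<Rightarrow> 'v form" where
  "omf w = (ordf w \<^bold>\<and> (\<^bold>\<exists>x. x \<^bold>\<in> w \<^bold>\<and> x \<^bold>= x) \<^bold>\<and> (\<^bold>\<forall>x. x \<^bold>\<in> w \<^bold>\<longrightarrow> (\<^bold>\<exists>y. y \<^bold>\<in> w \<^bold>\<and> x \<^bold>\<in> y)) \<^bold>\<and>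
    (\<^bold>\<forall>x. x \<^bold>\<in> w \<^bold>\<longrightarrow> (\<^bold>\<forall>y. y \<^bold>\<in> x \<^bold>\<longrightarrow> \<^bold>\<not> y \<^bold>= y) \<^bold>\<or> (\<^bold>\<exists>y. y \<^bold>\<in> x \<^bold>\<and> (\<^bold>\<forall>z. z \<^bold>\<in> x \<^bold>\<longrightarrow> z \<^bold>\<in> y \<^bold>\<or> z \<^bold>= y))))"
definition funf :: "'v \<Rightarrow> 'v form" where
  "funf f = (\<^bold>\<forall>i y y'. pair_in i y f \<^bold>\<and> pair_in i y' f \<^bold>\<longrightarrow> y \<^bold>= y')"
definition injf :: "'v \<Rightarrow> 'v \<Rightarrow> 'v \<Rightarrow> 'v form" where
  "injf g a w = ((\<^bold>\<forall>i. i \<^bold>\<in> a \<^bold>\<longrightarrow> (\<^bold>\<exists>n. n \<^bold>\<in> w \<^bold>\<and> pair_in i n g)) \<^bold>\<and>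
    (\<^bold>\<forall>i i' n. pair_in i n g \<^bold>\<and> pair_in i' n g \<^bold>\<longrightarrow> i \<^bold>= i') \<^bold>\<and> funf g)"
text \<open>Choice for the extension as assumed in \<open>zfwo\<close>: an ordinal enumerates the
  members of any given set. As a single sentence it can be forced and handed over to the term
  model.\<close>

definition wof :: "'v form" where
  "wof = (\<^bold>\<forall>x. \<^bold>\<exists>d f. ordf d \<^bold>\<and> (\<^bold>\<forall>y. y \<^bold>\<in> x \<^bold>\<longrightarrow> (\<^bold>\<exists>i. i \<^bold>\<in> d \<^bold>\<and> pair_in i y f)) \<^bold>\<and> funf f)"

lemma forel_pair_in [fori]: "forel (\<lambda>e. pair_in (e i) (e j) (e k)) (\<lambda>e. pair_in (e i) (e j) (e k))"
  unfolding pair_in_def is_pair_def is_upair_def by (intro fori)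

lemma forel_ordf [fori]: "forel (\<lambda>e. ordf (e i)) (\<lambda>e. ordf (e i))" unfolding ordf_def by (intro fori)
lemma forel_omf [fori]: "forel (\<lambda>e. omf (e i)) (\<lambda>e. omf (e i))" unfolding omf_def by (intro fori)
lemma forel_funf [fori]: "forel (\<lambda>e. funf (e i)) (\<lambda>e. funf (e i))" unfolding funf_def by (intro fori)
lemma forel_injf [fori]: "forel (\<lambda>e. injf (e i) (e j) (e k)) (\<lambda>e. injf (e i) (e j) (e k))" unfolding injf_def by (intro fori)
lemma forel_wof [fori]: "forel (\<lambda>e. wof) (\<lambda>e. wof)" unfolding wof_def by (intro fori)

context zf
begin

lemma sat_ordf [simp]: "sat E (ordf x) \<longleftrightarrow> Ord x"
  unfolding ordf_def Ord_def by auto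

lemma sat_omf [simp]: "sat E (omf w) \<Longrightarrow> w = omega"
proof -
  assume w: "sat E (omf w)"
  then have o: "Ord w" and ne: "w \<noteq> emp" and nm: "\<And>x. x \<epsilon> w \<Longrightarrow> \<exists>y. y \<epsilon> w \<and> x \<epsilon> y"
    and nl: "\<And>x. x \<epsilon> w \<Longrightarrow> (\<forall>y. \<not> y \<epsilon> x) \<or> (\<exists>y. y \<epsilon> x \<and> (\<forall>z. z \<epsilon> x \<longrightarrow> z \<epsilon> y \<or> z = y))"
    unfolding omf_def by auto
  have "\<not> Lim x" if x: "x \<epsilon> w" for x
  proof
    assume L: "Lim x"
    then obtain y where y: "y \<epsilon> x" "\<And>z. z \<epsilon> x \<Longrightarrow> z \<epsilon> y \<or> z = y"
      using nl[OF x] emp_iff[of x] unfolding Lim_def by blast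
    obtain z where z: "z \<epsilon> x" "y \<epsilon> z" using L y(1) unfolding Lim_def by blast
    show False using y(2)[OF z(1)] z(2) not_mem_sym[OF z(2)] by auto
  qed
  moreover have "Lim w" unfolding Lim_def using o ne nm by blast
  ultimately show ?thesis using Lim_omega_iff by blast
qed

lemma sat_injf: assumes "sat E (injf g a b)" shows "cle a b"
proof -
  have g: "\<And>i. i \<epsilon> a \<Longrightarrow> \<exists>n. n \<epsilon> b \<and> pr i n \<epsilon> g" "\<And>i i' n. pr i n \<epsilon> g \<Longrightarrow> pr i' n \<epsilon> g \<Longrightarrow> i = i'"
    "\<And>i n n'. pr i n \<epsilon> g \<Longrightarrow> pr i n' \<epsilon> g \<Longrightarrow> n = n'" using assms unfolding injf_def funf_def by auto
  have ap: "app g i \<epsilon> b \<and> pr i (app g i) \<epsilon> g" if i: "i \<epsilon> a" for i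
  proof -
    obtain n where n: "n \<epsilon> b" "pr i n \<epsilon> g" using g(1)[OF i] by blast
    have "app g i = n" by (rule app_eq[OF n(2)]) (use g(3) n(2) in blast)
    then show ?thesis using n by simp
  qed
  show ?thesis
  proof (rule cleI[OF dt1_appf])
    show "inj_on (app g) (el a)"
    proof (rule inj_onI)
      fix i j assume ij: "i \<in> el a" "j \<in> el a" "app g i = app g j"
      then show "i = j" using ap[of i] ap[of j] g(2)[of i "app g j" j] by simp
    qed
  qed (use ap in blast)
qed

lemma sat_wof: assumes "sat E wof" shows "zfwo E"
proof unfold_locales
  fix x
  have w: "\<forall>x. \<exists>d f. Ord d \<and> (\<forall>y. y \<epsilon> x \<longrightarrow> (\<exists>i. i \<epsilon> d \<and> pr i y \<epsilon> f)) \<and> (\<forall>i y y'. pr i y \<epsilon> f \<and> pr i y' \<epsilon> f \<longrightarrow> y = y')"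
    using assms unfolding wof_def funf_def by simp
  then show "\<exists>d f. Ord d \<and> (\<forall>y. y \<epsilon> x \<longrightarrow> (\<exists>i. i \<epsilon> d \<and> pr i y \<epsilon> f)) \<and> (\<forall>i y y'. pr i y \<epsilon> f \<and> pr i y' \<epsilon> f \<longrightarrow> y = y')"
    by (rule spec)
qed

end

context forcing
begin

section \<open>Guarded quantifiers and absoluteness for check names\<close>

named_theorems fci
named_theorems absi

text \<open>Invariance under forced equality. It allows an arbitrary member of a set to be replaced
  by the listed name to which it is forced equal.\<close>

definition fcong where "fcong \<phi> \<longleftrightarrow> (\<forall>p x y. p \<epsilon> P \<and> feq p x y \<and> fo (\<phi> x) p \<longrightarrow> fo (\<phi> y) p)"

lemma fcongD: "fcong \<phi> \<Longrightarrow> p \<epsilon> P \<Longrightarrow> feq p x y \<Longrightarrow> fo (\<phi> x) p \<Longrightarrow> fo (\<phi> y) p"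
  unfolding fcong_def by blast

lemma fcong_basic [fci]:
  "fcong (\<lambda>x. \<psi>)" "fcong (\<lambda>x. x \<^bold>\<in> t)" "fcong (\<lambda>x. t \<^bold>\<in> x)" "fcong (\<lambda>x. x \<^bold>= t)" "fcong (\<lambda>x. t \<^bold>= x)"
  "fcong \<phi> \<Longrightarrow> fcong \<phi>' \<Longrightarrow> fcong (\<lambda>x. \<phi> x \<^bold>\<and> \<phi>' x)"
  "fcong \<phi> \<Longrightarrow> fcong (\<lambda>x. \<^bold>\<not> \<phi> x)"
  "(\<And>z. fcong (\<lambda>x. \<chi> z x)) \<Longrightarrow> fcong (\<lambda>x. \<^bold>\<forall>z. \<chi> z x)"
proof -
  show "fcong (\<lambda>x. x \<^bold>\<in> t)" unfolding fcong_def using fmem_feq1 by auto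
  show "fcong (\<lambda>x. t \<^bold>\<in> x)" unfolding fcong_def using fmem_feq2 by auto
  show "fcong (\<lambda>x. x \<^bold>= t)" unfolding fcong_def using feq_trans feq_sym by (metis forces.simps(2))
  show "fcong (\<lambda>x. t \<^bold>= x)" unfolding fcong_def using feq_trans by (metis forces.simps(2))
  show "fcong (\<lambda>x. \<^bold>\<not> \<phi> x)" if "fcong \<phi>"
    unfolding fcong_def
  proof (intro allI impI, elim conjE)
    fix p x y assume p: "p \<epsilon> P" "feq p x y" and n: "fo (\<^bold>\<not> \<phi> x) p"
    have "fo (\<phi> x) q" if q: "q \<epsilon> P" "le q p" "fo (\<phi> y) q" for q
      using fcongD[OF \<open>fcong \<phi>\<close> q(1) feq_sym[OF q(1) feq_mono[OF p(2,1) q(1,2)]] q(3)] .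
    then show "fo (\<^bold>\<not> \<phi> y) p" using n by auto
  qed
qed (auto simp: fcong_def)

lemma fcong_derived [fci]:
  "fcong \<phi> \<Longrightarrow> fcong \<phi>' \<Longrightarrow> fcong (\<lambda>x. \<phi> x \<^bold>\<or> \<phi>' x)"
  "fcong \<phi> \<Longrightarrow> fcong \<phi>' \<Longrightarrow> fcong (\<lambda>x. \<phi> x \<^bold>\<longrightarrow> \<phi>' x)"
  "fcong \<phi> \<Longrightarrow> fcong \<phi>' \<Longrightarrow> fcong (\<lambda>x. \<phi> x \<^bold>\<longleftrightarrow> \<phi>' x)"
  "(\<And>z. fcong (\<lambda>x. \<chi> z x)) \<Longrightarrow> fcong (\<lambda>x. \<^bold>\<exists>z. \<chi> z x)"
  unfolding Disj_def Imp_def Iff_def Ex_def by (intro fci; assumption)+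

lemma fcong_pair_in [fci]:
  "fcong (\<lambda>x. pair_in x b r)" "fcong (\<lambda>x. pair_in a x r)" "fcong (\<lambda>x. pair_in a b x)"
  unfolding pair_in_def is_pair_def is_upair_def by (intro fci)+

lemma fo_ball_sn: assumes f: "dt1 f" "\<And>u. u \<epsilon> a \<Longrightarrow> name (f u)" and c: "fcong \<phi>" and p: "p \<epsilon> P"
  shows "fo (\<^bold>\<forall>y. y \<^bold>\<in> sn a f \<^bold>\<longrightarrow> \<phi> y) p \<longleftrightarrow> (\<forall>u. u \<epsilon> a \<longrightarrow> fo (\<phi> (f u)) p)"
proof (intro iffI allI impI)
  fix u assume h: "fo (\<^bold>\<forall>y. y \<^bold>\<in> sn a f \<^bold>\<longrightarrow> \<phi> y) p" and u: "u \<epsilon> a"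
  then have "fo (f u \<^bold>\<in> sn a f \<^bold>\<longrightarrow> \<phi> (f u)) p" using f(2) by simp
  then show "fo (\<phi> (f u)) p" unfolding fo_Imp[OF p] using p le_refl fmem_snI[OF f(1) u p] by simp
next
  assume h: "\<forall>u. u \<epsilon> a \<longrightarrow> fo (\<phi> (f u)) p"
  show "fo (\<^bold>\<forall>y. y \<^bold>\<in> sn a f \<^bold>\<longrightarrow> \<phi> y) p" unfolding forces.simps fo_Imp[OF p]
  proof (intro allI impI, elim conjE)
    fix y q assume q: "q \<epsilon> P" "le q p" and m: "fmem q y (sn a f)"
    show "fo (\<phi> y) q"
    proof (rule fo_dense[OF q(1)])
      fix q' assume "q' \<epsilon> P" "le q' q"
      then obtain r u where r: "r \<epsilon> P" "le r q'" "u \<epsilon> a" "feq r y (f u)" using m unfolding fmem_sn[OF f(1)] by blast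
      have "le r p" using le_trans r(2) \<open>le q' q\<close> q(2) by blast
      then have "fo (\<phi> (f u)) r" using fo_mono h p r by blast
      then show "\<exists>r. r \<epsilon> P \<and> le r q' \<and> fo (\<phi> y) r" using fcongD[OF c r(1) feq_sym[OF r(1,4)]] r by blast
    qed
  qed
qed

lemma fo_bex_sn: assumes f: "dt1 f" "\<And>u. u \<epsilon> a \<Longrightarrow> name (f u)" and c: "fcong \<phi>" and p: "p \<epsilon> P"
  shows "fo (\<^bold>\<exists>y. y \<^bold>\<in> sn a f \<^bold>\<and> \<phi> y) p \<longleftrightarrow> (\<forall>q. q \<epsilon> P \<and> le q p \<longrightarrow> (\<exists>r u. r \<epsilon> P \<and> le r q \<and> u \<epsilon> a \<and> fo (\<phi> (f u)) r))"
  unfolding fo_Ex[OF p]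
proof (intro iffI allI impI)
  fix q assume h: "\<forall>q. q \<epsilon> P \<and> le q p \<longrightarrow> (\<exists>r x. r \<epsilon> P \<and> le r q \<and> name x \<and> fo (x \<^bold>\<in> sn a f \<^bold>\<and> \<phi> x) r)" and q: "q \<epsilon> P \<and> le q p"
  then obtain r x where r: "r \<epsilon> P" "le r q" "fmem r x (sn a f)" "fo (\<phi> x) r" by auto
  then obtain t u where t: "t \<epsilon> P" "le t r" "u \<epsilon> a" "feq t x (f u)" unfolding fmem_sn[OF f(1)] using le_refl by blast
  have "fo (\<phi> (f u)) t" by (rule fcongD[OF c t(1,4) fo_mono[OF r(4,1) t(1,2)]])
  then show "\<exists>r u. r \<epsilon> P \<and> le r q \<and> u \<epsilon> a \<and> fo (\<phi> (f u)) r" using t le_trans[OF t(2) r(2)] by blast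
next
  fix q assume h: "\<forall>q. q \<epsilon> P \<and> le q p \<longrightarrow> (\<exists>r u. r \<epsilon> P \<and> le r q \<and> u \<epsilon> a \<and> fo (\<phi> (f u)) r)" and q: "q \<epsilon> P \<and> le q p"
  then obtain r u where r: "r \<epsilon> P" "le r q" "u \<epsilon> a" "fo (\<phi> (f u)) r" by blast
  then have "fo (f u \<^bold>\<in> sn a f \<^bold>\<and> \<phi> (f u)) r" using fmem_snI[OF f(1) r(3,1)] by simp
  then show "\<exists>r x. r \<epsilon> P \<and> le r q \<and> name x \<and> fo (x \<^bold>\<in> sn a f \<^bold>\<and> \<phi> x) r" using r f(2) by blast
qed

lemma fo_bexI: assumes f: "dt1 f" and "u \<epsilon> a" "name (f u)" "p \<epsilon> P" "fo (\<phi> (f u)) p"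
  shows "fo (\<^bold>\<exists>y. y \<^bold>\<in> sn a f \<^bold>\<and> \<phi> y) p"
  by (rule fo_ExI[OF assms(4,3)]) (use fmem_snI[OF f assms(2,4)] assms(5) in simp)

lemmas fo_ball_chk = fo_ball_sn[OF dt1_chk name_chk, folded chk_sn]
  and fo_bex_chk = fo_bex_sn[OF dt1_chk name_chk, folded chk_sn]
  and fo_bexI_chk = fo_bexI[OF dt1_chk _ name_chk, folded chk_sn]

text \<open>The truth value \<open>S\<close> in the ground model settles the formula for all
  conditions alike; the rules \<open>absi\<close> compute it along the syntax.\<close>

definition absf where "absf \<phi> S \<longleftrightarrow> (\<forall>p. p \<epsilon> P \<longrightarrow> (fo \<phi> p \<longleftrightarrow> S))"

lemma absf_rules [absi]:
  "absf (chk x \<^bold>\<in> chk y) (x \<epsilon> y)" "absf (chk x \<^bold>= chk y) (x = y)"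
  "absf \<phi> S \<Longrightarrow> absf \<psi> T \<Longrightarrow> absf (\<phi> \<^bold>\<and> \<psi>) (S \<and> T)"
  "absf \<phi> S \<Longrightarrow> absf \<psi> T \<Longrightarrow> absf (\<phi> \<^bold>\<or> \<psi>) (S \<or> T)"
  "absf \<phi> S \<Longrightarrow> absf (\<^bold>\<not> \<phi>) (\<not> S)"
  "(\<And>u. absf (\<chi> (chk u)) (R u)) \<Longrightarrow> fcong \<chi> \<Longrightarrow> absf (\<^bold>\<forall>y. y \<^bold>\<in> chk x \<^bold>\<longrightarrow> \<chi> y) (\<forall>u. u \<epsilon> x \<longrightarrow> R u)"
  "(\<And>u. absf (\<chi> (chk u)) (R u)) \<Longrightarrow> fcong \<chi> \<Longrightarrow> absf (\<^bold>\<exists>y. y \<^bold>\<in> chk x \<^bold>\<and> \<chi> y) (\<exists>u. u \<epsilon> x \<and> R u)"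
proof -
  show "absf (chk x \<^bold>\<in> chk y) (x \<epsilon> y)" "absf (chk x \<^bold>= chk y) (x = y)" unfolding absf_def by simp_all
  show "absf \<phi> S \<Longrightarrow> absf \<psi> T \<Longrightarrow> absf (\<phi> \<^bold>\<and> \<psi>) (S \<and> T)" unfolding absf_def by simp
  show "absf (\<phi> \<^bold>\<or> \<psi>) (S \<or> T)" if a: "absf \<phi> S" "absf \<psi> T" unfolding absf_def
  proof (intro allI impI)
    fix p assume p: "p \<epsilon> P"
    have "fo \<phi> r \<or> fo \<psi> r \<longleftrightarrow> S \<or> T" if "r \<epsilon> P" for r using a that unfolding absf_def by blast
    then show "fo (\<phi> \<^bold>\<or> \<psi>) p \<longleftrightarrow> S \<or> T" unfolding fo_Disj[OF p] using p le_refl[of p] le_refl by blast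
  qed
  show "absf (\<^bold>\<not> \<phi>) (\<not> S)" if a: "absf \<phi> S" unfolding absf_def forces.simps
  proof (intro allI impI)
    fix p assume p: "p \<epsilon> P"
    show "(\<forall>q. q \<epsilon> P \<and> le q p \<longrightarrow> \<not> fo \<phi> q) \<longleftrightarrow> \<not> S"
      using a p le_refl[of p] unfolding absf_def by blast
  qed
  show "absf (\<^bold>\<forall>y. y \<^bold>\<in> chk x \<^bold>\<longrightarrow> \<chi> y) (\<forall>u. u \<epsilon> x \<longrightarrow> R u)" if "\<And>u. absf (\<chi> (chk u)) (R u)" "fcong \<chi>"
    using that(1) fo_ball_chk[OF that(2)] unfolding absf_def by simp
  show "absf (\<^bold>\<exists>y. y \<^bold>\<in> chk x \<^bold>\<and> \<chi> y) (\<exists>u. u \<epsilon> x \<and> R u)" if a: "\<And>u. absf (\<chi> (chk u)) (R u)" "fcong \<chi>" unfolding absf_def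
  proof (intro allI impI)
    fix p assume p: "p \<epsilon> P"
    have "fo (\<chi> (chk u)) r \<longleftrightarrow> R u" if "r \<epsilon> P" for r u using a(1) that unfolding absf_def by blast
    then show "fo (\<^bold>\<exists>y. y \<^bold>\<in> chk x \<^bold>\<and> \<chi> y) p \<longleftrightarrow> (\<exists>u. u \<epsilon> x \<and> R u)"
      unfolding fo_bex_chk[OF a(2) p] using p le_refl[of p] le_refl by blast
  qed
qed

lemma fo_ordf: assumes "Ord a" "p \<epsilon> P" shows "fo (ordf (chk a)) p"
proof -
  have "absf (ordf (chk a)) ((\<forall>y. y \<epsilon> a \<longrightarrow> (\<forall>z. z \<epsilon> y \<longrightarrow> z \<epsilon> a)) \<and>
    (\<forall>y. y \<epsilon> a \<longrightarrow> (\<forall>z. z \<epsilon> a \<longrightarrow> y \<epsilon> z \<or> y = z \<or> z \<epsilon> y)))"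
    unfolding ordf_def by (intro absi fci)
  moreover have "(\<forall>y. y \<epsilon> a \<longrightarrow> (\<forall>z. z \<epsilon> y \<longrightarrow> z \<epsilon> a)) \<and> (\<forall>y. y \<epsilon> a \<longrightarrow> (\<forall>z. z \<epsilon> a \<longrightarrow> y \<epsilon> z \<or> y = z \<or> z \<epsilon> y))"
    using Ord_trans[OF assms(1)] Ord_lin[OF assms(1)] by blast
  ultimately show ?thesis unfolding absf_def using assms(2) by blast
qed

lemma fo_omf: assumes "p \<epsilon> P" shows "fo (omf (chk omega)) p"
proof -
  have "absf ((\<^bold>\<exists>x. x \<^bold>\<in> chk omega \<^bold>\<and> x \<^bold>= x) \<^bold>\<and> (\<^bold>\<forall>x. x \<^bold>\<in> chk omega \<^bold>\<longrightarrow> (\<^bold>\<exists>y. y \<^bold>\<in> chk omega \<^bold>\<and> x \<^bold>\<in> y)) \<^bold>\<and>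
    (\<^bold>\<forall>x. x \<^bold>\<in> chk omega \<^bold>\<longrightarrow> (\<^bold>\<forall>y. y \<^bold>\<in> x \<^bold>\<longrightarrow> \<^bold>\<not> y \<^bold>= y) \<^bold>\<or> (\<^bold>\<exists>y. y \<^bold>\<in> x \<^bold>\<and> (\<^bold>\<forall>z. z \<^bold>\<in> x \<^bold>\<longrightarrow> z \<^bold>\<in> y \<^bold>\<or> z \<^bold>= y))))
    ((\<exists>x. x \<epsilon> omega \<and> x = x) \<and> (\<forall>x. x \<epsilon> omega \<longrightarrow> (\<exists>y. y \<epsilon> omega \<and> x \<epsilon> y)) \<and>
    (\<forall>x. x \<epsilon> omega \<longrightarrow> (\<forall>y. y \<epsilon> x \<longrightarrow> \<not> y = y) \<or> (\<exists>y. y \<epsilon> x \<and> (\<forall>z. z \<epsilon> x \<longrightarrow> z \<epsilon> y \<or> z = y))))"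
    by (intro absi fci, auto simp: fcong_def)
  moreover have "(\<exists>x. x \<epsilon> omega \<and> x = x) \<and> (\<forall>x. x \<epsilon> omega \<longrightarrow> (\<exists>y. y \<epsilon> omega \<and> x \<epsilon> y))"
    using emp_omega Lim_omega unfolding Lim_def by blast
  moreover have "(\<forall>y. y \<epsilon> x \<longrightarrow> \<not> y = y) \<or> (\<exists>y. y \<epsilon> x \<and> (\<forall>z. z \<epsilon> x \<longrightarrow> z \<epsilon> y \<or> z = y))" if "x \<epsilon> omega" for x
    using omega_cases[OF that] by (elim disjE exE) auto
  ultimately show ?thesis unfolding absf_def omf_def using assms fo_ordf[OF Ord_omega] by simp
qed

section \<open>Names for pairs and functions\<close>

definition opn where "opn a b = nms (upair (nms (upair a a)) (nms (upair a b)))"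

lemma dt_nms [dfi]: "dt t \<Longrightarrow> dt (\<lambda>e. nms (t e))"
  by (rule dt1_app[of nms]) (unfold nms_def, intro dfi)

lemma dt_opn [dfi]: "dt s \<Longrightarrow> dt t \<Longrightarrow> dt (\<lambda>e. opn (s e) (t e))"
  unfolding opn_def by (intro dfi)

lemma name_opn [simp]: "name (opn a b)" unfolding opn_def by (rule name_nms)

lemma fmem_upn: assumes "name a" "name b" "q \<epsilon> P"
  shows "fmem q x (nms (upair a b)) \<longleftrightarrow> fo (x \<^bold>= a \<^bold>\<or> x \<^bold>= b) q"
proof -
  have S: "u \<epsilon> Sep (upair a b) name \<longleftrightarrow> u = a \<or> u = b" for u
    using assms by (subst mem_Sep) (intro dfi, auto)
  show ?thesis unfolding nms_def fmem_sn[OF dt_var[of 0]] S fo_Disj[OF assms(3)] forces.simps by blast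
qed

lemma fo_Iff_all: assumes "q \<epsilon> P" "name z" "name y" "\<And>x r. name x \<Longrightarrow> r \<epsilon> P \<Longrightarrow> fo (\<phi> x) r \<longleftrightarrow> fmem r x y"
  shows "fo (\<^bold>\<forall>x. x \<^bold>\<in> z \<^bold>\<longleftrightarrow> \<phi> x) q \<longleftrightarrow> feq q z y"
proof
  assume h: "fo (\<^bold>\<forall>x. x \<^bold>\<in> z \<^bold>\<longleftrightarrow> \<phi> x) q"
  show "feq q z y"
  proof (rule feqI[OF assms(1-3)])
    fix x r assume x: "name x" and r: "r \<epsilon> P" "le r q"
    have "fo (x \<^bold>\<in> z \<^bold>\<longleftrightarrow> \<phi> x) q" using h x by simp
    then show "fmem r x z \<longleftrightarrow> fmem r x y" unfolding fo_Iff[OF assms(1)] using assms(4)[OF x r(1)] r by simp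
  qed
next
  assume e: "feq q z y"
  show "fo (\<^bold>\<forall>x. x \<^bold>\<in> z \<^bold>\<longleftrightarrow> \<phi> x) q" unfolding forces.simps fo_Iff[OF assms(1)] sat_name
  proof (intro allI impI, elim conjE)
    fix x r assume x: "name x" and r: "r \<epsilon> P" "le r q"
    have e': "feq r z y" by (rule feq_mono[OF e assms(1) r])
    show "fmem r x z \<longleftrightarrow> fo (\<phi> x) r"
      using fmem_feq2[OF r(1) e'] fmem_feq2[OF r(1) feq_sym[OF r(1) e']] assms(4)[OF x r(1)] by blast
  qed
qed

lemma fo_upair: assumes "name a" "name b" "name z" "q \<epsilon> P" shows "fo (is_upair a b z) q \<longleftrightarrow> feq q z (nms (upair a b))"
  unfolding is_upair_def by (rule fo_Iff_all) (use assms fmem_upn name_nms in auto)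

lemma fo_is_pair: assumes "name a" "name b" "name z" "q \<epsilon> P" shows "fo (is_pair a b z) q \<longleftrightarrow> feq q z (opn a b)"
  unfolding is_pair_def
proof (rule fo_Iff_all[OF assms(4,3) name_opn])
  fix x r assume x: "name x" and r: "r \<epsilon> P"
  show "fo (is_upair a a x \<^bold>\<or> is_upair a b x) r \<longleftrightarrow> fmem r x (opn a b)"
    unfolding opn_def fmem_upn[OF name_nms name_nms r] fo_Disj[OF r] forces.simps
    using fo_upair[OF assms(1,1) x] fo_upair[OF assms(1,2) x] by blast
qed

text \<open>The pairing property holds in all models of set theory and is therefore forced; the
  variable \<open>e 2\<close> stands for the common pair.\<close>

lemma opn_inj:
  assumes n: "name a" "name b" "name c" "name d" and q: "q \<epsilon> P" and e: "feq q (opn a b) (opn c d)"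
  shows "feq q a c" "feq q b d"
proof -
  let ?V = "\<lambda>e. is_pair (e 0) (e 1) (e 2) \<^bold>\<and> is_pair (e 3) (e 4) (e 2) \<^bold>\<longrightarrow> e 0 \<^bold>= e 3 \<^bold>\<and> e 1 \<^bold>= e 4"
  let ?e = "\<lambda>n::nat. if n = 0 then a else if n = 1 then b else if n = 2 then opn a b else if n = 3 then c else d"
  have "fo (?V ?e) q"
  proof (rule fo_zf_valid[where \<psi> = ?V])
    show "forel ?V ?V" unfolding is_pair_def is_upair_def by (intro fori)
    fix E' :: "nat \<Rightarrow> nat \<Rightarrow> bool" and e assume "zf E'"
    then interpret Z: zf E' .
    show "sat E' (?V e)" by auto
  qed (use n q name_opn in auto)
  moreover have "fo (is_pair a b (opn a b)) q" "fo (is_pair c d (opn a b)) q" using fo_is_pair n q e by simp_all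
  ultimately have "fo (a \<^bold>= c \<^bold>\<and> b \<^bold>= d) q" using le_refl by (simp add: fo_Imp q)
  then show "feq q a c" "feq q b d" by simp_all
qed

lemma fo_pair_in: assumes n: "name a" "name b" and p: "p \<epsilon> P" shows "fo (pair_in a b R) p \<longleftrightarrow> fmem p (opn a b) R"
proof
  assume h: "fo (pair_in a b R) p"
  show "fmem p (opn a b) R"
  proof (rule fmem_dense)
    fix q assume q: "q \<epsilon> P" "le q p"
    then obtain r z where r: "r \<epsilon> P" "le r q" "name z" "fo (is_pair a b z) r" "fmem r z R"
      using h unfolding pair_in_def fo_Ex[OF p] by auto
    have "feq r z (opn a b)" using fo_is_pair[OF n r(3,1)] r(4) by blast
    then show "\<exists>r. r \<epsilon> P \<and> le r q \<and> fmem r (opn a b) R" using fmem_feq1[OF r(1) _ r(5)] r by blast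
  qed
next
  assume "fmem p (opn a b) R"
  then show "fo (pair_in a b R) p" unfolding pair_in_def
    by (intro fo_ExI[OF p name_opn[of a b]]) (simp add: fo_is_pair[OF n name_opn p] p)
qed

definition fnn where "fnn a f = sn a (\<lambda>u. opn (chk u) (f u))"

lemma dt1_fnn: "dt1 f \<Longrightarrow> dt1 (\<lambda>u. opn (chk u) (f u))"
  by (intro dfi) assumption

lemma name_fnn: "dt1 f \<Longrightarrow> name (fnn a f)"
  unfolding fnn_def by (rule name_sn[OF dt1_fnn]) simp_all

lemma fo_fnnI: assumes f: "dt1 f" and "u \<epsilon> a" "name (f u)" "p \<epsilon> P" shows "fo (pair_in (chk u) (f u) (fnn a f)) p"
  unfolding fo_pair_in[OF name_chk assms(3,4)] fnn_def using fmem_snI[OF dt1_fnn[OF f] assms(2,4)] .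

lemma fo_fnnD:
  assumes f: "dt1 f" "\<And>u. u \<epsilon> a \<Longrightarrow> name (f u)" and n: "name i" "name y" and q: "q \<epsilon> P" and h: "fo (pair_in i y (fnn a f)) q"
  obtains r u where "r \<epsilon> P" "le r q" "u \<epsilon> a" "feq r i (chk u)" "feq r y (f u)"
proof -
  obtain r u where r: "r \<epsilon> P" "le r q" "u \<epsilon> a" "feq r (opn i y) (opn (chk u) (f u))"
    using h unfolding fo_pair_in[OF n q] fnn_def fmem_sn[OF dt1_fnn[OF f(1)]] using q le_refl by blast
  show thesis using that[OF r(1-3)] opn_inj[OF n name_chk f(2)[OF r(3)] r(1,4)] by blast
qed

lemma fo_funf: assumes f: "dt1 f" "\<And>u. u \<epsilon> a \<Longrightarrow> name (f u)" and p: "p \<epsilon> P" shows "fo (funf (fnn a f)) p"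
  unfolding funf_def forces.simps fo_Imp[OF p] sat_name
proof (intro allI impI, elim conjE)
  fix i y y' q assume n: "name i" "name y" "name y'" and q: "q \<epsilon> P"
    and h: "fo (pair_in i y (fnn a f)) q" "fo (pair_in i y' (fnn a f)) q"
  show "feq q y y'"
  proof (rule feq_dense[OF q])
    fix q' assume q': "q' \<epsilon> P" "le q' q"
    obtain r u where r: "r \<epsilon> P" "le r q'" "u \<epsilon> a" "feq r i (chk u)" "feq r y (f u)"
      using fo_fnnD[OF f n(1,2) q'(1) fo_mono[OF h(1) q q']] by metis
    obtain t v where t: "t \<epsilon> P" "le t r" "v \<epsilon> a" "feq t i (chk v)" "feq t y' (f v)"
      using fo_fnnD[OF f n(1,3) r(1) fo_mono[OF h(2) q r(1) le_trans[OF r(2) q'(2)]]] by metis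
    have "feq t (chk u) (chk v)" using feq_trans[OF t(1) feq_sym[OF t(1) feq_mono[OF r(4,1) t(1,2)]] t(4)] .
    then have "u = v" using t(1) by simp
    then have "feq t y y'" using feq_trans[OF t(1) feq_mono[OF r(5,1) t(1,2)]] feq_sym[OF t(1,5)] by simp
    then show "\<exists>r. r \<epsilon> P \<and> le r q' \<and> feq r y y'" using t(1) le_trans[OF t(2) r(2)] by blast
  qed
qed

lemma fo_injf:
  assumes f: "dt1 f" "\<And>u. u \<epsilon> a \<Longrightarrow> name (f u)" and m: "\<And>u q. u \<epsilon> a \<Longrightarrow> q \<epsilon> P \<Longrightarrow> fmem q (f u) W"
    and inj: "\<And>u v q. u \<epsilon> a \<Longrightarrow> v \<epsilon> a \<Longrightarrow> q \<epsilon> P \<Longrightarrow> feq q (f u) (f v) \<Longrightarrow> u = v" and p: "p \<epsilon> P"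
  shows "fo (injf (fnn a f) (chk a) W) p"
proof -
  have "fo (\<^bold>\<forall>i. i \<^bold>\<in> chk a \<^bold>\<longrightarrow> (\<^bold>\<exists>n. n \<^bold>\<in> W \<^bold>\<and> pair_in i n (fnn a f))) p"
  proof (rule fo_ball_chk[THEN iffD2], intro fci, rule p, intro allI impI)
    fix u assume u: "u \<epsilon> a"
    show "fo (\<^bold>\<exists>n. n \<^bold>\<in> W \<^bold>\<and> pair_in (chk u) n (fnn a f)) p"
      by (rule fo_ExI[OF p f(2)[OF u]]) (use m[OF u p] fo_fnnI[OF f(1) u f(2)[OF u] p] in simp)
  qed
  moreover have "fo (\<^bold>\<forall>i i' n. pair_in i n (fnn a f) \<^bold>\<and> pair_in i' n (fnn a f) \<^bold>\<longrightarrow> i \<^bold>= i') p"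
    unfolding forces.simps fo_Imp[OF p] sat_name
  proof (intro allI impI, elim conjE)
    fix i i' y q assume n: "name i" "name i'" "name y" and q: "q \<epsilon> P"
      and h: "fo (pair_in i y (fnn a f)) q" "fo (pair_in i' y (fnn a f)) q"
    show "feq q i i'"
    proof (rule feq_dense[OF q])
      fix q' assume q': "q' \<epsilon> P" "le q' q"
      obtain r u where r: "r \<epsilon> P" "le r q'" "u \<epsilon> a" "feq r i (chk u)" "feq r y (f u)"
        using fo_fnnD[OF f n(1,3) q'(1) fo_mono[OF h(1) q q']] by metis
      obtain t v where t: "t \<epsilon> P" "le t r" "v \<epsilon> a" "feq t i' (chk v)" "feq t y (f v)"
        using fo_fnnD[OF f n(2,3) r(1) fo_mono[OF h(2) q r(1) le_trans[OF r(2) q'(2)]]] by metis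
      have "feq t (f u) (f v)" using feq_trans[OF t(1) feq_sym[OF t(1) feq_mono[OF r(5,1) t(1,2)]] t(5)] .
      then have "u = v" using inj[OF r(3) t(3,1)] by blast
      then have "feq t i i'" using feq_trans[OF t(1) feq_mono[OF r(4,1) t(1,2)]] feq_sym[OF t(1,4)] by simp
      then show "\<exists>r. r \<epsilon> P \<and> le r q' \<and> feq r i i'" using t(1) le_trans[OF t(2) r(2)] by blast
    qed
  qed
  ultimately show ?thesis unfolding injf_def using fo_funf[OF f p] by simp
qed

text \<open>A member of \<open>x\<close> is densely forced equal to a member of the domain of
  \<open>x\<close>, and the domain is enumerated in the ground model.\<close>

lemma fo_wof: assumes p: "p \<epsilon> P" shows "fo wof p"
proof -
  have "fo (\<^bold>\<exists>d f. ordf d \<^bold>\<and> (\<^bold>\<forall>y. y \<^bold>\<in> x \<^bold>\<longrightarrow> (\<^bold>\<exists>i. i \<^bold>\<in> d \<^bold>\<and> pair_in i y f)) \<^bold>\<and> funf f) p" if x: "name x" for x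
  proof -
    obtain d g where g: "Ord d" "dt1 g" "\<And>y. y \<epsilon> dom x \<Longrightarrow> \<exists>i. i \<epsilon> d \<and> g i = y" using wo_fun[of "dom x"] by blast
    \<comment> \<open>\<open>dom x\<close> may contain sets that are not names; these are replaced
      by a default name.\<close>
    define f where "f i = (if name (g i) then g i else chk emp)" for i
    have f: "dt1 f" "\<And>i. name (f i)" unfolding f_def by (intro dfi dt1_app[OF g(2)], simp)
    have "fo (\<^bold>\<forall>y. y \<^bold>\<in> x \<^bold>\<longrightarrow> (\<^bold>\<exists>i. i \<^bold>\<in> chk d \<^bold>\<and> pair_in i y (fnn d f))) p"
      unfolding forces.simps fo_Imp[OF p] sat_name
    proof (intro allI impI, elim conjE)
      fix y q assume y: "name y" and q: "q \<epsilon> P" and m: "fmem q y x"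
      show "fo (\<^bold>\<exists>i. i \<^bold>\<in> chk d \<^bold>\<and> pair_in i y (fnn d f)) q"
      proof (rule fo_dense[OF q])
        fix q' assume q': "q' \<epsilon> P" "le q' q"
        obtain r \<pi> s where r: "r \<epsilon> P" "le r q'" "pr \<pi> s \<epsilon> x" "le r s" "feq r y \<pi>"
          using fmem_mono[OF m q'(2)] q'(1) by (rule fmemD)
        obtain i where i: "i \<epsilon> d" "g i = \<pi>" using g(3)[OF mem_dom[OF r(3)]] by blast
        then have "f i = \<pi>" using name_dom(1)[OF x r(3)] unfolding f_def by simp
        then have "fo (pair_in (chk i) \<pi> (fnn d f)) r" using fo_fnnI[OF f(1) i(1) f(2) r(1)] by simp
        then have "fo (pair_in (chk i) y (fnn d f)) r"
          using fcongD[OF fcong_pair_in(2) r(1) feq_sym[OF r(1,5)]] by blast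
        then have "fo (\<^bold>\<exists>i. i \<^bold>\<in> chk d \<^bold>\<and> pair_in i y (fnn d f)) r" by (rule fo_bexI_chk[OF i(1) r(1)])
        then show "\<exists>r. r \<epsilon> P \<and> le r q' \<and> fo (\<^bold>\<exists>i. i \<^bold>\<in> chk d \<^bold>\<and> pair_in i y (fnn d f)) r" using r by blast
      qed
    qed
    then have F: "fo (ordf (chk d) \<^bold>\<and> (\<^bold>\<forall>y. y \<^bold>\<in> x \<^bold>\<longrightarrow> (\<^bold>\<exists>i. i \<^bold>\<in> chk d \<^bold>\<and> pair_in i y (fnn d f))) \<^bold>\<and> funf (fnn d f)) p"
      using fo_ordf[OF g(1) p] fo_funf[OF f p] by simp
    show ?thesis by (rule fo_ExI[OF p name_chk[of d]], rule fo_ExI[OF p name_fnn[OF f(1), of d]]) (rule F)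
  qed
  then show ?thesis unfolding wof_def by simp
qed

end

section \<open>Names for the branches given by the Cohen reals\<close>

context cohen
begin

abbreviation le where "le \<equiv> Fn_le E"

lemma le_iff: "le q p \<longleftrightarrow> sub p q" unfolding Fn_le_def by simp

sublocale forcing E P emp "Fn_le E"
  by unfold_locales (use P_emp in \<open>auto simp: le_iff\<close>, intro dfi)

text \<open>\<open>bn emp \<alpha>\<close> and \<open>bn (suc emp) \<alpha>\<close> are names for \<open>B\<^sub>\<alpha>\<close> and \<open>D\<^sub>\<alpha>\<close>.\<close>

definition bn where "bn v \<alpha> = Rep nodes (\<lambda>t. pr (chk (code t)) (cnd v \<alpha> (pfst t) (psnd t)))"

lemma dt_bn [dfi]: assumes "dt v" "dt \<alpha>" shows "dt (\<lambda>e. bn (v e) (\<alpha> e))"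
proof -
  have "dt2 bn" unfolding bn_def by (intro dfi)
  then show ?thesis using assms by (rule dt2_app)
qed

lemma mem_bn: "z \<epsilon> bn v \<alpha> \<longleftrightarrow> (\<exists>n a. pr n a \<epsilon> nodes \<and> z = pr (chk (code (pr n a))) (cnd v \<alpha> n a))"
proof -
  have "z \<epsilon> bn v \<alpha> \<longleftrightarrow> (\<exists>t. t \<epsilon> nodes \<and> z = pr (chk (code t)) (cnd v \<alpha> (pfst t) (psnd t)))"
    unfolding bn_def by (rule mem_Rep) (intro dfi)
  also have "\<dots> \<longleftrightarrow> (\<exists>n a. pr n a \<epsilon> nodes \<and> z = pr (chk (code (pr n a))) (cnd v \<alpha> n a))"
  proof (intro iffI; elim exE conjE)
    fix t assume t: "t \<epsilon> nodes" and z: "z = pr (chk (code t)) (cnd v \<alpha> (pfst t) (psnd t))"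
    obtain n a where "t = pr n a" using t unfolding mem_nodes by blast
    then show "\<exists>n a. pr n a \<epsilon> nodes \<and> z = pr (chk (code (pr n a))) (cnd v \<alpha> n a)"
      by (intro exI[of _ n] exI[of _ a]) (use t z in simp)
  next
    fix n a assume "pr n a \<epsilon> nodes" "z = pr (chk (code (pr n a))) (cnd v \<alpha> n a)"
    then show "\<exists>t. t \<epsilon> nodes \<and> z = pr (chk (code t)) (cnd v \<alpha> (pfst t) (psnd t))"
      by (intro exI[of _ "pr n a"]) simp
  qed
  finally show ?thesis .
qed

lemma name_bn: assumes "bit v" "\<alpha> \<epsilon> \<kappa>" shows "name (bn v \<alpha>)"
proof (rule nameI)
  fix z assume "z \<epsilon> bn v \<alpha>"
  then obtain n a where z: "pr n a \<epsilon> nodes" "z = pr (chk (code (pr n a))) (cnd v \<alpha> n a)" unfolding mem_bn by blast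
  then have "cnd v \<alpha> n a \<epsilon> P" using cnd_P[OF assms] pr_nodes by blast
  then show "\<exists>\<pi> s. name \<pi> \<and> s \<epsilon> P \<and> z = pr \<pi> s" using z(2) name_chk by blast
qed

lemma fmem_bnI: "pr n a \<epsilon> nodes \<Longrightarrow> sub (cnd v \<alpha> n a) p \<Longrightarrow> fmem p (chk (code (pr n a))) (bn v \<alpha>)"
  by (rule fmemI[of _ "cnd v \<alpha> n a"]) (use mem_bn in \<open>blast, simp add: le_iff\<close>)

lemma fmem_bnD: assumes "fmem p x (bn v \<alpha>)" "p \<epsilon> P"
  obtains r n a where "r \<epsilon> P" "le r p" "pr n a \<epsilon> nodes" "sub (cnd v \<alpha> n a) r" "feq r x (chk (code (pr n a)))"
proof -
  obtain r \<rho> s where r: "r \<epsilon> P" "le r p" "pr \<rho> s \<epsilon> bn v \<alpha>" "le r s" "feq r x \<rho>" using fmemD[OF assms] .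
  obtain n a where na: "pr n a \<epsilon> nodes" "pr \<rho> s = pr (chk (code (pr n a))) (cnd v \<alpha> n a)" using r(3) unfolding mem_bn by blast
  then have "\<rho> = chk (code (pr n a))" "s = cnd v \<alpha> n a" by simp_all
  then show thesis using that[OF r(1,2) na(1)] r(4,5) unfolding le_iff by blast
qed

lemma fmem_bnD_chk: assumes "fmem p (chk j) (bn v \<alpha>)" "p \<epsilon> P"
  obtains r n a where "r \<epsilon> P" "le r p" "pr n a \<epsilon> nodes" "sub (cnd v \<alpha> n a) r" "j = code (pr n a)"
proof -
  obtain r n a where r: "r \<epsilon> P" "le r p" "pr n a \<epsilon> nodes" "sub (cnd v \<alpha> n a) r" "feq r (chk j) (chk (code (pr n a)))"
    using fmem_bnD[OF assms] .
  then show thesis using that[OF r(1-4)] by simp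
qed

lemma code_inj: "pr n a \<epsilon> nodes \<Longrightarrow> pr m b \<epsilon> nodes \<Longrightarrow> code (pr n a) = code (pr m b) \<Longrightarrow> n = m \<and> a = b"
  using inj_onD[OF code(2), of "pr n a" "pr m b"] by simp

lemma omega_total: assumes "n \<epsilon> omega" "m \<epsilon> omega" shows "m \<epsilon> n \<or> sub n m"
  using Ord_not_mem[of m n] Ord_omega_mem assms by blast

text \<open>Once the branches are decided to differ at a position below \<open>n\<close>, a common
  code belongs to a node shorter than \<open>n\<close>, and such codes lie below
  \<open>N\<close>.\<close>

lemma bn_split:
  assumes p: "p \<epsilon> P" and v: "bit v" "bit v'" and \<alpha>: "\<alpha> \<epsilon> \<kappa>" "\<beta> \<epsilon> \<kappa>" and ne: "\<alpha> \<noteq> \<beta> \<or> v \<noteq> v'"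
  obtains r N where "r \<epsilon> P" "le r p" "N \<epsilon> omega"
    "\<And>j s. s \<epsilon> P \<Longrightarrow> le s r \<Longrightarrow> fmem s (chk j) (bn v \<alpha>) \<Longrightarrow> fmem s (chk j) (bn v' \<beta>) \<Longrightarrow> j \<epsilon> N"
proof -
  obtain r n a a' i where r: "r \<epsilon> P" "sub p r" "n \<epsilon> omega" "sub (cnd v \<alpha> n a) r" "sub (cnd v' \<beta> n a') r"
    "i \<epsilon> n" "\<not> (i \<epsilon> a \<longleftrightarrow> i \<epsilon> a')" using split[OF p v \<alpha> ne] .
  obtain N where N: "N \<epsilon> omega" "\<And>m b. pr m b \<epsilon> nodes \<Longrightarrow> m \<epsilon> n \<Longrightarrow> code (pr m b) \<epsilon> N" using code_below[OF r(3)] by blast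
  have "j \<epsilon> N" if s: "s \<epsilon> P" "le s r" "fmem s (chk j) (bn v \<alpha>)" "fmem s (chk j) (bn v' \<beta>)" for j s
  proof (rule ccontr)
    assume j: "\<not> j \<epsilon> N"
    obtain t m b where t: "t \<epsilon> P" "le t s" "pr m b \<epsilon> nodes" "sub (cnd v \<alpha> m b) t" "j = code (pr m b)"
      using fmem_bnD_chk[OF s(3,1)] .
    obtain u m' b' where u: "u \<epsilon> P" "le u t" "pr m' b' \<epsilon> nodes" "sub (cnd v' \<beta> m' b') u" "j = code (pr m' b')"
      using fmem_bnD_chk[OF fmem_mono[OF s(4) t(2)] t(1)] .
    have eq: "m' = m" "b' = b" using code_inj[OF t(3) u(3)] t(5) u(5) by simp_all
    have "sub n m" using omega_total[OF r(3)] N(2)[OF t(3)] t(3,5) j unfolding pr_nodes by blast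
    then have i: "i \<epsilon> m" using r(6) by blast
    have ur: "sub r u" using u(2) t(2) s(2) unfolding le_iff by blast
    have "i \<epsilon> a \<longleftrightarrow> i \<epsilon> b" by (rule cnd_agree[OF u(1) v(1) _ _ r(6) i]) (use r(4) ur t(4) u(2) le_iff in blast)+
    moreover have "i \<epsilon> a' \<longleftrightarrow> i \<epsilon> b" by (rule cnd_agree[OF u(1) v(2) _ _ r(6) i]) (use r(5) ur u(4) eq in blast)+
    ultimately show False using r(7) by simp
  qed
  then show thesis using that[OF r(1) _ N(1)] r(2) le_iff by blast
qed

lemma bn_unb: assumes p: "p \<epsilon> P" and v: "bit v" "\<alpha> \<epsilon> \<kappa>" and N: "N \<epsilon> omega"
  obtains q j where "q \<epsilon> P" "le q p" "j \<epsilon> omega" "\<not> j \<epsilon> N" "fmem q (chk j) (bn v \<alpha>)"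
proof -
  obtain n0 where n0: "n0 \<epsilon> omega" "\<And>m b. pr m b \<epsilon> nodes \<Longrightarrow> sub n0 m \<Longrightarrow> \<not> code (pr m b) \<epsilon> N" using code_above[OF N] by blast
  obtain q n a where q: "q \<epsilon> P" "sub p q" "n \<epsilon> omega" "sub n0 n" "sub a n" "sub (cnd v \<alpha> n a) q"
    using extend[OF p v n0(1)] by metis
  have t: "pr n a \<epsilon> nodes" using pr_nodes q(3,5) by blast
  show thesis by (rule that[OF q(1) _ code(3)[OF t] n0(2)[OF t q(4)] fmem_bnI[OF t q(6)]]) (use q(2) le_iff in blast)
qed

text \<open>A branch is forced to be unbounded, whereas two different branches have a bounded
  intersection.\<close>

lemma bn_neq: assumes p: "p \<epsilon> P" and v: "bit v" "bit v'" and \<alpha>: "\<alpha> \<epsilon> \<kappa>" "\<beta> \<epsilon> \<kappa>" and e: "feq p (bn v \<alpha>) (bn v' \<beta>)"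
  shows "\<alpha> = \<beta> \<and> v = v'"
proof (rule ccontr)
  assume "\<not> ?thesis"
  then obtain r N where r: "r \<epsilon> P" "le r p" "N \<epsilon> omega"
    "\<And>j s. s \<epsilon> P \<Longrightarrow> le s r \<Longrightarrow> fmem s (chk j) (bn v \<alpha>) \<Longrightarrow> fmem s (chk j) (bn v' \<beta>) \<Longrightarrow> j \<epsilon> N"
    using bn_split[OF p v \<alpha>] by blast
  obtain q j where q: "q \<epsilon> P" "le q r" "j \<epsilon> omega" "\<not> j \<epsilon> N" "fmem q (chk j) (bn v \<alpha>)" using bn_unb[OF r(1) v(1) \<alpha>(1) r(3)] .
  have "fmem q (chk j) (bn v' \<beta>)"
    by (rule fmem_feq2[OF q(1) _ q(5)]) (rule feq_mono[OF e p q(1) le_trans[OF q(2) r(2)]])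
  then show False using r(4)[OF q(1,2,5)] q(4) by blast
qed

text \<open>\<open>root\<close> applied to the constant family \<open>q\<close>: it provides an
  index whose block misses the root, and the root contains \<open>q\<close>.\<close>

lemma fresh: assumes l: "Lim l" and reg: "\<And>f. dt1 f \<Longrightarrow> (\<And>n. n \<epsilon> omega \<Longrightarrow> f n \<epsilon> l) \<Longrightarrow> \<exists>b. b \<epsilon> l \<and> (\<forall>n. n \<epsilon> omega \<longrightarrow> f n \<epsilon> b)"
    and q: "q \<epsilon> P"
  shows "unb l (\<lambda>a. off a emp q)"
  unfolding unb_def
proof (intro allI impI)
  fix b assume b: "b \<epsilon> l"
  let ?S = "\<lambda>a. \<not> a \<epsilon> b"
  have dS: "df1 ?S" by (intro dfi)
  have uS: "unb l ?S" unfolding unb_def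
  proof (intro allI impI)
    fix c assume c: "c \<epsilon> l"
    have ol: "Ord l" using l unfolding Lim_def by blast
    have "b \<epsilon> c \<or> b = c \<or> c \<epsilon> b" using Ord_lin[OF ol b c] .
    then show "\<exists>a. a \<epsilon> l \<and> \<not> a \<epsilon> c \<and> \<not> a \<epsilon> b" using b c not_mem_self not_mem_sym by metis
  qed
  have dr: "dt1 (\<lambda>_. q)" by (intro dfi)
  obtain \<rho> where r: "\<rho> \<epsilon> P" "sub q \<rho>"
    "\<And>s. s \<epsilon> P \<Longrightarrow> sub \<rho> s \<Longrightarrow> \<exists>a. a \<epsilon> l \<and> \<not> a \<epsilon> b \<and> un q s \<epsilon> P \<and> (\<forall>n y. \<not> pr (add a n) y \<epsilon> s \<or> \<not> n \<epsilon> omega)"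
    using root[OF l reg dS uS dr, of q] q by auto
  then obtain a where "a \<epsilon> l" "\<not> a \<epsilon> b" "\<And>n y. \<not> pr (add a n) y \<epsilon> \<rho> \<or> \<not> n \<epsilon> omega" by blast
  then show "\<exists>a. a \<epsilon> l \<and> \<not> a \<epsilon> b \<and> off a emp q" unfolding off_def using r(2) by blast
qed

end

section \<open>Bounded intersections with branches\<close>

context cohen
begin

text \<open>\<open>R\<close> codes a family of sets indexed by \<open>i\<close>, and one number of
  the ground model bounds the intersection of the i-th set with the branch below \<open>r\<close>.
  Speaking of conditions and check names keeps formulas out of the combinatorics.\<close>

definition bdd where "bdd R i v \<alpha> r \<longleftrightarrow> (\<exists>n. n \<epsilon> omega \<and>
  (\<forall>j s. s \<epsilon> P \<and> le s r \<and> fmem s (chk j) (bn v \<alpha>) \<and> fmem s (opn (chk i) (chk j)) R \<longrightarrow> j \<epsilon> n))"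

lemma df_bdd [dfi]: assumes "dt a" "dt i" "dt v" "dt x" "dt r" shows "df (\<lambda>e. bdd (a e) (i e) (v e) (x e) (r e))"
  unfolding bdd_def by (intro dfi assms assms[THEN dt_ren])

definition node_ext where "node_ext n a m b \<longleftrightarrow> pr m b \<epsilon> nodes \<and> sub n m \<and> (\<forall>i. i \<epsilon> n \<longrightarrow> (i \<epsilon> a \<longleftrightarrow> i \<epsilon> b))"

lemma df_node_ext [dfi]: assumes "dt n" "dt a" "dt m" "dt b" shows "df (\<lambda>e. node_ext (n e) (a e) (m e) (b e))"
  unfolding node_ext_def by (intro dfi assms assms[THEN dt_ren])

text \<open>A set that is bounded below \<open>q\<close> on all the branches \<open>bn emp \<alpha>\<close> misses a cone: otherwise uncountably
  many conditions deciding such bounds have the same node, and a condition putting a code above this node into the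
  set is compatible with one of them.\<close>

lemma missed_cone:
  assumes q: "q \<epsilon> P" and omk: "sub om1 \<kappa>"
    and hyp: "\<And>\<alpha> q'. \<alpha> \<epsilon> om1 \<Longrightarrow> q' \<epsilon> P \<Longrightarrow> le q' q \<Longrightarrow> \<exists>r. r \<epsilon> P \<and> le r q' \<and> bdd R i emp \<alpha> r"
    and t: "pr n0 a0 \<epsilon> nodes" and q1: "q1 \<epsilon> P" "le q1 q"
  shows "\<exists>r n a. r \<epsilon> P \<and> le r q1 \<and> node_ext n0 a0 n a \<and>
    (\<forall>m b s. node_ext n a m b \<and> s \<epsilon> P \<and> le s r \<longrightarrow> \<not> fmem s (opn (chk i) (chk (code (pr m b)))) R)"
proof (rule ccontr)
  assume no: "\<not> ?thesis"
  have n0: "n0 \<epsilon> omega" using t pr_nodes by blast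
  \<comment> \<open>\<open>z\<close> packs a condition \<open>r\<close> and a node on the branch of
    \<alpha> such that, below \<open>r\<close>, no node above it that is put on the branch has its
    code in the i-th set.\<close>
  define Q where "Q \<alpha> z \<longleftrightarrow> (\<exists>r n a. z = pr r (pr n a) \<and> r \<epsilon> P \<and> le r q1 \<and> node_ext n0 a0 n a \<and> sub (cnd emp \<alpha> n a) r \<and> off \<alpha> n r \<and>
    (\<forall>m b s. node_ext n a m b \<and> s \<epsilon> P \<and> le s r \<and> sub (cnd emp \<alpha> m b) s \<longrightarrow> \<not> fmem s (opn (chk i) (chk (code (pr m b)))) R))" for \<alpha> z
  have dQ: "df2 Q" unfolding Q_def by (intro dfi)
  \<comment> \<open>Only indices whose block is untouched by \<open>q1\<close> are used, so that
    each of these branches can be led through the given node.\<close>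
  define S where "S \<alpha> \<longleftrightarrow> off \<alpha> emp q1" for \<alpha>
  have dS: "df1 S" unfolding S_def by (intro dfi)
  have uS: "unb om1 S" unfolding S_def by (rule fresh[OF Lim_om1 om1_regular q1(1)])
  have ex: "\<exists>z. Q \<alpha> z" if \<alpha>: "\<alpha> \<epsilon> om1" "S \<alpha>" for \<alpha>
  proof -
    have ak: "\<alpha> \<epsilon> \<kappa>" using \<alpha>(1) omk by blast
    have p: "un q1 (cnd emp \<alpha> n0 a0) \<epsilon> P"
      by (rule extend_cnd[OF q1(1) flip(4) ak _ _ n0, of emp emp]) (use \<alpha>(2) in \<open>auto simp: S_def mem_cnd\<close>)
    have "le (un q1 (cnd emp \<alpha> n0 a0)) q" using q1(2) unfolding le_iff by simp
    then obtain r1 where r1: "r1 \<epsilon> P" "le r1 (un q1 (cnd emp \<alpha> n0 a0))" "bdd R i emp \<alpha> r1" using hyp[OF \<alpha>(1) p] by blast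
    obtain N where N: "N \<epsilon> omega" "\<And>j s. s \<epsilon> P \<Longrightarrow> le s r1 \<Longrightarrow> fmem s (chk j) (bn emp \<alpha>) \<Longrightarrow> fmem s (opn (chk i) (chk j)) R \<Longrightarrow> j \<epsilon> N"
      using r1(3) unfolding bdd_def by blast
    \<comment> \<open>Nodes of length at least \<open>n1\<close> have codes beyond the bound
      \<open>N\<close>; prolonging the decided segment to this length excludes them from the
      intersection.\<close>
    obtain n1 where n1: "n1 \<epsilon> omega" "\<And>m b. pr m b \<epsilon> nodes \<Longrightarrow> sub n1 m \<Longrightarrow> \<not> code (pr m b) \<epsilon> N" using code_above[OF N(1)] by blast
    obtain n2 where n2: "n2 \<epsilon> omega" "sub n0 n2" "sub n1 n2" using omega_max[OF n0 n1(1)] by blast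
    obtain r n a where r: "r \<epsilon> P" "sub r1 r" "n \<epsilon> omega" "sub n2 n" "sub a n" "sub (cnd emp \<alpha> n a) r" "off \<alpha> n r"
      using extend[OF r1(1) flip(4) ak n2(1)] by metis
    have na: "pr n a \<epsilon> nodes" using r(3,5) pr_nodes by blast
    have lr: "le r q1" "sub (cnd emp \<alpha> n0 a0) r" using r1(2) r(2) unfolding le_iff by simp_all
    have "k \<epsilon> a0 \<longleftrightarrow> k \<epsilon> a" if k: "k \<epsilon> n0" for k
      by (rule cnd_agree[OF r(1) flip(4) lr(2) r(6) k]) (use k n2(2) r(4) in blast)
    then have e: "node_ext n0 a0 n a" unfolding node_ext_def using na n2(2) r(4) by blast
    have "\<not> fmem s (opn (chk i) (chk (code (pr m b)))) R"
      if mb: "node_ext n a m b" and s: "s \<epsilon> P" "le s r" "sub (cnd emp \<alpha> m b) s" for m b s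
    proof
      assume A: "fmem s (opn (chk i) (chk (code (pr m b)))) R"
      have nd: "pr m b \<epsilon> nodes" "sub n1 m" using mb n2(3) r(4) unfolding node_ext_def by blast+
      have "le s r1" using s(2) r(2) unfolding le_iff by blast
      then show False using N(2)[OF s(1) _ fmem_bnI[OF nd(1) s(3)] A] n1(2)[OF nd] by blast
    qed
    then have "Q \<alpha> (pr r (pr n a))" unfolding Q_def using r(1,6,7) lr(1) e by blast
    then show ?thesis by blast
  qed
  have dSep: "\<alpha> \<epsilon> Sep om1 S \<longleftrightarrow> \<alpha> \<epsilon> om1 \<and> S \<alpha>" for \<alpha> by (rule mem_Sep[OF dS])
  have "\<exists>z. Q \<alpha> z" if "\<alpha> \<epsilon> Sep om1 S" for \<alpha> using ex that unfolding dSep by blast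
  then obtain g where g0: "dt1 g" "\<forall>\<alpha>. \<alpha> \<epsilon> Sep om1 S \<longrightarrow> Q \<alpha> (g \<alpha>)" using choice[OF dQ, of "Sep om1 S"] by blast
  then have g: "dt1 g" "\<And>\<alpha>. \<alpha> \<epsilon> om1 \<Longrightarrow> S \<alpha> \<Longrightarrow> Q \<alpha> (g \<alpha>)" unfolding dSep by blast+
  note [dfi] = dt1_app[OF g(1)] df1_app[OF dS]
  have dh: "dt1 (\<lambda>\<alpha>. code (psnd (g \<alpha>)))" "dt1 (\<lambda>\<alpha>. pfst (g \<alpha>))" by (intro dfi)+
  have h: "code (psnd (g \<alpha>)) \<epsilon> omega" if hh: "\<alpha> \<epsilon> om1" "S \<alpha>" for \<alpha>
  proof -
    obtain r n a where "g \<alpha> = pr r (pr n a)" "node_ext n0 a0 n a" using g(2)[OF hh] unfolding Q_def by blast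
    then show ?thesis using code(3) unfolding node_ext_def by simp
  qed
  obtain c where c: "unb om1 (\<lambda>\<alpha>. S \<alpha> \<and> code (psnd (g \<alpha>)) = c)"
    using pigeon[OF om1(1) om1_regular dS uS dh(1) h] by blast
  have dS': "df1 (\<lambda>\<alpha>. S \<alpha> \<and> code (psnd (g \<alpha>)) = c)" by (intro dfi)
  have rg: "pfst (g \<alpha>) \<epsilon> P \<and> sub q1 (pfst (g \<alpha>))" if hh: "\<alpha> \<epsilon> om1" "S \<alpha> \<and> code (psnd (g \<alpha>)) = c" for \<alpha>
  proof -
    obtain r n a where "g \<alpha> = pr r (pr n a)" "r \<epsilon> P" "le r q1" using g(2)[of \<alpha>] hh unfolding Q_def by blast
    then show ?thesis unfolding le_iff by simp
  qed
  obtain \<rho> where \<rho>: "\<rho> \<epsilon> P" "sub q1 \<rho>"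
    "\<And>s. s \<epsilon> P \<Longrightarrow> sub \<rho> s \<Longrightarrow> \<exists>\<alpha>. \<alpha> \<epsilon> om1 \<and> (S \<alpha> \<and> code (psnd (g \<alpha>)) = c) \<and> un (pfst (g \<alpha>)) s \<epsilon> P \<and> (\<forall>n y. \<not> pr (add \<alpha> n) y \<epsilon> s \<or> \<not> n \<epsilon> omega)"
    using root[OF Lim_om1 om1_regular dS' c dh(2) rg] by blast
  obtain \<alpha>0 where a0: "\<alpha>0 \<epsilon> om1" "S \<alpha>0" "code (psnd (g \<alpha>0)) = c" using \<rho>(3)[OF \<rho>(1)] by blast
  obtain r0 n a where na: "g \<alpha>0 = pr r0 (pr n a)" "node_ext n0 a0 n a" using g(2)[OF a0(1,2)] unfolding Q_def by blast
  have "le \<rho> q1" using \<rho>(2) le_iff by blast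
  \<comment> \<open>By assumption the cone of the repeated node \<open>(n, a)\<close> is not missed,
    so some condition below the root puts a code from this cone into the i-th set.\<close>
  then obtain m b s where s: "node_ext n a m b" "s \<epsilon> P" "le s \<rho>" "fmem s (opn (chk i) (chk (code (pr m b)))) R"
    using no na(2) \<rho>(1) by blast
  obtain \<alpha> where \<alpha>: "\<alpha> \<epsilon> om1" "S \<alpha>" "code (psnd (g \<alpha>)) = c" "un (pfst (g \<alpha>)) s \<epsilon> P" "\<And>n y. n \<epsilon> omega \<Longrightarrow> \<not> pr (add \<alpha> n) y \<epsilon> s"
    using \<rho>(3)[OF s(2)] s(3) unfolding le_iff by blast
  obtain r n' a' where r: "g \<alpha> = pr r (pr n' a')" "r \<epsilon> P" "node_ext n0 a0 n' a'" "sub (cnd emp \<alpha> n' a') r" "off \<alpha> n' r"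
    "\<And>m b s. node_ext n' a' m b \<Longrightarrow> s \<epsilon> P \<Longrightarrow> le s r \<Longrightarrow> sub (cnd emp \<alpha> m b) s \<Longrightarrow> \<not> fmem s (opn (chk i) (chk (code (pr m b)))) R"
    using g(2)[OF \<alpha>(1,2)] unfolding Q_def by blast
  have "code (pr n' a') = code (pr n a)" using \<alpha>(3) a0(3) r(1) na(1) by simp
  then have eq: "n' = n" "a' = a" using code_inj r(3) na(2) unfolding node_ext_def by blast+
  have u: "un r s \<epsilon> P" using \<alpha>(4) r(1) by simp
  \<comment> \<open>\<open>r\<close> leaves the branch of \<alpha> free beyond \<open>n\<close>, and
    \<open>s\<close> does not touch its block. So the branch can be led through
    \<open>(m, b)\<close>, contrary to the choice of \<open>r\<close>.\<close>
  have "un (un r s) (cnd emp \<alpha> m b) \<epsilon> P"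
  proof (rule extend_cnd[OF u flip(4)])
    show "sub (cnd emp \<alpha> n a) (un r s)" using r(4) eq by simp
    show "off \<alpha> n (un r s)" using r(5) \<alpha>(5) eq unfolding off_def by simp
    show "m \<epsilon> omega" "sub n m" "\<And>i. i \<epsilon> n \<Longrightarrow> i \<epsilon> a \<longleftrightarrow> i \<epsilon> b" using s(1) unfolding node_ext_def pr_nodes by blast+
    show "\<alpha> \<epsilon> \<kappa>" using \<alpha>(1) omk by blast
  qed
  then show False
    using r(6)[of m b "un (un r s) (cnd emp \<alpha> m b)"] s(1) fmem_mono[OF s(4), of "un (un r s) (cnd emp \<alpha> m b)"] eq
    unfolding le_iff by simp
qed

text \<open>The indices are thinned twice, over the fewer than \<kappa> sets and over the countably
  many nodes; the second step uses \<open>omega \<epsilon> \<kappa>\<close>. The missed cone has to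
  start at the shared node, because the conditions have already decided their branches up to
  there.\<close>

lemma bounded_branch:
  assumes q: "q \<epsilon> P" and omk: "sub om1 \<kappa>" and nw: "omega \<epsilon> \<kappa>" and \<mu>: "\<mu> \<epsilon> \<kappa>"
    and hyp: "\<And>i \<alpha> q'. i \<epsilon> \<mu> \<Longrightarrow> \<alpha> \<epsilon> om1 \<Longrightarrow> q' \<epsilon> P \<Longrightarrow> le q' q \<Longrightarrow> \<exists>r. r \<epsilon> P \<and> le r q' \<and> bdd R i emp \<alpha> r"
  shows "\<exists>\<beta>. \<beta> \<epsilon> \<kappa> \<and> (\<forall>i q'. i \<epsilon> \<mu> \<and> q' \<epsilon> P \<and> le q' q \<longrightarrow> (\<exists>r. r \<epsilon> P \<and> le r q' \<and> bdd R i (suc emp) \<beta> r))"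
proof (rule ccontr)
  assume no: "\<not> ?thesis"
  \<comment> \<open>The condition \<open>r\<close> decides the branch of \<beta> exactly up to the
    node \<open>(n, a)\<close>, and no stronger condition bounds the i-th set on this
    branch.\<close>
  define Q where "Q \<beta> z \<longleftrightarrow> (\<exists>i r n a. z = pr i (pr r (pr n a)) \<and> i \<epsilon> \<mu> \<and> r \<epsilon> P \<and> le r q \<and> pr n a \<epsilon> nodes \<and>
    sub (cnd (suc emp) \<beta> n a) r \<and> off \<beta> n r \<and> (\<forall>s. s \<epsilon> P \<and> le s r \<longrightarrow> \<not> bdd R i (suc emp) \<beta> s))" for \<beta> z
  have dQ: "df2 Q" unfolding Q_def by (intro dfi)
  have ex: "\<exists>z. Q \<beta> z" if \<beta>: "\<beta> \<epsilon> \<kappa>" for \<beta>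
  proof -
    obtain i q' where q': "i \<epsilon> \<mu>" "q' \<epsilon> P" "le q' q" "\<And>s. s \<epsilon> P \<Longrightarrow> le s q' \<Longrightarrow> \<not> bdd R i (suc emp) \<beta> s" using no \<beta> by blast
    obtain r n a where r: "r \<epsilon> P" "sub q' r" "n \<epsilon> omega" "sub a n" "sub (cnd (suc emp) \<beta> n a) r" "off \<beta> n r"
      using extend[OF q'(2) flip(5) \<beta> emp_omega] by metis
    have l: "le r q'" using r(2) le_iff by blast
    have "Q \<beta> (pr i (pr r (pr n a)))" unfolding Q_def
      using q'(1) r(1,5,6) le_trans[OF l q'(3)] r(3,4) pr_nodes q'(4) le_trans[OF _ l] by blast
    then show ?thesis by blast
  qed
  then obtain g where g: "dt1 g" "\<And>\<beta>. \<beta> \<epsilon> \<kappa> \<Longrightarrow> Q \<beta> (g \<beta>)" using choice[OF dQ] by blast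
  note [dfi] = dt1_app[OF g(1)]
  have reg: "\<exists>b. b \<epsilon> \<kappa> \<and> (\<forall>n. n \<epsilon> omega \<longrightarrow> f n \<epsilon> b)" if "dt1 f" "\<And>n. n \<epsilon> omega \<Longrightarrow> f n \<epsilon> \<kappa>" for f
    using kappa(3)[OF that(1) nw] that(2) by blast
  have regm: "\<exists>b. b \<epsilon> \<kappa> \<and> (\<forall>n. n \<epsilon> \<mu> \<longrightarrow> f n \<epsilon> b)" if "dt1 f" "\<And>n. n \<epsilon> \<mu> \<Longrightarrow> f n \<epsilon> \<kappa>" for f
    using kappa(3)[OF that(1) \<mu>] that(2) by blast
  have dh: "dt1 (\<lambda>\<beta>. pfst (g \<beta>))" "dt1 (\<lambda>\<beta>. pfst (psnd (g \<beta>)))" "dt1 (\<lambda>\<beta>. code (psnd (psnd (g \<beta>))))" by (intro dfi)+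
  have gm: "pfst (g \<beta>) \<epsilon> \<mu> \<and> pfst (psnd (g \<beta>)) \<epsilon> P \<and> sub q (pfst (psnd (g \<beta>))) \<and> code (psnd (psnd (g \<beta>))) \<epsilon> omega" if \<beta>: "\<beta> \<epsilon> \<kappa>" for \<beta>
  proof -
    obtain i r n a where "g \<beta> = pr i (pr r (pr n a))" "i \<epsilon> \<mu>" "r \<epsilon> P" "le r q" "pr n a \<epsilon> nodes"
      using g(2)[OF \<beta>] unfolding Q_def by blast
    then show ?thesis using code(3) le_iff by simp
  qed
  have dT: "df1 (\<lambda>\<beta>. True)" by (intro dfi)
  have uT: "unb \<kappa> (\<lambda>\<beta>. True)" unfolding unb_def using not_mem_self by blast
  obtain i where i: "i \<epsilon> \<mu>" "unb \<kappa> (\<lambda>\<beta>. True \<and> pfst (g \<beta>) = i)"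
    using pigeon[OF Ord_kappa regm dT uT dh(1)] gm by blast
  have di: "df1 (\<lambda>\<beta>. True \<and> pfst (g \<beta>) = i)" by (intro dfi)
  obtain c where c: "unb \<kappa> (\<lambda>\<beta>. (True \<and> pfst (g \<beta>) = i) \<and> code (psnd (psnd (g \<beta>))) = c)"
    using pigeon[OF Ord_kappa reg di i(2) dh(3)] gm by blast
  have dc: "df1 (\<lambda>\<beta>. (True \<and> pfst (g \<beta>) = i) \<and> code (psnd (psnd (g \<beta>))) = c)" by (intro dfi)
  have rg: "pfst (psnd (g \<beta>)) \<epsilon> P \<and> sub q (pfst (psnd (g \<beta>)))"
    if "\<beta> \<epsilon> \<kappa>" "(True \<and> pfst (g \<beta>) = i) \<and> code (psnd (psnd (g \<beta>))) = c" for \<beta>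
    using gm[OF that(1)] by blast
  obtain \<rho> where \<rho>: "\<rho> \<epsilon> P" "sub q \<rho>"
    "\<And>s. s \<epsilon> P \<Longrightarrow> sub \<rho> s \<Longrightarrow> \<exists>\<beta>. \<beta> \<epsilon> \<kappa> \<and> ((True \<and> pfst (g \<beta>) = i) \<and> code (psnd (psnd (g \<beta>))) = c) \<and>
      un (pfst (psnd (g \<beta>))) s \<epsilon> P \<and> (\<forall>n y. \<not> pr (add \<beta> n) y \<epsilon> s \<or> \<not> n \<epsilon> omega)"
    using root[OF Lim_kappa reg dc c dh(2) rg] by blast
  obtain \<beta>0 where b0: "\<beta>0 \<epsilon> \<kappa>" "code (psnd (psnd (g \<beta>0))) = c" using \<rho>(3)[OF \<rho>(1)] by blast
  obtain i0 r0 n a where na: "g \<beta>0 = pr i0 (pr r0 (pr n a))" "pr n a \<epsilon> nodes" using g(2)[OF b0(1)] unfolding Q_def by blast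
  have lr: "le \<rho> q" using \<rho>(2) le_iff by blast
  obtain r m b where r: "r \<epsilon> P" "le r \<rho>" "node_ext n a m b"
    "\<And>m' b' s. node_ext m b m' b' \<Longrightarrow> s \<epsilon> P \<Longrightarrow> le s r \<Longrightarrow> \<not> fmem s (opn (chk i) (chk (code (pr m' b')))) R"
    using missed_cone[OF q omk hyp[OF i(1)] na(2) \<rho>(1) lr] by blast
  obtain \<beta> where \<beta>: "\<beta> \<epsilon> \<kappa>" "pfst (g \<beta>) = i" "code (psnd (psnd (g \<beta>))) = c" "un (pfst (psnd (g \<beta>))) r \<epsilon> P"
    "\<And>n y. n \<epsilon> omega \<Longrightarrow> \<not> pr (add \<beta> n) y \<epsilon> r"
    using \<rho>(3)[OF r(1)] r(2) unfolding le_iff by blast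
  obtain i' rb n' a' where rb: "g \<beta> = pr i' (pr rb (pr n' a'))" "rb \<epsilon> P" "pr n' a' \<epsilon> nodes"
    "sub (cnd (suc emp) \<beta> n' a') rb" "off \<beta> n' rb" "\<And>s. s \<epsilon> P \<Longrightarrow> le s rb \<Longrightarrow> \<not> bdd R i' (suc emp) \<beta> s"
    using g(2)[OF \<beta>(1)] unfolding Q_def by blast
  have "code (pr n' a') = code (pr n a)" using \<beta>(3) b0(2) rb(1) na(1) by simp
  then have eq: "n' = n" "a' = a" "i' = i" using code_inj[OF rb(3) na(2)] \<beta>(2) rb(1) by simp_all
  have u: "un rb r \<epsilon> P" using \<beta>(4) rb(1) by simp
  have mn: "m \<epsilon> omega" "sub n m" "\<And>i. i \<epsilon> n \<Longrightarrow> i \<epsilon> a \<longleftrightarrow> i \<epsilon> b" "pr m b \<epsilon> nodes" using r(3) unfolding node_ext_def pr_nodes by blast+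
  define s where "s = un (un rb r) (cnd (suc emp) \<beta> m b)"
  have s: "s \<epsilon> P" unfolding s_def
  proof (rule extend_cnd[OF u flip(5) \<beta>(1) _ _ mn(1-3)])
    show "sub (cnd (suc emp) \<beta> n a) (un rb r)" using rb(4) eq by simp
    show "off \<beta> n (un rb r)" using rb(5) \<beta>(5) eq unfolding off_def by simp
  qed
  have ls: "le s rb" "le s r" "sub (cnd (suc emp) \<beta> m b) s" unfolding le_iff s_def by simp_all
  \<comment> \<open>Nothing in the missed cone belongs to the i-th set, so the intersection consists
    of codes of nodes shorter than \<open>m\<close>.\<close>
  obtain N where N: "N \<epsilon> omega" "\<And>m' b'. pr m' b' \<epsilon> nodes \<Longrightarrow> m' \<epsilon> m \<Longrightarrow> code (pr m' b') \<epsilon> N" using code_below[OF mn(1)] by blast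
  have "j \<epsilon> N" if h: "s' \<epsilon> P" "le s' s" "fmem s' (chk j) (bn (suc emp) \<beta>)" "fmem s' (opn (chk i) (chk j)) R" for j s'
  proof (rule ccontr)
    assume j: "\<not> j \<epsilon> N"
    obtain t m' b' where t: "t \<epsilon> P" "le t s'" "pr m' b' \<epsilon> nodes" "sub (cnd (suc emp) \<beta> m' b') t" "j = code (pr m' b')"
      using fmem_bnD_chk[OF h(3,1)] .
    have sm: "sub m m'" using omega_total[OF mn(1)] N(2)[OF t(3)] t(3,5) j unfolding pr_nodes by blast
    have lt: "le t s" by (rule le_trans[OF t(2) h(2)])
    then have st: "sub (cnd (suc emp) \<beta> m b) t" using ls(3) unfolding le_iff by blast
    have "k \<epsilon> b \<longleftrightarrow> k \<epsilon> b'" if k: "k \<epsilon> m" for k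
      by (rule cnd_agree[OF t(1) flip(5) st t(4) k]) (use sm k in blast)
    then have "node_ext m b m' b'" unfolding node_ext_def using t(3) sm by blast
    then show False using r(4)[OF _ t(1) le_trans[OF lt ls(2)]] fmem_mono[OF h(4) t(2)] t(5) by blast
  qed
  then have "bdd R i (suc emp) \<beta> s" unfolding bdd_def using N(1) by blast
  then show False using rb(6)[OF s ls(1)] eq by blast
qed

end

text \<open>The properties of \<open>w = \<omega>\<close>, \<open>k = \<kappa>\<close>, \<open>b = \<F>\<close> and \<open>d = {D\<^sub>\<beta> | \<beta> < \<kappa>}\<close> from which the theorem follows in any model of set
  theory; \<open>rbf w R i X\<close> says that \<open>X\<close> is almost disjoint from \<open>{j | (i, j) \<in> R}\<close>.\<close>

definition unbf :: "'v \<Rightarrow> 'v \<Rightarrow> 'v form" where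
  "unbf w X = ((\<^bold>\<forall>j. j \<^bold>\<in> X \<^bold>\<longrightarrow> j \<^bold>\<in> w) \<^bold>\<and> (\<^bold>\<forall>n. n \<^bold>\<in> w \<^bold>\<longrightarrow> (\<^bold>\<exists>j. j \<^bold>\<in> X \<^bold>\<and> \<^bold>\<not> j \<^bold>\<in> n)))"
definition bddf :: "'v \<Rightarrow> 'v \<Rightarrow> 'v \<Rightarrow> 'v form" where
  "bddf w X Y = (\<^bold>\<exists>n. n \<^bold>\<in> w \<^bold>\<and> (\<^bold>\<forall>j. j \<^bold>\<in> X \<^bold>\<and> j \<^bold>\<in> Y \<^bold>\<longrightarrow> j \<^bold>\<in> n))"
definition rbf :: "'v \<Rightarrow> 'v \<Rightarrow> 'v \<Rightarrow> 'v \<Rightarrow> 'v form" where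
  "rbf w R i X = (\<^bold>\<exists>n. n \<^bold>\<in> w \<^bold>\<and> (\<^bold>\<forall>j. j \<^bold>\<in> X \<^bold>\<longrightarrow> pair_in i j R \<^bold>\<longrightarrow> j \<^bold>\<in> n))"
definition adf :: "'v \<Rightarrow> 'v \<Rightarrow> 'v \<Rightarrow> 'v form" where
  "adf w b d = ((\<^bold>\<forall>X. X \<^bold>\<in> b \<^bold>\<longrightarrow> unbf w X) \<^bold>\<and> (\<^bold>\<forall>X. X \<^bold>\<in> d \<^bold>\<longrightarrow> unbf w X) \<^bold>\<and>
    (\<^bold>\<forall>X. X \<^bold>\<in> b \<^bold>\<longrightarrow> (\<^bold>\<forall>Y. Y \<^bold>\<in> b \<^bold>\<longrightarrow> X \<^bold>= Y \<^bold>\<or> bddf w X Y)) \<^bold>\<and>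
    (\<^bold>\<forall>X. X \<^bold>\<in> b \<^bold>\<longrightarrow> (\<^bold>\<forall>Y. Y \<^bold>\<in> d \<^bold>\<longrightarrow> bddf w X Y)) \<^bold>\<and>
    (\<^bold>\<forall>X. X \<^bold>\<in> d \<^bold>\<longrightarrow> (\<^bold>\<forall>Y. Y \<^bold>\<in> d \<^bold>\<longrightarrow> X \<^bold>= Y \<^bold>\<or> bddf w X Y)))"
text \<open>Size at most aleph-one, expressed by an enumeration along an ordinal with countable
  members; in this form it passes from the ground model to the extension.\<close>

definition smallf :: "'v \<Rightarrow> 'v \<Rightarrow> 'v form" where
  "smallf w b = (\<^bold>\<exists>f l. ordf l \<^bold>\<and> (\<^bold>\<forall>a. a \<^bold>\<in> l \<^bold>\<longrightarrow> (\<^bold>\<exists>g. injf g a w)) \<^bold>\<and>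
    (\<^bold>\<forall>X. X \<^bold>\<in> b \<^bold>\<longrightarrow> (\<^bold>\<exists>i. i \<^bold>\<in> l \<^bold>\<and> pair_in i X f)) \<^bold>\<and> funf f)"
text \<open>\<open>R\<close> lists \<open>m\<close> many sets at once. For \<open>k = w\<close> a
  size in \<open>k\<close> is finite, which an infinite family rules out by itself.\<close>

definition reapf :: "'v \<Rightarrow> 'v \<Rightarrow> 'v \<Rightarrow> 'v \<Rightarrow> 'v form" where
  "reapf w k b d = (k \<^bold>= w \<^bold>\<or> (\<^bold>\<forall>m. m \<^bold>\<in> k \<^bold>\<longrightarrow> (\<^bold>\<forall>R. (\<^bold>\<forall>i. i \<^bold>\<in> m \<^bold>\<longrightarrow> (\<^bold>\<forall>X. X \<^bold>\<in> b \<^bold>\<longrightarrow> rbf w R i X)) \<^bold>\<longrightarrow>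
    (\<^bold>\<exists>Y. Y \<^bold>\<in> d \<^bold>\<and> (\<^bold>\<forall>i. i \<^bold>\<in> m \<^bold>\<longrightarrow> rbf w R i Y)))))"
definition cohenf :: "'v \<Rightarrow> 'v \<Rightarrow> 'v \<Rightarrow> 'v \<Rightarrow> 'v form" where
  "cohenf w k b d = (wof \<^bold>\<and> omf w \<^bold>\<and> ordf k \<^bold>\<and> (\<^bold>\<forall>x. x \<^bold>\<in> w \<^bold>\<longrightarrow> x \<^bold>\<in> k) \<^bold>\<and> adf w b d \<^bold>\<and> (\<^bold>\<exists>g. injf g w d) \<^bold>\<and>
    smallf w b \<^bold>\<and> reapf w k b d)"

lemma forel_unbf [fori]: "forel (\<lambda>e. unbf (e i) (e j)) (\<lambda>e. unbf (e i) (e j))"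
  unfolding unbf_def by (intro fori)
lemma forel_bddf [fori]: "forel (\<lambda>e. bddf (e i) (e j) (e k)) (\<lambda>e. bddf (e i) (e j) (e k))"
  unfolding bddf_def by (intro fori)
lemma forel_rbf [fori]: "forel (\<lambda>e. rbf (e i) (e j) (e k) (e l)) (\<lambda>e. rbf (e i) (e j) (e k) (e l))"
  unfolding rbf_def by (intro fori)
lemma forel_cohenf [fori]: "forel (\<lambda>e. cohenf (e i) (e j) (e k) (e l)) (\<lambda>e. cohenf (e i) (e j) (e k) (e l))"
  unfolding cohenf_def adf_def smallf_def reapf_def by (intro fori)

section \<open>The combinatorial properties are forced\<close>

context cohen
begin

lemma fcong_unbf [fci]: "fcong (\<lambda>x. unbf w x)"
  unfolding unbf_def by (intro fci)
lemma fcong_bddf [fci]: "fcong (\<lambda>x. bddf w x y)" "fcong (\<lambda>x. bddf w y x)"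
  unfolding bddf_def by (intro fci)+
lemma fcong_rbf [fci]: "fcong (\<lambda>x. rbf w R x y)" "fcong (\<lambda>x. rbf w R y x)"
  unfolding rbf_def by (intro fci)+
lemma fcong_injf [fci]: "fcong (\<lambda>x. injf g x w)"
  unfolding injf_def funf_def by (intro fci)

text \<open>Members of a branch are densely forced equal to check names of codes, so membership in a
  check name is tested on codes.\<close>

lemma fmem_chk_via: assumes "q \<epsilon> P" "\<And>r n a. r \<epsilon> P \<Longrightarrow> le r q \<Longrightarrow> pr n a \<epsilon> nodes \<Longrightarrow> sub (cnd v \<alpha> n a) r \<Longrightarrow>
    feq r x (chk (code (pr n a))) \<Longrightarrow> code (pr n a) \<epsilon> y" and m: "fmem q x (bn v \<alpha>)"
  shows "fmem q x (chk y)"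
proof (rule fmem_dense)
  fix q' assume q': "q' \<epsilon> P" "le q' q"
  obtain r n a where r: "r \<epsilon> P" "le r q'" "pr n a \<epsilon> nodes" "sub (cnd v \<alpha> n a) r" "feq r x (chk (code (pr n a)))"
    using fmem_bnD[OF fmem_mono[OF m q'(2)] q'(1)] .
  have "fmem r x (chk y)"
    by (rule fmem_feq1[OF r(1) feq_sym[OF r(1,5)] fmem_chkI[OF assms(2)[OF r(1) le_trans[OF r(2) q'(2)] r(3-5)] r(1)]])
  then show "\<exists>r. r \<epsilon> P \<and> le r q' \<and> fmem r x (chk y)" using r by blast
qed

lemma fo_unbf: assumes v: "bit v" "\<alpha> \<epsilon> \<kappa>" and p: "p \<epsilon> P" shows "fo (unbf (chk omega) (bn v \<alpha>)) p"
proof -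
  have "fo (\<^bold>\<forall>j. j \<^bold>\<in> bn v \<alpha> \<^bold>\<longrightarrow> j \<^bold>\<in> chk omega) p" unfolding forces.simps fo_Imp[OF p]
  proof (intro allI impI, elim conjE)
    fix x q assume q: "q \<epsilon> P" and m: "fmem q x (bn v \<alpha>)"
    show "fmem q x (chk omega)" by (rule fmem_chk_via[OF q _ m]) (rule code(3))
  qed
  moreover have "fo (\<^bold>\<forall>n. n \<^bold>\<in> chk omega \<^bold>\<longrightarrow> (\<^bold>\<exists>j. j \<^bold>\<in> bn v \<alpha> \<^bold>\<and> \<^bold>\<not> j \<^bold>\<in> n)) p"
  proof (rule fo_ball_chk[THEN iffD2], intro fci, rule p, intro allI impI)
    fix n assume n: "n \<epsilon> omega"
    show "fo (\<^bold>\<exists>j. j \<^bold>\<in> bn v \<alpha> \<^bold>\<and> \<^bold>\<not> j \<^bold>\<in> chk n) p"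
    proof (rule fo_dense[OF p])
      fix q assume q: "q \<epsilon> P" "le q p"
      obtain r j where r: "r \<epsilon> P" "le r q" "j \<epsilon> omega" "\<not> j \<epsilon> n" "fmem r (chk j) (bn v \<alpha>)" using bn_unb[OF q(1) v n] .
      have "fo (\<^bold>\<exists>j. j \<^bold>\<in> bn v \<alpha> \<^bold>\<and> \<^bold>\<not> j \<^bold>\<in> chk n) r"
        by (rule fo_ExI[OF r(1) name_chk[of j]]) (use r(4,5) in simp)
      then show "\<exists>r. r \<epsilon> P \<and> le r q \<and> fo (\<^bold>\<exists>j. j \<^bold>\<in> bn v \<alpha> \<^bold>\<and> \<^bold>\<not> j \<^bold>\<in> chk n) r" using r by blast
    qed
  qed
  ultimately show ?thesis unfolding unbf_def by simp
qed

lemma fo_bddf: assumes v: "bit v" "bit v'" and \<alpha>: "\<alpha> \<epsilon> \<kappa>" "\<beta> \<epsilon> \<kappa>" and ne: "\<alpha> \<noteq> \<beta> \<or> v \<noteq> v'" and p: "p \<epsilon> P"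
  shows "fo (bddf (chk omega) (bn v \<alpha>) (bn v' \<beta>)) p"
proof (rule fo_dense[OF p])
  fix q assume q: "q \<epsilon> P" "le q p"
  obtain r N where r: "r \<epsilon> P" "le r q" "N \<epsilon> omega"
    "\<And>j s. s \<epsilon> P \<Longrightarrow> le s r \<Longrightarrow> fmem s (chk j) (bn v \<alpha>) \<Longrightarrow> fmem s (chk j) (bn v' \<beta>) \<Longrightarrow> j \<epsilon> N"
    using bn_split[OF q(1) v \<alpha> ne] by blast
  have "fo (\<^bold>\<forall>j. j \<^bold>\<in> bn v \<alpha> \<^bold>\<and> j \<^bold>\<in> bn v' \<beta> \<^bold>\<longrightarrow> j \<^bold>\<in> chk N) r" unfolding forces.simps fo_Imp[OF r(1)]
  proof (intro allI impI, elim conjE)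
    fix x s assume s: "s \<epsilon> P" "le s r" "fmem s x (bn v \<alpha>)" "fmem s x (bn v' \<beta>)"
    show "fmem s x (chk N)"
    proof (rule fmem_chk_via[OF s(1) _ s(3)])
      fix t n a assume t: "t \<epsilon> P" "le t s" "pr n a \<epsilon> nodes" "sub (cnd v \<alpha> n a) t" "feq t x (chk (code (pr n a)))"
      show "code (pr n a) \<epsilon> N"
        by (rule r(4)[OF t(1) le_trans[OF t(2) s(2)] fmem_bnI[OF t(3,4)] fmem_feq1[OF t(1,5) fmem_mono[OF s(4) t(2)]]])
    qed
  qed
  then have "fo (bddf (chk omega) (bn v \<alpha>) (bn v' \<beta>)) r" unfolding bddf_def by (rule fo_bexI_chk[OF r(3,1)])
  then show "\<exists>r. r \<epsilon> P \<and> le r q \<and> fo (bddf (chk omega) (bn v \<alpha>) (bn v' \<beta>)) r" using r by blast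
qed

text \<open>The link between the formula and \<open>bdd\<close>: the existential quantifier over
  bounds becomes density, and the guarded quantifier over the branch runs over check names of
  codes.\<close>

lemma fo_rbf: assumes p: "p \<epsilon> P"
  shows "fo (rbf (chk omega) R (chk i) (bn v \<alpha>)) p \<longleftrightarrow> (\<forall>q. q \<epsilon> P \<and> le q p \<longrightarrow> (\<exists>r. r \<epsilon> P \<and> le r q \<and> bdd R i v \<alpha> r))"
proof -
  have *: "fo (\<^bold>\<forall>j. j \<^bold>\<in> bn v \<alpha> \<^bold>\<longrightarrow> pair_in (chk i) j R \<^bold>\<longrightarrow> j \<^bold>\<in> chk n) r \<longleftrightarrow>
    (\<forall>j s. s \<epsilon> P \<and> le s r \<and> fmem s (chk j) (bn v \<alpha>) \<and> fmem s (opn (chk i) (chk j)) R \<longrightarrow> j \<epsilon> n)" if r: "r \<epsilon> P" for n r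
  proof (intro iffI allI impI; (elim conjE)?)
    fix j s assume h: "fo (\<^bold>\<forall>j. j \<^bold>\<in> bn v \<alpha> \<^bold>\<longrightarrow> pair_in (chk i) j R \<^bold>\<longrightarrow> j \<^bold>\<in> chk n) r"
      and s: "s \<epsilon> P" "le s r" "fmem s (chk j) (bn v \<alpha>)" "fmem s (opn (chk i) (chk j)) R"
    have "fo (chk j \<^bold>\<in> bn v \<alpha> \<^bold>\<longrightarrow> pair_in (chk i) (chk j) R \<^bold>\<longrightarrow> chk j \<^bold>\<in> chk n) r" using h by simp
    then have "fo (pair_in (chk i) (chk j) R \<^bold>\<longrightarrow> chk j \<^bold>\<in> chk n) s" unfolding fo_Imp[OF r] using s(1-3) by simp
    moreover have "fo (pair_in (chk i) (chk j) R) s" using s(1,4) by (simp add: fo_pair_in)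
    ultimately have "fo (chk j \<^bold>\<in> chk n) s" unfolding fo_Imp[OF s(1)] using s(1) le_refl by blast
    then show "j \<epsilon> n" using s(1) by simp
  next
    assume h: "\<forall>j s. s \<epsilon> P \<and> le s r \<and> fmem s (chk j) (bn v \<alpha>) \<and> fmem s (opn (chk i) (chk j)) R \<longrightarrow> j \<epsilon> n"
    show "fo (\<^bold>\<forall>j. j \<^bold>\<in> bn v \<alpha> \<^bold>\<longrightarrow> pair_in (chk i) j R \<^bold>\<longrightarrow> j \<^bold>\<in> chk n) r" unfolding forces.simps fo_Imp[OF r]
    proof (intro allI impI, elim conjE)
      fix x s assume s: "s \<epsilon> P" "le s r" "fmem s x (bn v \<alpha>)"
      show "fo (pair_in (chk i) x R \<^bold>\<longrightarrow> x \<^bold>\<in> chk n) s" unfolding fo_Imp[OF s(1)] forces.simps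
      proof (intro allI impI, elim conjE)
        fix q assume q: "q \<epsilon> P" "le q s" "fo (pair_in (chk i) x R) q"
        show "fmem q x (chk n)"
        proof (rule fmem_chk_via[OF q(1) _ fmem_mono[OF s(3) q(2)]])
          fix t m a assume t: "t \<epsilon> P" "le t q" "pr m a \<epsilon> nodes" "sub (cnd v \<alpha> m a) t" "feq t x (chk (code (pr m a)))"
          have "fo (pair_in (chk i) (chk (code (pr m a))) R) t"
            by (rule fcongD[OF fcong_pair_in(2) t(1,5) fo_mono[OF q(3,1) t(1,2)]])
          then have "fmem t (opn (chk i) (chk (code (pr m a)))) R" using t(1) by (simp add: fo_pair_in)
          then show "code (pr m a) \<epsilon> n"
            using h t(1) le_trans[OF t(2) le_trans[OF q(2) s(2)]] fmem_bnI[OF t(3,4)] by blast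
        qed
      qed
    qed
  qed
  have c: "fcong (\<lambda>n. \<^bold>\<forall>j. j \<^bold>\<in> bn v \<alpha> \<^bold>\<longrightarrow> pair_in (chk i) j R \<^bold>\<longrightarrow> j \<^bold>\<in> n)" by (intro fci)
  define F where "F n r \<longleftrightarrow> fo (\<^bold>\<forall>j. j \<^bold>\<in> bn v \<alpha> \<^bold>\<longrightarrow> pair_in (chk i) j R \<^bold>\<longrightarrow> j \<^bold>\<in> chk n) r" for n r
  define G where "G n r \<longleftrightarrow> (\<forall>j s. s \<epsilon> P \<and> le s r \<and> fmem s (chk j) (bn v \<alpha>) \<and> fmem s (opn (chk i) (chk j)) R \<longrightarrow> j \<epsilon> n)" for n r
  have FG: "r \<epsilon> P \<Longrightarrow> F n r \<longleftrightarrow> G n r" for n r unfolding F_def G_def by (rule *)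
  show ?thesis unfolding rbf_def fo_bex_chk[OF c p] bdd_def F_def[symmetric] G_def[symmetric] using FG by blast
qed

text \<open>For \<kappa> = \<omega> there are only countably many branches, so the index set shrinks
  to \<omega>. In both cases it is part of \<kappa> and has countable members.\<close>

definition lam where "lam = (if \<kappa> = omega then omega else om1)"
abbreviation bb where "bb \<equiv> sn lam (bn emp)"
abbreviation dd where "dd \<equiv> sn \<kappa> (bn (suc emp))"

text \<open>A countable \<kappa> would be equipotent with its member \<omega>, although it is a
  cardinal.\<close>

lemma om1_sub: assumes ne: "\<kappa> \<noteq> omega" shows "omega \<epsilon> \<kappa>" "sub om1 \<kappa>"
proof -
  show w: "omega \<epsilon> \<kappa>" using Ord_sub[OF Ord_omega Ord_kappa] kappa(2) ne by blast
  have "\<not> \<kappa> \<epsilon> om1"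
  proof
    assume "\<kappa> \<epsilon> om1"
    then have "cle \<kappa> omega" by (rule om1(3))
    then obtain B where B: "sub B omega" "eqp \<kappa> B" using cle_image by blast
    have "\<exists>k. k \<epsilon> B \<and> \<not> k \<epsilon> n" if n: "n \<epsilon> omega" for n
    proof (rule ccontr)
      assume "\<not> ?thesis"
      then have "sub B n" by blast
      then have "fin \<kappa>" using fin_cle[OF eqp_cle[OF B(2)]] fin_sub[OF fin_omega_mem[OF n]] by blast
      then show False using fin_sub[OF _ kappa(2)] omega_not_fin by blast
    qed
    then have "eqp B omega" using eqp_omega[OF B(1)] by blast
    then have "eqp omega \<kappa>" using eqp_sym[OF eqp_trans[OF B(2)]] by blast
    then show False using kappa(1) w unfolding card_in_def by blast
  qed
  then show "sub om1 \<kappa>" using Ord_not_mem[OF Ord_kappa om1(1)] by blast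
qed

lemma lam: "Ord lam" "sub lam \<kappa>" "a \<epsilon> lam \<Longrightarrow> cle a omega"
proof -
  show "Ord lam" using om1(1) unfolding lam_def by simp
  show "sub lam \<kappa>" using om1_sub(2) kappa(2) unfolding lam_def by (cases "\<kappa> = omega") auto
  show "a \<epsilon> lam \<Longrightarrow> cle a omega" using om1(3) cle_sub[OF omega_trans] unfolding lam_def by (cases "\<kappa> = omega") auto
qed

lemma dt1_bn: "dt1 (bn v)" by (intro dfi)

lemma name_bb: "name bb" and name_dd: "name dd"
  by (rule name_sn[OF dt1_bn name_bn]; use lam(2) in simp)+

lemma fo_ball_bb: "fcong \<phi> \<Longrightarrow> p \<epsilon> P \<Longrightarrow> fo (\<^bold>\<forall>y. y \<^bold>\<in> bb \<^bold>\<longrightarrow> \<phi> y) p \<longleftrightarrow> (\<forall>u. u \<epsilon> lam \<longrightarrow> fo (\<phi> (bn emp u)) p)"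
  by (rule fo_ball_sn[OF dt1_bn name_bn]) (use lam(2) in simp_all)

lemma fo_ball_dd: "fcong \<phi> \<Longrightarrow> p \<epsilon> P \<Longrightarrow> fo (\<^bold>\<forall>y. y \<^bold>\<in> dd \<^bold>\<longrightarrow> \<phi> y) p \<longleftrightarrow> (\<forall>u. u \<epsilon> \<kappa> \<longrightarrow> fo (\<phi> (bn (suc emp) u)) p)"
  by (rule fo_ball_sn[OF dt1_bn name_bn]) simp_all

lemma fo_AllI: "(\<And>x. name x \<Longrightarrow> fo (\<phi> x) p) \<Longrightarrow> fo (All \<phi>) p" by simp

lemma fo_DisjI: assumes "p \<epsilon> P" "fo \<phi> p \<or> fo \<psi> p" shows "fo (\<phi> \<^bold>\<or> \<psi>) p"
  unfolding fo_Disj[OF assms(1)] using assms fo_mono le_refl by blast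

lemma fo_adf: assumes p: "p \<epsilon> P" shows "fo (adf (chk omega) bb dd) p"
proof -
  have l: "u \<epsilon> lam \<Longrightarrow> u \<epsilon> \<kappa>" for u using lam(2) by blast
  have "fo (\<^bold>\<forall>X. X \<^bold>\<in> bb \<^bold>\<longrightarrow> unbf (chk omega) X) p"
    by (rule fo_ball_bb[OF _ p, THEN iffD2]) (intro fci, use fo_unbf[OF flip(4) l p] in blast)
  moreover have "fo (\<^bold>\<forall>X. X \<^bold>\<in> dd \<^bold>\<longrightarrow> unbf (chk omega) X) p"
    by (rule fo_ball_dd[OF _ p, THEN iffD2]) (intro fci, use fo_unbf[OF flip(5) _ p] in blast)
  moreover have e: "fo (bn v u \<^bold>= bn v u' \<^bold>\<or> bddf (chk omega) (bn v u) (bn v u')) p"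
    if h: "bit v" "u \<epsilon> \<kappa>" "u' \<epsilon> \<kappa>" for v u u'
    by (rule fo_DisjI[OF p]) (use fo_bddf[OF h(1,1,2,3) _ p] p in \<open>cases "u = u'"; simp\<close>)
  have "fo (\<^bold>\<forall>X. X \<^bold>\<in> bb \<^bold>\<longrightarrow> (\<^bold>\<forall>Y. Y \<^bold>\<in> bb \<^bold>\<longrightarrow> X \<^bold>= Y \<^bold>\<or> bddf (chk omega) X Y)) p"
  proof (rule fo_ball_bb[OF _ p, THEN iffD2], intro fci, intro allI impI)
    fix u assume u: "u \<epsilon> lam"
    show "fo (\<^bold>\<forall>Y. Y \<^bold>\<in> bb \<^bold>\<longrightarrow> bn emp u \<^bold>= Y \<^bold>\<or> bddf (chk omega) (bn emp u) Y) p"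
      by (rule fo_ball_bb[OF _ p, THEN iffD2]) (intro fci, use e[OF flip(4) l[OF u] l] in blast)
  qed
  moreover have "fo (\<^bold>\<forall>X. X \<^bold>\<in> dd \<^bold>\<longrightarrow> (\<^bold>\<forall>Y. Y \<^bold>\<in> dd \<^bold>\<longrightarrow> X \<^bold>= Y \<^bold>\<or> bddf (chk omega) X Y)) p"
  proof (rule fo_ball_dd[OF _ p, THEN iffD2], intro fci, intro allI impI)
    fix u assume u: "u \<epsilon> \<kappa>"
    show "fo (\<^bold>\<forall>Y. Y \<^bold>\<in> dd \<^bold>\<longrightarrow> bn (suc emp) u \<^bold>= Y \<^bold>\<or> bddf (chk omega) (bn (suc emp) u) Y) p"
      by (rule fo_ball_dd[OF _ p, THEN iffD2]) (intro fci, use e[OF flip(5) u] in blast)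
  qed
  moreover have "fo (\<^bold>\<forall>X. X \<^bold>\<in> bb \<^bold>\<longrightarrow> (\<^bold>\<forall>Y. Y \<^bold>\<in> dd \<^bold>\<longrightarrow> bddf (chk omega) X Y)) p"
  proof (rule fo_ball_bb[OF _ p, THEN iffD2], intro fci, intro allI impI)
    fix u assume u: "u \<epsilon> lam"
    have "emp \<noteq> suc emp" using mem_suc[of emp emp] by (intro notI) simp
    then have "fo (bddf (chk omega) (bn emp u) (bn (suc emp) u')) p" if "u' \<epsilon> \<kappa>" for u'
      using fo_bddf[OF flip(4,5) l[OF u] that _ p] by blast
    then show "fo (\<^bold>\<forall>Y. Y \<^bold>\<in> dd \<^bold>\<longrightarrow> bddf (chk omega) (bn emp u) Y) p"
      by (intro fo_ball_dd[OF _ p, THEN iffD2]) (intro fci, blast)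
  qed
  ultimately show ?thesis unfolding adf_def by simp
qed

lemma fo_inj_dd: assumes p: "p \<epsilon> P" shows "fo (\<^bold>\<exists>g. injf g (chk omega) dd) p"
proof (rule fo_ExI[OF p name_fnn[OF dt1_bn]])
  show "fo (injf (fnn omega (bn (suc emp))) (chk omega) dd) p"
  proof (rule fo_injf[OF dt1_bn _ _ _ p])
    fix u q assume u: "u \<epsilon> omega"
    then have uk: "u \<epsilon> \<kappa>" using kappa(2) by blast
    show "name (bn (suc emp) u)" by (rule name_bn[OF flip(5) uk])
    show "q \<epsilon> P \<Longrightarrow> fmem q (bn (suc emp) u) dd" by (rule fmem_snI[OF dt1_bn uk])
    fix v assume "v \<epsilon> omega"
    then have vk: "v \<epsilon> \<kappa>" using kappa(2) by blast
    show "q \<epsilon> P \<Longrightarrow> feq q (bn (suc emp) u) (bn (suc emp) v) \<Longrightarrow> u = v" using bn_neq[OF _ flip(5,5) uk vk] by blast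
  qed
qed

text \<open>The injections of the members of \<open>lam\<close> into \<omega> come from the ground
  model and are transferred by check names.\<close>

lemma fo_smallf: assumes p: "p \<epsilon> P" shows "fo (smallf (chk omega) bb) p"
proof -
  let ?f = "fnn lam (bn emp)"
  have nb: "name (bn emp u)" if "u \<epsilon> lam" for u using name_bn[OF flip(4)] lam(2) that by blast
  have "fo (\<^bold>\<forall>a. a \<^bold>\<in> chk lam \<^bold>\<longrightarrow> (\<^bold>\<exists>g. injf g a (chk omega))) p"
  proof (rule fo_ball_chk[THEN iffD2], intro fci, rule p, intro allI impI)
    fix a assume "a \<epsilon> lam"
    then obtain h where h: "dt1 h" "inj_on h (el a)" "\<And>x. x \<epsilon> a \<Longrightarrow> h x \<epsilon> omega" using lam(3) unfolding cle_iff by blast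
    note [dfi] = dt1_app[OF h(1)]
    have d: "dt1 (\<lambda>i. chk (h i))" by (intro dfi)
    show "fo (\<^bold>\<exists>g. injf g (chk a) (chk omega)) p"
    proof (rule fo_ExI[OF p name_fnn[OF d]])
      show "fo (injf (fnn a (\<lambda>i. chk (h i))) (chk a) (chk omega)) p"
      proof (rule fo_injf[OF d _ _ _ p])
        fix u v q assume u: "u \<epsilon> a"
        show "name (chk (h u))" by simp
        show "q \<epsilon> P \<Longrightarrow> fmem q (chk (h u)) (chk omega)" using h(3)[OF u] by simp
        show "v \<epsilon> a \<Longrightarrow> q \<epsilon> P \<Longrightarrow> feq q (chk (h u)) (chk (h v)) \<Longrightarrow> u = v" using inj_onD[OF h(2)] u by simp
      qed
    qed
  qed
  moreover have "fo (\<^bold>\<forall>X. X \<^bold>\<in> bb \<^bold>\<longrightarrow> (\<^bold>\<exists>i. i \<^bold>\<in> chk lam \<^bold>\<and> pair_in i X ?f)) p"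
  proof (rule fo_ball_bb[OF _ p, THEN iffD2], intro fci, intro allI impI)
    fix u assume u: "u \<epsilon> lam"
    show "fo (\<^bold>\<exists>i. i \<^bold>\<in> chk lam \<^bold>\<and> pair_in i (bn emp u) ?f) p"
      by (rule fo_bexI_chk[OF u p]) (rule fo_fnnI[OF dt1_bn u nb[OF u] p])
  qed
  ultimately have F: "fo (ordf (chk lam) \<^bold>\<and> (\<^bold>\<forall>a. a \<^bold>\<in> chk lam \<^bold>\<longrightarrow> (\<^bold>\<exists>g. injf g a (chk omega))) \<^bold>\<and>
    (\<^bold>\<forall>X. X \<^bold>\<in> bb \<^bold>\<longrightarrow> (\<^bold>\<exists>i. i \<^bold>\<in> chk lam \<^bold>\<and> pair_in i X ?f)) \<^bold>\<and> funf ?f) p"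
    using fo_ordf[OF lam(1) p] fo_funf[OF dt1_bn nb p] by simp
  show ?thesis unfolding smallf_def
    by (rule fo_ExI[OF p name_fnn[OF dt1_bn, of lam emp]], rule fo_ExI[OF p name_chk[of lam]]) (rule F)
qed

lemma fo_reapf: assumes p: "p \<epsilon> P" shows "fo (reapf (chk omega) (chk \<kappa>) bb dd) p"
proof (cases "\<kappa> = omega")
  case True
  then show ?thesis unfolding reapf_def by (intro fo_DisjI[OF p]) (use p in simp)
next
  case ne: False
  note w = om1_sub[OF ne]
  have l: "lam = om1" using ne by (simp add: lam_def)
  let ?H = "\<lambda>m R. \<^bold>\<forall>i. i \<^bold>\<in> m \<^bold>\<longrightarrow> (\<^bold>\<forall>X. X \<^bold>\<in> bb \<^bold>\<longrightarrow> rbf (chk omega) R i X)"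
  let ?C = "\<lambda>m R. \<^bold>\<exists>Y. Y \<^bold>\<in> dd \<^bold>\<and> (\<^bold>\<forall>i. i \<^bold>\<in> m \<^bold>\<longrightarrow> rbf (chk omega) R i Y)"
  have "fo (\<^bold>\<forall>m. m \<^bold>\<in> chk \<kappa> \<^bold>\<longrightarrow> (\<^bold>\<forall>R. ?H m R \<^bold>\<longrightarrow> ?C m R)) p"
  proof (rule fo_ball_chk[THEN iffD2], intro fci, rule p, intro allI impI)
    fix \<mu> assume \<mu>: "\<mu> \<epsilon> \<kappa>"
    show "fo (\<^bold>\<forall>R. ?H (chk \<mu>) R \<^bold>\<longrightarrow> ?C (chk \<mu>) R) p"
    proof (rule fo_AllI, unfold fo_Imp[OF p], intro allI impI, elim conjE)
      fix R q assume q: "q \<epsilon> P" and H: "fo (?H (chk \<mu>) R) q"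
      have c1: "fcong (\<lambda>i. \<^bold>\<forall>X. X \<^bold>\<in> bb \<^bold>\<longrightarrow> rbf (chk omega) R i X)" by (intro fci)
      have H1: "fo (rbf (chk omega) R (chk i) (bn emp \<alpha>)) q" if "i \<epsilon> \<mu>" "\<alpha> \<epsilon> om1" for i \<alpha>
        using H[unfolded fo_ball_chk[OF c1 q], unfolded fo_ball_bb[OF fcong_rbf(2) q], unfolded l] that by blast
      have H2: "\<exists>r. r \<epsilon> P \<and> le r q' \<and> bdd R i emp \<alpha> r" if h: "i \<epsilon> \<mu>" "\<alpha> \<epsilon> om1" "q' \<epsilon> P" "le q' q" for i \<alpha> q'
        by (rule H1[OF h(1,2), unfolded fo_rbf[OF q], rule_format, OF conjI[OF h(3,4)]])
      have "\<exists>\<beta>. \<beta> \<epsilon> \<kappa> \<and> (\<forall>i q'. i \<epsilon> \<mu> \<and> q' \<epsilon> P \<and> le q' q \<longrightarrow> (\<exists>r. r \<epsilon> P \<and> le r q' \<and> bdd R i (suc emp) \<beta> r))"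
        by (rule bounded_branch[OF q w(2,1) \<mu>]) (rule H2)
      then obtain \<beta> where \<beta>: "\<beta> \<epsilon> \<kappa>"
        "\<forall>i q'. i \<epsilon> \<mu> \<and> q' \<epsilon> P \<and> le q' q \<longrightarrow> (\<exists>r. r \<epsilon> P \<and> le r q' \<and> bdd R i (suc emp) \<beta> r)"
        by (elim exE conjE) (rule that)
      have "fo (rbf (chk omega) R (chk i) (bn (suc emp) \<beta>)) q" if h: "i \<epsilon> \<mu>" for i
        unfolding fo_rbf[OF q] using \<beta>(2) h by (intro allI impI) (elim allE impE, auto)
      then have "fo (\<^bold>\<forall>i. i \<^bold>\<in> chk \<mu> \<^bold>\<longrightarrow> rbf (chk omega) R i (bn (suc emp) \<beta>)) q"
        unfolding fo_ball_chk[OF fcong_rbf(1) q] by blast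
      then show "fo (?C (chk \<mu>) R) q" by (rule fo_bexI[OF dt1_bn \<beta>(1) name_bn[OF flip(5) \<beta>(1)] q])
    qed
  qed
  then show ?thesis unfolding reapf_def by (intro fo_DisjI[OF p]) blast
qed

lemma fo_cohenf: assumes p: "p \<epsilon> P" shows "fo (cohenf (chk omega) (chk \<kappa>) bb dd) p"
proof -
  have "fo (\<^bold>\<forall>x. x \<^bold>\<in> chk omega \<^bold>\<longrightarrow> x \<^bold>\<in> chk \<kappa>) p"
    by (rule fo_ball_chk[THEN iffD2], intro fci, rule p) (use p kappa(2) in simp)
  then show ?thesis unfolding cohenf_def forces.simps
    using fo_wof[OF p] fo_omf[OF p] fo_ordf[OF Ord_kappa p] fo_adf[OF p] fo_inj_dd[OF p] fo_smallf[OF p] fo_reapf[OF p]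
    unfolding forces.simps by blast
qed

end

section \<open>Almost disjoint families in a model\<close>

context zf
begin

definition inter where "inter X Y = Sep X (\<lambda>z. z \<epsilon> Y)"

lemma dt_inter [dfi]: "dt s \<Longrightarrow> dt t \<Longrightarrow> dt (\<lambda>e. inter (s e) (t e))"
  by (rule dt2_app[of inter]) (unfold inter_def, intro dfi)

lemma mem_inter [simp]: "z \<epsilon> inter X Y \<longleftrightarrow> z \<epsilon> X \<and> z \<epsilon> Y"
  unfolding inter_def by (rule mem_Sep) (intro dfi)

definition adm where "adm X Y \<longleftrightarrow> fin (inter X Y)"

lemma df_adm [dfi]: "dt s \<Longrightarrow> dt t \<Longrightarrow> df (\<lambda>e. adm (s e) (t e))"
  unfolding adm_def by (intro dfi)

lemma adm_sym: "adm X Y \<Longrightarrow> adm Y X"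
  unfolding adm_def by (erule fin_sub) simp

lemma sat_is_ad [simp]: "sat E (is_ad X Y) \<longleftrightarrow> adm X Y"
proof -
  have "sat E (is_inter X Y z) \<longleftrightarrow> z = inter X Y" for z
    unfolding is_inter_def using exten[of z "inter X Y"] by auto
  then show ?thesis unfolding is_ad_def adm_def by simp
qed

definition adfam where "adfam F \<longleftrightarrow> (\<forall>X Y. X \<epsilon> F \<and> Y \<epsilon> F \<and> X \<noteq> Y \<longrightarrow> adm X Y)"
definition madin where "madin \<X> F \<longleftrightarrow> sub F \<X> \<and> adfam F \<and> \<not> (\<exists>X. X \<epsilon> \<X> \<and> (\<forall>Y. Y \<epsilon> F \<longrightarrow> adm X Y))"
definition perp where "perp F \<X> \<longleftrightarrow> (\<forall>Y. Y \<epsilon> \<X> \<longleftrightarrow> (sub Y omega \<and> eqp Y omega) \<and> (\<forall>X. X \<epsilon> F \<longrightarrow> adm X Y))"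
definition madsize where "madsize \<X> m \<longleftrightarrow> (\<exists>F. cle omega F \<and> madin \<X> F \<and> card_in m \<and> eqp F m)"
definition aval where "aval l m \<longleftrightarrow> (\<exists>F. (\<forall>X. X \<epsilon> F \<longrightarrow> sub X omega \<and> eqp X omega) \<and> adfam F \<and> cle F l \<and>
  (\<exists>\<X>. perp F \<X> \<and> madsize \<X> m \<and> (\<forall>n. madsize \<X> n \<longrightarrow> sub m n)))"

lemma df_madsize [dfi]: assumes "dt s" "dt t" shows "df (\<lambda>e. madsize (s e) (t e))"
proof -
  have "df2 madsize" unfolding madsize_def madin_def adfam_def card_in_def by (intro dfi)
  then show ?thesis using assms by (rule df2_app)
qed

lemma df_aval [dfi]: assumes "dt s" "dt t" shows "df (\<lambda>e. aval (s e) (t e))"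
proof -
  have "df2 aval" unfolding aval_def perp_def adfam_def by (intro dfi)
  then show ?thesis using assms by (rule df2_app)
qed

lemma sat_aval: "sat E (is_a_plus_value l m) \<longleftrightarrow> aval l m"
  unfolding is_a_plus_value_def is_a_plus_def is_a_def is_inf_mad_size_def is_ad_family_on_def is_ad_family_def is_perp_def
    is_mad_in_def is_ctbl_subset_def is_card_of_def aval_def perp_def madsize_def madin_def adfam_def by simp

lemma adm_iff: assumes "sub X omega" shows "adm X Y \<longleftrightarrow> (\<exists>n. n \<epsilon> omega \<and> (\<forall>j. j \<epsilon> X \<and> j \<epsilon> Y \<longrightarrow> j \<epsilon> n))"
proof
  assume "adm X Y"
  then obtain n where n: "n \<epsilon> omega" "sub (inter X Y) n" using fin_bounded_omega[of "inter X Y"] assms unfolding adm_def by auto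
  then show "\<exists>n. n \<epsilon> omega \<and> (\<forall>j. j \<epsilon> X \<and> j \<epsilon> Y \<longrightarrow> j \<epsilon> n)" by auto
next
  assume "\<exists>n. n \<epsilon> omega \<and> (\<forall>j. j \<epsilon> X \<and> j \<epsilon> Y \<longrightarrow> j \<epsilon> n)"
  then obtain n where n: "n \<epsilon> omega" "\<forall>j. j \<epsilon> X \<and> j \<epsilon> Y \<longrightarrow> j \<epsilon> n" by blast
  then show "adm X Y" unfolding adm_def by (intro fin_sub[OF fin_omega_mem[OF n(1)]]) simp
qed

lemma not_adm_self: assumes "eqp X omega" shows "\<not> adm X X"
proof
  assume "adm X X"
  then have "fin X" unfolding adm_def by (rule fin_sub) simp
  then have "fin omega" by (rule fin_cle[OF eqp_cle[OF eqp_sym[OF assms]]])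
  then show False using omega_not_fin by simp
qed

end

section \<open>Extension to maximal families, the supremum, and the lower bound\<close>

context zfwo
begin

text \<open>Greedy recursion along an enumeration: a candidate is accepted if it is almost disjoint
  from \<open>d\<close> and from all earlier values, and a rejected one contributes
  \<open>d0\<close>, which is in the family already. A set almost disjoint from the result would
  have been accepted, yet an infinite set is not almost disjoint from itself.\<close>

lemma ex_mad:
  assumes \<X>: "\<And>X. X \<epsilon> \<X> \<Longrightarrow> eqp X omega" and d: "sub d \<X>" "adfam d" "d0 \<epsilon> d"
  shows "\<exists>F. sub d F \<and> madin \<X> F"
proof -
  obtain \<delta> g where g: "Ord \<delta>" "dt1 g" "\<And>y. y \<epsilon> \<X> \<Longrightarrow> \<exists>i. i \<epsilon> \<delta> \<and> g i = y" using wo_fun[of \<X>] by blast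
  note [dfi] = dt1_app[OF g(2)]
  define H where "H i f = (if g i \<epsilon> \<X> \<and> (\<forall>Y. Y \<epsilon> d \<longrightarrow> adm (g i) Y) \<and> (\<forall>j. j \<epsilon> i \<longrightarrow> adm (g i) (app f j)) then g i else d0)" for i f
  have H: "dt2 H" unfolding H_def by (intro dfi)
  define h where "h = rec H"
  note [dfi] = dt2_app[OF H]
  have h: "dt1 h" unfolding h_def by (intro dfi)
  define ok where "ok i \<longleftrightarrow> g i \<epsilon> \<X> \<and> (\<forall>Y. Y \<epsilon> d \<longrightarrow> adm (g i) Y) \<and> (\<forall>j. j \<epsilon> i \<longrightarrow> adm (g i) (h j))" for i
  have hi: "h i = (if ok i then g i else d0)" for i
  proof -
    have "h i = H i (Lam i h)" unfolding h_def by (rule rec_eq[OF H])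
    moreover have "(\<forall>j. j \<epsilon> i \<longrightarrow> adm (g i) (app (Lam i h) j)) \<longleftrightarrow> (\<forall>j. j \<epsilon> i \<longrightarrow> adm (g i) (h j))"
      using app_Lam[OF h] by (intro iff_allI imp_cong) simp_all
    then have "H i (Lam i h) = (if ok i then g i else d0)" unfolding H_def ok_def by (simp only:)
    ultimately show ?thesis by (rule trans)
  qed
  define F where "F = un d (Rep \<delta> h)"
  have F: "X \<epsilon> F \<longleftrightarrow> X \<epsilon> d \<or> (\<exists>i. i \<epsilon> \<delta> \<and> X = h i)" for X unfolding F_def by (simp add: mem_Rep[OF h])
  have okD: "h i = g i" "g i \<epsilon> \<X>" "\<And>Y. Y \<epsilon> d \<Longrightarrow> adm (g i) Y" "\<And>j. j \<epsilon> i \<Longrightarrow> adm (g i) (h j)" if ok: "ok i" for i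
    using hi[of i] ok by simp (use ok in \<open>unfold ok_def, blast+\<close>)
  have nok: "h i = d0" if "\<not> ok i" for i using hi[of i] that by simp
  have hd: "ok i \<or> h i \<epsilon> d" for i using nok[of i] d(3) by (cases "ok i") simp_all
  have hX: "adm (h i) Y" if ok: "ok i" and Y: "Y \<epsilon> d" for i Y using okD(3)[OF ok Y] okD(1)[OF ok] by simp
  have hj: "h i = h j \<or> adm (h i) (h j)" if ji: "j \<epsilon> i" for i j
  proof (cases "ok i")
    case True
    then show ?thesis using okD(4)[OF True ji] okD(1)[OF True] by simp
  next
    case False
    then show ?thesis using nok[OF False] hX[OF _ d(3), of j] adm_sym[of "h j" d0] nok[of j] by (cases "ok j") simp_all
  qed
  have hh: "h i = h j \<or> adm (h i) (h j)" if ij: "i \<epsilon> \<delta>" "j \<epsilon> \<delta>" for i j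
    using Ord_lin[OF g(1) ij] hj[of j i] hj[of i j] adm_sym by auto
  have hY: "h i = Y \<or> adm (h i) Y" if Y: "Y \<epsilon> d" for i Y
    using hX[OF _ Y, of i] hd[of i] d(2) Y unfolding adfam_def by blast
  have "adfam F" unfolding adfam_def F
  proof (intro allI impI, elim conjE disjE exE)
    fix X Y assume "X \<noteq> Y" "X \<epsilon> d" "Y \<epsilon> d"
    then show "adm X Y" using d(2) unfolding adfam_def by blast
  next
    fix X Y i assume "X \<noteq> Y" "X \<epsilon> d" "Y = h i"
    then show "adm X Y" using hY[of X i] adm_sym by blast
  next
    fix X Y i assume "X \<noteq> Y" "X = h i" "Y \<epsilon> d"
    then show "adm X Y" using hY[of Y i] by blast
  next
    fix X Y i j assume "X \<noteq> Y" "X = h i" "Y = h j" "i \<epsilon> \<delta>" "j \<epsilon> \<delta>"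
    then show "adm X Y" using hh[of i j] by blast
  qed
  moreover have "sub F \<X>"
  proof (intro allI impI)
    fix X assume "X \<epsilon> F"
    moreover have "h i \<epsilon> \<X>" for i using okD(1,2)[of i] nok[of i] d(1,3) by (cases "ok i") simp_all
    ultimately show "X \<epsilon> \<X>" unfolding F using d(1) by auto
  qed
  moreover have "\<not> (\<exists>X. X \<epsilon> \<X> \<and> (\<forall>Y. Y \<epsilon> F \<longrightarrow> adm X Y))"
  proof (intro notI, elim exE conjE)
    fix X assume X: "X \<epsilon> \<X>" and a: "\<forall>Y. Y \<epsilon> F \<longrightarrow> adm X Y"
    obtain i where i: "i \<epsilon> \<delta>" "g i = X" using g(3)[OF X] by blast
    have "h j \<epsilon> F" if "j \<epsilon> i" for j unfolding F using Ord_trans[OF g(1) that i(1)] by blast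
    then have "ok i" unfolding ok_def using X a i(2) F by blast
    then have "X \<epsilon> F" unfolding F using i okD(1)[of i] by (intro disjI2 exI[of _ i]) simp
    then show False using a not_adm_self[OF \<X>[OF X]] by blast
  qed
  ultimately have "madin \<X> F" unfolding madin_def by blast
  moreover have "sub d F" unfolding F by blast
  ultimately show ?thesis by blast
qed

text \<open>Each value is the size of a family of subsets of \<omega>, so an ordinal that does not
  inject into the power set of \<omega> bounds them all, and a least bound exists.\<close>

lemma aval_sup: "\<exists>s. sat E (is_a_plus_card l s) \<and> (\<forall>m. aval l m \<longrightarrow> sub m s)"
proof -
  obtain \<theta> where \<theta>: "Ord \<theta>" "\<not> cle \<theta> (Pw omega)" using Hartogs by blast
  let ?B = "\<lambda>t. \<forall>m. aval l m \<longrightarrow> sub m t"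
  have dB: "df1 ?B" by (intro dfi)
  have "?B \<theta>"
  proof (intro allI impI)
    fix m z assume m: "aval l m" and z: "z \<epsilon> m"
    obtain F \<X> F' where \<X>: "perp F \<X>" and F: "madin \<X> F'" "card_in m" "eqp F' m"
      using m unfolding aval_def madsize_def by (elim exE conjE) (rule that)
    have "sub F' (Pw omega)" using F(1) \<X> unfolding madin_def perp_def by auto
    then have "cle m (Pw omega)" by (rule cle_trans[OF eqp_cle[OF eqp_sym[OF F(3)]] cle_sub])
    then have "\<not> sub \<theta> m" using cle_trans[OF cle_sub] \<theta>(2) by blast
    moreover have "Ord m" using F(2) unfolding card_in_def by blast
    ultimately have "m \<epsilon> \<theta>" using Ord_not_mem[OF _ \<theta>(1)] by blast
    then show "z \<epsilon> \<theta>" using Ord_trans[OF \<theta>(1) z] by blast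
  qed
  note L = lst[OF dB \<theta>(1) this]
  have "sat E (is_a_plus_card l (lst ?B))"
    unfolding is_a_plus_card_def by (simp add: sat_aval) (use L(1,2) lst_sub[OF dB] in blast)
  then show ?thesis using L(2) by blast
qed

text \<open>The value attained by \<open>b\<close> is defined because the infinite family
  \<open>d\<close> extends to a maximal one. If this value \<open>m\<close> were a member of
  \<open>k\<close>, it would itself be an index set to which \<open>reapf\<close> applies.\<close>

lemma sat_a_plus:
  assumes S: "sat E (cohenf w k b d)"
  shows "sat E (a_plus_aleph1_ge k)"
proof -
  have w: "w = omega" by (rule sat_omf) (use S in \<open>simp add: cohenf_def\<close>)
  have k: "Ord k" "sub omega k" using S unfolding cohenf_def w by simp_all
  have A: "sat E (adf omega b d)" using S unfolding cohenf_def w by simp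
  have b: "sub X omega" "eqp X omega" if X: "X \<epsilon> b" for X
  proof -
    show s: "sub X omega" using A X unfolding adf_def unbf_def by simp
    show "eqp X omega" by (rule eqp_omega[OF s]) (use A X in \<open>simp add: adf_def unbf_def\<close>)
  qed
  have d: "sub X omega" "eqp X omega" if X: "X \<epsilon> d" for X
  proof -
    show s: "sub X omega" using A X unfolding adf_def unbf_def by simp
    show "eqp X omega" by (rule eqp_omega[OF s]) (use A X in \<open>simp add: adf_def unbf_def\<close>)
  qed
  have bd: "sat E (bddf omega X Y) \<Longrightarrow> sub X omega \<Longrightarrow> adm X Y" for X Y
    unfolding bddf_def by (subst adm_iff) simp_all
  have A': "\<And>X Y. X \<epsilon> b \<Longrightarrow> Y \<epsilon> b \<Longrightarrow> X = Y \<or> sat E (bddf omega X Y)" "\<And>X Y. X \<epsilon> b \<Longrightarrow> Y \<epsilon> d \<Longrightarrow> sat E (bddf omega X Y)"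
    "\<And>X Y. X \<epsilon> d \<Longrightarrow> Y \<epsilon> d \<Longrightarrow> X = Y \<or> sat E (bddf omega X Y)"
    using A unfolding adf_def by simp_all
  have adb: "adfam b" unfolding adfam_def using A'(1) bd[OF _ b(1)] by blast
  have add': "adfam d" unfolding adfam_def using A'(3) bd[OF _ d(1)] by blast
  have adbd: "adm X Y" if "X \<epsilon> b" "Y \<epsilon> d" for X Y using A'(2)[OF that] bd[OF _ b(1)[OF that(1)]] by blast
  obtain g where "sat E (injf g omega d)" using S unfolding cohenf_def w by auto
  then have cd: "cle omega d" by (rule sat_injf)
  have "sat E (smallf omega b)" using S unfolding cohenf_def w by simp
  then have "\<exists>f l. Ord l \<and> (\<forall>a. a \<epsilon> l \<longrightarrow> (\<exists>g. sat E (injf g a omega))) \<and> (\<forall>X. X \<epsilon> b \<longrightarrow> (\<exists>i. i \<epsilon> l \<and> pr i X \<epsilon> f)) \<and>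
    (\<forall>i y y'. pr i y \<epsilon> f \<and> pr i y' \<epsilon> f \<longrightarrow> y = y')" unfolding smallf_def funf_def by simp
  then obtain f l where f0: "Ord l" "\<forall>a. a \<epsilon> l \<longrightarrow> (\<exists>g. sat E (injf g a omega))" "\<forall>X. X \<epsilon> b \<longrightarrow> (\<exists>i. i \<epsilon> l \<and> pr i X \<epsilon> f)"
    "\<forall>i y y'. pr i y \<epsilon> f \<and> pr i y' \<epsilon> f \<longrightarrow> y = y'" by (elim exE conjE) (rule that)
  then have f: "Ord l" "\<And>a. a \<epsilon> l \<Longrightarrow> \<exists>g. sat E (injf g a omega)" "\<And>X. X \<epsilon> b \<Longrightarrow> \<exists>i. i \<epsilon> l \<and> pr i X \<epsilon> f"
    "\<And>i y y'. pr i y \<epsilon> f \<Longrightarrow> pr i y' \<epsilon> f \<Longrightarrow> y = y'" by blast+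
  have cb: "cle b om1"
  proof -
    \<comment> \<open>A member of \<open>b\<close> is sent to its least index in \<open>l\<close>;
      the index is a countable ordinal and hence lies below \<open>om1\<close>.\<close>
    let ?Q = "\<lambda>X i. i \<epsilon> l \<and> pr i X \<epsilon> f"
    have dQ: "df1 (?Q X)" for X by (intro dfi)
    have L: "?Q X (lst (?Q X))" if Xb: "X \<epsilon> b" for X
    proof -
      obtain i where "?Q X i" using f(3)[OF Xb] by blast
      then show ?thesis using lst(2)[OF dQ, of i X] Ord_mem[OF f(1)] by blast
    qed
    show ?thesis
    proof (rule cleI[of "\<lambda>X. lst (?Q X)"])
      show "dt1 (\<lambda>X. lst (?Q X))" by (intro dfi)
      show "inj_on (\<lambda>X. lst (?Q X)) (el b)"
      proof (rule inj_onI)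
        fix X Y assume h: "X \<in> el b" "Y \<in> el b" "lst (?Q X) = lst (?Q Y)"
        have "pr (lst (?Q X)) X \<epsilon> f" "pr (lst (?Q Y)) Y \<epsilon> f" using L h(1,2) by simp_all
        then show "X = Y" using f(4) h(3) by simp
      qed
      fix X assume "X \<epsilon> b"
      then have i: "lst (?Q X) \<epsilon> l" using L by blast
      show "lst (?Q X) \<epsilon> om1" by (rule om1I[OF Ord_mem[OF f(1) i]]) (use f(2)[OF i] sat_injf in blast)
    qed
  qed
  define \<X> where "\<X> = Sep (Pw omega) (\<lambda>Y. eqp Y omega \<and> (\<forall>X. X \<epsilon> b \<longrightarrow> adm X Y))"
  have \<X>: "Y \<epsilon> \<X> \<longleftrightarrow> (sub Y omega \<and> eqp Y omega) \<and> (\<forall>X. X \<epsilon> b \<longrightarrow> adm X Y)" for Y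
  proof -
    have "Y \<epsilon> \<X> \<longleftrightarrow> Y \<epsilon> Pw omega \<and> eqp Y omega \<and> (\<forall>X. X \<epsilon> b \<longrightarrow> adm X Y)" unfolding \<X>_def by (rule mem_Sep) (intro dfi)
    then show ?thesis by simp
  qed
  have dX: "sub d \<X>" unfolding \<X> using d adbd by blast
  have dne: "\<exists>d0. d0 \<epsilon> d" using cd unfolding cle_iff using emp_omega by blast
  then obtain F0 where F0: "sub d F0" "madin \<X> F0" using ex_mad[OF _ dX add'] \<X> by blast
  obtain m1 where m1: "card_in m1" "eqp F0 m1" using ex_card by blast
  have "madsize \<X> m1" unfolding madsize_def using cle_trans[OF cd cle_sub[OF F0(1)]] F0(2) m1 by blast
  then have ex: "Ord m1" "madsize \<X> m1" using m1(1) unfolding card_in_def by blast+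
  have dm: "df1 (madsize \<X>)" by (intro dfi)
  define m where "m = lst (madsize \<X>)"
  have m: "madsize \<X> m" "Ord m" unfolding m_def using lst[OF dm ex] by blast+
  have "sub m n" if "madsize \<X> n" for n unfolding m_def
    by (rule lst_sub[OF dm _ that]) (use that in \<open>auto simp: madsize_def card_in_def\<close>)
  moreover have "perp b \<X>" unfolding perp_def \<X> by blast
  ultimately have val: "aval om1 m" unfolding aval_def using b adb cb m(1) by blast
  have "\<not> m \<epsilon> k"
  proof
    assume mk: "m \<epsilon> k"
    obtain F where F: "cle omega F" "madin \<X> F" "eqp F m" using m(1) unfolding madsize_def by blast
    have nf: "\<not> fin F" using fin_cle[OF F(1)] omega_not_fin by blast
    have "k \<noteq> omega"
    proof
      assume "k = omega"
      then have "fin m" using mk fin_omega_mem by simp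
      then show False using fin_cle[OF eqp_cle[OF F(3)]] nf by blast
    qed
    then have R: "\<And>R. (\<forall>i. i \<epsilon> m \<longrightarrow> (\<forall>X. X \<epsilon> b \<longrightarrow> sat E (rbf omega R i X))) \<Longrightarrow> \<exists>Y. Y \<epsilon> d \<and> (\<forall>i. i \<epsilon> m \<longrightarrow> sat E (rbf omega R i Y))"
      using S mk unfolding cohenf_def w reapf_def by simp
    obtain h where h: "dt1 h" "bij_betw h (el m) (el F)" using eqp_sym[OF F(3)] unfolding eqp_iff by blast
    note [dfi] = dt1_app[OF h(1)]
    have hF: "h i \<epsilon> F" if "i \<epsilon> m" for i using bij_betwE[OF h(2)] that by simp
    have Fh: "\<exists>i. i \<epsilon> m \<and> h i = Z" if "Z \<epsilon> F" for Z
    proof -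
      have "Z \<in> h ` el m" using bij_betw_imp_surj_on[OF h(2)] that by simp
      then obtain i where "Z = h i" "i \<in> el m" by (rule imageE)
      then show ?thesis by (intro exI[of _ i]) simp
    qed
    \<comment> \<open>The mad family as one relation whose section at \<open>i\<close> is
      \<open>h i\<close>; \<open>reapf\<close> then yields a member of \<open>d\<close> almost
      disjoint from the whole family.\<close>
    define R where "R = Sep (prod m omega) (\<lambda>z. psnd z \<epsilon> h (pfst z))"
    have "z \<epsilon> R \<longleftrightarrow> z \<epsilon> prod m omega \<and> psnd z \<epsilon> h (pfst z)" for z unfolding R_def by (rule mem_Sep) (intro dfi)
    then have Rm: "pr i j \<epsilon> R \<longleftrightarrow> (i \<epsilon> m \<and> j \<epsilon> omega) \<and> j \<epsilon> h i" for i j by simp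
    have rb: "sat E (rbf omega R i X) \<longleftrightarrow> adm X (h i)" if "i \<epsilon> m" "sub X omega" for i X
      unfolding adm_iff[OF that(2)] rbf_def using that by (simp add: Rm) blast
    have FX: "sub F \<X>" using F(2) unfolding madin_def by blast
    have "adm X (h i)" if "i \<epsilon> m" "X \<epsilon> b" for i X
      using FX hF[OF that(1)] that(2) unfolding \<X> by blast
    then have "\<forall>i. i \<epsilon> m \<longrightarrow> (\<forall>X. X \<epsilon> b \<longrightarrow> sat E (rbf omega R i X))" using rb b(1) by simp
    from R[OF this] obtain Y where Y: "Y \<epsilon> d" "\<And>i. i \<epsilon> m \<Longrightarrow> sat E (rbf omega R i Y)" by blast
    have "adm Y Z" if ZF: "Z \<epsilon> F" for Z
    proof -
      obtain i where i: "i \<epsilon> m" "h i = Z" using Fh[OF ZF] by blast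
      then show ?thesis using Y(2)[OF i(1)] rb[OF i(1) d(1)[OF Y(1)]] by simp
    qed
    then show False using F(2) Y(1) dX unfolding madin_def by blast
  qed
  then have "sub k m" using Ord_not_mem[OF m(2) k(1)] by blast
  moreover obtain s where s: "sat E (is_a_plus_card om1 s)" "sub m s" using aval_sup[of om1] val by blast
  ultimately show ?thesis unfolding a_plus_aleph1_ge_def using sat_is_aleph1 s(1)
    by simp (intro exI[of _ om1] exI[of _ s], auto)
qed

end

section \<open>Transfer of the conclusion to the forcing relation\<close>

lemma forel_goal [fori]: "forel (\<lambda>e. a_plus_aleph1_ge (e i)) (\<lambda>e. a_plus_aleph1_ge (e i))"
  unfolding a_plus_aleph1_ge_def is_a_plus_card_def is_aleph1_def is_a_plus_value_def is_a_plus_def is_perp_def is_a_def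
    is_inf_mad_size_def is_mad_in_def is_ad_family_on_def is_ad_family_def is_ad_def is_ctbl_subset_def is_card_of_def
    is_card_def is_finite_def is_omega_def is_limit_def is_ord_def is_transitive_def card_le_def equipollent_def
    is_bij_def is_inj_def is_fun_def is_partial_fun_def is_inter_def is_empty_def subset_of_def is_pair_def is_upair_def
  by (intro fori)

theorem theorem4p2:
  fixes E :: "'v \<Rightarrow> 'v \<Rightarrow> bool" and \<kappa> P top_cond \<kappa>_check :: 'v
  assumes "ZFC_model E"
    and "sat E (is_regular \<kappa>)"
    and "sat E (is_Fn2 \<kappa> P)"
    and "sat E (is_empty top_cond)"
    and "sat E (is_check_name top_cond \<kappa> \<kappa>_check)"
  shows "extension_models E P (Fn_le E) (a_plus_aleph1_ge \<kappa>_check)"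
proof -
  interpret zfwo E by (rule ZFC_model_zfwo[OF assms(1)])
  interpret cohen E \<kappa> P by unfold_locales (fact assms(2,3))+
  have "top_cond = emp" using assms(4) by simp
  then have chk: "\<kappa>_check = chk \<kappa>" using assms(5) is_check_name by simp
  have "fo (a_plus_aleph1_ge (chk \<kappa>)) p" if p: "E p P" for p
  proof (rule ccontr)
    assume no: "\<not> fo (a_plus_aleph1_ge (chk \<kappa>)) p"
    define e0 where "e0 n = (if n = 0 then chk \<kappa> else if n = 1 then chk omega else if n = 2 then bb else dd)" for n :: nat
    \<comment> \<open>The implication from \<open>cohenf\<close> to the conclusion, written with
      negation and conjunction so that its forcing clauses unfold directly. It holds in all models
      of set theory and is therefore forced.\<close>
    let ?\<Phi> = "\<lambda>e. \<^bold>\<not> (cohenf (e 1) (e 0) (e 2) (e 3) \<^bold>\<and> \<^bold>\<not> a_plus_aleph1_ge (e 0))"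
    have n0: "name (e0 n)" for n unfolding e0_def using name_bb name_dd by simp
    have "fo (?\<Phi> e0) p"
    proof (rule fo_zf_valid[where \<psi> = ?\<Phi>])
      show "forel ?\<Phi> ?\<Phi>" by (intro fori)
      fix E' :: "nat \<Rightarrow> nat \<Rightarrow> bool" and e :: "nat \<Rightarrow> nat" assume Z: "zf E'"
      show "sat E' (?\<Phi> e)"
      proof (unfold sat.simps, intro notI, elim conjE)
        assume S: "sat E' (cohenf (e 1) (e 0) (e 2) (e 3))" and n: "\<not> sat E' (a_plus_aleph1_ge (e 0))"
        interpret Z: zf E' by (rule Z)
        have "sat E' wof" using S unfolding cohenf_def by simp
        then interpret W: zfwo E' by (rule Z.sat_wof)
        show False using W.sat_a_plus[OF S] n by simp
      qed
    qed (use n0 p in auto)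
    then have N: "\<forall>q. E q P \<and> le q p \<longrightarrow> \<not> fo (cohenf (e0 1) (e0 0) (e0 2) (e0 3) \<^bold>\<and> \<^bold>\<not> a_plus_aleph1_ge (e0 0)) q"
      by (simp only: forces.simps(3))
    have "fo (a_plus_aleph1_ge (chk \<kappa>)) p"
    proof (rule fo_dense[OF p])
      fix q assume q: "E q P" "le q p"
      obtain r where r: "E r P" "le r q" "fo (a_plus_aleph1_ge (chk \<kappa>)) r \<or> fo (\<^bold>\<not> a_plus_aleph1_ge (chk \<kappa>)) r"
        using fo_decide[OF q(1), of "a_plus_aleph1_ge (chk \<kappa>)"] by (elim exE conjE) (rule that)
      have e: "e0 0 = chk \<kappa>" "e0 1 = chk omega" "e0 2 = bb" "e0 3 = dd" by (simp_all add: e0_def)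
      \<comment> \<open>A condition deciding the conclusion negatively would force the conjunction
        that \<open>?\<Phi>\<close> excludes, since \<open>cohenf\<close> is forced by every
        condition.\<close>
      have "\<not> fo (\<^bold>\<not> a_plus_aleph1_ge (chk \<kappa>)) r"
      proof
        assume "fo (\<^bold>\<not> a_plus_aleph1_ge (chk \<kappa>)) r"
        then have "fo (cohenf (e0 1) (e0 0) (e0 2) (e0 3) \<^bold>\<and> \<^bold>\<not> a_plus_aleph1_ge (e0 0)) r"
          unfolding forces.simps(4) e using fo_cohenf[OF r(1)] by (rule conjI[rotated])
        then show False using N r(1) le_trans[OF r(2) q(2)] by (elim allE[of _ r] impE) simp_all
      qed
      then show "\<exists>r. E r P \<and> le r q \<and> fo (a_plus_aleph1_ge (chk \<kappa>)) r" using r by blast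
    qed
    then show False using no by (rule notE[rotated])
  qed
  then show ?thesis unfolding extension_models_def chk by (intro allI impI)
qed

end
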